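(* Let $d=2$ or $d=3$, let $\Omega$ be a rotation vector, $q_0,p_0\in\mathbb{R}^d$, $v_0\in\Sigma^3$, and let $V\in C^\infty(\mathbb{R}^d;\mathbb{R})$ satisfy $\partial_x^{\alpha}V\in L^\infty(\mathbb{R}^d)$ for all multi-indices $|\alpha|\ge 2$. Let $(q,p)\in C^\infty(\mathbb{R};\mathbb{R}^d)^2$ be the solution of $$\dot q=p+\Omega\wedge q,\quad \dot p=-\nabla V(q)+\Omega\wedge p,\quad q(0)=q_0,\ p(0)=p_0,$$ let $S(t)=\int_0^t\big(\tfrac12|p(s)|^2-V(q(s))\big)\,ds$, and let $v\in C(\mathbb{R};\Sigma^3)$ be the solution of $$i\partial_t v=-\tfrac12\Delta v+\tfrac12\big(y\cdot Q_V(t)y\big)v+(\Omega\cdot L)v,\quad v_{|t=0}=v_0,\qquad Q_V(t)=\nabla^2V(q(t)).$$ Define $$\varphi^\varepsilon(t,x)=\varepsilon^{-d/4}\,v\Big(t,\frac{x-q(t)}{\sqrt\varepsilon}\Big)e^{i(S(t)+p(t)\cdot(x-q(t)))/\varepsilon},$$ and let $\psi^\varepsilon$ be the solution of $$i\varepsilon\partial_t\psi^\varepsilon=-\frac{\varepsilon^2}{2}\Delta\psi^\varepsilon+V(x)\psi^\varepsilon+\varepsilon(\Omega\cdot L)\psi^\varepsilon,\quad \psi^\varepsilon(0,x)=\varepsilon^{-d/4}v_0\Big(\frac{x-q_0}{\sqrt\varepsilon}\Big)e^{i(x-q_0)\cdot p_0/\varepsilon}.$$ Then there exist constants $C,K>0$,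 independent of $\varepsilon\in(0,1]$ and of $t$, such that for all $t\ge 0$ and all $\varepsilon\in(0,1]$, $$\|\psi^\varepsilon(t,\cdot)-\varphi^\varepsilon(t,\cdot)\|_{L^2(\mathbb{R}^d)}\le K\sqrt\varepsilon\,e^{Ct}.$$ In particular, there exists $c>0$ independent of $\varepsilon$ such that $$\sup_{0\le t\le c\log\frac1\varepsilon}\|\psi^\varepsilon(t,\cdot)-\varphi^\varepsilon(t,\cdot)\|_{L^2(\mathbb{R}^d)}\longrightarrow 0\quad\text{as }\varepsilon\to0.$$
   Context: For $k\in\mathbb{N}$, $\Sigma^k=\{f\in L^2(\mathbb{R}^d):\ \|f\|_{\Sigma^k}:=\sum_{|\alpha|+|\beta|\le k}\|x^\alpha\partial_x^\beta f\|_{L^2(\mathbb{R}^d)}<\infty\}$. $\wedge$ is the cross product in $\mathbb{R}^3$; $L=-i\,x\wedge\nabla$ is the angular momentum operator (with $y$ in place of $x$ when acting on functions of $y$). For $d=3$, $\Omega\in\mathbb{R}^3$ is a fixed vector and $\Omega\cdot L=-i(\Omega\wedge x)\cdot\nabla$. For $d=2$, $\mathbb{R}^2$ is identified with $\mathbb{R}^2\times\{0\}\subset\mathbb{R}^3$ and $\Omega=(0,0,\Omega_3)$ with $\Omega_3\in\mathbb{R}$, so that $\Omega\wedge x=\Omega_3(-x_2,x_1)$ and $\Omega\cdot L=-i\Omega_3(x_1\partial_2-x_2\partial_1)$. The Hamiltonian system for $(q,p)$ has a unique global smooth solution; $\nabla^2V$ is the Hessian matrix of $V$. It is known (Kitada)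 that, for every $k\in\mathbb{N}$ and $v_0\in\Sigma^k$, the linear amplitude equation for $v$ has a unique global solution $v\in C(\mathbb{R};\Sigma^k)$, with $\|v(t,\cdot)\|_{L^2}=\|v_0\|_{L^2}$ for all $t\in\mathbb{R}$ and $\|v(t,\cdot)\|_{\Sigma^k}\lesssim e^{C_{k,d}t}$ for $t\ge0$ and some constant $C_{k,d}>0$. For each $\varepsilon$, $\psi^\varepsilon\in C(\mathbb{R};L^2(\mathbb{R}^d))$ is the unique ($L^2$-norm preserving) solution of the linear Schrödinger equation. *)

theory Defs
  imports "HOL-Analysis.Analysis"
begin

section \<open>Cross product with the rotation vector\<close>

text \<open>
  The dimension is the cardinality of the index type. The sort \<open>{finite, comm_ring_1}\<close>
  only provides the index literals 1, 2, 3; the index types 2 and 3 of \<open>real^2\<close> and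
  \<open>real^3\<close> belong to it, and every index type of this sort with two (three) elements is
  enumerated by 1, 2 (by 1, 2, 3). \<open>to_R3\<close> identifies the plane with its copy
  \<open>x\<^sub>3 = 0\<close> in space; \<open>wedge\<close> reads the cross product in space back in dimension 2 or 3.
  In dimension 2 it is meaningful for \<open>\<Omega> = (0, 0, \<Omega>\<^sub>3)\<close>, where the third
  component of the cross product vanishes.
\<close>

definition to_R3 :: "real^'d::{finite,comm_ring_1} \<Rightarrow> real^3" where
  "to_R3 x = vector [x $ 1, x $ 2, if CARD('d) = 3 then x $ 3 else 0]"

definition wedge :: "real^3 \<Rightarrow> real^'d::{finite,comm_ring_1} \<Rightarrow> real^'d::_" where
  "wedge \<Omega> x = (\<chi> i. cross3 \<Omega> (to_R3 x) $ (if i = 1 then 1 else if i = 2 then 2 else 3))"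

lemma wedge_dim3: "wedge \<Omega> (x :: real^3) = cross3 \<Omega> x"
  by (simp add: wedge_def to_R3_def cross3_def vec_eq_iff forall_3)

lemma wedge_dim2:
  "wedge (vector [0, 0, w]) (x :: real^2) = w *\<^sub>R vector [- (x $ 2), x $ 1]"
  by (simp add: wedge_def to_R3_def cross3_def vec_eq_iff forall_2)


section \<open>Smooth functions and multi-indices\<close>

definition dir_deriv ::
    "'a::euclidean_space \<Rightarrow> ('a \<Rightarrow> 'b::real_normed_vector) \<Rightarrow> 'a \<Rightarrow> 'b" where
  "dir_deriv b f x = frechet_derivative f (at x) b"

text \<open>All iterated partial derivatives exist and are (totally) differentiable, hence
  continuous; this is the class of infinitely differentiable functions.\<close>

definition smooth :: "('a::euclidean_space \<Rightarrow> 'b::real_normed_vector) \<Rightarrow> bool" where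
  "smooth f \<longleftrightarrow> (\<forall>bs. set bs \<subseteq> Basis \<longrightarrow> foldr dir_deriv bs f differentiable_on UNIV)"

definition partial :: "'d::finite \<Rightarrow> (real^'d \<Rightarrow> 'b::real_normed_vector) \<Rightarrow> real^'d \<Rightarrow> 'b" where
  "partial i = dir_deriv (axis i 1)"

definition gradient :: "(real^'d::finite \<Rightarrow> real) \<Rightarrow> real^'d \<Rightarrow> real^'d" where
  "gradient f x = (\<chi> i. partial i f x)"

definition hessian :: "(real^'d::finite \<Rightarrow> real) \<Rightarrow> real^'d \<Rightarrow> real^'d^'d" where
  "hessian f x = (\<chi> i j. partial i (partial j f) x)"

definition laplacian :: "(real^'d::finite \<Rightarrow> 'b::real_normed_vector) \<Rightarrow> real^'d \<Rightarrow> 'b" where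
  "laplacian f x = (\<Sum>i\<in>UNIV. partial i (partial i f) x)"

definition mi_order :: "('d::finite \<Rightarrow> nat) \<Rightarrow> nat" where
  "mi_order \<alpha> = (\<Sum>i\<in>UNIV. \<alpha> i)"

definition mi_power :: "real^'d::finite \<Rightarrow> ('d \<Rightarrow> nat) \<Rightarrow> real" where
  "mi_power x \<alpha> = (\<Prod>i\<in>UNIV. (x $ i) ^ \<alpha> i)"

text \<open>The coordinate directions are taken in some fixed enumeration. Its choice is
  irrelevant, since \<open>mi_deriv\<close> is only applied to smooth functions.\<close>

definition coords :: "'d::finite list" where
  "coords = (SOME is. distinct is \<and> set is = UNIV)"

definition mi_deriv ::
    "('d::finite \<Rightarrow> nat) \<Rightarrow> (real^'d \<Rightarrow> 'b::real_normed_vector) \<Rightarrow> real^'d \<Rightarrow> 'b" where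
  "mi_deriv \<alpha> = foldr (\<lambda>i D. (partial i ^^ \<alpha> i) \<circ> D) coords id"

definition test_function :: "(real^'d::finite \<Rightarrow> complex) \<Rightarrow> bool" where
  "test_function \<eta> \<longleftrightarrow> smooth \<eta> \<and> compact (closure {x. \<eta> x \<noteq> 0})"


section \<open>The spaces $L^2$ and $\Sigma^k$\<close>

text \<open>Elements of $L^2$ are represented by Borel functions; all notions below are invariant
  under modification on null sets.\<close>

definition L2 :: "(real^'d::finite \<Rightarrow> complex) set" where
  "L2 = {f. f \<in> borel_measurable lborel \<and> integrable lborel (\<lambda>x. (norm (f x))\<^sup>2)}"

definition L2_norm :: "(real^'d::finite \<Rightarrow> complex) \<Rightarrow> real" where
  "L2_norm f = sqrt (\<integral>x. (norm (f x))\<^sup>2 \<partial>lborel)"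

definition L2_inner ::
    "(real^'d::finite \<Rightarrow> complex) \<Rightarrow> (real^'d \<Rightarrow> complex) \<Rightarrow> complex" where
  "L2_inner f g = (\<integral>x. cnj (f x) * g x \<partial>lborel)"

definition locally_integrable :: "(real^'d::finite \<Rightarrow> complex) \<Rightarrow> bool" where
  "locally_integrable f \<longleftrightarrow>
     f \<in> borel_measurable lborel \<and> (\<forall>K. compact K \<longrightarrow> set_integrable lborel K f)"

definition has_weak_deriv ::
    "('d::finite \<Rightarrow> nat) \<Rightarrow> (real^'d \<Rightarrow> complex) \<Rightarrow> (real^'d \<Rightarrow> complex) \<Rightarrow> bool" where
  "has_weak_deriv \<beta> f g \<longleftrightarrow> locally_integrable f \<and> locally_integrable g \<and>
     (\<forall>\<eta>. test_function \<eta> \<longrightarrow>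
        (\<integral>x. f x * mi_deriv \<beta> \<eta> x \<partial>lborel) = (-1) ^ mi_order \<beta> * (\<integral>x. g x * \<eta> x \<partial>lborel))"

definition weak_deriv ::
    "('d::finite \<Rightarrow> nat) \<Rightarrow> (real^'d \<Rightarrow> complex) \<Rightarrow> real^'d \<Rightarrow> complex" where
  "weak_deriv \<beta> f = (SOME g. has_weak_deriv \<beta> f g)"

text \<open>The function $x^\alpha \partial_x^\beta f$.\<close>

definition weighted_deriv ::
    "('d::finite \<Rightarrow> nat) \<Rightarrow> ('d \<Rightarrow> nat) \<Rightarrow> (real^'d \<Rightarrow> complex) \<Rightarrow> real^'d \<Rightarrow> complex" where
  "weighted_deriv \<alpha> \<beta> f x = of_real (mi_power x \<alpha>) * weak_deriv \<beta> f x"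

definition Sigma_space :: "nat \<Rightarrow> (real^'d::finite \<Rightarrow> complex) set" where
  "Sigma_space k = {f \<in> L2. \<forall>\<alpha> \<beta>. mi_order \<alpha> + mi_order \<beta> \<le> k \<longrightarrow>
     (\<exists>g. has_weak_deriv \<beta> f g) \<and> weighted_deriv \<alpha> \<beta> f \<in> L2}"

definition Sigma_norm :: "nat \<Rightarrow> (real^'d::finite \<Rightarrow> complex) \<Rightarrow> real" where
  "Sigma_norm k f = (\<Sum>(\<alpha>, \<beta>) | mi_order \<alpha> + mi_order \<beta> \<le> k. L2_norm (weighted_deriv \<alpha> \<beta> f))"

lemma finite_mi_pairs:
  "finite {(\<alpha> :: 'd::finite \<Rightarrow> nat, \<beta> :: 'd \<Rightarrow> nat). mi_order \<alpha> + mi_order \<beta> \<le> k}"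
proof -
  have le: "\<alpha> i \<le> mi_order \<alpha>" for \<alpha> :: "'d \<Rightarrow> nat" and i
    unfolding mi_order_def using member_le_sum[of i UNIV \<alpha>] by simp
  have "{(\<alpha> :: 'd \<Rightarrow> nat, \<beta> :: 'd \<Rightarrow> nat). mi_order \<alpha> + mi_order \<beta> \<le> k} \<subseteq>
      PiE UNIV (\<lambda>_. {..k}) \<times> PiE UNIV (\<lambda>_. {..k})"
    by (auto simp: PiE_iff intro: order_trans[OF le])
  then show ?thesis
    by (rule finite_subset) (intro finite_cartesian_product finite_PiE; simp)
qed

text \<open>$C(\mathbb{R}; L^2)$ and $C(\mathbb{R}; \Sigma^k)$.\<close>

definition continuous_L2 :: "(real \<Rightarrow> real^'d::finite \<Rightarrow> complex) \<Rightarrow> bool" where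
  "continuous_L2 u \<longleftrightarrow> (\<forall>t. u t \<in> L2) \<and>
     (\<forall>t. ((\<lambda>s. L2_norm (\<lambda>x. u s x - u t x)) \<longlongrightarrow> 0) (at t))"

definition continuous_Sigma :: "nat \<Rightarrow> (real \<Rightarrow> real^'d::finite \<Rightarrow> complex) \<Rightarrow> bool" where
  "continuous_Sigma k u \<longleftrightarrow> (\<forall>t. u t \<in> Sigma_space k) \<and>
     (\<forall>t. ((\<lambda>s. Sigma_norm k (\<lambda>x. u s x - u t x)) \<longlongrightarrow> 0) (at t))"


section \<open>Schroedinger equations with rotation\<close>

text \<open>$\Omega \cdot L = -i (\Omega \wedge x) \cdot \nabla$.\<close>

definition Omega_L ::
    "real^3 \<Rightarrow> (real^'d::{finite,comm_ring_1} \<Rightarrow> complex) \<Rightarrow> real^'d::_ \<Rightarrow> complex" where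
  "Omega_L \<Omega> f x = - \<i> * (\<Sum>j\<in>UNIV. of_real (wedge \<Omega> x $ j) * partial j f x)"

definition hamiltonian :: "real \<Rightarrow> (real^'d::_ \<Rightarrow> real) \<Rightarrow> real^3 \<Rightarrow>
    (real^'d::{finite,comm_ring_1} \<Rightarrow> complex) \<Rightarrow> real^'d::_ \<Rightarrow> complex" where
  "hamiltonian h U \<Omega> f x =
     - of_real (h\<^sup>2 / 2) * laplacian f x + of_real (U x) * f x + of_real h * Omega_L \<Omega> f x"

text \<open>
  The equation $i h \partial_t u = -\frac{h^2}{2} \Delta u + U(t,x) u + h (\Omega \cdot L) u$ in the
  sense of distributions. The Hamiltonian is formally self-adjoint, so pairing the equation with
  a test function \<open>\<eta>\<close> moves it onto \<open>\<eta>\<close>. For \<open>u\<close> continuous with values in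
  $L^2$ and \<open>U\<close> continuous the right-hand side of the paired equation is continuous in time,
  so the distributional time derivative is a classical one.
\<close>

definition schroedinger_solution :: "real \<Rightarrow> (real \<Rightarrow> real^'d::_ \<Rightarrow> real) \<Rightarrow> real^3 \<Rightarrow>
    (real \<Rightarrow> real^'d::{finite,comm_ring_1} \<Rightarrow> complex) \<Rightarrow> bool" where
  "schroedinger_solution h U \<Omega> u \<longleftrightarrow>
     (\<forall>\<eta> t. test_function \<eta> \<longrightarrow>
        (\<exists>D. ((\<lambda>s. L2_inner \<eta> (u s)) has_vector_derivative D) (at t) \<and>
             \<i> * of_real h * D = L2_inner (hamiltonian h (U t) \<Omega> \<eta>) (u t)))"

end

theory Submission
  imports Defs
begin

text \<open>In the frame moving with the wave packet, \<open>\<psi>\<close> solves a Schroedinger equation with potential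
  \<open>(V (q + sqrt \<epsilon> y) - V q - sqrt \<epsilon> y \<bullet> \<nabla>V q) / \<epsilon>\<close>, which differs from the quadratic potential in the
  equation of \<open>v\<close> by at most a multiple of \<open>sqrt \<epsilon> |y|\<^sup>3\<close>. So the difference of the two solutions is driven
  by a source of norm at most \<open>sqrt \<epsilon>\<close> times the \<open>\<Sigma>\<^sup>3\<close> norm of \<open>v\<close>, which grows at most exponentially
  because the commutators of positions and derivatives with the quadratic Hamiltonian have the same
  order again.

  Solutions are only distributional, so uniqueness and the energy inequality are not free. The
  energy is regularised as \<open>\<integral>\<integral> cnj (u y) k\<^sub>\<delta> y z (u z)\<close> with a smooth compactly supported kernel
  that depends on \<open>|y - z|\<close> and \<open>|y + z|\<close> only. It commutes with rotations, and its commutator with the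
  Hamiltonian tends to zero strongly for potentials of at most quadratic growth.\<close>

section \<open>Calculus in $L^2$\<close>

lemma L2_measurable [measurable_dest]: "f \<in> L2 \<Longrightarrow> f \<in> borel_measurable borel"
  by (simp add: L2_def)

lemma L2_integrable_square: "f \<in> L2 \<Longrightarrow> integrable lborel (\<lambda>x. (norm (f x))\<^sup>2)"
  by (simp add: L2_def)

lemma L2_I:
  "f \<in> borel_measurable borel \<Longrightarrow> integrable lborel (\<lambda>x. (norm (f x))\<^sup>2) \<Longrightarrow> f \<in> L2"
  by (simp add: L2_def)

lemma L2_norm_nonneg [simp]: "0 \<le> L2_norm f"
  by (simp add: L2_norm_def)

lemma L2_norm_power2: "(L2_norm f)\<^sup>2 = (\<integral>x. (norm (f x))\<^sup>2 \<partial>lborel)"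
  by (simp add: L2_norm_def)

lemma L2_bound:
  assumes "g \<in> L2" and "f \<in> borel_measurable borel" and "AE x in lborel. norm (f x) \<le> c * norm (g x)"
  shows "f \<in> L2"
proof (rule L2_I)
  show "integrable lborel (\<lambda>x. (norm (f x))\<^sup>2)"
  proof (rule Bochner_Integration.integrable_bound)
    show "integrable lborel (\<lambda>x. c\<^sup>2 * (norm (g x))\<^sup>2)"
      using L2_integrable_square[OF assms(1)] by simp
    show "AE x in lborel. norm ((norm (f x))\<^sup>2) \<le> norm (c\<^sup>2 * (norm (g x))\<^sup>2)"
      using assms(3)
    proof eventually_elim
      case (elim x)
      show ?case using power_mono[OF elim, of 2] by (simp add: power_mult_distrib)
    qed
  qed (use assms in measurable)
qed (use assms in simp)

lemma L2_norm_bound: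
  assumes "g \<in> L2" and "f \<in> borel_measurable borel" and "AE x in lborel. norm (f x) \<le> c * norm (g x)"
    and "0 \<le> c"
  shows "L2_norm f \<le> c * L2_norm g"
proof -
  have f: "f \<in> L2" using L2_bound[OF assms(1-3)] .
  have "(L2_norm f)\<^sup>2 \<le> (\<integral>x. c\<^sup>2 * (norm (g x))\<^sup>2 \<partial>lborel)"
    unfolding L2_norm_power2
  proof (rule integral_mono_AE)
    show "AE x in lborel. (norm (f x))\<^sup>2 \<le> c\<^sup>2 * (norm (g x))\<^sup>2"
      using assms(3)
    proof eventually_elim
      case (elim x)
      show ?case using power_mono[OF elim, of 2] by (simp add: power_mult_distrib)
    qed
  qed (use L2_integrable_square f assms(1) in auto)
  also have "\<dots> = (c * L2_norm g)\<^sup>2"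
    by (simp add: L2_norm_power2 power_mult_distrib)
  finally show ?thesis
    by (rule power2_le_imp_le) (use assms(4) in simp)
qed

lemma L2_norm_AE_cong:
  assumes "f \<in> borel_measurable borel" "g \<in> borel_measurable borel" "AE x in lborel. f x = g x"
  shows "L2_norm f = L2_norm g"
proof -
  have "(\<integral>x. (norm (f x))\<^sup>2 \<partial>lborel) = (\<integral>x. (norm (g x))\<^sup>2 \<partial>lborel)"
    by (rule integral_cong_AE) (use assms in auto)
  then show ?thesis by (simp add: L2_norm_def)
qed

lemma L2_mult_bounded:
  assumes "f \<in> L2" "m \<in> borel_measurable borel" "\<And>x. norm (m x) \<le> c"
  shows "(\<lambda>x. m x * f x) \<in> L2"
proof (rule L2_bound[OF assms(1)])
  show "(\<lambda>x. m x * f x) \<in> borel_measurable borel" using assms(1,2) by measurable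
  show "AE x in lborel. norm (m x * f x) \<le> c * norm (f x)"
    by (auto simp: norm_mult intro!: mult_right_mono assms(3))
qed

lemma L2_scale: "f \<in> L2 \<Longrightarrow> (\<lambda>x. c * f x) \<in> L2"
  by (rule L2_mult_bounded[where c = "norm c"]) auto

lemma L2_norm_scale: "L2_norm (\<lambda>x. c * f x) = norm c * L2_norm f"
  by (simp add: L2_norm_def norm_mult power_mult_distrib real_sqrt_mult)

lemma L2_zero [simp]: "(\<lambda>x. 0) \<in> L2"
  by (simp add: L2_def)

lemma L2_norm_zero [simp]: "L2_norm (\<lambda>x. 0) = 0"
  by (simp add: L2_norm_def)

lemma L2_add:
  assumes "f \<in> L2" "g \<in> L2"
  shows "(\<lambda>x. f x + g x) \<in> L2"
proof (rule L2_I)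
  show "(\<lambda>x. f x + g x) \<in> borel_measurable borel" using assms by measurable
  show "integrable lborel (\<lambda>x. (norm (f x + g x))\<^sup>2)"
  proof (rule Bochner_Integration.integrable_bound)
    show "integrable lborel (\<lambda>x. 2 * (norm (f x))\<^sup>2 + 2 * (norm (g x))\<^sup>2)"
      using assms[THEN L2_integrable_square] by simp
    have "(norm (a + b))\<^sup>2 \<le> 2 * (norm a)\<^sup>2 + 2 * (norm b)\<^sup>2" for a b :: complex
    proof -
      have "(norm (a + b))\<^sup>2 \<le> (norm a + norm b)\<^sup>2"
        by (intro power_mono norm_triangle_ineq) auto
      also have "\<dots> \<le> 2 * (norm a)\<^sup>2 + 2 * (norm b)\<^sup>2"
        using sum_squares_bound[of "norm a" "norm b"] by (simp add: power2_sum)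
      finally show ?thesis .
    qed
    then show "AE x in lborel. norm ((norm (f x + g x))\<^sup>2) \<le> norm (2 * (norm (f x))\<^sup>2 + 2 * (norm (g x))\<^sup>2)"
      by (auto intro!: AE_I2)
  qed (use assms in measurable)
qed

lemma L2_diff:
  assumes "f \<in> L2" "g \<in> L2"
  shows "(\<lambda>x. f x - g x) \<in> L2"
  using L2_add[OF assms(1) L2_scale[OF assms(2), of "-1"]] by simp

lemma L2_sum:
  assumes "\<And>i. i \<in> I \<Longrightarrow> f i \<in> L2"
  shows "(\<lambda>x. \<Sum>i\<in>I. f i x) \<in> L2"
  using assms by (induction I rule: infinite_finite_induct) (auto intro: L2_add)

lemma L2_integrable_norm_prod:
  assumes "f \<in> L2" "g \<in> L2"
  shows "integrable lborel (\<lambda>x. norm (f x) * norm (g x))"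
proof (rule Bochner_Integration.integrable_bound)
  show "integrable lborel (\<lambda>x. (norm (f x))\<^sup>2 + (norm (g x))\<^sup>2)"
    using assms[THEN L2_integrable_square] by simp
  have "a * b \<le> a\<^sup>2 + b\<^sup>2" for a b :: real
    using sum_squares_bound[of a b] sum_power2_ge_zero[of a b] by linarith
  then show "AE x in lborel. norm (norm (f x) * norm (g x)) \<le> norm ((norm (f x))\<^sup>2 + (norm (g x))\<^sup>2)"
    by (auto simp: abs_mult)
qed (use assms in measurable)

lemma L2_integrable_prod:
  assumes "f \<in> L2" "g \<in> L2"
  shows "integrable lborel (\<lambda>x. f x * g x)"
  by (rule Bochner_Integration.integrable_bound[OF L2_integrable_norm_prod[OF assms]])
    (use assms L2_measurable in \<open>simp_all add: norm_mult\<close>)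

lemma borel_measurable_cnj [measurable]:
  "f \<in> borel_measurable M \<Longrightarrow> (\<lambda>x. cnj (f x)) \<in> borel_measurable M"
  using borel_measurable_continuous_on[of cnj f M] by (auto intro!: continuous_intros)

lemma L2_cnj: "f \<in> L2 \<Longrightarrow> (\<lambda>x. cnj (f x)) \<in> L2"
  by (auto simp: L2_def)

lemma L2_inner_integrable:
  assumes "f \<in> L2" "g \<in> L2"
  shows "integrable lborel (\<lambda>x. cnj (f x) * g x)"
  using L2_integrable_prod[OF L2_cnj[OF assms(1)] assms(2)] .

lemma L2_Cauchy_Schwarz:
  assumes "f \<in> L2" "g \<in> L2"
  shows "(\<integral>x. norm (f x) * norm (g x) \<partial>lborel) \<le> L2_norm f * L2_norm g"
proof -
  have [measurable]: "f \<in> borel_measurable borel" "g \<in> borel_measurable borel"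
    using assms by (auto simp: L2_def)
  define I where "I = (\<integral>x. norm (f x) * norm (g x) \<partial>lborel)"
  have I0: "0 \<le> I" by (simp add: I_def)
  have *: "(\<integral>\<^sup>+x. ennreal (norm (h x)) ^ 2 \<partial>lborel) = ennreal ((L2_norm h)\<^sup>2)" if "h \<in> L2" for h :: "real^'a \<Rightarrow> complex"
    unfolding L2_norm_power2
    by (subst nn_integral_eq_integral[symmetric]) (use L2_integrable_square[OF that] in \<open>auto simp: ennreal_power\<close>)
  have "(\<integral>\<^sup>+x. ennreal (norm (f x)) * ennreal (norm (g x)) \<partial>lborel) = ennreal I"
    unfolding I_def
    by (subst nn_integral_eq_integral[symmetric]) (use L2_integrable_norm_prod[OF assms] in \<open>auto simp: ennreal_mult\<close>)
  then have "ennreal I ^ 2 \<le> ennreal ((L2_norm f)\<^sup>2) * ennreal ((L2_norm g)\<^sup>2)"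
    using Cauchy_Schwarz_nn_integral[of "\<lambda>x. ennreal (norm (f x))" lborel "\<lambda>x. ennreal (norm (g x))"]
      *[OF assms(1)] *[OF assms(2)] by simp
  then have "I\<^sup>2 \<le> (L2_norm f)\<^sup>2 * (L2_norm g)\<^sup>2"
    using I0 by (simp add: ennreal_power flip: ennreal_mult)
  then have "I\<^sup>2 \<le> (L2_norm f * L2_norm g)\<^sup>2" by (simp add: power_mult_distrib)
  then show ?thesis unfolding I_def[symmetric] by (rule power2_le_imp_le) simp
qed

lemma L2_inner_bound:
  assumes "f \<in> L2" "g \<in> L2"
  shows "norm (L2_inner f g) \<le> L2_norm f * L2_norm g"
proof -
  have "norm (L2_inner f g) \<le> (\<integral>x. norm (cnj (f x) * g x) \<partial>lborel)"
    unfolding L2_inner_def by (rule integral_norm_bound)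
  also have "\<dots> \<le> L2_norm f * L2_norm g"
    using L2_Cauchy_Schwarz[OF assms] by (simp add: norm_mult)
  finally show ?thesis .
qed

lemma L2_norm_triangle:
  assumes "f \<in> L2" "g \<in> L2"
  shows "L2_norm (\<lambda>x. f x + g x) \<le> L2_norm f + L2_norm g"
proof -
  have "(L2_norm (\<lambda>x. f x + g x))\<^sup>2 \<le> (\<integral>x. (norm (f x))\<^sup>2 + (norm (g x))\<^sup>2 + 2 * (norm (f x) * norm (g x)) \<partial>lborel)"
    unfolding L2_norm_power2
  proof (rule integral_mono)
    show "integrable lborel (\<lambda>x. (norm (f x + g x))\<^sup>2)"
      using L2_add[OF assms] by (rule L2_integrable_square)
    show "integrable lborel (\<lambda>x. (norm (f x))\<^sup>2 + (norm (g x))\<^sup>2 + 2 * (norm (f x) * norm (g x)))"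
      using assms by (intro Bochner_Integration.integrable_add integrable_mult_right) (auto intro: L2_integrable_square L2_integrable_norm_prod)
    fix x
    have "(norm (f x + g x))\<^sup>2 \<le> (norm (f x) + norm (g x))\<^sup>2"
      by (intro power_mono norm_triangle_ineq) auto
    then show "(norm (f x + g x))\<^sup>2 \<le> (norm (f x))\<^sup>2 + (norm (g x))\<^sup>2 + 2 * (norm (f x) * norm (g x))"
      by (simp add: power2_sum)
  qed
  also have "\<dots> = (L2_norm f)\<^sup>2 + (L2_norm g)\<^sup>2 + 2 * (\<integral>x. norm (f x) * norm (g x) \<partial>lborel)"
    using L2_integrable_square[OF assms(1)] L2_integrable_square[OF assms(2)] L2_integrable_norm_prod[OF assms]
    by (simp add: L2_norm_power2)
  also have "\<dots> \<le> (L2_norm f + L2_norm g)\<^sup>2"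
    using L2_Cauchy_Schwarz[OF assms] by (simp add: power2_sum)
  finally show ?thesis by (rule power2_le_imp_le) simp
qed

lemma L2_norm_triangle_diff:
  assumes "f \<in> L2" "g \<in> L2"
  shows "\<bar>L2_norm f - L2_norm g\<bar> \<le> L2_norm (\<lambda>x. f x - g x)"
proof -
  have "L2_norm f \<le> L2_norm (\<lambda>x. f x - g x) + L2_norm g"
    using L2_norm_triangle[OF L2_diff[OF assms] assms(2)] by simp
  moreover have "L2_norm g \<le> L2_norm (\<lambda>x. g x - f x) + L2_norm f"
    using L2_norm_triangle[OF L2_diff[OF assms(2,1)] assms(1)] by simp
  moreover have "L2_norm (\<lambda>x. g x - f x) = L2_norm (\<lambda>x. f x - g x)"
    by (simp add: L2_norm_def norm_minus_commute)
  ultimately show ?thesis by simp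
qed

lemma L2_norm_sum:
  assumes "finite I" "\<And>i. i \<in> I \<Longrightarrow> f i \<in> L2"
  shows "L2_norm (\<lambda>x. \<Sum>i\<in>I. f i x) \<le> (\<Sum>i\<in>I. L2_norm (f i))"
  using assms
proof (induction I)
  case (insert i I)
  have "L2_norm (\<lambda>x. f i x + (\<Sum>i\<in>I. f i x)) \<le> L2_norm (f i) + L2_norm (\<lambda>x. \<Sum>i\<in>I. f i x)"
    using insert.prems by (intro L2_norm_triangle L2_sum) auto
  with insert show ?case by simp
qed simp

lemma L2_inner_add_right:
  assumes "f \<in> L2" "g \<in> L2" "h \<in> L2"
  shows "L2_inner f (\<lambda>x. g x + h x) = L2_inner f g + L2_inner f h"
  using L2_inner_integrable[OF assms(1,2)] L2_inner_integrable[OF assms(1,3)]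
  by (simp add: L2_inner_def distrib_left)

lemma L2_inner_diff_right:
  assumes "f \<in> L2" "g \<in> L2" "h \<in> L2"
  shows "L2_inner f (\<lambda>x. g x - h x) = L2_inner f g - L2_inner f h"
  using L2_inner_integrable[OF assms(1,2)] L2_inner_integrable[OF assms(1,3)]
  by (simp add: L2_inner_def right_diff_distrib)

lemma L2_inner_scale_right: "L2_inner f (\<lambda>x. c * g x) = c * L2_inner f g"
  unfolding L2_inner_def by (simp add: mult.left_commute)

lemma L2_inner_cnj: "L2_inner g f = cnj (L2_inner f g)"
proof -
  have "cnj (L2_inner f g) = (\<integral>x. cnj (cnj (f x) * g x) \<partial>lborel)"
    unfolding L2_inner_def by (rule Bochner_Integration.integral_cnj[symmetric])
  then show ?thesis by (simp add: L2_inner_def mult.commute del: Bochner_Integration.integral_cnj)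
qed

lemma L2_inner_add_left:
  assumes "f \<in> L2" "g \<in> L2" "h \<in> L2"
  shows "L2_inner (\<lambda>x. g x + h x) f = L2_inner g f + L2_inner h f"
  using L2_inner_add_right[OF assms] L2_inner_cnj complex_cnj_add by metis

lemma L2_inner_diff_left:
  assumes "f \<in> L2" "g \<in> L2" "h \<in> L2"
  shows "L2_inner (\<lambda>x. g x - h x) f = L2_inner g f - L2_inner h f"
  using L2_inner_diff_right[OF assms] L2_inner_cnj complex_cnj_diff by metis

lemma L2_inner_scale_left: "L2_inner (\<lambda>x. c * g x) f = cnj c * L2_inner g f"
  unfolding L2_inner_def by (simp add: mult.assoc)

lemma L2_inner_sum_left:
  assumes "f \<in> L2" "\<And>i. i \<in> I \<Longrightarrow> g i \<in> L2"
  shows "L2_inner (\<lambda>x. \<Sum>i\<in>I. g i x) f = (\<Sum>i\<in>I. L2_inner (g i) f)"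
  using assms(2)
proof (induction I rule: infinite_finite_induct)
  case (insert i I)
  then show ?case
    using L2_inner_add_left[OF assms(1), of "g i" "\<lambda>x. \<Sum>i\<in>I. g i x"] by (auto intro: L2_sum)
qed (auto simp: L2_inner_def)

lemma L2_inner_sum_right:
  assumes "f \<in> L2" "\<And>i. i \<in> I \<Longrightarrow> g i \<in> L2"
  shows "L2_inner f (\<lambda>x. \<Sum>i\<in>I. g i x) = (\<Sum>i\<in>I. L2_inner f (g i))"
  using assms(2)
proof (induction I rule: infinite_finite_induct)
  case (insert i I)
  then show ?case
    using L2_inner_add_right[OF assms(1), of "g i" "\<lambda>x. \<Sum>i\<in>I. g i x"] by (auto intro: L2_sum)
qed (auto simp: L2_inner_def)

lemma L2_inner_self: "f \<in> L2 \<Longrightarrow> L2_inner f f = of_real ((L2_norm f)\<^sup>2)"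
  unfolding L2_inner_def L2_norm_power2
  by (subst integral_complex_of_real[symmetric]) (simp add: mult.commute[of "cnj _"] complex_norm_square[symmetric])

lemma L2_inner_AE_cong_right:
  assumes "f \<in> borel_measurable borel" "g \<in> borel_measurable borel" "h \<in> borel_measurable borel"
    and "AE x in lborel. g x = h x"
  shows "L2_inner f g = L2_inner f h"
  unfolding L2_inner_def by (rule integral_cong_AE) (use assms in auto)

lemma continuous_L2_norm:
  assumes "continuous_L2 u"
  shows "continuous_on UNIV (\<lambda>t. L2_norm (u t))"
proof -
  have "((\<lambda>s. L2_norm (u s)) \<longlongrightarrow> L2_norm (u t)) (at t)" for t
  proof (rule Lim_transform[OF tendsto_const])
    show "((\<lambda>s. L2_norm (u s) - L2_norm (u t)) \<longlongrightarrow> 0) (at t)"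
    proof (rule Lim_null_comparison)
      show "\<forall>\<^sub>F s in at t. norm (L2_norm (u s) - L2_norm (u t)) \<le> L2_norm (\<lambda>x. u s x - u t x)"
        using assms L2_norm_triangle_diff by (auto simp: continuous_L2_def intro!: always_eventually)
      show "((\<lambda>s. L2_norm (\<lambda>x. u s x - u t x)) \<longlongrightarrow> 0) (at t)"
        using assms by (simp add: continuous_L2_def)
    qed
  qed
  then show ?thesis by (simp add: continuous_on_def)
qed

lemma L2_bounded_support:
  assumes "f \<in> borel_measurable borel" "\<And>x. norm (f x) \<le> c" "\<And>x. norm x > R \<Longrightarrow> f x = 0"
  shows "f \<in> L2"
proof (rule L2_I[OF assms(1)])
  show "integrable lborel (\<lambda>x. (norm (f x))\<^sup>2)"
  proof (rule Bochner_Integration.integrable_bound)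
    show "integrable lborel (\<lambda>x. indicator (cball 0 R) x *\<^sub>R c\<^sup>2)"
      using emeasure_lborel_cball_finite
      by (intro integrable_scaleR_left integrable_real_indicator) auto
    show "AE x in lborel. norm ((norm (f x))\<^sup>2) \<le> norm (indicator (cball 0 R) x *\<^sub>R c\<^sup>2)"
    proof (rule AE_I2)
      fix x
      show "norm ((norm (f x))\<^sup>2) \<le> norm (indicator (cball 0 R) x *\<^sub>R c\<^sup>2)"
        using power_mono[OF assms(2)[of x], of 2] assms(3)[of x] by (cases "norm x > R") (auto simp: indicator_def)
    qed
  qed (use assms in measurable)
qed

section \<open>Smooth functions\<close>

lemma dir_deriv_eq: "(f has_derivative f') (at x) \<Longrightarrow> dir_deriv b f x = f' b"
  unfolding dir_deriv_def using frechet_derivative_at by metis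

lemma smooth_iff:
  "smooth f \<longleftrightarrow> (\<forall>x. f differentiable (at x)) \<and> (\<forall>b\<in>Basis. smooth (dir_deriv b f))"
proof
  assume f: "smooth f"
  have "smooth (dir_deriv b f)" if "b \<in> Basis" for b
    unfolding smooth_def
  proof (intro allI impI)
    fix bs :: "'a list" assume "set bs \<subseteq> Basis"
    then have "set (bs @ [b]) \<subseteq> Basis" using that by auto
    then have "foldr dir_deriv (bs @ [b]) f differentiable_on UNIV"
      using f unfolding smooth_def by blast
    then show "foldr dir_deriv bs (dir_deriv b f) differentiable_on UNIV" by simp
  qed
  moreover have "foldr dir_deriv [] f differentiable_on UNIV"
    using f unfolding smooth_def by (metis empty_set empty_subsetI)
  ultimately show "(\<forall>x. f differentiable (at x)) \<and> (\<forall>b\<in>Basis. smooth (dir_deriv b f))"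
    by (simp add: differentiable_on_def)
next
  assume f: "(\<forall>x. f differentiable (at x)) \<and> (\<forall>b\<in>Basis. smooth (dir_deriv b f))"
  show "smooth f"
    unfolding smooth_def
  proof (intro allI impI)
    fix bs :: "'a list" assume bs: "set bs \<subseteq> Basis"
    show "foldr dir_deriv bs f differentiable_on UNIV"
    proof (cases bs rule: rev_cases)
      case Nil
      then show ?thesis using f by (simp add: differentiable_on_def)
    next
      case (snoc as b)
      then show ?thesis using f bs by (auto simp: smooth_def)
    qed
  qed
qed

lemma smooth_differentiable: "smooth f \<Longrightarrow> f differentiable (at x)"
  using smooth_iff by blast

lemma smooth_dir_deriv: "smooth f \<Longrightarrow> b \<in> Basis \<Longrightarrow> smooth (dir_deriv b f)"
  using smooth_iff by blast

lemma smooth_coinduct: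
  assumes "P f"
    and step: "\<And>f. P f \<Longrightarrow> (\<forall>x. f differentiable (at x)) \<and> (\<forall>b\<in>Basis. P (dir_deriv b f))"
  shows "smooth f"
  unfolding smooth_def
proof (intro allI impI)
  fix bs :: "'a list" assume "set bs \<subseteq> Basis"
  then show "foldr dir_deriv bs f differentiable_on UNIV"
    using \<open>P f\<close>
  proof (induction bs arbitrary: f rule: rev_induct)
    case Nil
    then show ?case using step by (simp add: differentiable_on_def)
  next
    case (snoc b bs)
    then show ?case using step[of f] by simp
  qed
qed

lemma smooth_has_derivative: "smooth f \<Longrightarrow> (f has_derivative frechet_derivative f (at x)) (at x)"
  using smooth_differentiable frechet_derivative_works by blast

lemma smooth_continuous_on: "smooth f \<Longrightarrow> continuous_on S f"
  by (meson smooth_differentiable differentiable_imp_continuous_within continuous_at_imp_continuous_on)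

lemma smooth_measurable:
  fixes f :: "'a::euclidean_space \<Rightarrow> 'b::real_normed_vector"
  shows "smooth f \<Longrightarrow> f \<in> borel_measurable borel"
  by (simp add: borel_measurable_continuous_onI smooth_continuous_on)

lemma dir_deriv_const [simp]: "dir_deriv b (\<lambda>x. c) = (\<lambda>x. 0)"
  using dir_deriv_eq[OF has_derivative_const] by blast

lemma smooth_const [simp]: "smooth (\<lambda>x. c)"
proof (rule smooth_coinduct[where P = "\<lambda>f. \<exists>c. f = (\<lambda>x. c)"])
  fix f :: "'a \<Rightarrow> 'b" assume "\<exists>c. f = (\<lambda>x. c)"
  then obtain c where "f = (\<lambda>x. c)" by blast
  then show "(\<forall>x. f differentiable (at x)) \<and> (\<forall>b\<in>Basis. \<exists>c. dir_deriv b f = (\<lambda>x. c))"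
    by auto
qed blast

lemma dir_deriv_bounded_linear:
  assumes "bounded_linear L" "smooth f"
  shows "dir_deriv b (\<lambda>x. L (f x)) = (\<lambda>x. L (dir_deriv b f x))"
proof
  fix x
  show "dir_deriv b (\<lambda>x. L (f x)) x = L (dir_deriv b f x)"
    unfolding dir_deriv_def[of b f]
    by (rule dir_deriv_eq[OF bounded_linear.has_derivative[OF assms(1) smooth_has_derivative[OF assms(2)]]])
qed

lemma smooth_bounded_linear:
  fixes f :: "'x::euclidean_space \<Rightarrow> 'a::real_normed_vector" and L :: "'a \<Rightarrow> 'b::real_normed_vector"
  assumes L: "bounded_linear L" and f: "smooth f"
  shows "smooth (\<lambda>x. L (f x))"
proof (rule smooth_coinduct[where P = "\<lambda>h. \<exists>f. smooth f \<and> h = (\<lambda>x. L (f x))"])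
  fix h :: "'x \<Rightarrow> 'b" assume "\<exists>f. smooth f \<and> h = (\<lambda>x. L (f x))"
  then obtain f :: "'x \<Rightarrow> 'a" where f: "smooth f" "h = (\<lambda>x. L (f x))" by blast
  have "h differentiable (at x)" for x
    using bounded_linear.has_derivative[OF L smooth_has_derivative[OF f(1)]] f(2) differentiableI by blast
  then show "(\<forall>x. h differentiable (at x)) \<and> (\<forall>b\<in>Basis. \<exists>f. smooth f \<and> dir_deriv b h = (\<lambda>x. L (f x)))"
    using dir_deriv_bounded_linear[OF L f(1)] smooth_dir_deriv[OF f(1)] f(2) by metis
qed (use f in blast)

lemma smooth_linear: "bounded_linear L \<Longrightarrow> smooth L"
proof (subst smooth_iff, intro conjI ballI allI)
  assume L: "bounded_linear L"
  fix x show "L differentiable (at x)" using L by (rule bounded_linear_imp_differentiable)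
next
  assume L: "bounded_linear L"
  fix b :: 'a
  have "dir_deriv b L = (\<lambda>x. L b)"
    using dir_deriv_eq[OF bounded_linear_imp_has_derivative[OF L]] by blast
  then show "smooth (dir_deriv b L)" by simp
qed

lemma dir_deriv_add:
  assumes "smooth f" "smooth g"
  shows "dir_deriv b (\<lambda>x. f x + g x) = (\<lambda>x. dir_deriv b f x + dir_deriv b g x)"
proof
  fix x
  show "dir_deriv b (\<lambda>x. f x + g x) x = dir_deriv b f x + dir_deriv b g x"
    unfolding dir_deriv_def[of b f] dir_deriv_def[of b g]
    by (rule dir_deriv_eq[OF has_derivative_add[OF assms[THEN smooth_has_derivative]]])
qed

lemma smooth_add:
  assumes "smooth f" "smooth g"
  shows "smooth (\<lambda>x. f x + g x)"
proof (rule smooth_coinduct[where P = "\<lambda>h. \<exists>f g. smooth f \<and> smooth g \<and> h = (\<lambda>x. f x + g x)"])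
  fix h :: "'a \<Rightarrow> 'b" assume "\<exists>f g. smooth f \<and> smooth g \<and> h = (\<lambda>x. f x + g x)"
  then obtain f g where fg: "smooth f" "smooth g" "h = (\<lambda>x. f x + g x)" by blast
  then show "(\<forall>x. h differentiable (at x)) \<and>
      (\<forall>b\<in>Basis. \<exists>f g. smooth f \<and> smooth g \<and> dir_deriv b h = (\<lambda>x. f x + g x))"
    using dir_deriv_add[OF fg(1,2)] smooth_dir_deriv smooth_differentiable
    by (metis differentiable_add)
qed (use assms in blast)

lemma smooth_minus: "smooth f \<Longrightarrow> smooth (\<lambda>x. - f x)"
  by (rule smooth_bounded_linear[OF bounded_linear_minus[OF bounded_linear_ident]])

lemma smooth_diff: "smooth f \<Longrightarrow> smooth g \<Longrightarrow> smooth (\<lambda>x. f x - g x)"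
  using smooth_add[OF _ smooth_minus, of f g] by simp

lemma smooth_sum: "(\<And>i. i \<in> I \<Longrightarrow> smooth (f i)) \<Longrightarrow> smooth (\<lambda>x. \<Sum>i\<in>I. f i x)"
  by (induction I rule: infinite_finite_induct) (auto intro: smooth_add)

text \<open>Smoothness of products, compositions and flat functions is proved by coinduction: the spans below
  are closed under directional derivatives.\<close>

inductive bilinear_span for B where
  base: "smooth f \<Longrightarrow> smooth g \<Longrightarrow> bilinear_span B (\<lambda>x. B (f x) (g x))"
| add: "bilinear_span B f \<Longrightarrow> bilinear_span B g \<Longrightarrow> bilinear_span B (\<lambda>x. f x + g x)"

lemma dir_deriv_bilinear:
  assumes B: "bounded_bilinear B" and "smooth f" "smooth g"
  shows "dir_deriv b (\<lambda>x. B (f x) (g x)) = (\<lambda>x. B (f x) (dir_deriv b g x) + B (dir_deriv b f x) (g x))"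
proof
  fix x
  show "dir_deriv b (\<lambda>x. B (f x) (g x)) x = B (f x) (dir_deriv b g x) + B (dir_deriv b f x) (g x)"
    unfolding dir_deriv_def[of b f] dir_deriv_def[of b g]
    by (rule dir_deriv_eq[OF bounded_bilinear.FDERIV[OF B smooth_has_derivative[OF assms(2)] smooth_has_derivative[OF assms(3)]]])
qed

lemma smooth_bilinear:
  fixes f :: "'x::euclidean_space \<Rightarrow> 'a::real_normed_vector" and g :: "'x \<Rightarrow> 'b::real_normed_vector"
    and B :: "'a \<Rightarrow> 'b \<Rightarrow> 'c::real_normed_vector"
  assumes B: "bounded_bilinear B" and "smooth f" "smooth g"
  shows "smooth (\<lambda>x. B (f x) (g x))"
proof (rule smooth_coinduct[where P = "bilinear_span B"])
  show "bilinear_span B (\<lambda>x. B (f x) (g x))" using assms by (auto intro: bilinear_span.base)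
next
  fix h :: "'x \<Rightarrow> 'c" assume "bilinear_span B h"
  then show "(\<forall>x. h differentiable (at x)) \<and> (\<forall>b\<in>Basis. bilinear_span B (dir_deriv b h))"
  proof induction
    case (base f g)
    have "(\<lambda>x. B (f x) (g x)) differentiable (at x)" for x
      using bounded_bilinear.FDERIV[OF B smooth_has_derivative[OF base(1)] smooth_has_derivative[OF base(2)]]
        differentiableI by blast
    then show ?case
      using base by (auto simp: dir_deriv_bilinear[OF B base] intro!: bilinear_span.intros intro: smooth_dir_deriv)
  next
    case (add f g)
    have "dir_deriv b (\<lambda>x. f x + g x) = (\<lambda>x. dir_deriv b f x + dir_deriv b g x)" for b
    proof
      fix x
      have "(f has_derivative frechet_derivative f (at x)) (at x)" "(g has_derivative frechet_derivative g (at x)) (at x)"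
        using add.IH frechet_derivative_works by blast+
      then show "dir_deriv b (\<lambda>x. f x + g x) x = dir_deriv b f x + dir_deriv b g x"
        unfolding dir_deriv_def[of b f] dir_deriv_def[of b g]
        by (intro dir_deriv_eq[OF has_derivative_add])
    qed
    then show ?case using add by (auto intro: differentiable_add bilinear_span.add)
  qed
qed

lemmas smooth_mult = smooth_bilinear[OF bounded_bilinear_mult]
lemmas smooth_scaleR = smooth_bilinear[OF bounded_bilinear_scaleR]
lemmas smooth_inner = smooth_bilinear[OF bounded_bilinear_inner]
lemmas smooth_of_real = smooth_bounded_linear[OF bounded_linear_of_real]
lemmas smooth_cnj = smooth_bounded_linear[OF bounded_linear_cnj]
lemmas smooth_id = smooth_linear[OF bounded_linear_ident]
lemmas smooth_nth = smooth_linear[OF bounded_linear_vec_nth]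

inductive comp_span where
  base: "smooth (f :: real \<Rightarrow> real) \<Longrightarrow> smooth g \<Longrightarrow> smooth k \<Longrightarrow> comp_span (\<lambda>x. f (g x) * k x)"
| add: "comp_span f \<Longrightarrow> comp_span g \<Longrightarrow> comp_span (\<lambda>x. f x + g x)"

lemma has_derivative_real_smooth:
  fixes f :: "real \<Rightarrow> real"
  assumes "smooth f"
  shows "(f has_real_derivative dir_deriv 1 f x) (at x)"
proof -
  have "(f has_derivative frechet_derivative f (at x)) (at x)" using smooth_has_derivative[OF assms] .
  moreover have "frechet_derivative f (at x) = (*) (dir_deriv 1 f x)"
  proof
    fix h
    show "frechet_derivative f (at x) h = dir_deriv 1 f x * h"
      using linear_cmul[OF linear_frechet_derivative[OF smooth_differentiable[OF assms]], of x h 1]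
      unfolding dir_deriv_def by (simp add: mult.commute)
  qed
  ultimately show ?thesis by (simp add: has_field_derivative_def)
qed

lemma dir_deriv_compose_real:
  fixes f :: "real \<Rightarrow> real"
  assumes "smooth f" "smooth g"
  shows "dir_deriv b (\<lambda>x. f (g x)) = (\<lambda>x. dir_deriv 1 f (g x) * dir_deriv b g x)"
proof
  fix x
  show "dir_deriv b (\<lambda>x. f (g x)) x = dir_deriv 1 f (g x) * dir_deriv b g x"
    unfolding dir_deriv_def[of b g]
    by (rule dir_deriv_eq[OF has_derivative_compose[OF smooth_has_derivative[OF assms(2)]
          has_derivative_real_smooth[OF assms(1), unfolded has_field_derivative_def]]])
qed

lemma smooth_compose_real:
  fixes f :: "real \<Rightarrow> real" and g :: "'x::euclidean_space \<Rightarrow> real"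
  assumes "smooth f" "smooth g"
  shows "smooth (\<lambda>x. f (g x))"
proof (rule smooth_coinduct[where P = "comp_span"])
  show "comp_span (\<lambda>x. f (g x))" using assms comp_span.base[of f g "\<lambda>x. 1"] by simp
next
  fix h :: "'x \<Rightarrow> real" assume "comp_span h"
  then show "(\<forall>x. h differentiable (at x)) \<and> (\<forall>b\<in>Basis. comp_span (dir_deriv b h))"
  proof induction
    case (base f g k)
    have d: "((\<lambda>x. f (g x) * k x) has_derivative
        (\<lambda>h. f (g x) * frechet_derivative k (at x) h + (dir_deriv 1 f (g x) * frechet_derivative g (at x) h) * k x)) (at x)" for x
      by (rule has_derivative_mult[OF has_derivative_compose[OF smooth_has_derivative[OF base(2)]
          has_derivative_real_smooth[OF base(1), unfolded has_field_derivative_def]] smooth_has_derivative[OF base(3)]])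
    have "dir_deriv b (\<lambda>x. f (g x) * k x) =
        (\<lambda>x. f (g x) * dir_deriv b k x + dir_deriv 1 f (g x) * (dir_deriv b g x * k x))" for b
      using dir_deriv_eq[OF d] by (auto simp: dir_deriv_def mult.assoc)
    moreover have "(\<lambda>x. f (g x) * k x) differentiable (at x)" for x using d differentiableI by blast
    ultimately show ?case
      using comp_span.add[OF comp_span.base[OF base(1,2) smooth_dir_deriv[OF base(3)]]
          comp_span.base[OF smooth_dir_deriv[OF base(1)] base(2) smooth_mult[OF smooth_dir_deriv[OF base(2)] base(3)]]]
      by auto
  next
    case (add f g)
    have "dir_deriv b (\<lambda>x. f x + g x) = (\<lambda>x. dir_deriv b f x + dir_deriv b g x)" for b
    proof
      fix x
      have "(f has_derivative frechet_derivative f (at x)) (at x)" "(g has_derivative frechet_derivative g (at x)) (at x)"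
        using add.IH frechet_derivative_works by blast+
      then show "dir_deriv b (\<lambda>x. f x + g x) x = dir_deriv b f x + dir_deriv b g x"
        unfolding dir_deriv_def[of b f] dir_deriv_def[of b g]
        by (intro dir_deriv_eq[OF has_derivative_add])
    qed
    then show ?case using add by (auto intro: differentiable_add comp_span.add)
  qed
qed

lemma dir_deriv_affine:
  assumes "smooth f"
  shows "dir_deriv b (\<lambda>x. f (c *\<^sub>R x + a)) = (\<lambda>x. c *\<^sub>R dir_deriv b f (c *\<^sub>R x + a))"
proof
  fix x
  have "((\<lambda>x. c *\<^sub>R x + a) has_derivative (\<lambda>h. c *\<^sub>R h)) (at x)"
    by (auto intro!: derivative_eq_intros)
  from dir_deriv_eq[OF has_derivative_compose[OF this smooth_has_derivative[OF assms]]]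
  show "dir_deriv b (\<lambda>x. f (c *\<^sub>R x + a)) x = c *\<^sub>R dir_deriv b f (c *\<^sub>R x + a)"
    using linear_frechet_derivative[OF smooth_differentiable[OF assms]]
    by (simp add: dir_deriv_def linear_cmul)
qed

lemma smooth_affine:
  assumes "smooth f"
  shows "smooth (\<lambda>x. f (c *\<^sub>R x + a))"
proof (rule smooth_coinduct[where P = "\<lambda>h. \<exists>f. smooth f \<and> h = (\<lambda>x. f (c *\<^sub>R x + a))"])
  fix h :: "'a \<Rightarrow> 'b" assume "\<exists>f. smooth f \<and> h = (\<lambda>x. f (c *\<^sub>R x + a))"
  then obtain f where f: "smooth f" "h = (\<lambda>x. f (c *\<^sub>R x + a))" by blast
  have "((\<lambda>x. c *\<^sub>R x + a) has_derivative (\<lambda>h. c *\<^sub>R h)) (at x)" for x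
    by (auto intro!: derivative_eq_intros)
  from has_derivative_compose[OF this smooth_has_derivative[OF f(1)]]
  have "h differentiable (at x)" for x using f(2) differentiableI by blast
  moreover have "\<exists>f. smooth f \<and> dir_deriv b h = (\<lambda>x. f (c *\<^sub>R x + a))" if "b \<in> Basis" for b
    using dir_deriv_affine[OF f(1)] smooth_scaleR[OF smooth_const[of c] smooth_dir_deriv[OF f(1) that]] f(2)
    by (intro exI[of _ "\<lambda>x. c *\<^sub>R dir_deriv b f x"]) auto
  ultimately show "(\<forall>x. h differentiable (at x)) \<and>
    (\<forall>b\<in>Basis. \<exists>f. smooth f \<and> dir_deriv b h = (\<lambda>x. f (c *\<^sub>R x + a)))" by blast
qed (use assms in blast)

lemma smooth_deriv_line:
  fixes f :: "'a::euclidean_space \<Rightarrow> real"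
  assumes "smooth f"
  shows "((\<lambda>t. f (x + t *\<^sub>R b)) has_real_derivative dir_deriv b f (x + t *\<^sub>R b)) (at t)"
proof -
  have "((\<lambda>t. x + t *\<^sub>R b) has_derivative (\<lambda>h. h *\<^sub>R b)) (at t)"
    by (auto intro!: derivative_eq_intros)
  from has_derivative_compose[OF this smooth_has_derivative[OF assms]]
  show ?thesis
    using linear_frechet_derivative[OF smooth_differentiable[OF assms]]
    by (simp add: dir_deriv_def linear_cmul has_field_derivative_def mult_commute_abs)
qed

lemma dir_deriv_commute_real:
  fixes f :: "'a::euclidean_space \<Rightarrow> real"
  assumes f: "smooth f" and a: "a \<in> Basis" and b: "b \<in> Basis"
  shows "dir_deriv a (dir_deriv b f) x = dir_deriv b (dir_deriv a f) x"
proof -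
  have key: "\<exists>s t. 0 < s \<and> s < h \<and> 0 < t \<and> t < h \<and>
      f (x + h *\<^sub>R a + h *\<^sub>R b) - f (x + h *\<^sub>R a) - f (x + h *\<^sub>R b) + f x =
      h * h * dir_deriv b (dir_deriv a f) (x + s *\<^sub>R a + t *\<^sub>R b)"
    if h: "0 < h" and a: "a \<in> Basis" for h a b
  proof -
    have "\<exists>s. 0 < s \<and> s < h \<and> (f ((x + h *\<^sub>R b) + h *\<^sub>R a) - f (x + h *\<^sub>R a)) - (f ((x + h *\<^sub>R b) + 0 *\<^sub>R a) - f (x + 0 *\<^sub>R a)) =
        (h - 0) * (dir_deriv a f ((x + h *\<^sub>R b) + s *\<^sub>R a) - dir_deriv a f (x + s *\<^sub>R a))"
      by (rule MVT2[OF h, where f = "\<lambda>s. f ((x + h *\<^sub>R b) + s *\<^sub>R a) - f (x + s *\<^sub>R a)"])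
        (auto intro!: derivative_intros smooth_deriv_line f)
    then obtain s where s: "0 < s" "s < h"
      "f (x + h *\<^sub>R a + h *\<^sub>R b) - f (x + h *\<^sub>R a) - f (x + h *\<^sub>R b) + f x =
        h * (dir_deriv a f (x + s *\<^sub>R a + h *\<^sub>R b) - dir_deriv a f (x + s *\<^sub>R a))"
      by (auto simp: algebra_simps)
    have "\<exists>t. 0 < t \<and> t < h \<and> dir_deriv a f ((x + s *\<^sub>R a) + h *\<^sub>R b) - dir_deriv a f ((x + s *\<^sub>R a) + 0 *\<^sub>R b) =
        (h - 0) * dir_deriv b (dir_deriv a f) ((x + s *\<^sub>R a) + t *\<^sub>R b)"
      by (rule MVT2[OF h, where f = "\<lambda>t. dir_deriv a f ((x + s *\<^sub>R a) + t *\<^sub>R b)"])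
        (auto intro!: smooth_deriv_line smooth_dir_deriv f a)
    then show ?thesis using s by (auto simp: mult.assoc)
  qed
  define F where "F = dir_deriv b (dir_deriv a f)"
  define G where "G = dir_deriv a (dir_deriv b f)"
  have "isCont F x" "isCont G x"
    unfolding F_def G_def using f a b
    by (metis smooth_dir_deriv smooth_differentiable differentiable_imp_continuous_within)+
  have "\<bar>F x - G x\<bar> \<le> e" if e: "e > 0" for e
  proof -
    obtain d1 where d1: "d1 > 0" "\<And>y. dist y x < d1 \<Longrightarrow> dist (F y) (F x) < e / 2"
      using \<open>isCont F x\<close> e unfolding continuous_at_eps_delta by (meson half_gt_zero)
    obtain d2 where d2: "d2 > 0" "\<And>y. dist y x < d2 \<Longrightarrow> dist (G y) (G x) < e / 2"
      using \<open>isCont G x\<close> e unfolding continuous_at_eps_delta by (meson half_gt_zero)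
    define h where "h = min d1 d2 / 2"
    have h: "h > 0" using d1 d2 by (simp add: h_def)
    have near: "dist (x + s *\<^sub>R a + t *\<^sub>R b) x < min d1 d2" if "0 < s" "s < h" "0 < t" "t < h" "a \<in> Basis" "b \<in> Basis" for s t and a b :: 'a
    proof -
      have "norm (s *\<^sub>R a + t *\<^sub>R b) \<le> s + t"
        using norm_triangle_ineq[of "s *\<^sub>R a" "t *\<^sub>R b"] that by simp
      also have "\<dots> < min d1 d2" using that by (simp add: h_def)
      finally show ?thesis by (simp add: dist_norm add.assoc)
    qed
    obtain s t where st: "0 < s" "s < h" "0 < t" "t < h"
      "f (x + h *\<^sub>R a + h *\<^sub>R b) - f (x + h *\<^sub>R a) - f (x + h *\<^sub>R b) + f x = h * h * F (x + s *\<^sub>R a + t *\<^sub>R b)"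
      using key[OF h a, of b] unfolding F_def by blast
    obtain s' t' where st': "0 < s'" "s' < h" "0 < t'" "t' < h"
      "f (x + h *\<^sub>R b + h *\<^sub>R a) - f (x + h *\<^sub>R b) - f (x + h *\<^sub>R a) + f x = h * h * G (x + s' *\<^sub>R b + t' *\<^sub>R a)"
      using key[OF h b, of a] unfolding G_def by blast
    have "h * h * F (x + s *\<^sub>R a + t *\<^sub>R b) = h * h * G (x + s' *\<^sub>R b + t' *\<^sub>R a)"
      using st(5) st'(5) by (simp add: algebra_simps)
    then have "F (x + s *\<^sub>R a + t *\<^sub>R b) = G (x + s' *\<^sub>R b + t' *\<^sub>R a)" using h by simp
    moreover have "\<bar>F (x + s *\<^sub>R a + t *\<^sub>R b) - F x\<bar> < e / 2"
      using d1(2) near[OF st(1-4) a b] by (simp add: dist_real_def)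
    moreover have "\<bar>G (x + s' *\<^sub>R b + t' *\<^sub>R a) - G x\<bar> < e / 2"
      using d2(2) near[OF st'(1-4) b a] by (simp add: dist_real_def)
    ultimately show ?thesis by linarith
  qed
  then have "\<bar>F x - G x\<bar> \<le> 0" by (rule field_le_epsilon) simp
  then show ?thesis unfolding F_def G_def by simp
qed

lemma dir_deriv_commute:
  fixes f :: "'a::euclidean_space \<Rightarrow> 'b::euclidean_space"
  assumes f: "smooth f" and a: "a \<in> Basis" and b: "b \<in> Basis"
  shows "dir_deriv a (dir_deriv b f) = dir_deriv b (dir_deriv a f)"
proof
  fix x
  show "dir_deriv a (dir_deriv b f) x = dir_deriv b (dir_deriv a f) x"
  proof (rule euclidean_eqI)
    fix i :: 'b assume "i \<in> Basis"
    note L = bounded_linear_inner_left[of i]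
    have "dir_deriv a (dir_deriv b (\<lambda>x. f x \<bullet> i)) x = dir_deriv b (dir_deriv a (\<lambda>x. f x \<bullet> i)) x"
      using dir_deriv_commute_real[OF smooth_bounded_linear[OF L f] a b] .
    then show "dir_deriv a (dir_deriv b f) x \<bullet> i = dir_deriv b (dir_deriv a f) x \<bullet> i"
      using f a b by (simp add: dir_deriv_bounded_linear[OF L] smooth_dir_deriv)
  qed
qed

lemma smooth_partial: "smooth f \<Longrightarrow> smooth (partial i f)"
  unfolding partial_def by (rule smooth_dir_deriv) (auto simp: axis_in_Basis_iff)

lemma partial_commute:
  fixes f :: "real^'d::finite \<Rightarrow> 'b::euclidean_space"
  shows "smooth f \<Longrightarrow> partial i (partial j f) = partial j (partial i f)"
  unfolding partial_def by (rule dir_deriv_commute) (auto simp: axis_in_Basis_iff)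

lemma partial_const [simp]: "partial i (\<lambda>x. c) = (\<lambda>x. 0)"
  by (simp add: partial_def)

lemma partial_bounded_linear:
  "bounded_linear L \<Longrightarrow> smooth f \<Longrightarrow> partial i (\<lambda>x. L (f x)) = (\<lambda>x. L (partial i f x))"
  unfolding partial_def by (rule dir_deriv_bounded_linear)

lemma partial_add: "smooth f \<Longrightarrow> smooth g \<Longrightarrow> partial i (\<lambda>x. f x + g x) = (\<lambda>x. partial i f x + partial i g x)"
  unfolding partial_def by (rule dir_deriv_add)

lemma partial_bilinear:
  "bounded_bilinear B \<Longrightarrow> smooth f \<Longrightarrow> smooth g \<Longrightarrow>
    partial i (\<lambda>x. B (f x) (g x)) = (\<lambda>x. B (f x) (partial i g x) + B (partial i f x) (g x))"
  unfolding partial_def by (rule dir_deriv_bilinear)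

lemmas partial_mult = partial_bilinear[OF bounded_bilinear_mult]
lemmas partial_of_real = partial_bounded_linear[OF bounded_linear_of_real]
lemmas partial_cnj = partial_bounded_linear[OF bounded_linear_cnj]
lemmas partial_cmult = partial_bounded_linear[OF bounded_linear_mult_right]

lemma partial_sum:
  "(\<And>k. k \<in> I \<Longrightarrow> smooth (f k)) \<Longrightarrow> partial i (\<lambda>x. \<Sum>k\<in>I. f k x) = (\<lambda>x. \<Sum>k\<in>I. partial i (f k) x)"
  by (induction I rule: infinite_finite_induct) (auto simp: partial_add smooth_sum)

lemma partial_nth: "partial i (\<lambda>x. x $ k) = (\<lambda>x. if i = k then 1 else 0)"
proof
  fix x :: "real^'a"
  show "partial i (\<lambda>x. x $ k) x = (if i = k then 1 else 0)"
    unfolding partial_def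
    using dir_deriv_eq[OF bounded_linear_imp_has_derivative[OF bounded_linear_vec_nth[of k]], of "axis i 1" x]
    by (simp add: axis_def)
qed

lemma frechet_derivative_partial:
  fixes f :: "real^'d::finite \<Rightarrow> 'b::real_normed_vector"
  assumes "smooth f"
  shows "frechet_derivative f (at x) h = (\<Sum>i\<in>UNIV. (h $ i) *\<^sub>R partial i f x)"
proof -
  have L: "linear (frechet_derivative f (at x))"
    using linear_frechet_derivative[OF smooth_differentiable[OF assms]] .
  have "h = (\<Sum>i\<in>UNIV. (h $ i) *\<^sub>R axis i 1)"
    using basis_expansion[of h] by (simp add: scalar_mult_eq_scaleR)
  then have "frechet_derivative f (at x) h = frechet_derivative f (at x) (\<Sum>i\<in>UNIV. (h $ i) *\<^sub>R axis i 1)"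
    by simp
  also have "\<dots> = (\<Sum>i\<in>UNIV. (h $ i) *\<^sub>R partial i f x)"
    using L by (simp add: linear_sum linear_cmul partial_def dir_deriv_def)
  finally show ?thesis .
qed

lemma has_derivative_partial:
  fixes f :: "real^'d::finite \<Rightarrow> 'b::real_normed_vector"
  assumes "smooth f"
  shows "(f has_derivative (\<lambda>h. \<Sum>i\<in>UNIV. (h $ i) *\<^sub>R partial i f x)) (at x)"
  using smooth_has_derivative[OF assms] frechet_derivative_partial[OF assms]
  by (metis (no_types, lifting) ext)

lemma funpow_partial_smooth: "smooth f \<Longrightarrow> smooth ((partial i ^^ n) f)"
  by (induction n) (auto intro: smooth_partial)

lemma funpow_partial_commute:
  fixes f :: "real^'d::finite \<Rightarrow> 'b::euclidean_space"
  shows "smooth f \<Longrightarrow> (partial i ^^ n) (partial j f) = partial j ((partial i ^^ n) f)"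
  by (induction n) (auto simp: partial_commute funpow_partial_smooth)

definition mi_deriv_list :: "'d::finite list \<Rightarrow> ('d \<Rightarrow> nat) \<Rightarrow> (real^'d \<Rightarrow> 'b::real_normed_vector) \<Rightarrow> real^'d \<Rightarrow> 'b" where
  "mi_deriv_list is \<alpha> = foldr (\<lambda>i D. (partial i ^^ \<alpha> i) \<circ> D) is id"

lemma mi_deriv_list_simps [simp]:
  "mi_deriv_list [] \<alpha> f = f"
  "mi_deriv_list (i # is) \<alpha> f = (partial i ^^ \<alpha> i) (mi_deriv_list is \<alpha> f)"
  by (simp_all add: mi_deriv_list_def)

lemma mi_deriv_list_smooth: "smooth f \<Longrightarrow> smooth (mi_deriv_list is \<alpha> f)"
  by (induction "is") (auto intro: funpow_partial_smooth)

lemma mi_deriv_list_partial: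
  fixes f :: "real^'d::finite \<Rightarrow> 'b::euclidean_space"
  shows "smooth f \<Longrightarrow> mi_deriv_list is \<alpha> (partial j f) = partial j (mi_deriv_list is \<alpha> f)"
  by (induction "is") (auto simp: funpow_partial_commute mi_deriv_list_smooth)

lemma mi_deriv_list_update:
  fixes f :: "real^'d::finite \<Rightarrow> 'b::euclidean_space"
  assumes "smooth f" "distinct is"
  shows "mi_deriv_list is (\<alpha>(j := Suc (\<alpha> j))) f =
    (if j \<in> set is then partial j (mi_deriv_list is \<alpha> f) else mi_deriv_list is \<alpha> f)"
  using assms(2)
  by (induction "is") (use assms(1) in \<open>auto simp: funpow_partial_commute mi_deriv_list_smooth\<close>)

lemma coords: "distinct (coords :: 'd::finite list)" "set (coords :: 'd list) = UNIV"
proof -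
  obtain xs :: "'d list" where "set xs = UNIV" "distinct xs"
    using finite_distinct_list[of "UNIV :: 'd set"] by auto
  then have "distinct (coords :: 'd list) \<and> set (coords :: 'd list) = UNIV"
    unfolding coords_def by (intro someI[of "\<lambda>is. distinct is \<and> set is = UNIV" xs]) simp
  then show "distinct (coords :: 'd list)" "set (coords :: 'd list) = UNIV" by auto
qed

lemma mi_deriv_eq_list: "mi_deriv = mi_deriv_list coords"
  by (simp add: fun_eq_iff mi_deriv_def mi_deriv_list_def)

lemma mi_deriv_Suc:
  fixes f :: "real^'d::finite \<Rightarrow> 'b::euclidean_space"
  assumes "smooth f"
  shows "mi_deriv (\<alpha>(j := Suc (\<alpha> j))) f = partial j (mi_deriv \<alpha> f)"
    and "mi_deriv \<alpha> (partial j f) = partial j (mi_deriv \<alpha> f)"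
  using assms by (auto simp: mi_deriv_eq_list mi_deriv_list_partial mi_deriv_list_update coords)

lemma mi_deriv_zero [simp]: "mi_deriv (\<lambda>i. 0) f = f"
proof -
  have "mi_deriv_list is (\<lambda>i. 0) f = f" for "is" by (induction "is") auto
  then show ?thesis by (simp add: mi_deriv_eq_list)
qed

lemma mi_order_zero [simp]: "mi_order (\<lambda>i. 0) = 0"
  by (simp add: mi_order_def)

lemma mi_order_Suc: "mi_order (\<alpha>(j := Suc (\<alpha> j))) = Suc (mi_order \<alpha>)"
proof -
  have *: "mi_order \<beta> = \<beta> j + sum \<beta> (UNIV - {j})" for \<beta> :: "'a \<Rightarrow> nat"
    unfolding mi_order_def by (rule sum.remove) auto
  have "sum (\<alpha>(j := Suc (\<alpha> j))) (UNIV - {j}) = sum \<alpha> (UNIV - {j})"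
    by (rule sum.cong) auto
  then show ?thesis unfolding *[of "\<alpha>(j := Suc (\<alpha> j))"] *[of \<alpha>] by simp
qed

lemma mi_power_zero [simp]: "mi_power x (\<lambda>i. 0) = 1"
  by (simp add: mi_power_def)

lemma mi_power_Suc: "mi_power x (\<alpha>(j := Suc (\<alpha> j))) = x $ j * mi_power x \<alpha>"
proof -
  have *: "mi_power x \<beta> = (x $ j) ^ \<beta> j * (\<Prod>i\<in>UNIV - {j}. (x $ i) ^ \<beta> i)" for \<beta>
    unfolding mi_power_def by (rule prod.remove) auto
  have "(\<Prod>i\<in>UNIV - {j}. (x $ i) ^ (\<alpha>(j := Suc (\<alpha> j))) i) = (\<Prod>i\<in>UNIV - {j}. (x $ i) ^ \<alpha> i)"
    by (rule prod.cong) auto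
  then show ?thesis unfolding *[of "\<alpha>(j := Suc (\<alpha> j))"] *[of \<alpha>] by simp
qed

lemma mi_order_pos_decompose:
  assumes "mi_order \<alpha> > 0"
  obtains \<alpha>' j where "\<alpha> = \<alpha>'(j := Suc (\<alpha>' j))" "mi_order \<alpha> = Suc (mi_order \<alpha>')"
proof -
  obtain j where "\<alpha> j > 0"
    using assms unfolding mi_order_def by (metis finite_class.finite_UNIV gr_zeroI less_not_refl sum.neutral)
  then have "\<alpha> = (\<alpha>(j := \<alpha> j - 1))(j := Suc ((\<alpha>(j := \<alpha> j - 1)) j))" by auto
  then show ?thesis using that mi_order_Suc by metis
qed

lemma test_function_iff: "test_function \<eta> \<longleftrightarrow> smooth \<eta> \<and> (\<exists>R. \<forall>x. norm x > R \<longrightarrow> \<eta> x = 0)"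
proof safe
  assume t: "test_function \<eta>"
  then show "smooth \<eta>" by (simp add: test_function_def)
  have "bounded (closure {x. \<eta> x \<noteq> 0})" using t by (simp add: test_function_def compact_imp_bounded)
  then obtain R where "\<And>x. \<eta> x \<noteq> 0 \<Longrightarrow> norm x \<le> R"
    by (metis (mono_tags, lifting) bounded_iff closure_subset mem_Collect_eq subsetD)
  then show "\<exists>R. \<forall>x. norm x > R \<longrightarrow> \<eta> x = 0" by (meson not_le)
next
  fix R assume "smooth \<eta>" and R: "\<forall>x. norm x > R \<longrightarrow> \<eta> x = 0"
  then have "{x. \<eta> x \<noteq> 0} \<subseteq> cball 0 R" by (auto simp: not_less[symmetric])
  then have "bounded {x. \<eta> x \<noteq> 0}" using bounded_cball bounded_subset by blast
  then show "test_function \<eta>" using \<open>smooth \<eta>\<close> by (simp add: test_function_def compact_closure)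
qed

lemma test_function_smooth: "test_function \<eta> \<Longrightarrow> smooth \<eta>"
  by (simp add: test_function_def)

lemma test_function_mult_smooth:
  assumes "smooth f" "test_function \<eta>"
  shows "test_function (\<lambda>x. f x * \<eta> x)"
  using assms by (auto simp: test_function_iff intro: smooth_mult)

lemma test_function_scale: "test_function \<eta> \<Longrightarrow> test_function (\<lambda>x. c * \<eta> x)"
  using test_function_mult_smooth[OF smooth_const] .

lemma test_function_add:
  assumes "test_function f" "test_function g"
  shows "test_function (\<lambda>x. f x + g x)"
proof -
  obtain R R' where "\<And>x. norm x > R \<Longrightarrow> f x = 0" "\<And>x. norm x > R' \<Longrightarrow> g x = 0"
    using assms unfolding test_function_iff by blast
  then have "\<forall>x. norm x > max R R' \<longrightarrow> f x + g x = 0" by simp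
  then show ?thesis using assms smooth_add unfolding test_function_iff by blast
qed

lemma test_function_sum:
  "(\<And>i. i \<in> I \<Longrightarrow> test_function (f i)) \<Longrightarrow> test_function (\<lambda>x. \<Sum>i\<in>I. f i x)"
proof (induction I rule: infinite_finite_induct)
  case (insert x F)
  then show ?case by (auto intro: test_function_add)
qed (auto simp: test_function_iff)

lemma test_function_cnj: "test_function \<eta> \<Longrightarrow> test_function (\<lambda>x. cnj (\<eta> x))"
  by (auto simp: test_function_iff intro: smooth_cnj)

lemma partial_eq_0_outside:
  fixes f :: "real^'d::finite \<Rightarrow> 'b::real_normed_vector"
  assumes "\<And>x. norm x > R \<Longrightarrow> f x = 0" "norm x > R"
  shows "partial i f x = 0"
proof -
  have "open {x::real^'d. norm x > R}" by (intro open_Collect_less continuous_intros)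
  then have "(f has_derivative (\<lambda>h. 0)) (at x)"
    by (rule has_derivative_transform_within_open[OF has_derivative_const[of 0]]) (use assms in auto)
  then show ?thesis unfolding partial_def by (rule dir_deriv_eq)
qed

lemma test_function_partial: "test_function \<eta> \<Longrightarrow> test_function (partial i \<eta>)"
proof -
  assume t: "test_function \<eta>"
  then obtain R where "\<And>x. norm x > R \<Longrightarrow> \<eta> x = 0" unfolding test_function_iff by blast
  then have "\<forall>x. norm x > R \<longrightarrow> partial i \<eta> x = 0" using partial_eq_0_outside by blast
  then show ?thesis
    using smooth_partial[OF test_function_smooth[OF t]] unfolding test_function_iff by blast
qed

lemma test_function_bounded:
  assumes "test_function \<eta>"
  obtains c where "\<And>x. norm (\<eta> x) \<le> c" "c > 0"
proof -
  obtain R where R: "\<And>x. norm x > R \<Longrightarrow> \<eta> x = 0" and s: "smooth \<eta>"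
    using assms unfolding test_function_iff by blast
  have "compact (\<eta> ` cball 0 R)"
    by (intro compact_continuous_image smooth_continuous_on s) auto
  then have "bounded (\<eta> ` cball 0 R)" by (rule compact_imp_bounded)
  then obtain c where c: "\<And>x. x \<in> cball 0 R \<Longrightarrow> norm (\<eta> x) \<le> c"
    unfolding bounded_iff by blast
  have "norm (\<eta> x) \<le> max c 1" for x
  proof (cases "norm x > R")
    case False
    then show ?thesis using c[of x] by simp
  qed (use R in simp)
  then show ?thesis using that[of "max c 1"] by simp
qed

lemma test_function_L2: "test_function \<eta> \<Longrightarrow> \<eta> \<in> L2"
proof -
  assume t: "test_function \<eta>"
  obtain c where c: "\<And>x. norm (\<eta> x) \<le> c" using test_function_bounded[OF t] by blast
  obtain R where R: "\<And>x. norm x > R \<Longrightarrow> \<eta> x = 0" using t unfolding test_function_iff by blast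
  show ?thesis using L2_bounded_support[OF smooth_measurable[OF test_function_smooth[OF t]] c R] .
qed

lemma test_function_measurable: "test_function \<eta> \<Longrightarrow> \<eta> \<in> borel_measurable borel"
  by (intro smooth_measurable test_function_smooth)

section \<open>A bump function\<close>

definition flat_exp :: "real \<Rightarrow> real" where
  "flat_exp s = (if s \<le> 0 then 0 else exp (- (1 / s)))"

inductive flat_span where
  base: "flat_span (\<lambda>s. c * (1 / s) ^ k * flat_exp s)"
| add: "flat_span f \<Longrightarrow> flat_span g \<Longrightarrow> flat_span (\<lambda>x. f x + g x)"

lemma tendsto_power_flat_exp: "((\<lambda>s. (1 / s) ^ k * flat_exp s) \<longlongrightarrow> 0) (at 0)"
proof -
  have "((\<lambda>s. (inverse s) ^ k / exp (inverse s)) \<longlongrightarrow> (0::real)) (at_right 0)"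
    by (rule filterlim_compose[OF tendsto_power_div_exp_0 filterlim_inverse_at_top_right])
  then have "((\<lambda>s. (1 / s) ^ k * flat_exp s) \<longlongrightarrow> 0) (at_right 0)"
    by (rule Lim_transform_eventually)
      (auto simp: flat_exp_def exp_minus field_simps eventually_at_filter intro!: always_eventually)
  moreover have "((\<lambda>s. (1 / s) ^ k * flat_exp s) \<longlongrightarrow> 0) (at_left 0)"
    by (rule Lim_transform_eventually[OF tendsto_const])
      (auto simp: flat_exp_def eventually_at_filter intro!: always_eventually)
  ultimately show ?thesis by (simp add: filterlim_at_split)
qed

lemma flat_base_deriv:
  "((\<lambda>s. c * (1 / s) ^ k * flat_exp s) has_real_derivative
     (c * (1 / s) ^ (k + 2) * flat_exp s + (- c * real k) * (1 / s) ^ (k + 1) * flat_exp s)) (at s)"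
proof -
  consider "s < 0" | "s = 0" | "s > 0" by linarith
  then show ?thesis
  proof cases
    case 1
    have "((\<lambda>s. 0) has_real_derivative 0) (at s)" by simp
    then have "((\<lambda>s. c * (1 / s) ^ k * flat_exp s) has_real_derivative 0) (at s)"
      by (rule has_field_derivative_transform_within_open[of _ _ _ "{..<0}"]) (use 1 in \<open>auto simp: flat_exp_def\<close>)
    then show ?thesis using 1 by (simp add: flat_exp_def)
  next
    case 2
    have "((\<lambda>h. c * ((1 / h) ^ Suc k * flat_exp h)) \<longlongrightarrow> c * 0) (at 0)"
      by (intro tendsto_intros tendsto_power_flat_exp)
    then show ?thesis using 2 by (simp add: DERIV_def flat_exp_def field_simps cong: if_cong)
  next
    case 3
    have "((\<lambda>s. c * (1 / s) ^ k * exp (- (1 / s))) has_real_derivative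
      (c * (1 / s) ^ (k + 2) * exp (- (1 / s)) + (- c * real k) * (1 / s) ^ (k + 1) * exp (- (1 / s)))) (at s)"
    proof (cases k)
      case 0
      then show ?thesis
        using 3 by (auto intro!: derivative_eq_intros simp: power_divide field_simps power2_eq_square)
    next
      case (Suc m)
      have "((\<lambda>s. 1 / s) has_real_derivative - ((1 / s)\<^sup>2)) (at s)"
        using 3 by (auto intro!: derivative_eq_intros simp: power_divide field_simps power2_eq_square)
      note d = this DERIV_power[OF this, of "Suc m"]
      show ?thesis unfolding Suc
        by (rule DERIV_cong[OF DERIV_mult[OF DERIV_cmult[OF d(2), of c] DERIV_fun_exp[OF DERIV_minus[OF d(1)]]]])
          (simp add: algebra_simps power2_eq_square add_divide_distrib diff_divide_distrib)
    qed
    then have "((\<lambda>s. c * (1 / s) ^ k * flat_exp s) has_real_derivative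
      (c * (1 / s) ^ (k + 2) * exp (- (1 / s)) + (- c * real k) * (1 / s) ^ (k + 1) * exp (- (1 / s)))) (at s)"
      by (rule has_field_derivative_transform_within_open[of _ _ _ "{0<..}"]) (use 3 in \<open>auto simp: flat_exp_def\<close>)
    then show ?thesis using 3 by (simp add: flat_exp_def)
  qed
qed

lemma dir_deriv_real_eq: "(f has_real_derivative D) (at x) \<Longrightarrow> dir_deriv 1 f x = D"
  using dir_deriv_eq[of f "(*) D" x 1] by (simp add: has_field_derivative_def)

lemma smooth_flat_exp: "smooth flat_exp"
proof (rule smooth_coinduct[where P = "flat_span"])
  show "flat_span flat_exp" using flat_span.base[of 1 0] by simp
next
  fix f :: "real \<Rightarrow> real" assume "flat_span f"
  then have "(\<exists>g. flat_span g \<and> (\<forall>s. (f has_real_derivative g s) (at s)))"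
  proof induction
    case (base c k)
    show ?case using flat_base_deriv flat_span.intros by blast
  next
    case (add f g)
    then obtain f' g' where "flat_span f'" "\<And>s. (f has_real_derivative f' s) (at s)"
      "flat_span g'" "\<And>s. (g has_real_derivative g' s) (at s)" by blast
    then show ?case by (intro exI[of _ "\<lambda>s. f' s + g' s"]) (auto intro: DERIV_add flat_span.add)
  qed
  then obtain g where g: "flat_span g" "\<And>s. (f has_real_derivative g s) (at s)" by blast
  then have "dir_deriv 1 f = g" using dir_deriv_real_eq by blast
  then show "(\<forall>x. f differentiable (at x)) \<and> (\<forall>b\<in>Basis. flat_span (dir_deriv b f))"
    using g by (auto simp: real_differentiable_def)
qed

lemma flat_exp_bounds: "0 \<le> flat_exp s" "flat_exp s \<le> 1" "s \<le> 0 \<Longrightarrow> flat_exp s = 0" "s > 0 \<Longrightarrow> flat_exp s > 0"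
  by (auto simp: flat_exp_def)

lemma flat_exp_limit: "(\<lambda>n. flat_exp (real n * s)) \<longlonglongrightarrow> (if s > 0 then 1 else 0)"
proof (cases "s > 0")
  case True
  have "(\<lambda>n. exp (- (inverse (real n) * (1 / s)))) \<longlonglongrightarrow> exp (- (0 * (1 / s)))"
    by (intro tendsto_intros lim_inverse_n)
  then have "(\<lambda>n. flat_exp (real n * s)) \<longlonglongrightarrow> exp (- (0 * (1 / s)))"
    by (rule Lim_transform_eventually)
      (use True in \<open>auto simp: flat_exp_def field_simps eventually_sequentially mult_le_0_iff intro!: exI[of _ 1]\<close>)
  then show ?thesis using True by simp
next
  case False
  then have "real n * s \<le> 0" for n by (simp add: mult_nonneg_nonpos)
  then show ?thesis using False flat_exp_bounds(3) by simp
qed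

lemma smooth_prod:
  fixes f :: "'i \<Rightarrow> 'x::euclidean_space \<Rightarrow> real"
  shows "(\<And>i. i \<in> I \<Longrightarrow> smooth (f i)) \<Longrightarrow> smooth (\<lambda>x. \<Prod>i\<in>I. f i x)"
  by (induction I rule: infinite_finite_induct) (auto intro: smooth_mult)

section \<open>The fundamental lemma of the calculus of variations\<close>

definition box_bump :: "nat \<Rightarrow> real^'d::finite \<Rightarrow> real^'d \<Rightarrow> real^'d \<Rightarrow> real" where
  "box_bump n a b x = (\<Prod>i\<in>UNIV. flat_exp (real n * (x $ i - a $ i)) * flat_exp (real n * (b $ i - x $ i)))"

lemma box_bump_bounds: "0 \<le> box_bump n a b x" "box_bump n a b x \<le> 1" "x \<notin> box a b \<Longrightarrow> box_bump n a b x = 0"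
proof -
  show "0 \<le> box_bump n a b x" "box_bump n a b x \<le> 1" unfolding box_bump_def
    by (auto intro!: prod_nonneg prod_le_1 mult_nonneg_nonneg mult_le_one flat_exp_bounds)
  assume "x \<notin> box a b"
  then obtain i where "x $ i - a $ i \<le> 0 \<or> b $ i - x $ i \<le> 0"
    by (auto simp: mem_box_cart not_less)
  then have "real n * (x $ i - a $ i) \<le> 0 \<or> real n * (b $ i - x $ i) \<le> 0"
    by (auto simp: mult_nonneg_nonpos)
  then have "flat_exp (real n * (x $ i - a $ i)) * flat_exp (real n * (b $ i - x $ i)) = 0"
    using flat_exp_bounds(3) by auto
  then show "box_bump n a b x = 0" unfolding box_bump_def by (intro prod_zero) auto
qed

lemma box_bump_limit: "(\<lambda>n. box_bump n a b x) \<longlonglongrightarrow> indicator (box a b) x"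
proof -
  have "(\<lambda>n. box_bump n a b x) \<longlonglongrightarrow> (\<Prod>i\<in>UNIV. (if x $ i - a $ i > 0 then 1 else 0) * (if b $ i - x $ i > 0 then 1 else 0))"
    unfolding box_bump_def by (intro tendsto_prod tendsto_mult flat_exp_limit)
  moreover have "(\<Prod>i\<in>UNIV. (if x $ i - a $ i > 0 then 1 else 0) * (if b $ i - x $ i > 0 then 1 else 0)) = (indicator (box a b) x :: real)"
  proof (cases "x \<in> box a b")
    case False
    then obtain i where "\<not> a $ i < x $ i \<or> \<not> x $ i < b $ i" by (auto simp: mem_box_cart)
    then show ?thesis using False by (auto intro!: prod_zero)
  qed (auto simp: mem_box_cart)
  ultimately show ?thesis by simp
qed

lemma box_bump_smooth: "smooth (box_bump n a b)"
proof -
  have "smooth (\<lambda>x. flat_exp (real n * (x $ i - a $ i)) * flat_exp (real n * (b $ i - x $ i)))" for i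
    by (intro smooth_mult smooth_compose_real[OF smooth_flat_exp] smooth_diff smooth_nth smooth_const)
  then show ?thesis unfolding box_bump_def[abs_def] by (rule smooth_prod)
qed

lemma test_function_box_bump: "test_function (\<lambda>x. of_real (box_bump n a b x))"
  unfolding test_function_iff
proof
  show "smooth (\<lambda>x. complex_of_real (box_bump n a b x))" by (intro smooth_of_real box_bump_smooth)
  obtain R where R: "\<And>x. x \<in> box a b \<Longrightarrow> norm x \<le> R" using bounded_box[of a b] unfolding bounded_iff by blast
  then have "\<forall>x. R < norm x \<longrightarrow> complex_of_real (box_bump n a b x) = 0"
    using box_bump_bounds(3) by fastforce
  then show "\<exists>R. \<forall>x. R < norm x \<longrightarrow> complex_of_real (box_bump n a b x) = 0" by blast
qed

lemma locally_integrable_box: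
  assumes "locally_integrable g"
  shows "integrable lborel (\<lambda>x. indicator (box a b) x *\<^sub>R g x)"
proof -
  have "set_integrable lborel (cbox a b) g" using assms by (simp add: locally_integrable_def)
  then have "set_integrable lborel (box a b) g"
    by (rule set_integrable_subset) (auto simp: box_subset_cbox)
  then show ?thesis by (simp add: set_integrable_def)
qed

lemma locally_integrable_integral_box:
  assumes g: "locally_integrable g" and 0: "\<And>\<eta>. test_function \<eta> \<Longrightarrow> (\<integral>x. g x * \<eta> x \<partial>lborel) = 0"
  shows "(\<integral>x. indicator (box a b) x *\<^sub>R g x \<partial>lborel) = 0"
proof -
  have gm [measurable]: "g \<in> borel_measurable borel" using g by (simp add: locally_integrable_def)
  have [measurable]: "box_bump n a b \<in> borel_measurable borel" for n by (intro smooth_measurable box_bump_smooth)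
  have "(\<lambda>n. \<integral>x. g x * of_real (box_bump n a b x) \<partial>lborel) \<longlonglongrightarrow> (\<integral>x. indicator (box a b) x *\<^sub>R g x \<partial>lborel)"
  proof (rule integral_dominated_convergence[where w = "\<lambda>x. norm (indicator (box a b) x *\<^sub>R g x)"])
    show "integrable lborel (\<lambda>x. norm (indicator (box a b) x *\<^sub>R g x))"
      by (intro integrable_norm locally_integrable_box g)
    show "AE x in lborel. (\<lambda>n. g x * of_real (box_bump n a b x)) \<longlonglongrightarrow> indicator (box a b) x *\<^sub>R g x"
    proof (rule AE_I2)
      fix x
      have "(\<lambda>n. g x * of_real (box_bump n a b x)) \<longlonglongrightarrow> g x * of_real (indicator (box a b) x)"
        by (intro tendsto_intros box_bump_limit)
      then show "(\<lambda>n. g x * of_real (box_bump n a b x)) \<longlonglongrightarrow> indicator (box a b) x *\<^sub>R g x"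
        by (simp add: scaleR_conv_of_real mult.commute)
    qed
    show "AE x in lborel. norm (g x * of_real (box_bump n a b x)) \<le> norm (indicator (box a b) x *\<^sub>R g x)" for n
    proof (rule AE_I2)
      fix x
      show "norm (g x * of_real (box_bump n a b x)) \<le> norm (indicator (box a b) x *\<^sub>R g x)"
        using box_bump_bounds[where n = n and a = a and b = b and x = x] by (cases "x \<in> box a b") (auto simp: norm_mult mult_left_le)
    qed
  qed auto
  moreover have "(\<integral>x. g x * of_real (box_bump n a b x) \<partial>lborel) = 0" for n
    by (rule 0[OF test_function_box_bump])
  ultimately have "(\<lambda>n. 0) \<longlonglongrightarrow> (\<integral>x. indicator (box a b) x *\<^sub>R g x \<partial>lborel)" by simp
  then show ?thesis by (simp add: LIMSEQ_const_iff)
qed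

lemma fundamental_lemma:
  fixes g :: "real^'d::finite \<Rightarrow> complex"
  assumes g: "locally_integrable g" and 0: "\<And>\<eta>. test_function \<eta> \<Longrightarrow> (\<integral>x. g x * \<eta> x \<partial>lborel) = 0"
  shows "AE x in lborel. g x = 0"
proof -
  have "AE x in lborel. indicator (box (\<chi> i. - real n) (\<chi> i. real n)) x *\<^sub>R g x = 0" for n
  proof (rule sigma_finite_measure.density_zero[OF sigma_finite_lborel])
    define l u :: "real^'d" where "l = (\<chi> i. - real n)" and "u = (\<chi> i. real n)"
    let ?g = "\<lambda>x. indicator (box l u) x *\<^sub>R g x"
    have int: "integrable lborel ?g" by (intro locally_integrable_box g)
    show "integrable lborel (\<lambda>x. indicator (box (\<chi> i. - real n) (\<chi> i. real n)) x *\<^sub>R g x)"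
      by (intro locally_integrable_box g)
    fix A :: "(real^'d) set" assume "A \<in> sets lborel"
    then have A: "A \<in> sigma_sets UNIV (range (\<lambda>(a, b). box a b))"
      by (simp add: borel_eq_box)
    have "set_lebesgue_integral lborel A ?g = 0"
    proof (rule sigma_sets_induct_disjoint[OF _ _ A])
      show "Int_stable (range (\<lambda>(a, b). box a b :: (real^'d) set))"
        by (auto simp: Int_stable_def box_Int_box)
    next
      fix A :: "(real^'d) set" assume "A \<in> range (\<lambda>(a, b). box a b)"
      then obtain a b where "A = box a b" by auto
      then obtain c d where cd: "A \<inter> box l u = box c d"
        using box_Int_box[of a b l u] by blast
      have "set_lebesgue_integral lborel A ?g = (\<integral>x. indicator (box c d) x *\<^sub>R g x \<partial>lborel)"
        unfolding set_lebesgue_integral_def cd[symmetric] by (simp add: indicator_inter_arith)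
      then show "set_lebesgue_integral lborel A ?g = 0"
        using locally_integrable_integral_box[OF g 0] by simp
    next
      show "set_lebesgue_integral lborel {} ?g = 0" by (simp add: set_lebesgue_integral_def)
    next
      fix A assume "A \<in> sigma_sets UNIV (range (\<lambda>(a, b). box a b :: (real^'d) set))" and A0: "set_lebesgue_integral lborel A ?g = 0"
      then have [measurable]: "A \<in> sets borel" by (simp add: borel_eq_box)
      have int': "integrable lborel (\<lambda>x. indicator A x *\<^sub>R ?g x)"
        by (rule integrable_mult_indicator[OF _ int]) simp
      have "(\<lambda>x. indicator (UNIV - A) x *\<^sub>R ?g x) = (\<lambda>x. ?g x - indicator A x *\<^sub>R ?g x)"
        by (auto simp: indicator_def)
      then have "set_lebesgue_integral lborel (UNIV - A) ?g = (\<integral>x. ?g x \<partial>lborel) - set_lebesgue_integral lborel A ?g"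
        unfolding set_lebesgue_integral_def by (simp only: Bochner_Integration.integral_diff[OF int int'])
      then show "set_lebesgue_integral lborel (UNIV - A) ?g = 0"
        using A0 locally_integrable_integral_box[OF g 0] by simp
    next
      fix A :: "nat \<Rightarrow> (real^'d) set" assume d: "disjoint_family A" and "range A \<subseteq> sigma_sets UNIV (range (\<lambda>(a, b). box a b))"
        and A0: "\<And>i. set_lebesgue_integral lborel (A i) ?g = 0"
      then have A: "A i \<in> sets borel" for i by (auto simp: borel_eq_box)
      have "set_lebesgue_integral lborel (\<Union>i. A i) ?g = (\<Sum>i. set_lebesgue_integral lborel (A i) ?g)"
      proof (rule lebesgue_integral_countable_add)
        have "integrable lborel (\<lambda>x. indicator (\<Union>i. A i) x *\<^sub>R ?g x)"
          by (rule integrable_mult_indicator[OF _ int]) (use A in auto)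
        then show "set_integrable lborel (\<Union>i. A i) ?g" by (simp only: set_integrable_def)
      qed (use A d in \<open>auto simp: disjoint_family_on_def\<close>)
      then show "set_lebesgue_integral lborel (\<Union>i. A i) ?g = 0" using A0 by simp
    qed auto
    then show "set_lebesgue_integral lborel A (\<lambda>x. indicator (box (\<chi> i. - real n) (\<chi> i. real n)) x *\<^sub>R g x) = 0"
      unfolding l_def u_def .
  qed
  then have "AE x in lborel. \<forall>n. indicator (box (\<chi> i. - real n) (\<chi> i. real n)) x *\<^sub>R g x = 0"
    unfolding AE_all_countable by blast
  then show ?thesis
  proof eventually_elim
    case (elim x)
    obtain n where "real n > norm x" using reals_Archimedean2 by blast
    then have "- real n < x $ i \<and> x $ i < real n" for i
      using component_le_norm_cart[of x i] by linarith
    then have "x \<in> box (\<chi> i. - real n) (\<chi> i. real n)" by (simp add: mem_box_cart)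
    then show ?case using spec[OF elim, of n] by simp
  qed
qed

section \<open>Convergence and density in $L^2$\<close>

lemma nn_integral_lborel_affine:
  fixes f :: "'a::euclidean_space \<Rightarrow> ennreal"
  assumes [measurable]: "f \<in> borel_measurable borel" and c: "c \<noteq> 0"
  shows "(\<integral>\<^sup>+x. f x \<partial>lborel) = ennreal (\<bar>c\<bar> ^ DIM('a)) * (\<integral>\<^sup>+x. f (t + c *\<^sub>R x) \<partial>lborel)"
  by (subst lborel_affine[OF c, of t]) (simp add: nn_integral_density nn_integral_distr nn_integral_cmult)

lemma integral_lborel_affine:
  fixes f :: "'a::euclidean_space \<Rightarrow> 'b::{banach, second_countable_topology}"
  assumes [measurable]: "f \<in> borel_measurable borel" and c: "c \<noteq> 0"
  shows "(\<integral>x. f x \<partial>lborel) = (\<bar>c\<bar> ^ DIM('a)) *\<^sub>R (\<integral>x. f (t + c *\<^sub>R x) \<partial>lborel)"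
  by (subst lborel_affine[OF c, of t]) (simp add: integral_density integral_distr)

lemma integrable_lborel_affine:
  fixes f :: "'a::euclidean_space \<Rightarrow> 'b::{banach, second_countable_topology}"
  assumes f: "integrable lborel f" and c: "c \<noteq> 0"
  shows "integrable lborel (\<lambda>x. f (t + c *\<^sub>R x))"
proof -
  have [measurable]: "f \<in> borel_measurable borel" using f by simp
  have "integrable (density (distr lborel borel (\<lambda>x. t + c *\<^sub>R x)) (\<lambda>_. ennreal (\<bar>c\<bar> ^ DIM('a)))) f"
    using f lborel_affine[OF c, of t] by simp
  then have "integrable lborel (\<lambda>x. (\<bar>c\<bar> ^ DIM('a)) *\<^sub>R f (t + c *\<^sub>R x))"
    by (simp add: integrable_density integrable_distr_eq)
  then have "integrable lborel (\<lambda>x. inverse (\<bar>c\<bar> ^ DIM('a)) *\<^sub>R (\<bar>c\<bar> ^ DIM('a)) *\<^sub>R f (t + c *\<^sub>R x))"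
    by (rule integrable_scaleR_right)
  then show ?thesis using c by simp
qed

lemma L2_norm_tendsto_0:
  fixes f :: "nat \<Rightarrow> real^'d::finite \<Rightarrow> complex"
  assumes f: "\<And>n. f n \<in> borel_measurable borel" and w: "w \<in> L2"
    and bound: "\<And>n. AE x in lborel. norm (f n x) \<le> norm (w x)"
    and lim: "AE x in lborel. (\<lambda>n. f n x) \<longlonglongrightarrow> 0"
  shows "(\<lambda>n. L2_norm (f n)) \<longlonglongrightarrow> 0"
proof -
  have "(\<lambda>n. \<integral>x. (norm (f n x))\<^sup>2 \<partial>lborel) \<longlonglongrightarrow> integral\<^sup>L lborel (\<lambda>x::real^'d. 0::real)"
  proof (rule integral_dominated_convergence[where w = "\<lambda>x. (norm (w x))\<^sup>2"])
    show "integrable lborel (\<lambda>x. (norm (w x))\<^sup>2)" using w by (rule L2_integrable_square)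
    show "AE x in lborel. (\<lambda>n. (norm (f n x))\<^sup>2) \<longlonglongrightarrow> 0"
      using lim
    proof eventually_elim
      case (elim x)
      show ?case using tendsto_power[OF tendsto_norm[OF elim], of 2] by simp
    qed
    show "AE x in lborel. norm ((norm (f n x))\<^sup>2) \<le> (norm (w x))\<^sup>2" for n
      using bound[of n] by eventually_elim (simp add: power_mono)
  qed (use f w in measurable)
  then have "(\<lambda>n. sqrt (\<integral>x. (norm (f n x))\<^sup>2 \<partial>lborel)) \<longlonglongrightarrow> sqrt 0"
    by (intro tendsto_real_sqrt) simp
  then show ?thesis by (simp add: L2_norm_def)
qed

lemma L2_inner_tendsto:
  assumes "\<And>s. f s \<in> L2" "\<And>s. g s \<in> L2" "f' \<in> L2" "g' \<in> L2"
    and f: "((\<lambda>s. L2_norm (\<lambda>x. f s x - f' x)) \<longlongrightarrow> 0) F"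
    and g: "((\<lambda>s. L2_norm (\<lambda>x. g s x - g' x)) \<longlongrightarrow> 0) F"
  shows "((\<lambda>s. L2_inner (f s) (g s)) \<longlongrightarrow> L2_inner f' g') F"
proof (rule Lim_transform[OF tendsto_const])
  let ?a = "\<lambda>s. L2_norm (\<lambda>x. f s x - f' x)" and ?b = "\<lambda>s. L2_norm (\<lambda>x. g s x - g' x)"
  have lim: "((\<lambda>s. ?a s * ?b s + L2_norm f' * ?b s + ?a s * L2_norm g') \<longlongrightarrow> 0 * 0 + L2_norm f' * 0 + 0 * L2_norm g') F"
    by (intro tendsto_intros f g)
  have bound: "norm (L2_inner (f s) (g s) - L2_inner f' g') \<le> ?a s * ?b s + L2_norm f' * ?b s + ?a s * L2_norm g'" for s
  proof -
    have L: "(\<lambda>x. f s x - f' x) \<in> L2" "(\<lambda>x. g s x - g' x) \<in> L2"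
      by (intro L2_diff assms)+
    have "L2_inner (f s) (g s) - L2_inner f' g' =
        L2_inner (\<lambda>x. f s x - f' x) (\<lambda>x. g s x - g' x) + L2_inner f' (\<lambda>x. g s x - g' x) + L2_inner (\<lambda>x. f s x - f' x) g'"
    proof -
      note e = L2_inner_diff_left[OF L(2) assms(1,3)] L2_inner_diff_right[OF assms(1,2,4)]
          L2_inner_diff_right[OF assms(3,2,4)] L2_inner_diff_left[OF assms(4,1,3)]
      show ?thesis unfolding e[of s] e(3)[of s] by (simp only: algebra_simps)
    qed
    then have "norm (L2_inner (f s) (g s) - L2_inner f' g') \<le> norm (L2_inner (\<lambda>x. f s x - f' x) (\<lambda>x. g s x - g' x))
        + norm (L2_inner f' (\<lambda>x. g s x - g' x)) + norm (L2_inner (\<lambda>x. f s x - f' x) g')"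
      by (simp only: norm_triangle_mono[OF norm_triangle_ineq order_refl])
    from order_trans[OF this add_mono[OF add_mono[OF L2_inner_bound[OF L] L2_inner_bound[OF assms(3) L(2)]]
        L2_inner_bound[OF L(1) assms(4)]]]
    show ?thesis .
  qed
  show "((\<lambda>s. L2_inner (f s) (g s) - L2_inner f' g') \<longlongrightarrow> 0) F"
    by (rule Lim_null_comparison[OF always_eventually]) (use bound lim in \<open>simp_all only: mult_zero_left mult_zero_right add_0 simp_thms\<close>)
qed

definition clip :: "real \<Rightarrow> complex \<Rightarrow> complex" where
  "clip M w = of_real (M / max M (norm w)) * w"

definition cutoff :: "real \<Rightarrow> 'a::real_normed_vector \<Rightarrow> real" where
  "cutoff M x = max 0 (min 1 (M + 1 - norm x))"

lemma clip_cutoff_bounds: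
  assumes "M > 0"
  shows "norm (of_real (cutoff M x) * clip M w) \<le> norm w"
    and "norm (of_real (cutoff M x) * clip M w) \<le> M"
    and "norm x > M + 1 \<Longrightarrow> of_real (cutoff M x) * clip M w = 0"
    and "norm x \<le> M \<Longrightarrow> norm w \<le> M \<Longrightarrow> of_real (cutoff M x) * clip M w = w"
proof -
  have c: "0 \<le> cutoff M x" "cutoff M x \<le> 1" by (auto simp: cutoff_def)
  have n: "norm (clip M w) = M / max M (norm w) * norm w"
    using assms by (simp add: clip_def norm_mult norm_divide)
  have "M / max M (norm w) \<le> 1" using assms by simp
  then have 1: "norm (clip M w) \<le> norm w" unfolding n using mult_right_mono[of _ 1 "norm w"] by fastforce
  have 2: "norm (clip M w) \<le> M" unfolding n using assms by (simp add: field_simps max_def)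
  have le: "norm (of_real (cutoff M x) * clip M w) \<le> norm (clip M w)"
    using c mult_right_mono[of "cutoff M x" 1 "norm (clip M w)"] by (simp add: norm_mult)
  show "norm (of_real (cutoff M x) * clip M w) \<le> norm w" using le 1 by simp
  show "norm (of_real (cutoff M x) * clip M w) \<le> M" using le 2 by simp
  show "norm x > M + 1 \<Longrightarrow> of_real (cutoff M x) * clip M w = 0" by (simp add: cutoff_def)
  show "norm x \<le> M \<Longrightarrow> norm w \<le> M \<Longrightarrow> of_real (cutoff M x) * clip M w = w"
    using assms by (simp add: cutoff_def clip_def)
qed

lemma continuous_on_clip: "M > 0 \<Longrightarrow> continuous_on UNIV (clip M)"
  unfolding clip_def by (intro continuous_intros) (auto simp: max_def split: if_splits)

lemma continuous_on_cutoff: "continuous_on UNIV (cutoff M)"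
  unfolding cutoff_def by (intro continuous_intros)

lemma L2_dense:
  fixes f :: "real^'d::finite \<Rightarrow> complex"
  assumes f: "f \<in> L2" and e: "e > 0"
  obtains c M where "continuous_on UNIV c" "\<And>x. norm (c x) \<le> M" "\<And>x. norm x > M + 1 \<Longrightarrow> c x = 0"
    "c \<in> L2" "L2_norm (\<lambda>x. f x - c x) < e"
proof -
  have fm [measurable]: "f \<in> borel_measurable borel" using f by (simp add: L2_measurable)
  have cm [measurable]: "clip M \<in> borel_measurable borel" if "M > 0" for M
    using continuous_on_clip[OF that] borel_measurable_continuous_onI by blast
  have km [measurable]: "cutoff M \<in> borel_measurable borel" for M :: real
    using continuous_on_cutoff borel_measurable_continuous_onI by blast
  let ?f = "\<lambda>M x. of_real (cutoff M x) * clip M (f x)"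
  have "(\<lambda>n. L2_norm (\<lambda>x. f x - ?f (real (Suc n)) x)) \<longlonglongrightarrow> 0"
  proof (rule L2_norm_tendsto_0[where w = "\<lambda>x. 2 * f x"])
    show "(\<lambda>x. f x - ?f (real (Suc n)) x) \<in> borel_measurable borel" for n
      using measurable_compose[OF fm cm[of "real (Suc n)"]] by measurable
    show "(\<lambda>x. 2 * f x) \<in> L2" by (intro L2_scale f)
    show "AE x in lborel. norm (f x - ?f (real (Suc n)) x) \<le> norm (2 * f x)" for n
    proof (rule AE_I2)
      fix x
      have "norm (f x - ?f (real (Suc n)) x) \<le> norm (f x) + norm (f x)"
        by (intro order_trans[OF norm_triangle_ineq4] add_mono clip_cutoff_bounds(1)) auto
      then show "norm (f x - ?f (real (Suc n)) x) \<le> norm (2 * f x)" by (simp add: norm_mult)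
    qed
    show "AE x in lborel. (\<lambda>n. f x - ?f (real (Suc n)) x) \<longlonglongrightarrow> 0"
    proof (rule AE_I2)
      fix x
      obtain N where N: "real N > max (norm x) (norm (f x))" using reals_Archimedean2 by blast
      have "f x - ?f (real (Suc n)) x = 0" if "n \<ge> N" for n
      proof -
        have "real N \<le> real (Suc n)" using that by simp
        then have "norm x \<le> real (Suc n)" "norm (f x) \<le> real (Suc n)" using N by linarith+
        then show ?thesis using clip_cutoff_bounds(4)[of "real (Suc n)" x "f x"] by simp
      qed
      then show "(\<lambda>n. f x - ?f (real (Suc n)) x) \<longlonglongrightarrow> 0"
        by (intro tendsto_eventually) (auto simp: eventually_sequentially)
    qed
  qed
  then obtain n where n: "L2_norm (\<lambda>x. f x - ?f (real (Suc n)) x) < e / 2"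
    using e by (metis (no_types, lifting) LIMSEQ_D half_gt_zero_iff le_refl diff_zero real_norm_def abs_less_iff)
  define M where "M = real (Suc n)"
  have M: "M > 0" by (simp add: M_def)
  have "f \<in> borel_measurable (lebesgue_on UNIV)" using measurable_completion[of f lborel borel] by simp
  then have "f measurable_on UNIV" by (intro lebesgue_measurable_imp_measurable_on) auto
  then obtain N g where N: "negligible N" and gc: "\<And>n. continuous_on UNIV (g n)"
    and gl: "\<And>x. x \<notin> N \<Longrightarrow> (\<lambda>n. g n x) \<longlonglongrightarrow> f x"
    unfolding measurable_on_def by auto
  let ?c = "\<lambda>n x. of_real (cutoff M x) * clip M (g n x)"
  have cc: "continuous_on UNIV (?c n)" for n
    by (intro continuous_intros continuous_on_cutoff continuous_on_compose2[OF continuous_on_clip[OF M] gc]) auto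
  have ccm: "?c n \<in> borel_measurable borel" for n using cc borel_measurable_continuous_onI by blast
  have cL2: "?c n \<in> L2" for n
    using L2_bounded_support[OF ccm] clip_cutoff_bounds(2,3)[OF M] by blast
  have fL2: "?f M \<in> L2"
    by (rule L2_bounded_support[of _ M "M + 1"])
      (use measurable_compose[OF fm cm[OF M]] clip_cutoff_bounds(2,3)[OF M] in \<open>auto\<close>)
  have "(\<lambda>n. L2_norm (\<lambda>x. ?f M x - ?c n x)) \<longlonglongrightarrow> 0"
  proof (rule L2_norm_tendsto_0[where w = "\<lambda>x. of_real (2 * M) * indicator (cball 0 (M + 1)) x"])
    show "(\<lambda>x. ?f M x - ?c n x) \<in> borel_measurable borel" for n using fL2 cL2 L2_measurable L2_diff by blast
    show "(\<lambda>x. of_real (2 * M) * indicator (cball 0 (M + 1)) x) \<in> L2"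
      by (rule L2_bounded_support[of _ "2 * M" "M + 1"]) (use M in \<open>auto simp: indicator_def norm_mult\<close>)
    show "AE x in lborel. norm (?f M x - ?c n x) \<le> norm (of_real (2 * M) * indicator (cball 0 (M + 1)) x :: complex)" for n
    proof (rule AE_I2)
      fix x :: "real^'d"
      show "norm (?f M x - ?c n x) \<le> norm (of_real (2 * M) * indicator (cball 0 (M + 1)) x :: complex)"
      proof (cases "norm x > M + 1")
        case False
        have "norm (?f M x - ?c n x) \<le> M + M"
          by (intro order_trans[OF norm_triangle_ineq4] add_mono clip_cutoff_bounds(2) M)
        then show ?thesis using False M by (simp add: norm_mult)
      qed (simp add: clip_cutoff_bounds(3)[OF M])
    qed
    have "AE x in lborel. x \<notin> N"
      using N AE_not_in[of N lebesgue] AE_completion_iff[of "\<lambda>x. x \<notin> N" lborel]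
      by (simp add: negligible_iff_null_sets)
    then show "AE x in lborel. (\<lambda>n. ?f M x - ?c n x) \<longlonglongrightarrow> 0"
    proof eventually_elim
      case (elim x)
      have "isCont (clip M) (f x)" using continuous_on_clip[OF M] by (simp add: continuous_on_eq_continuous_at)
      then have "(\<lambda>n. clip M (g n x)) \<longlonglongrightarrow> clip M (f x)"
        using gl[OF elim] isCont_tendsto_compose by blast
      then have "(\<lambda>n. ?f M x - ?c n x) \<longlonglongrightarrow> ?f M x - ?f M x" by (intro tendsto_intros)
      then show ?case by simp
    qed
  qed
  then obtain k where k: "L2_norm (\<lambda>x. ?f M x - ?c k x) < e / 2"
    using e by (metis (no_types, lifting) LIMSEQ_D half_gt_zero_iff le_refl diff_zero real_norm_def abs_less_iff)
  have "L2_norm (\<lambda>x. f x - ?c k x) \<le> L2_norm (\<lambda>x. f x - ?f M x) + L2_norm (\<lambda>x. ?f M x - ?c k x)"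
    using L2_norm_triangle[OF L2_diff[OF f fL2] L2_diff[OF fL2 cL2[of k]]] by simp
  then have "L2_norm (\<lambda>x. f x - ?c k x) < e" using n k by (simp add: M_def)
  then show ?thesis using that[OF cc clip_cutoff_bounds(2,3)[OF M] cL2] by blast
qed

section \<open>Sesquilinear forms given by bounded kernels\<close>

definition kernel_form :: "(real^'d::finite \<Rightarrow> real^'d \<Rightarrow> complex) \<Rightarrow> (real^'d \<Rightarrow> complex) \<Rightarrow> (real^'d \<Rightarrow> complex) \<Rightarrow> complex" where
  "kernel_form c f g = (\<integral>y. (\<integral>z. cnj (f y) * c y z * g z \<partial>lborel) \<partial>lborel)"

definition bounded_kernel :: "(real^'d::finite \<Rightarrow> real^'d \<Rightarrow> complex) \<Rightarrow> bool" where
  "bounded_kernel c \<longleftrightarrow> (\<lambda>(y, z). c y z) \<in> borel_measurable (borel \<Otimes>\<^sub>M borel) \<and>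
     (\<exists>M R. (\<forall>y z. norm (c y z) \<le> M) \<and> (\<forall>y z. norm y > R \<or> norm z > R \<longrightarrow> c y z = 0))"

lemma bounded_kernel_measurable:
  "bounded_kernel c \<Longrightarrow> (\<lambda>p. c (fst p) (snd p)) \<in> borel_measurable (borel \<Otimes>\<^sub>M borel)"
  by (simp add: bounded_kernel_def case_prod_beta')

lemma bounded_kernel_integrable:
  assumes c: "bounded_kernel c" and f: "f \<in> L2" and g: "g \<in> L2"
  shows "integrable (lborel \<Otimes>\<^sub>M lborel) (\<lambda>(y, z). cnj (f y) * c y z * g z)"
proof -
  have [measurable]: "(\<lambda>p. c (fst p) (snd p)) \<in> borel_measurable (borel \<Otimes>\<^sub>M borel)"
    using bounded_kernel_measurable[OF c] .
  have [measurable]: "f \<in> borel_measurable borel" "g \<in> borel_measurable borel" using f g L2_measurable by auto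
  obtain M R where M: "\<And>y z. norm (c y z) \<le> M" and R: "\<And>y z. norm y > R \<or> norm z > R \<Longrightarrow> c y z = 0"
    using c unfolding bounded_kernel_def by blast
  have M0: "M \<ge> 0" using M[of 0 0] norm_ge_zero order_trans by blast
  have [measurable]: "cball (0 :: real^'a) R \<in> sets borel" by (rule borel_closed) simp
  let ?f = "\<lambda>y. norm (f y) * indicator (cball 0 R) y" and ?g = "\<lambda>y. norm (g y) * indicator (cball 0 R) y"
  have norm_indicator: "norm (indicator S x :: complex) = indicator S x" for S and x :: "real^'a"
    by (simp add: indicator_def)
  have ind: "(\<lambda>x. indicator (cball 0 R) x) \<in> L2"
    by (rule L2_bounded_support[of _ 1 R]) (auto simp: indicator_def)
  have fi: "integrable lborel ?f" and gi: "integrable lborel ?g"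
    using L2_integrable_norm_prod[OF f ind] L2_integrable_norm_prod[OF g ind] by (simp_all add: norm_indicator)
  have "integrable (lborel \<Otimes>\<^sub>M lborel) (\<lambda>(y, z). M * (?f y * ?g z))"
  proof (rule lborel_pair.Fubini_integrable)
    show "integrable lborel (\<lambda>x. \<integral>y. norm (case (x, y) of (y, z) \<Rightarrow> M * (?f y * ?g z)) \<partial>lborel)"
    proof -
      have "(\<integral>y. norm (case (x, y) of (y, z) \<Rightarrow> M * (?f y * ?g z)) \<partial>lborel) = (\<integral>z. ?g z \<partial>lborel) * M * ?f x" for x
      proof -
        have "(\<integral>y. norm (case (x, y) of (y, z) \<Rightarrow> M * (?f y * ?g z)) \<partial>lborel) = (\<integral>z. (M * ?f x) * ?g z \<partial>lborel)"
          using M0 by (intro Bochner_Integration.integral_cong) (auto simp: abs_mult)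
        also have "\<dots> = (M * ?f x) * (\<integral>z. ?g z \<partial>lborel)" by (rule integral_mult_right_zero)
        finally show ?thesis by (simp only: mult_ac)
      qed
      then show ?thesis using integrable_mult_right[OF fi] by (simp only:)
    qed
    show "AE x in lborel. integrable lborel (\<lambda>y. case (x, y) of (y, z) \<Rightarrow> M * (?f y * ?g z))"
      using gi by simp
  qed measurable
  then show ?thesis
  proof (rule Bochner_Integration.integrable_bound)
    show "AE p in lborel \<Otimes>\<^sub>M lborel. norm (case p of (y, z) \<Rightarrow> cnj (f y) * c y z * g z) \<le> norm (case p of (y, z) \<Rightarrow> M * (?f y * ?g z))"
    proof (rule AE_I2, clarify)
      fix y z :: "real^'a"
      show "norm (cnj (f y) * c y z * g z) \<le> norm (M * (?f y * ?g z))"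
      proof (cases "norm y > R \<or> norm z > R")
        case False
        have "norm (f y) * norm (c y z) * norm (g z) \<le> norm (f y) * M * norm (g z)"
          using M[of y z] by (intro mult_left_mono mult_right_mono) auto
        then show ?thesis using False M0 by (simp add: norm_mult mult_ac)
      qed (simp add: R)
    qed
  qed (measurable)
qed


lemma kernel_form_eq_inner: "kernel_form c f g = L2_inner f (\<lambda>y. \<integral>z. c y z * g z \<partial>lborel)"
  unfolding kernel_form_def L2_inner_def
  by (simp add: mult.assoc)

lemma kernel_form_swap:
  assumes "bounded_kernel c" "f \<in> L2" "g \<in> L2"
  shows "cnj (kernel_form c f g) = kernel_form (\<lambda>y z. cnj (c z y)) g f"
proof -
  have "kernel_form c f g = (\<integral>z. (\<integral>y. cnj (f y) * c y z * g z \<partial>lborel) \<partial>lborel)"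
    unfolding kernel_form_def
    by (rule lborel_pair.Fubini_integral[symmetric, OF bounded_kernel_integrable[OF assms]])
  then have "cnj (kernel_form c f g) = (\<integral>z. (\<integral>y. cnj (cnj (f y) * c y z * g z) \<partial>lborel) \<partial>lborel)"
    by (simp only: Bochner_Integration.integral_cnj)
  then show ?thesis unfolding kernel_form_def by (simp add: mult_ac)
qed

lemma kernel_form_eq_pair:
  assumes "bounded_kernel c" "f \<in> L2" "g \<in> L2"
  shows "kernel_form c f g = (\<integral>(y, z). cnj (f y) * c y z * g z \<partial>(lborel \<Otimes>\<^sub>M lborel))"
  unfolding kernel_form_def
  using lborel_pair.integral_fst[OF bounded_kernel_integrable[OF assms]] by simp

lemma kernel_form_diff:
  assumes "bounded_kernel c" "bounded_kernel c'" "f \<in> L2" "g \<in> L2"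
    and "bounded_kernel (\<lambda>y z. c y z - c' y z)"
  shows "kernel_form (\<lambda>y z. c y z - c' y z) f g = kernel_form c f g - kernel_form c' f g"
  using bounded_kernel_integrable[OF assms(1,3,4)] bounded_kernel_integrable[OF assms(2,3,4)]
  by (simp add: kernel_form_eq_pair assms case_prod_beta' left_diff_distrib right_diff_distrib)

lemma kernel_form_Schur:
  fixes m :: "real^'d::finite \<Rightarrow> real"
  assumes c: "bounded_kernel c" and f: "f \<in> L2" and g: "g \<in> L2"
    and m [measurable]: "m \<in> borel_measurable borel" and m0: "\<And>y. 0 \<le> m y" "\<And>y. m y \<le> 1"
    and k [measurable]: "k \<in> borel_measurable borel" and k0: "\<And>y. 0 \<le> k y" and k_even: "\<And>y. k (- y) = k y"
    and a0: "0 \<le> a" and a: "(\<integral>\<^sup>+z. ennreal (k z) \<partial>lborel) \<le> ennreal a"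
    and bound: "\<And>y z. norm (c y z) \<le> k (y - z) * m y"
  shows "norm (kernel_form c f g) \<le> a * L2_norm (\<lambda>y. of_real (m y) * f y) * L2_norm g"
proof -
  have [measurable]: "(\<lambda>p. c (fst p) (snd p)) \<in> borel_measurable (borel \<Otimes>\<^sub>M borel)"
    using bounded_kernel_measurable[OF c] .
  have [measurable]: "f \<in> borel_measurable borel" "g \<in> borel_measurable borel" using f g L2_measurable by auto
  have mf: "(\<lambda>y. of_real (m y) * f y) \<in> L2"
    by (rule L2_mult_bounded[OF f, of _ 1]) (use m0 in auto)
  let ?F = "\<lambda>p. ennreal (sqrt (k (fst p - snd p)) * (m (fst p) * norm (f (fst p))))"
  let ?G = "\<lambda>p. ennreal (sqrt (k (fst p - snd p)) * norm (g (snd p)))"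
  have shift: "(\<integral>\<^sup>+z. ennreal (k (y - z)) \<partial>lborel) \<le> ennreal a" for y
    using nn_integral_lborel_affine[of "\<lambda>z. ennreal (k z)" "-1" y] a by simp
  have shift': "(\<integral>\<^sup>+z. ennreal (k (z - y)) \<partial>lborel) \<le> ennreal a" for y
    using shift[of y] k_even[of "y - _"] by simp
  have nn: "(\<integral>\<^sup>+x. ennreal ((norm (h x))\<^sup>2) \<partial>lborel) = ennreal ((L2_norm h)\<^sup>2)" if "h \<in> L2" for h :: "real^'d \<Rightarrow> complex"
    unfolding L2_norm_power2 by (rule nn_integral_eq_integral) (use L2_integrable_square[OF that] in auto)
  have "(\<integral>\<^sup>+p. ?F p ^ 2 \<partial>(lborel \<Otimes>\<^sub>M lborel)) = (\<integral>\<^sup>+y. (\<integral>\<^sup>+z. ?F (y, z) ^ 2 \<partial>lborel) \<partial>lborel)"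
    by (rule lborel.nn_integral_fst[symmetric]) measurable
  also have "\<dots> = (\<integral>\<^sup>+y. (\<integral>\<^sup>+z. ennreal ((norm (of_real (m y) * f y))\<^sup>2) * ennreal (k (y - z)) \<partial>lborel) \<partial>lborel)"
    using m0 k0 by (intro nn_integral_cong) (simp add: ennreal_power power_mult_distrib norm_mult mult.commute flip: ennreal_mult)
  also have "\<dots> = (\<integral>\<^sup>+y. ennreal ((norm (of_real (m y) * f y))\<^sup>2) * (\<integral>\<^sup>+z. ennreal (k (y - z)) \<partial>lborel) \<partial>lborel)"
    by (intro nn_integral_cong nn_integral_cmult) measurable
  also have "\<dots> \<le> (\<integral>\<^sup>+y. ennreal ((norm (of_real (m y) * f y))\<^sup>2) * ennreal a \<partial>lborel)"
    by (intro nn_integral_mono mult_left_mono shift) auto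
  also have "\<dots> = ennreal ((L2_norm (\<lambda>y. of_real (m y) * f y))\<^sup>2) * ennreal a"
    by (subst nn_integral_multc) (simp_all only: nn[OF mf], measurable)
  finally have F: "(\<integral>\<^sup>+p. ?F p ^ 2 \<partial>(lborel \<Otimes>\<^sub>M lborel)) \<le> ennreal ((L2_norm (\<lambda>y. of_real (m y) * f y))\<^sup>2) * ennreal a" .
  have "(\<integral>\<^sup>+p. ?G p ^ 2 \<partial>(lborel \<Otimes>\<^sub>M lborel)) = (\<integral>\<^sup>+z. (\<integral>\<^sup>+y. ?G (y, z) ^ 2 \<partial>lborel) \<partial>lborel)"
    by (rule lborel_pair.nn_integral_snd[symmetric]) measurable
  also have "\<dots> = (\<integral>\<^sup>+z. (\<integral>\<^sup>+y. ennreal ((norm (g z))\<^sup>2) * ennreal (k (y - z)) \<partial>lborel) \<partial>lborel)"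
    using m0 k0 by (intro nn_integral_cong) (simp add: ennreal_power power_mult_distrib norm_mult mult.commute flip: ennreal_mult)
  also have "\<dots> = (\<integral>\<^sup>+z. ennreal ((norm (g z))\<^sup>2) * (\<integral>\<^sup>+y. ennreal (k (y - z)) \<partial>lborel) \<partial>lborel)"
    by (intro nn_integral_cong nn_integral_cmult) measurable
  also have "\<dots> \<le> (\<integral>\<^sup>+z. ennreal ((norm (g z))\<^sup>2) * ennreal a \<partial>lborel)"
    by (intro nn_integral_mono mult_left_mono shift') auto
  also have "\<dots> = ennreal ((L2_norm g)\<^sup>2) * ennreal a"
    by (subst nn_integral_multc) (simp_all only: nn[OF g], measurable)
  finally have G: "(\<integral>\<^sup>+p. ?G p ^ 2 \<partial>(lborel \<Otimes>\<^sub>M lborel)) \<le> ennreal ((L2_norm g)\<^sup>2) * ennreal a" .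
  have "ennreal (norm (kernel_form c f g)) \<le> (\<integral>\<^sup>+p. norm (case p of (y, z) \<Rightarrow> cnj (f y) * c y z * g z) \<partial>(lborel \<Otimes>\<^sub>M lborel))"
    unfolding kernel_form_eq_pair[OF c f g]
    by (rule integral_norm_bound_ennreal[OF bounded_kernel_integrable[OF c f g]])
  also have "\<dots> \<le> (\<integral>\<^sup>+p. ?F p * ?G p \<partial>(lborel \<Otimes>\<^sub>M lborel))"
  proof (rule nn_integral_mono, clarify)
    fix y z :: "real^'d"
    have "norm (cnj (f y) * c y z * g z) \<le> norm (f y) * (k (y - z) * m y) * norm (g z)"
      using bound[of y z] by (auto simp: norm_mult intro!: mult_right_mono mult_left_mono)
    also have "\<dots> = (sqrt (k (y - z)) * (m y * norm (f y))) * (sqrt (k (y - z)) * norm (g z))"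
      using real_sqrt_mult_self[of "k (y - z)"] k0[of "y - z"] by (simp add: mult_ac)
    finally show "ennreal (norm (cnj (f y) * c y z * g z)) \<le> ?F (y, z) * ?G (y, z)"
      using m0 k0 by (simp flip: ennreal_mult)
  qed
  finally have "(ennreal (norm (kernel_form c f g)))\<^sup>2 \<le> (\<integral>\<^sup>+p. ?F p * ?G p \<partial>(lborel \<Otimes>\<^sub>M lborel))\<^sup>2"
    by (rule power_mono) simp
  also have "\<dots> \<le> (\<integral>\<^sup>+p. ?F p ^ 2 \<partial>(lborel \<Otimes>\<^sub>M lborel)) * (\<integral>\<^sup>+p. ?G p ^ 2 \<partial>(lborel \<Otimes>\<^sub>M lborel))"
    by (rule Cauchy_Schwarz_nn_integral) measurable
  also have "\<dots> \<le> (ennreal ((L2_norm (\<lambda>y. of_real (m y) * f y))\<^sup>2) * ennreal a) * (ennreal ((L2_norm g)\<^sup>2) * ennreal a)"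
    by (rule mult_mono[OF F G]) auto
  also have "\<dots> = ennreal ((a * L2_norm (\<lambda>y. of_real (m y) * f y) * L2_norm g)\<^sup>2)"
    using a0 by (simp add: power_mult_distrib power2_eq_square mult_ac flip: ennreal_mult)
  finally have "(norm (kernel_form c f g))\<^sup>2 \<le> (a * L2_norm (\<lambda>y. of_real (m y) * f y) * L2_norm g)\<^sup>2"
    by (simp add: ennreal_power)
  then show ?thesis by (rule power2_le_imp_le) (use a0 in simp)
qed

section \<open>Hamiltonians and weak solutions\<close>

definition ham :: "(real^'d \<Rightarrow> real^'d) \<Rightarrow> (real^'d::finite \<Rightarrow> real) \<Rightarrow> (real^'d \<Rightarrow> complex) \<Rightarrow> real^'d \<Rightarrow> complex" where
  "ham W U \<eta> x = - (1 / 2) * laplacian \<eta> x + of_real (U x) * \<eta> x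
     - \<i> * (\<Sum>j\<in>UNIV. of_real (W x $ j) * partial j \<eta> x)"

definition skew :: "(real^'d::finite \<Rightarrow> real^'d) \<Rightarrow> bool" where
  "skew W \<longleftrightarrow> linear W \<and> (\<forall>x y. W x \<bullet> y = - (x \<bullet> W y))"

definition weak_solution :: "(real^'d::finite \<Rightarrow> real^'d) \<Rightarrow> (real \<Rightarrow> real^'d \<Rightarrow> real) \<Rightarrow>
    (real \<Rightarrow> real^'d \<Rightarrow> complex) \<Rightarrow> (real \<Rightarrow> real^'d \<Rightarrow> complex) \<Rightarrow> bool" where
  "weak_solution W U u g \<longleftrightarrow> (\<forall>\<eta> t. test_function \<eta> \<longrightarrow>
     ((\<lambda>s. L2_inner \<eta> (u s)) has_vector_derivative
       - \<i> * (L2_inner (ham W (U t) \<eta>) (u t) + L2_inner \<eta> (g t))) (at t))"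

section \<open>Differentiation in time of quadratic forms\<close>

lemma norm_diff_quotient_le:
  fixes f :: "real \<Rightarrow> complex"
  assumes d: "\<And>s. \<bar>s - t\<bar> < 1 \<Longrightarrow> (f has_vector_derivative f' s) (at s)"
    and b: "\<And>s. \<bar>s - t\<bar> < 1 \<Longrightarrow> norm (f' s) \<le> N" and h: "\<bar>h\<bar> < 1"
  shows "norm (f (t + h) - f t) \<le> N * \<bar>h\<bar>"
proof -
  have ball: "\<bar>s - t\<bar> < 1" if "s \<in> ball t 1" for s :: real using that by (simp add: dist_real_def)
  have "norm (f (t + h) - f t) \<le> N * norm (t + h - t)"
  proof (rule differentiable_bound[of "ball t 1" f "\<lambda>s h. h *\<^sub>R f' s"])
    show "(f has_derivative (\<lambda>h. h *\<^sub>R f' s)) (at s within ball t 1)" if "s \<in> ball t 1" for s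
      using d[OF ball[OF that]] by (auto simp: has_vector_derivative_def intro: has_derivative_at_withinI)
    show "onorm (\<lambda>h. h *\<^sub>R f' s) \<le> N" if "s \<in> ball t 1" for s
    proof (rule onorm_le)
      fix h :: real
      show "norm (h *\<^sub>R f' s) \<le> N * norm h"
        using mult_right_mono[OF b[OF ball[OF that]], of "\<bar>h\<bar>"] by (simp add: mult.commute)
    qed
  qed (use h in \<open>auto simp: dist_real_def\<close>)
  then show ?thesis by simp
qed

lemma L2_diff_quotient:
  fixes f f' :: "real \<Rightarrow> real^'d::finite \<Rightarrow> complex"
  assumes m: "\<And>s. f s \<in> borel_measurable borel" and m': "f' t \<in> borel_measurable borel"
    and d: "\<And>s y. \<bar>s - t\<bar> < 1 \<Longrightarrow> ((\<lambda>s. f s y) has_vector_derivative f' s y) (at s)"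
    and b: "\<And>s y. \<bar>s - t\<bar> < 1 \<Longrightarrow> norm (f' s y) \<le> N"
    and supp: "\<And>s y. \<bar>s - t\<bar> < 1 \<Longrightarrow> norm y > R \<Longrightarrow> f s y = 0 \<and> f' s y = 0"
  shows "((\<lambda>h. L2_norm (\<lambda>y. (f (t + h) y - f t y) / of_real h - f' t y)) \<longlongrightarrow> 0) (at 0)"
  unfolding tendsto_at_iff_sequentially
proof (intro allI impI)
  fix X :: "nat \<Rightarrow> real" assume X: "\<forall>i. X i \<in> UNIV - {0}" "X \<longlonglongrightarrow> 0"
  define q where "q n y = (f (t + X n) y - f t y) / of_real (X n) - f' t y" for n y
  have N0: "N \<ge> 0" using order_trans[OF norm_ge_zero b[of t 0]] by simp
  have ev: "\<forall>\<^sub>F n in sequentially. \<bar>X n\<bar> < 1"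
    using tendstoD[OF X(2), of 1] by (simp add: dist_real_def)
  have "(\<lambda>n. L2_norm (\<lambda>y. if \<bar>X n\<bar> < 1 then q n y else 0)) \<longlonglongrightarrow> 0"
  proof (rule L2_norm_tendsto_0[where w = "\<lambda>x. of_real (2 * N) * indicator (cball 0 R) x"])
    show "(\<lambda>y. if \<bar>X n\<bar> < 1 then q n y else 0) \<in> borel_measurable borel" for n
      unfolding q_def using m m' by measurable
    show "(\<lambda>x. of_real (2 * N) * indicator (cball 0 R) x) \<in> L2"
      by (rule L2_bounded_support[of _ "2 * N" R]) (use N0 in \<open>auto simp: indicator_def norm_mult\<close>)
    show "AE y in lborel. norm (if \<bar>X n\<bar> < 1 then q n y else 0) \<le> norm (of_real (2 * N) * indicator (cball 0 R) y :: complex)" for n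
    proof (rule AE_I2)
      fix y :: "real^'d"
      have "norm (q n y) \<le> 2 * N" if "\<bar>X n\<bar> < 1"
      proof -
        have "norm ((f (t + X n) y - f t y) / of_real (X n)) \<le> N"
          using norm_diff_quotient_le[OF d[of _ y] b[of _ y] that] X(1) by (auto simp: norm_divide divide_le_eq)
        then show ?thesis unfolding q_def using norm_triangle_ineq4[of "(f (t + X n) y - f t y) / of_real (X n)" "f' t y"] b[of t y]
          by simp
      qed
      moreover have "q n y = 0" if "\<bar>X n\<bar> < 1" "norm y > R"
        unfolding q_def using supp[of "t + X n" y] supp[of t y] that by simp
      ultimately show "norm (if \<bar>X n\<bar> < 1 then q n y else 0) \<le> norm (of_real (2 * N) * indicator (cball 0 R) y :: complex)"
        using N0 by (cases "norm y > R") (auto simp: norm_mult)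
    qed
    show "AE y in lborel. (\<lambda>n. if \<bar>X n\<bar> < 1 then q n y else 0) \<longlonglongrightarrow> 0"
    proof (rule AE_I2)
      fix y
      have "((\<lambda>h. norm (f (t + h) y - f t y - h *\<^sub>R f' t y) / norm h) \<longlongrightarrow> 0) (at 0)"
        using d[of t y] by (simp add: has_vector_derivative_def has_derivative_at)
      then have "(\<lambda>n. norm (f (t + X n) y - f t y - X n *\<^sub>R f' t y) / norm (X n)) \<longlonglongrightarrow> 0"
        using X unfolding tendsto_at_iff_sequentially comp_def by blast
      moreover have "norm (f (t + X n) y - f t y - X n *\<^sub>R f' t y) / norm (X n) = norm (q n y)" for n
      proof -
        have x: "X n \<noteq> 0" using X(1) by simp
        then have "q n y = (f (t + X n) y - f t y - X n *\<^sub>R f' t y) / of_real (X n)"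
          unfolding q_def by (simp add: diff_divide_distrib scaleR_conv_of_real)
        then show ?thesis by (simp only: norm_divide norm_of_real real_norm_def)
      qed
      ultimately have "(\<lambda>n. q n y) \<longlonglongrightarrow> 0" by (simp add: tendsto_norm_zero_iff)
      then show "(\<lambda>n. if \<bar>X n\<bar> < 1 then q n y else 0) \<longlonglongrightarrow> 0"
        by (rule Lim_transform_eventually) (use ev in eventually_elim, simp)
    qed
  qed
  then have "(\<lambda>n. L2_norm (q n)) \<longlonglongrightarrow> 0"
    by (rule Lim_transform_eventually) (use ev in eventually_elim, simp)
  then show "((\<lambda>h. L2_norm (\<lambda>y. (f (t + h) y - f t y) / of_real h - f' t y)) \<circ> X) \<longlonglongrightarrow> 0"
    by (simp add: comp_def q_def[abs_def])
qed

lemma kernel_apply_bound: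
  fixes c :: "real^'d::finite \<Rightarrow> real^'d \<Rightarrow> complex"
  assumes c: "bounded_kernel c" and f: "f \<in> L2" and N: "\<And>y z. norm (c y z) \<le> N"
    and R: "\<And>y z. norm y > R \<or> norm z > R \<Longrightarrow> c y z = 0"
  shows "norm (\<integral>z. c y z * f z \<partial>lborel) \<le> N * L2_norm (indicator (cball 0 R) :: real^'d \<Rightarrow> complex) * L2_norm f"
proof -
  have [measurable]: "(\<lambda>p. c (fst p) (snd p)) \<in> borel_measurable (borel \<Otimes>\<^sub>M borel)"
    using bounded_kernel_measurable[OF c] .
  have cm: "(\<lambda>z. c y z) \<in> borel_measurable borel"
    using measurable_compose[OF _ bounded_kernel_measurable[OF c], of "\<lambda>z. (y, z)" borel] by simp
  have [measurable]: "cball (0 :: real^'d) R \<in> sets borel" by (rule borel_closed) simp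
  have ind: "(indicator (cball 0 R) :: real^'d \<Rightarrow> complex) \<in> L2"
    by (rule L2_bounded_support[of _ 1 R]) (auto simp: indicator_def)
  have N0: "N \<ge> 0" using N[of 0 0] norm_ge_zero order_trans by blast
  have le: "norm (cnj (c y z)) \<le> N * norm (indicator (cball 0 R) z :: complex)" for z
    using N[of y z] R[of y z] by (cases "norm z > R") auto
  have cL2: "(\<lambda>z. cnj (c y z)) \<in> L2"
    by (rule L2_bound[OF ind, where c = N]) (use cm le in auto)
  have "norm (L2_inner (\<lambda>z. cnj (c y z)) f) \<le> L2_norm (\<lambda>z. cnj (c y z)) * L2_norm f"
    by (rule L2_inner_bound[OF cL2 f])
  also have "\<dots> \<le> (N * L2_norm (indicator (cball 0 R) :: real^'d \<Rightarrow> complex)) * L2_norm f"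
    by (intro mult_right_mono L2_norm_bound[OF ind]) (use cm le N0 in auto)
  finally show ?thesis by (simp add: L2_inner_def)
qed

lemma kernel_apply_measurable:
  assumes "bounded_kernel c" "f \<in> borel_measurable borel"
  shows "(\<lambda>y. \<integral>z. c y z * f z \<partial>lborel) \<in> borel_measurable borel"
proof -
  have [measurable]: "(\<lambda>p. c (fst p) (snd p)) \<in> borel_measurable (borel \<Otimes>\<^sub>M borel)"
    using bounded_kernel_measurable[OF assms(1)] .
  note [measurable] = assms(2)
  have "(\<lambda>(y, z). c y z * f z) \<in> borel_measurable (borel \<Otimes>\<^sub>M lborel)"
    by (simp add: case_prod_beta')
  from lborel.borel_measurable_lebesgue_integral[OF this] show ?thesis by simp
qed

lemma kernel_apply_L2:
  fixes c :: "real^'d::finite \<Rightarrow> real^'d \<Rightarrow> complex"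
  assumes c: "bounded_kernel c" and f: "f \<in> L2"
  shows "(\<lambda>y. \<integral>z. c y z * f z \<partial>lborel) \<in> L2"
proof -
  obtain N R where N: "\<And>y z. norm (c y z) \<le> N" and R: "\<And>y z. norm y > R \<or> norm z > R \<Longrightarrow> c y z = 0"
    using c unfolding bounded_kernel_def by blast
  show ?thesis
    by (rule L2_bounded_support[OF _ kernel_apply_bound[OF c f N R], where R = R])
      (use R kernel_apply_measurable[OF c L2_measurable[OF f]] in simp_all)
qed

lemma bounded_near:
  fixes f :: "real \<Rightarrow> real"
  assumes "continuous_on UNIV f"
  obtains C where "C \<ge> 0" "\<And>s. \<bar>s - t\<bar> < 1 \<Longrightarrow> f s \<le> C"
proof -
  have "compact (f ` cball t 1)"
    using assms by (intro compact_continuous_image) (auto intro: continuous_on_subset)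
  then have "bounded (f ` cball t 1)" by (rule compact_imp_bounded)
  then obtain C where C: "\<And>s. s \<in> cball t 1 \<Longrightarrow> norm (f s) \<le> C" unfolding bounded_iff by blast
  show ?thesis
  proof (rule that[of C])
    show "C \<ge> 0" using C[of t] by (simp add: order_trans[OF abs_ge_zero])
    show "f s \<le> C" if "\<bar>s - t\<bar> < 1" for s
      using C[of s] that by (simp add: dist_real_def abs_minus_commute)
  qed
qed

lemma kernel_form_time_derivative:
  fixes u g :: "real \<Rightarrow> real^'d::finite \<Rightarrow> complex" and k :: "real^'d \<Rightarrow> real^'d \<Rightarrow> real"
    and h :: "real \<Rightarrow> real^'d \<Rightarrow> real^'d \<Rightarrow> complex"
  assumes u: "continuous_L2 u" and sol: "weak_solution W U u g"
    and g: "\<And>t. g t \<in> L2" "\<And>t. L2_norm (g t) \<le> \<gamma> t" and \<gamma>: "continuous_on UNIV \<gamma>"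
    and k_test: "\<And>y. test_function (\<lambda>z. of_real (k y z))" and sym: "\<And>y z. k y z = k z y"
    and bk: "bounded_kernel (\<lambda>y z. of_real (k y z))"
    and h: "\<And>s y z. ham W (U s) (\<lambda>z. of_real (k y z)) z = cnj (h s y z)"
    and bh: "\<And>s. bounded_kernel (h s)"
    and unif: "\<And>s y z. \<bar>s - t\<bar> < 1 \<Longrightarrow> norm (h s y z) \<le> N"
      "\<And>s y z. norm y > R \<or> norm z > R \<Longrightarrow> h s y z = 0 \<and> k y z = 0"
  shows "((\<lambda>s. Re (kernel_form (\<lambda>y z. of_real (k y z)) (u s) (u s))) has_real_derivative
     2 * Im (kernel_form (h t) (u t) (u t) + kernel_form (\<lambda>y z. of_real (k y z)) (u t) (g t))) (at t)"
proof -
  let ?k = "\<lambda>y z. complex_of_real (k y z)"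
  have uL2: "u s \<in> L2" for s using u by (simp add: continuous_L2_def)
  define G where "G s y = (\<integral>z. ?k y z * u s z \<partial>lborel)" for s y
  define H where "H s y = (\<integral>z. h s y z * u s z \<partial>lborel)" for s y
  define Q where "Q s y = (\<integral>z. ?k y z * g s z \<partial>lborel)" for s y
  define G' where "G' s y = - \<i> * (H s y + Q s y)" for s y
  have GL2: "G s \<in> L2" for s unfolding G_def[abs_def] by (rule kernel_apply_L2[OF bk uL2])
  have HL2: "H s \<in> L2" for s unfolding H_def[abs_def] by (rule kernel_apply_L2[OF bh uL2])
  have QL2: "Q s \<in> L2" for s unfolding Q_def[abs_def] by (rule kernel_apply_L2[OF bk g(1)])
  have G'L2: "G' s \<in> L2" for s unfolding G'_def[abs_def] by (intro L2_scale L2_add HL2 QL2)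
  have dG: "((\<lambda>s. G s y) has_vector_derivative G' s y) (at s)" for s y
  proof -
    have "((\<lambda>s. L2_inner (?k y) (u s)) has_vector_derivative
        - \<i> * (L2_inner (ham W (U s) (?k y)) (u s) + L2_inner (?k y) (g s))) (at s)"
      using sol k_test unfolding weak_solution_def by blast
    then show ?thesis unfolding G_def G'_def H_def Q_def L2_inner_def h by simp
  qed
  obtain Nk where Nk: "\<And>y z. norm (?k y z) \<le> Nk" using bk unfolding bounded_kernel_def by blast
  have Nk0: "Nk \<ge> 0" using Nk[of 0 0] norm_ge_zero order_trans by blast
  have N0: "N \<ge> 0" using order_trans[OF norm_ge_zero unif(1)[of t 0 0]] by simp
  obtain Cu where Cu: "Cu \<ge> 0" "\<And>s. \<bar>s - t\<bar> < 1 \<Longrightarrow> L2_norm (u s) \<le> Cu"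
    using bounded_near[OF continuous_L2_norm[OF u], of t] by blast
  obtain Cg where Cg: "Cg \<ge> 0" "\<And>s. \<bar>s - t\<bar> < 1 \<Longrightarrow> \<gamma> s \<le> Cg"
    using bounded_near[OF \<gamma>, of t] by blast
  let ?I = "L2_norm (indicator (cball 0 R) :: real^'d \<Rightarrow> complex)"
  have bG': "norm (G' s y) \<le> N * ?I * Cu + Nk * ?I * Cg" if s: "\<bar>s - t\<bar> < 1" for s y
  proof -
    have 1: "norm (H s y) \<le> N * ?I * L2_norm (u s)" unfolding H_def
      by (rule kernel_apply_bound[OF bh uL2 unif(1)[OF s]]) (use unif(2) in blast)
    have 2: "norm (Q s y) \<le> Nk * ?I * L2_norm (g s)" unfolding Q_def
      by (rule kernel_apply_bound[OF bk g(1) Nk]) (use unif(2) in \<open>simp only: of_real_0\<close>)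
    have "norm (G' s y) = norm (H s y + Q s y)" by (simp add: G'_def norm_mult)
    also have "\<dots> \<le> N * ?I * L2_norm (u s) + Nk * ?I * L2_norm (g s)"
      by (rule norm_triangle_mono[OF 1 2])
    also have "\<dots> \<le> N * ?I * Cu + Nk * ?I * Cg"
      using N0 Nk0 Cu(2)[OF s] Cg(2)[OF s] g(2)[of s] by (intro add_mono mult_left_mono) auto
    finally show ?thesis .
  qed
  have suppG: "G s y = 0 \<and> G' s y = 0" if "norm y > R" for s y
    using unif(2)[of y] that by (simp add: G_def G'_def H_def Q_def)
  let ?D = "\<lambda>s y. (G (t + s) y - G t y) / of_real s"
  have limG: "((\<lambda>s. L2_norm (\<lambda>y. ?D s y - G' t y)) \<longlongrightarrow> 0) (at 0)"
    by (rule L2_diff_quotient[OF _ _ dG bG']) (use GL2 G'L2 L2_measurable suppG in blast)+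
  have limu: "((\<lambda>s. L2_norm (\<lambda>y. u (t + s) y - u t y)) \<longlongrightarrow> 0) (at 0)"
    using u unfolding continuous_L2_def by (simp add: LIM_offset_zero_iff)
  have DL2: "?D s \<in> L2" for s
    using L2_scale[OF L2_diff[OF GL2[of "t + s"] GL2[of t]], of "inverse (of_real s)"] by (simp add: field_simps)
  define F where "F s = kernel_form ?k (u s) (u s)" for s
  have F: "F s = L2_inner (u s) (G s)" for s unfolding F_def kernel_form_eq_inner G_def[abs_def] ..
  have quot: "(F (t + s) - F t) / of_real s = cnj (L2_inner (u (t + s)) (?D s)) + L2_inner (u t) (?D s)" for s
  proof -
    let ?du = "\<lambda>y. u (t + s) y - u t y"
    have duL2: "?du \<in> L2" by (intro L2_diff uL2)
    have K: "(\<lambda>y. \<integral>z. ?k y z * ?du z \<partial>lborel) = (\<lambda>y. G (t + s) y - G t y)"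
    proof
      fix y
      have "L2_inner (?k y) ?du = L2_inner (?k y) (u (t + s)) - L2_inner (?k y) (u t)"
        by (intro L2_inner_diff_right test_function_L2 k_test uL2)
      then show "(\<integral>z. ?k y z * ?du z \<partial>lborel) = G (t + s) y - G t y"
        unfolding G_def by (simp add: L2_inner_def)
    qed
    have "L2_inner ?du (G (t + s)) = kernel_form ?k ?du (u (t + s))"
      unfolding kernel_form_eq_inner G_def[abs_def] ..
    also have "\<dots> = cnj (kernel_form ?k (u (t + s)) ?du)"
      using kernel_form_swap[OF bk uL2 duL2, of "t + s"] sym by simp
    also have "kernel_form ?k (u (t + s)) ?du = L2_inner (u (t + s)) (\<lambda>y. G (t + s) y - G t y)"
      unfolding kernel_form_eq_inner K ..
    finally have 1: "L2_inner ?du (G (t + s)) = cnj (L2_inner (u (t + s)) (\<lambda>y. G (t + s) y - G t y))" .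
    have "F (t + s) - F t = L2_inner ?du (G (t + s)) + L2_inner (u t) (\<lambda>y. G (t + s) y - G t y)"
      unfolding F using L2_inner_diff_left[OF GL2[of "t + s"] uL2[of "t + s"] uL2[of t]]
        L2_inner_diff_right[OF uL2[of t] GL2[of "t + s"] GL2[of t]] by simp
    then have 2: "F (t + s) - F t = cnj (L2_inner (u (t + s)) (\<lambda>y. G (t + s) y - G t y)) + L2_inner (u t) (\<lambda>y. G (t + s) y - G t y)"
      unfolding 1 .
    have D: "?D s = (\<lambda>y. inverse (of_real s) * (G (t + s) y - G t y))" by (simp add: divide_inverse mult.commute)
    show ?thesis unfolding D L2_inner_scale_right 2 by (simp add: divide_inverse distrib_left mult.commute)
  qed
  have "((\<lambda>s. cnj (L2_inner (u (t + s)) (?D s)) + L2_inner (u t) (?D s)) \<longlongrightarrow>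
      cnj (L2_inner (u t) (G' t)) + L2_inner (u t) (G' t)) (at 0)"
    by (intro tendsto_intros L2_inner_tendsto limu limG DL2 uL2 G'L2) simp_all
  then have "((\<lambda>s. Re ((F (t + s) - F t) / of_real s)) \<longlongrightarrow> Re (cnj (L2_inner (u t) (G' t)) + L2_inner (u t) (G' t))) (at 0)"
    unfolding quot by (rule tendsto_Re)
  moreover have "Re (cnj (L2_inner (u t) (G' t)) + L2_inner (u t) (G' t)) =
     2 * Im (kernel_form (h t) (u t) (u t) + kernel_form ?k (u t) (g t))"
  proof -
    have "L2_inner (u t) (G' t) = - \<i> * (L2_inner (u t) (H t) + L2_inner (u t) (Q t))"
      unfolding G'_def[abs_def] L2_inner_scale_right L2_inner_add_right[OF uL2 HL2 QL2] ..
    also have "\<dots> = - \<i> * (kernel_form (h t) (u t) (u t) + kernel_form ?k (u t) (g t))"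
      unfolding kernel_form_eq_inner H_def[abs_def] Q_def[abs_def] ..
    finally show ?thesis by simp
  qed
  ultimately have "((\<lambda>s. Re ((F (t + s) - F t) / of_real s)) \<longlongrightarrow>
     2 * Im (kernel_form (h t) (u t) (u t) + kernel_form ?k (u t) (g t))) (at 0)"
    by simp
  then show ?thesis unfolding DERIV_def F_def by (simp add: Re_divide_of_real)
qed

section \<open>The regularising kernels\<close>

definition radial_kernel :: "(real \<Rightarrow> real) \<Rightarrow> (real \<Rightarrow> real) \<Rightarrow> real^'d::finite \<Rightarrow> real^'d \<Rightarrow> real" where
  "radial_kernel A B y z = A ((norm (y + z))\<^sup>2) * B ((norm (y - z))\<^sup>2)"

lemma radial_kernel_sym: "radial_kernel A B y z = radial_kernel A B z y"
  by (simp add: radial_kernel_def add.commute norm_minus_commute)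

lemma smooth_norm_power2: "smooth (\<lambda>z::real^'d::finite. (norm (y + z))\<^sup>2)" "smooth (\<lambda>z::real^'d::finite. (norm (y - z))\<^sup>2)"
  unfolding power2_norm_eq_inner by (intro smooth_inner smooth_add smooth_diff smooth_const smooth_id)+

lemma partial_norm_power2:
  "partial j (\<lambda>z::real^'d::finite. (norm (y + z))\<^sup>2) = (\<lambda>z. 2 * ((y + z) $ j))"
  "partial j (\<lambda>z::real^'d::finite. (norm (y - z))\<^sup>2) = (\<lambda>z. - 2 * ((y - z) $ j))"
proof -
  have "((\<lambda>z. (norm (y + z))\<^sup>2) has_derivative (\<lambda>h. 2 * ((y + z) \<bullet> h))) (at z)" for z :: "real^'d"
    unfolding power2_norm_eq_inner by (auto intro!: derivative_eq_intros simp: inner_commute inner_simps algebra_simps)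
  from dir_deriv_eq[OF this] show "partial j (\<lambda>z::real^'d. (norm (y + z))\<^sup>2) = (\<lambda>z. 2 * ((y + z) $ j))"
    by (simp add: partial_def fun_eq_iff inner_axis)
  have "((\<lambda>z. (norm (y - z))\<^sup>2) has_derivative (\<lambda>h. - 2 * ((y - z) \<bullet> h))) (at z)" for z :: "real^'d"
    unfolding power2_norm_eq_inner by (auto intro!: derivative_eq_intros simp: inner_commute inner_simps algebra_simps)
  from dir_deriv_eq[OF this] show "partial j (\<lambda>z::real^'d. (norm (y - z))\<^sup>2) = (\<lambda>z. - 2 * ((y - z) $ j))"
    by (simp add: partial_def fun_eq_iff inner_axis)
qed

lemma smooth_radial_kernel: "smooth A \<Longrightarrow> smooth B \<Longrightarrow> smooth (radial_kernel A B y)"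
  unfolding radial_kernel_def[abs_def]
  by (rule smooth_mult[OF smooth_compose_real[OF _ smooth_norm_power2(1)] smooth_compose_real[OF _ smooth_norm_power2(2)]])

lemma partial_radial_kernel:
  assumes "smooth A" "smooth B"
  shows "partial j (radial_kernel A B y) = (\<lambda>z. 2 * ((y + z) $ j) * radial_kernel (dir_deriv 1 A) B y z
     - 2 * ((y - z) $ j) * radial_kernel A (dir_deriv 1 B) y z)"
proof -
  note s = smooth_compose_real[OF assms(1) smooth_norm_power2(1)] smooth_compose_real[OF assms(2) smooth_norm_power2(2)]
  have 1: "partial j (\<lambda>z. A ((norm (y + z))\<^sup>2)) = (\<lambda>z. dir_deriv 1 A ((norm (y + z))\<^sup>2) * (2 * ((y + z) $ j)))"
    unfolding partial_def dir_deriv_compose_real[OF assms(1) smooth_norm_power2(1)] partial_norm_power2(1)[unfolded partial_def] ..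
  have 2: "partial j (\<lambda>z. B ((norm (y - z))\<^sup>2)) = (\<lambda>z. dir_deriv 1 B ((norm (y - z))\<^sup>2) * (- 2 * ((y - z) $ j)))"
    unfolding partial_def dir_deriv_compose_real[OF assms(2) smooth_norm_power2(2)] partial_norm_power2(2)[unfolded partial_def] ..
  show ?thesis
    unfolding radial_kernel_def[abs_def] partial_mult[OF s] 1 2 by (simp add: fun_eq_iff algebra_simps)
qed

lemma partial_add_nth: "partial j (\<lambda>z. c * ((y + z) $ j)) = (\<lambda>z. c)" "partial j (\<lambda>z. c * ((y - z) $ j)) = (\<lambda>z. - c)"
  for y :: "real^'d::finite"
proof -
  have "((\<lambda>z. c * ((y + z) $ j)) has_derivative (\<lambda>h. c * h $ j)) (at z)" for z
    by (auto intro!: derivative_eq_intros bounded_linear.has_derivative[OF bounded_linear_vec_nth])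
  from dir_deriv_eq[OF this] show "partial j (\<lambda>z. c * ((y + z) $ j)) = (\<lambda>z. c)"
    by (simp add: partial_def fun_eq_iff axis_def)
  have "((\<lambda>z. c * ((y - z) $ j)) has_derivative (\<lambda>h. - c * h $ j)) (at z)" for z
    by (auto intro!: derivative_eq_intros bounded_linear.has_derivative[OF bounded_linear_vec_nth])
  from dir_deriv_eq[OF this] show "partial j (\<lambda>z. c * ((y - z) $ j)) = (\<lambda>z. - c)"
    by (simp add: partial_def fun_eq_iff axis_def)
qed

lemma smooth_add_nth: "smooth (\<lambda>z::real^'d::finite. c * ((y + z) $ j))" "smooth (\<lambda>z::real^'d::finite. c * ((y - z) $ j))"
  by (simp_all only: vector_add_component vector_minus_component)
    (intro smooth_mult smooth_add smooth_diff smooth_const smooth_nth)+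

lemma laplacian_radial_kernel:
  fixes y z :: "real^'d::finite"
  assumes A: "smooth A" and B: "smooth B"
  defines "A1 \<equiv> dir_deriv 1 A" and "B1 \<equiv> dir_deriv 1 B"
  defines "A2 \<equiv> dir_deriv 1 A1" and "B2 \<equiv> dir_deriv 1 B1"
  shows "laplacian (radial_kernel A B y) z =
     2 * real CARD('d) * (radial_kernel A1 B y z + radial_kernel A B1 y z)
     + 4 * (norm (y + z))\<^sup>2 * radial_kernel A2 B y z
     - 8 * ((y + z) \<bullet> (y - z)) * radial_kernel A1 B1 y z
     + 4 * (norm (y - z))\<^sup>2 * radial_kernel A B2 y z"
proof -
  have s: "smooth A1" "smooth B1" unfolding A1_def B1_def by (auto intro: smooth_dir_deriv A B)
  have "partial j (partial j (radial_kernel A B y)) z =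
     2 * (radial_kernel A1 B y z + radial_kernel A B1 y z)
     + 4 * (((y + z) $ j) * ((y + z) $ j)) * radial_kernel A2 B y z
     - 8 * (((y + z) $ j) * ((y - z) $ j)) * radial_kernel A1 B1 y z
     + 4 * (((y - z) $ j) * ((y - z) $ j)) * radial_kernel A B2 y z" for j
  proof -
    have "partial j (\<lambda>z. 2 * ((y + z) $ j) * radial_kernel A1 B y z + (- 2) * ((y - z) $ j) * radial_kernel A B1 y z) z =
        (2 * ((y + z) $ j) * partial j (radial_kernel A1 B y) z + 2 * radial_kernel A1 B y z)
        + ((- 2) * ((y - z) $ j) * partial j (radial_kernel A B1 y) z + 2 * radial_kernel A B1 y z)"
      using smooth_radial_kernel[OF s(1) B, of y] smooth_radial_kernel[OF A s(2), of y]
      by (simp only: partial_add partial_mult smooth_mult smooth_add_nth partial_add_nth)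
    then show ?thesis
      unfolding partial_radial_kernel[OF A B] partial_radial_kernel[OF s(1) B] partial_radial_kernel[OF A s(2)]
      unfolding A1_def[symmetric] B1_def[symmetric] A2_def[symmetric] B2_def[symmetric]
      by (simp add: algebra_simps)
  qed
  then show ?thesis
    unfolding laplacian_def power2_norm_eq_inner inner_vec_def
    by (simp add: sum.distrib sum_subtractf sum_distrib_left sum_distrib_right mult.assoc)
qed

lemma partial_of_real_twice:
  "smooth f \<Longrightarrow> laplacian (\<lambda>z. complex_of_real (f z)) z = of_real (laplacian f z)"
  unfolding laplacian_def by (simp add: partial_of_real smooth_partial)

lemma ham_radial_kernel:
  fixes y z :: "real^'d::finite"
  assumes A: "smooth A" and B: "smooth B"
  shows "ham W U (\<lambda>z. of_real (radial_kernel A B y z)) z =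
     of_real (- (1 / 2) * laplacian (radial_kernel A B y) z + U z * radial_kernel A B y z)
     - \<i> * of_real (2 * (W z \<bullet> (y + z)) * radial_kernel (dir_deriv 1 A) B y z
         - 2 * (W z \<bullet> (y - z)) * radial_kernel A (dir_deriv 1 B) y z)"
proof -
  note s = smooth_radial_kernel[OF A B, of y]
  have "(\<Sum>j\<in>UNIV. complex_of_real (W z $ j) * partial j (\<lambda>z. of_real (radial_kernel A B y z)) z) =
     of_real (\<Sum>j\<in>UNIV. W z $ j * partial j (radial_kernel A B y) z)"
    by (simp add: partial_of_real[OF s])
  also have "(\<Sum>j\<in>UNIV. W z $ j * partial j (radial_kernel A B y) z) =
     2 * (W z \<bullet> (y + z)) * radial_kernel (dir_deriv 1 A) B y z
         - 2 * (W z \<bullet> (y - z)) * radial_kernel A (dir_deriv 1 B) y z"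
    unfolding partial_radial_kernel[OF A B] inner_vec_def
    by (simp add: algebra_simps sum_subtractf sum.distrib sum_distrib_left)
  finally show ?thesis unfolding ham_def partial_of_real_twice[OF s] by simp
qed

text \<open>Since the kernel depends on \<open>y + z\<close> and \<open>y - z\<close> only through their lengths, the rotation drops out and
  the Laplacians leave only a mixed first-order term.\<close>

lemma radial_kernel_commutator:
  fixes y z :: "real^'d::finite"
  assumes A: "smooth A" and B: "smooth B" and W: "skew W"
  shows "cnj (ham W U (\<lambda>z. of_real (radial_kernel A B y z)) z) - ham W U (\<lambda>y. of_real (radial_kernel A B z y)) y =
     of_real (8 * ((y + z) \<bullet> (y - z)) * radial_kernel (dir_deriv 1 A) (dir_deriv 1 B) y z
       + (U z - U y) * radial_kernel A B y z)"
proof -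
  have w: "W y \<bullet> z = - (W z \<bullet> y)" "W y \<bullet> y = 0" "W z \<bullet> z = 0"
    using W unfolding skew_def by (metis inner_commute, (metis inner_commute neg_equal_zero)+)
  have n: "norm (z + y) = norm (y + z)" "norm (z - y) = norm (y - z)" by (simp_all add: add.commute norm_minus_commute)
  show ?thesis
    unfolding ham_radial_kernel[OF A B] laplacian_radial_kernel[OF A B] radial_kernel_sym[of _ _ z y] n
    by (simp add: complex_eq_iff inner_add_right inner_diff_right inner_add_left w inner_commute[of z y] algebra_simps)
qed

definition bump :: "real \<Rightarrow> real" where
  "bump s = flat_exp (1 - s)"

lemma smooth_bump: "smooth bump"
  using smooth_affine[OF smooth_flat_exp, of "-1" 1] by (simp add: bump_def[abs_def] add.commute)

lemma bump_bounds: "0 \<le> bump s" "0 \<le> s \<Longrightarrow> bump s \<le> bump 0" "s \<ge> 1 \<Longrightarrow> bump s = 0" "s < 1 \<Longrightarrow> bump s > 0"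
proof -
  show "0 \<le> s \<Longrightarrow> bump s \<le> bump 0"
    by (cases "s < 1") (auto simp: bump_def flat_exp_def field_simps)
qed (auto simp: bump_def flat_exp_bounds)

lemma dir_deriv_bump_bound: obtains C where "C > 0" "\<And>s. 0 \<le> s \<Longrightarrow> \<bar>dir_deriv 1 bump s\<bar> \<le> C" "\<And>s. s > 1 \<Longrightarrow> dir_deriv 1 bump s = 0"
proof -
  have z: "dir_deriv 1 bump s = 0" if "s > 1" for s
  proof -
    have "(bump has_real_derivative 0) (at s)"
      by (rule has_field_derivative_transform_within_open[of "\<lambda>s. 0" _ _ "{1<..}"]) (use that bump_bounds(3) in auto)
    then show ?thesis by (rule dir_deriv_real_eq)
  qed
  have "compact (dir_deriv 1 bump ` {0..1})"
    by (intro compact_continuous_image smooth_continuous_on smooth_dir_deriv smooth_bump) auto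
  then have "bounded (dir_deriv 1 bump ` {0..1})" by (rule compact_imp_bounded)
  then obtain C where C: "\<And>s. s \<in> {0..1} \<Longrightarrow> \<bar>dir_deriv 1 bump s\<bar> \<le> C" unfolding bounded_iff by force
  show ?thesis
  proof (rule that[of "max C 1"])
    fix s :: real assume "0 \<le> s"
    then show "\<bar>dir_deriv 1 bump s\<bar> \<le> max C 1" using C[of s] z[of s] by (cases "s \<le> 1") auto
  qed (use z in auto)
qed

definition bump_mass :: "'a::euclidean_space itself \<Rightarrow> real" where
  "bump_mass _ = (\<integral>x. bump ((norm (x::'a))\<^sup>2) \<partial>lborel)"

definition mollifier :: "real \<Rightarrow> real^'d::finite \<Rightarrow> real" where
  "mollifier \<delta> x = bump ((norm x / \<delta>)\<^sup>2) / (bump_mass TYPE(real^'d) * \<delta> ^ CARD('d))"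

definition reg_kernel :: "real \<Rightarrow> real^'d::finite \<Rightarrow> real^'d \<Rightarrow> real" where
  "reg_kernel \<delta> = radial_kernel (\<lambda>s. bump (\<delta>\<^sup>2 * s))
     (\<lambda>r. 1 / (bump 0 * bump_mass TYPE(real^'d) * \<delta> ^ CARD('d)) * bump (r / \<delta>\<^sup>2))"

lemma bump_measurable [measurable]: "bump \<in> borel_measurable borel"
  by (rule smooth_measurable[OF smooth_bump])

lemma bump_le_1: "bump s \<le> 1"
  by (simp add: bump_def flat_exp_bounds)

lemma bump_integrable: "integrable lborel (\<lambda>x::'a::euclidean_space. bump ((norm x)\<^sup>2))"
proof (rule Bochner_Integration.integrable_bound)
  show "integrable lborel (\<lambda>x::'a. indicator (cball 0 1) x :: real)"
    using emeasure_lborel_cball_finite by (intro integrable_real_indicator) auto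
  show "AE x in lborel. norm (bump ((norm x)\<^sup>2)) \<le> norm (indicator (cball (0::'a) 1) x :: real)"
  proof (rule AE_I2)
    fix x :: 'a
    show "norm (bump ((norm x)\<^sup>2)) \<le> norm (indicator (cball (0::'a) 1) x :: real)"
    proof (cases "norm x \<le> 1")
      case True
      then show ?thesis using bump_le_1[of "(norm x)\<^sup>2"] bump_bounds(1)[of "(norm x)\<^sup>2"] by simp
    next
      case False
      then have "1 \<le> (norm x)\<^sup>2" by (simp add: power2_eq_square) (smt (verit) mult_le_cancel_left1)
      then show ?thesis using bump_bounds(3)[of "(norm x)\<^sup>2"] by simp
    qed
  qed
qed measurable

lemma bump_mass_pos: "bump_mass TYPE('a::euclidean_space) > 0"
proof -
  have nn: "0 \<le> bump_mass TYPE('a)" unfolding bump_mass_def by (intro Bochner_Integration.integral_nonneg) (simp add: bump_bounds)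
  have "bump_mass TYPE('a) \<noteq> 0"
  proof
    assume "bump_mass TYPE('a) = 0"
    then have "AE x::'a in lborel. bump ((norm x)\<^sup>2) = 0"
      unfolding bump_mass_def by (subst (asm) integral_nonneg_eq_0_iff_AE[OF bump_integrable]) (auto simp: bump_bounds)
    then have "AE x::'a in lborel. x \<notin> ball 0 1"
    proof eventually_elim
      case (elim x)
      show ?case
      proof
        assume "x \<in> ball 0 1"
        then have "(norm x)\<^sup>2 < 1" by (simp add: power_less_one_iff abs_square_less_1)
        then show False using bump_bounds(4)[of "(norm x)\<^sup>2"] elim by simp
      qed
    qed
    then have "emeasure lborel (ball (0::'a) 1) = 0" by (subst (asm) AE_iff_measurable[of "ball 0 1"]) auto
    then show False using content_ball_pos[of 1 "0::'a"] by (simp add: measure_def)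
  qed
  then show ?thesis using nn by simp
qed

context
  fixes \<delta> :: real
  assumes \<delta>: "0 < \<delta>" "\<delta> \<le> 1"
begin

lemma mollifier_nonneg: "0 \<le> mollifier \<delta> (x::real^'d::finite)"
  using bump_mass_pos[where 'a="real^'d"] \<delta> bump_bounds(1) unfolding mollifier_def
  by (intro divide_nonneg_nonneg mult_nonneg_nonneg) (auto simp: less_imp_le)

lemma mollifier_even: "mollifier \<delta> (- x) = mollifier \<delta> x"
  by (simp add: mollifier_def)

lemma mollifier_measurable [measurable]: "mollifier \<delta> \<in> borel_measurable borel"
  unfolding mollifier_def[abs_def] by measurable

lemma mollifier_support: "norm x \<ge> \<delta> \<Longrightarrow> mollifier \<delta> x = 0"
proof -
  assume "norm x \<ge> \<delta>"
  then have "1 \<le> norm x / \<delta>" using \<delta> by simp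
  then have "1 \<le> (norm x / \<delta>)\<^sup>2" by (rule one_le_power)
  then show ?thesis unfolding mollifier_def using bump_bounds(3) by simp
qed

lemma mollifier_integral: "integrable lborel (mollifier \<delta> :: real^'d::finite \<Rightarrow> real)" "(\<integral>x. mollifier \<delta> (x::real^'d) \<partial>lborel) = 1"
proof -
  let ?J = "bump_mass TYPE(real^'d)"
  have eq: "mollifier \<delta> (0 + \<delta> *\<^sub>R x) = bump ((norm x)\<^sup>2) / (?J * \<delta> ^ CARD('d))" for x :: "real^'d"
    using \<delta> by (simp add: mollifier_def)
  have "integrable lborel (\<lambda>x::real^'d. bump ((norm (0 + inverse \<delta> *\<^sub>R x))\<^sup>2) / (?J * \<delta> ^ CARD('d)))"
    using integrable_lborel_affine[OF bump_integrable, where c = "inverse \<delta>" and t = "0::real^'d"] \<delta>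
    by (intro integrable_divide) simp
  then show "integrable lborel (mollifier \<delta> :: real^'d \<Rightarrow> real)"
    using \<delta> by (simp add: mollifier_def[abs_def] divide_inverse mult.commute power_mult_distrib)
  have "(\<integral>x. mollifier \<delta> (x::real^'d) \<partial>lborel) = \<bar>\<delta>\<bar> ^ DIM(real^'d) * (\<integral>x. mollifier \<delta> (0 + \<delta> *\<^sub>R (x::real^'d)) \<partial>lborel)"
    using integral_lborel_affine[OF mollifier_measurable, where c = \<delta> and t = "0::real^'d"] \<delta> by simp
  also have "\<dots> = \<delta> ^ CARD('d) * (?J / (?J * \<delta> ^ CARD('d)))"
    unfolding eq using \<delta> by (simp add: bump_mass_def)
  also have "\<dots> = 1" using \<delta> bump_mass_pos[where 'a="real^'d"] by simp
  finally show "(\<integral>x. mollifier \<delta> (x::real^'d) \<partial>lborel) = 1" .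
qed

lemma mollifier_nn_integral: "(\<integral>\<^sup>+x. ennreal (mollifier \<delta> (x::real^'d::finite)) \<partial>lborel) = 1"
  by (subst nn_integral_eq_integral[OF mollifier_integral(1)]) (simp_all add: mollifier_nonneg mollifier_integral(2))

lemma reg_kernel_eq: "reg_kernel \<delta> y z = mollifier \<delta> (y - z) * (bump ((\<delta> * norm (y + z))\<^sup>2) / bump 0)"
  by (simp add: reg_kernel_def radial_kernel_def mollifier_def power_divide power_mult_distrib mult_ac)

lemma bump_quotient: "0 \<le> bump (s\<^sup>2) / bump 0" "bump (s\<^sup>2) / bump 0 \<le> 1"
  using bump_bounds(1)[of "s\<^sup>2"] bump_bounds(2)[of "s\<^sup>2"] bump_bounds(4)[of 0] by (auto simp: divide_le_eq)

lemma reg_kernel_bounds: "0 \<le> reg_kernel \<delta> y z" "reg_kernel \<delta> y z \<le> mollifier \<delta> (y - z)"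
  unfolding reg_kernel_eq using mollifier_nonneg[of "y - z"] bump_quotient[of "\<delta> * norm (y + z)"]
  by (auto intro!: mult_nonneg_nonneg mult_left_le simp del: times_divide_eq_right)

lemma reg_kernel_support: "norm y > 1 / \<delta> \<or> norm z > 1 / \<delta> \<Longrightarrow> reg_kernel \<delta> y z = 0"
proof (rule ccontr)
  assume *: "norm y > 1 / \<delta> \<or> norm z > 1 / \<delta>" and nz: "reg_kernel \<delta> y z \<noteq> 0"
  have 1: "norm (y - z) < \<delta>" using nz mollifier_support[of "y - z"] unfolding reg_kernel_eq by force
  have "(\<delta> * norm (y + z))\<^sup>2 < 1" using nz bump_bounds(3)[of "(\<delta> * norm (y + z))\<^sup>2"] unfolding reg_kernel_eq by force
  then have "\<delta> * norm (y + z) < 1" using \<delta> by (simp add: abs_square_less_1)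
  then have 2: "norm (y + z) < 1 / \<delta>" using \<delta> by (simp add: field_simps)
  have "2 *\<^sub>R y = (y + z) + (y - z)" "2 *\<^sub>R z = (y + z) - (y - z)" by (simp_all add: scaleR_2)
  then have "2 * norm y \<le> norm (y + z) + norm (y - z)" "2 * norm z \<le> norm (y + z) + norm (y - z)"
    using norm_triangle_ineq[of "y + z" "y - z"] norm_triangle_ineq4[of "y + z" "y - z"]
    by (metis norm_scaleR abs_numeral)+
  moreover have "\<delta> \<le> 1 / \<delta>" using \<delta> by (simp add: le_divide_eq mult_le_one)
  ultimately show False using 1 2 * by linarith
qed

lemma smooth_reg_profile: "smooth (\<lambda>s. bump (\<delta>\<^sup>2 * s))" "smooth (\<lambda>r. c * bump (r / \<delta>\<^sup>2))"
proof -
  show "smooth (\<lambda>s. bump (\<delta>\<^sup>2 * s))"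
    by (rule smooth_compose_real[OF smooth_bump smooth_linear]) (rule bounded_linear_mult_right)
  show "smooth (\<lambda>r. c * bump (r / \<delta>\<^sup>2))"
    by (rule smooth_mult[OF smooth_const smooth_compose_real[OF smooth_bump smooth_linear]]) (rule bounded_linear_divide)
qed

lemma dir_deriv_reg_profile:
  "dir_deriv 1 (\<lambda>s. bump (\<delta>\<^sup>2 * s)) = (\<lambda>s. \<delta>\<^sup>2 * dir_deriv 1 bump (\<delta>\<^sup>2 * s))"
  "dir_deriv 1 (\<lambda>r. c * bump (r / \<delta>\<^sup>2)) = (\<lambda>r. c / \<delta>\<^sup>2 * dir_deriv 1 bump (r / \<delta>\<^sup>2))"
proof -
  note d = has_derivative_real_smooth[OF smooth_bump]
  have "((\<lambda>s. bump (\<delta>\<^sup>2 * s)) has_real_derivative dir_deriv 1 bump (\<delta>\<^sup>2 * s) * (\<delta>\<^sup>2 * 1)) (at s)" for s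
    by (rule DERIV_chain2[OF d]) (rule DERIV_cmult[OF DERIV_ident])
  from dir_deriv_real_eq[OF this] show "dir_deriv 1 (\<lambda>s. bump (\<delta>\<^sup>2 * s)) = (\<lambda>s. \<delta>\<^sup>2 * dir_deriv 1 bump (\<delta>\<^sup>2 * s))"
    by (simp add: fun_eq_iff mult.commute)
  have "((\<lambda>r. c * bump (r / \<delta>\<^sup>2)) has_real_derivative c * (dir_deriv 1 bump (r / \<delta>\<^sup>2) * (1 / \<delta>\<^sup>2))) (at r)" for r
    by (rule DERIV_cmult[OF DERIV_chain2[OF d DERIV_cdivide[OF DERIV_ident]]])
  from dir_deriv_real_eq[OF this] show "dir_deriv 1 (\<lambda>r. c * bump (r / \<delta>\<^sup>2)) = (\<lambda>r. c / \<delta>\<^sup>2 * dir_deriv 1 bump (r / \<delta>\<^sup>2))"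
    by (simp add: fun_eq_iff)
qed

lemma smooth_reg_kernel: "smooth (reg_kernel \<delta> y)"
  unfolding reg_kernel_def by (rule smooth_radial_kernel[OF smooth_reg_profile])

lemma test_function_reg_kernel: "test_function (\<lambda>z. of_real (reg_kernel \<delta> y z))"
  unfolding test_function_iff using smooth_of_real[OF smooth_reg_kernel] reg_kernel_support of_real_0 by metis

lemma reg_kernel_commutator_bound:
  fixes y z :: "real^'d::finite"
  assumes W: "skew W" and U: "\<bar>U y - U z\<bar> \<le> M * norm (y - z) * (norm y + norm z)" and M: "M \<ge> 0"
    and C: "\<And>s. 0 \<le> s \<Longrightarrow> \<bar>dir_deriv 1 bump s\<bar> \<le> C" "\<And>s. s > 1 \<Longrightarrow> dir_deriv 1 bump s = 0"
  shows "norm (cnj (ham W U (\<lambda>z. of_real (reg_kernel \<delta> y z)) z) - ham W U (\<lambda>y. of_real (reg_kernel \<delta> z y)) y)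
    \<le> (16 * C\<^sup>2 + 2 * M) / (bump 0 * bump_mass TYPE(real^'d) * \<delta> ^ CARD('d)) * indicator (cball 0 \<delta>) (y - z) * min 1 (\<delta> * (1 + norm y))"
proof -
  define N where "N = 1 / (bump 0 * bump_mass TYPE(real^'d) * \<delta> ^ CARD('d))"
  have N: "N \<ge> 0" unfolding N_def using bump_bounds(4)[of 0] bump_mass_pos[where 'a="real^'d"] \<delta> by simp
  have C0: "0 \<le> C" using C(1)[of 0] abs_ge_zero order_trans by blast
  let ?m = "min 1 (\<delta> * (1 + norm y))"
  define R1 where "R1 = 8 * ((y + z) \<bullet> (y - z)) * (\<delta>\<^sup>2 * dir_deriv 1 bump (\<delta>\<^sup>2 * (norm (y + z))\<^sup>2) *
     (N / \<delta>\<^sup>2 * dir_deriv 1 bump ((norm (y - z))\<^sup>2 / \<delta>\<^sup>2)))"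
  define R2 where "R2 = (U z - U y) * (bump (\<delta>\<^sup>2 * (norm (y + z))\<^sup>2) * (N * bump ((norm (y - z))\<^sup>2 / \<delta>\<^sup>2)))"
  have eq: "cnj (ham W U (\<lambda>z. of_real (reg_kernel \<delta> y z)) z) - ham W U (\<lambda>y. of_real (reg_kernel \<delta> z y)) y = of_real (R1 + R2)"
    unfolding reg_kernel_def radial_kernel_commutator[OF smooth_reg_profile W] dir_deriv_reg_profile R1_def R2_def N_def
    by (simp only: radial_kernel_def)
  have "norm (of_real (R1 + R2) :: complex) \<le> \<bar>R1\<bar> + \<bar>R2\<bar>" by (simp only: norm_of_real abs_triangle_ineq)
  also have "\<dots> \<le> (16 * C\<^sup>2 + 2 * M) * N * indicator (cball 0 \<delta>) (y - z) * ?m"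
  proof (cases "\<delta> * norm (y + z) \<le> 1 \<and> norm (y - z) \<le> \<delta>")
    case False
    then have "1 < \<delta> * norm (y + z) \<or> 1 < norm (y - z) / \<delta>" using \<delta> by auto
    then have "1 < (\<delta> * norm (y + z))\<^sup>2 \<or> 1 < (norm (y - z) / \<delta>)\<^sup>2" by (metis one_less_power pos2)
    then have "1 < \<delta>\<^sup>2 * (norm (y + z))\<^sup>2 \<or> 1 < (norm (y - z))\<^sup>2 / \<delta>\<^sup>2" by (simp add: power_mult_distrib power_divide)
    then have "R1 = 0" "R2 = 0" unfolding R1_def R2_def using C(2) bump_bounds(3) by auto
    then show ?thesis using N M \<delta> by (auto simp: indicator_def)
  next
    case True
    have "2 *\<^sub>R y = (y + z) + (y - z)" by (simp_all add: scaleR_2)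
    then have y2: "2 * norm y \<le> norm (y + z) + norm (y - z)"
      using norm_triangle_ineq[of "y + z" "y - z"] by (metis norm_scaleR abs_numeral)
    have "2 *\<^sub>R z = (y + z) - (y - z)" by (simp_all add: scaleR_2)
    then have z2: "2 * norm z \<le> norm (y + z) + norm (y - z)"
      using norm_triangle_ineq4[of "y + z" "y - z"] by (metis norm_scaleR abs_numeral)
    have "y + z = 2 *\<^sub>R y - (y - z)" by (simp add: scaleR_2)
    then have yz: "norm (y + z) \<le> 2 * norm y + norm (y - z)"
      using norm_triangle_ineq4[of "2 *\<^sub>R y" "y - z"] by (metis norm_scaleR abs_numeral)
    have m1: "\<delta> * norm (y + z) \<le> 2 * ?m"
    proof -
      have "\<delta> * norm (y + z) \<le> \<delta> * (2 * (1 + norm y))"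
        using yz True \<delta> by (intro mult_left_mono) auto
      then have "\<delta> * norm (y + z) \<le> 2 * (\<delta> * (1 + norm y))" by (simp only: mult_ac)
      then show ?thesis using True by (simp add: min_def)
    qed
    have m2: "norm (y - z) * (norm y + norm z) \<le> 2 * ?m"
    proof -
      have "norm (y - z) * (norm y + norm z) \<le> \<delta> * (norm (y + z) + norm (y - z))"
        using True y2 z2 \<delta> by (intro mult_mono) auto
      moreover have "\<delta> * norm (y - z) \<le> 1 * 1" using True \<delta> by (intro mult_mono) auto
      moreover have "\<delta> * (norm (y + z) + norm (y - z)) \<le> \<delta> * (2 * (1 + norm y))"
        using True yz \<delta> by (intro mult_left_mono) auto
      moreover have "\<delta> * (2 * (1 + norm y)) = 2 * (\<delta> * (1 + norm y))" by (simp only: mult_ac)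
      moreover have "\<delta> * (norm (y + z) + norm (y - z)) = \<delta> * norm (y + z) + \<delta> * norm (y - z)" by (rule distrib_left)
      ultimately have "norm (y - z) * (norm y + norm z) \<le> 2 * 1"
        and "norm (y - z) * (norm y + norm z) \<le> 2 * (\<delta> * (1 + norm y))"
        using True by linarith+
      then show ?thesis unfolding min_def by presburger
    qed
    have "\<bar>R1\<bar> = 8 * \<bar>(y + z) \<bullet> (y - z)\<bar> * (\<bar>dir_deriv 1 bump (\<delta>\<^sup>2 * (norm (y + z))\<^sup>2)\<bar> * \<bar>dir_deriv 1 bump ((norm (y - z))\<^sup>2 / \<delta>\<^sup>2)\<bar> * N)"
      unfolding R1_def using \<delta> N by (simp add: abs_mult)
    also have "\<dots> \<le> 8 * (norm (y + z) * norm (y - z)) * (C * C * N)"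
      using C0 N by (intro mult_mono Cauchy_Schwarz_ineq2 C(1) mult_nonneg_nonneg) auto
    also have "\<dots> \<le> 8 * (norm (y + z) * \<delta>) * (C * C * N)"
      using C0 N True by (intro mult_right_mono mult_left_mono mult_nonneg_nonneg) auto
    also have "\<dots> \<le> 8 * (2 * ?m) * (C * C * N)"
      using C0 N m1 by (intro mult_right_mono mult_left_mono mult_nonneg_nonneg) (auto simp: mult.commute)
    finally have 1: "\<bar>R1\<bar> \<le> 16 * C\<^sup>2 * N * ?m" by (simp add: power2_eq_square mult_ac)
    have b: "bump (\<delta>\<^sup>2 * (norm (y + z))\<^sup>2) * (N * bump ((norm (y - z))\<^sup>2 / \<delta>\<^sup>2)) \<le> 1 * (N * 1)"
      using N bump_bounds(1) bump_le_1 by (intro mult_mono mult_left_mono mult_nonneg_nonneg) auto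
    have "\<bar>R2\<bar> = \<bar>U y - U z\<bar> * (bump (\<delta>\<^sup>2 * (norm (y + z))\<^sup>2) * (N * bump ((norm (y - z))\<^sup>2 / \<delta>\<^sup>2)))"
      unfolding R2_def using N bump_bounds(1) by (simp add: abs_mult abs_minus_commute)
    also have "\<dots> \<le> (M * (norm (y - z) * (norm y + norm z))) * (1 * (N * 1))"
      using U N bump_bounds(1) M by (intro mult_mono b mult_nonneg_nonneg) (auto simp: mult.assoc)
    also have "\<dots> \<le> (M * (2 * ?m)) * (1 * (N * 1))"
      using M N m2 by (intro mult_right_mono mult_left_mono) auto
    finally have 2: "\<bar>R2\<bar> \<le> 2 * M * N * ?m" by (simp add: mult_ac)
    show ?thesis using 1 2 True by (simp add: algebra_simps)
  qed
  finally show ?thesis unfolding eq by (simp add: N_def)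
qed

lemma cball_mass:
  "(\<integral>\<^sup>+x. ennreal (c / \<delta> ^ CARD('d) * indicator (cball 0 \<delta>) (x::real^'d::finite)) \<partial>lborel) = ennreal (c * measure lborel (cball (0::real^'d) 1))"
  if "c \<ge> 0" for c
proof -
  have ind: "indicator (cball 0 \<delta>) (0 + \<delta> *\<^sub>R x) = (indicator (cball (0::real^'d) 1) x :: real)" for x
    using \<delta> by (simp add: indicator_def mult_le_cancel_left1)
  have "(\<integral>\<^sup>+x. ennreal (c / \<delta> ^ CARD('d) * indicator (cball 0 \<delta>) (x::real^'d)) \<partial>lborel) =
      ennreal (\<delta> ^ CARD('d)) * (\<integral>\<^sup>+x. ennreal (c / \<delta> ^ CARD('d) * indicator (cball 0 1) (x::real^'d)) \<partial>lborel)"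
  proof -
    have [measurable]: "cball (0 :: real^'d) \<delta> \<in> sets borel" by (rule borel_closed) simp
    have "(\<lambda>x::real^'d. ennreal (c / \<delta> ^ CARD('d) * indicator (cball 0 \<delta>) x)) \<in> borel_measurable borel"
      by measurable
    from nn_integral_lborel_affine[OF this, of \<delta> 0] show ?thesis
      unfolding ind using \<delta> by simp
  qed
  also have "(\<integral>\<^sup>+x. ennreal (c / \<delta> ^ CARD('d) * indicator (cball 0 1) (x::real^'d)) \<partial>lborel) =
      ennreal (c / \<delta> ^ CARD('d)) * (\<integral>\<^sup>+x. indicator (cball 0 1) (x::real^'d) \<partial>lborel)"
  proof -
    have [measurable]: "cball (0 :: real^'d) 1 \<in> sets borel" by (rule borel_closed) simp
    have "ennreal (c / \<delta> ^ CARD('d) * indicator (cball 0 1) x) = ennreal (c / \<delta> ^ CARD('d)) * indicator (cball 0 1) x" for x :: "real^'d"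
      by (cases "x \<in> cball 0 1") (simp_all only: indicator_simps mult_1_right mult_zero_right ennreal_0 simp_thms)
    then show ?thesis by (simp only: nn_integral_cmult[OF borel_measurable_indicator] borel_closed closed_cball sets_lborel)
  qed
  also have "(\<integral>\<^sup>+x. indicator (cball 0 1) (x::real^'d) \<partial>lborel) = ennreal (measure lborel (cball (0::real^'d) 1))"
    using emeasure_lborel_cball_finite[of "0::real^'d" 1] by (simp add: emeasure_eq_ennreal_measure)
  also have "ennreal (\<delta> ^ CARD('d)) * (ennreal (c / \<delta> ^ CARD('d)) * ennreal (measure lborel (cball (0::real^'d) 1))) =
      ennreal (c * measure lborel (cball (0::real^'d) 1))"
    using that \<delta> by (simp flip: ennreal_mult add: measure_nonneg)
  finally show ?thesis .
qed

lemma bounded_kernel_continuous: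
  fixes c :: "real^'d::finite \<Rightarrow> real^'d \<Rightarrow> complex"
  assumes c: "continuous_on UNIV (\<lambda>p. c (fst p) (snd p))" and R: "\<And>y z. norm y > R \<or> norm z > R \<Longrightarrow> c y z = 0"
  shows "bounded_kernel c"
proof -
  have "compact ((\<lambda>p. c (fst p) (snd p)) ` (cball 0 R \<times> cball 0 R))"
    using c by (intro compact_continuous_image compact_Times) (auto intro: continuous_on_subset)
  then have "bounded ((\<lambda>p. c (fst p) (snd p)) ` (cball 0 R \<times> cball 0 R))" by (rule compact_imp_bounded)
  then obtain M where M: "\<And>y z. norm y \<le> R \<Longrightarrow> norm z \<le> R \<Longrightarrow> norm (c y z) \<le> M" unfolding bounded_iff by force
  have "norm (c y z) \<le> max M 0" for y z
    using M[of y z] R[of y z] by (cases "norm y > R \<or> norm z > R") auto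
  moreover have "(\<lambda>(y, z). c y z) \<in> borel_measurable (borel \<Otimes>\<^sub>M borel)"
    unfolding borel_prod case_prod_beta' by (rule borel_measurable_continuous_onI[OF c])
  ultimately show ?thesis unfolding bounded_kernel_def using R by blast
qed

lemma continuous_radial_kernel:
  assumes "continuous_on UNIV A" "continuous_on UNIV B"
  shows "continuous_on UNIV (\<lambda>p. radial_kernel A B (fst p) (snd p))"
  unfolding radial_kernel_def
  by (intro continuous_intros continuous_on_compose2[OF assms(1)] continuous_on_compose2[OF assms(2)]) auto

lemma bounded_reg_kernel: "bounded_kernel (\<lambda>y z. of_real (reg_kernel \<delta> y z))"
proof (rule bounded_kernel_continuous[where R = "1 / \<delta>"])
  show "continuous_on UNIV (\<lambda>p. complex_of_real (reg_kernel \<delta> (fst p) (snd p)))"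
    unfolding reg_kernel_def
    by (intro continuous_intros continuous_radial_kernel smooth_continuous_on smooth_reg_profile)
qed (simp add: reg_kernel_support)

lemma ham_zero_outside:
  assumes "\<And>x. norm x > R \<Longrightarrow> \<eta> x = 0" "norm x > R"
  shows "ham W U \<eta> x = 0"
proof -
  note p = partial_eq_0_outside[OF assms(1)]
  have "partial i (partial i \<eta>) x = 0" for i
    by (rule partial_eq_0_outside[OF p assms(2)])
  then show ?thesis using assms p[OF _ assms(2)] by (simp add: ham_def laplacian_def)
qed

lemma ham_reg_kernel_zero:
  assumes "norm y > 1 / \<delta> \<or> norm z > 1 / \<delta>"
  shows "ham W U (\<lambda>z. of_real (reg_kernel \<delta> y z)) z = 0"
proof (cases "norm y > 1 / \<delta>")
  case True
  then have "(\<lambda>z. complex_of_real (reg_kernel \<delta> y z)) = (\<lambda>z. 0)" by (intro ext) (simp add: reg_kernel_support)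
  then show ?thesis by (simp add: ham_def laplacian_def)
next
  case False
  show ?thesis
    by (rule ham_zero_outside[where R = "1 / \<delta>"]) (use reg_kernel_support assms False in auto)
qed

lemma bounded_ham_reg_kernel:
  fixes W :: "real^'d::finite \<Rightarrow> real^'d"
  assumes W: "linear W" and U: "continuous_on UNIV U"
  shows "bounded_kernel (\<lambda>y z. cnj (ham W U (\<lambda>z. of_real (reg_kernel \<delta> y z)) z))"
proof (rule bounded_kernel_continuous[where R = "1 / \<delta>"])
  have [continuous_intros]: "continuous_on S (\<lambda>p. W (f p))" if "continuous_on S f" for f :: "(real^'d) \<times> (real^'d) \<Rightarrow> real^'d" and S
    using linear_continuous_on_compose[OF that W] .
  have [continuous_intros]: "continuous_on UNIV (\<lambda>p. U (snd p))"
    by (rule continuous_on_compose2[OF U]) (auto intro: continuous_intros)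
  note s = smooth_reg_profile smooth_dir_deriv[OF smooth_reg_profile(1)] smooth_dir_deriv[OF smooth_reg_profile(2)]
    smooth_dir_deriv[OF smooth_dir_deriv[OF smooth_reg_profile(1)]] smooth_dir_deriv[OF smooth_dir_deriv[OF smooth_reg_profile(2)]]
  note r = continuous_radial_kernel[OF smooth_continuous_on smooth_continuous_on]
  show "continuous_on UNIV (\<lambda>p. cnj (ham W U (\<lambda>z. of_real (reg_kernel \<delta> (fst p) z)) (snd p)))"
    unfolding reg_kernel_def ham_radial_kernel[OF smooth_reg_profile] laplacian_radial_kernel[OF smooth_reg_profile]
    by (intro continuous_intros r s) (auto simp: s)
qed (simp add: ham_reg_kernel_zero)

end

section \<open>Approximation of the identity\<close>

lemma reg_kernel_form_bound:
  fixes f g :: "real^'d::finite \<Rightarrow> complex"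
  assumes \<delta>: "0 < \<delta>" "\<delta> \<le> 1" and "f \<in> L2" "g \<in> L2"
  shows "norm (kernel_form (\<lambda>y z. of_real (reg_kernel \<delta> y z)) f g) \<le> L2_norm f * L2_norm g"
proof -
  have "norm (kernel_form (\<lambda>y z. of_real (reg_kernel \<delta> y z)) f g) \<le> 1 * L2_norm (\<lambda>y. of_real 1 * f y) * L2_norm g"
    by (rule kernel_form_Schur[where k = "mollifier \<delta>", OF bounded_reg_kernel[OF \<delta>] assms(3,4)])
      (auto simp: mollifier_nn_integral[OF \<delta>] mollifier_even[OF \<delta>] mollifier_nonneg[OF \<delta>] mollifier_measurable[OF \<delta>] reg_kernel_bounds[OF \<delta>])
  then show ?thesis by simp
qed

lemma reg_kernel_apply_close:
  fixes c :: "real^'d::finite \<Rightarrow> complex"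
  assumes \<delta>: "0 < \<delta>" "\<delta> \<le> 1" and c: "continuous_on UNIV c" and M: "\<And>x. norm (c x) \<le> M"
    and e: "\<And>z. norm (y - z) < \<delta> \<Longrightarrow> norm (of_real (bump ((\<delta> * norm (y + z))\<^sup>2) / bump 0) * c z - w) \<le> e"
  shows "norm ((\<integral>z. of_real (reg_kernel \<delta> y z) * c z \<partial>lborel) - w) \<le> e"
proof -
  let ?r = "\<lambda>z. complex_of_real (bump ((\<delta> * norm (y + z))\<^sup>2) / bump 0)"
  have cm [measurable]: "c \<in> borel_measurable borel" using c by (rule borel_measurable_continuous_onI)
  note mm [measurable] = mollifier_measurable[OF \<delta>]
  have eq: "mollifier \<delta> (y + (-1) *\<^sub>R z) = mollifier \<delta> (y - z)" for z by simp
  have mi: "integrable lborel (\<lambda>z. mollifier \<delta> (y - z))"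
    using integrable_lborel_affine[OF mollifier_integral(1)[OF \<delta>], of "-1" y] by simp
  have m1: "(\<integral>z. mollifier \<delta> (y - z) \<partial>lborel) = 1"
    using integral_lborel_affine[OF mm, of "-1" y] mollifier_integral(2)[OF \<delta>, where 'd='d] by simp
  have i1: "integrable lborel (\<lambda>z. of_real (mollifier \<delta> (y - z)) * (?r z * c z))"
  proof (rule Bochner_Integration.integrable_bound)
    show "integrable lborel (\<lambda>z. mollifier \<delta> (y - z) * M)" using mi by simp
    show "AE z in lborel. norm (of_real (mollifier \<delta> (y - z)) * (?r z * c z)) \<le> norm (mollifier \<delta> (y - z) * M)"
    proof (rule AE_I2)
      fix z
      have "norm (?r z * c z) \<le> 1 * M"
        unfolding norm_mult norm_of_real
        by (intro mult_mono M) (use bump_quotient[OF \<delta>, of "\<delta> * norm (y + z)"] in auto)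
      then have "mollifier \<delta> (y - z) * norm (?r z * c z) \<le> mollifier \<delta> (y - z) * M"
        using mollifier_nonneg[OF \<delta>, of "y - z"] by (intro mult_left_mono) simp_all
      moreover have "norm (of_real (mollifier \<delta> (y - z)) * (?r z * c z)) = mollifier \<delta> (y - z) * norm (?r z * c z)"
        using mollifier_nonneg[OF \<delta>, of "y - z"] by (simp only: norm_mult[of "of_real _"] norm_of_real abs_of_nonneg)
      ultimately have "norm (of_real (mollifier \<delta> (y - z)) * (?r z * c z)) \<le> mollifier \<delta> (y - z) * M"
        by (simp only:)
      then show "norm (of_real (mollifier \<delta> (y - z)) * (?r z * c z)) \<le> norm (mollifier \<delta> (y - z) * M)"
        by (rule order_trans) (simp only: real_norm_def abs_ge_self)
    qed
  qed measurable
  have i2: "integrable lborel (\<lambda>z. of_real (mollifier \<delta> (y - z)) * w)" using mi by simp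
  have "(\<integral>z. of_real (reg_kernel \<delta> y z) * c z \<partial>lborel) - w = (\<integral>z. of_real (mollifier \<delta> (y - z)) * (?r z * c z) \<partial>lborel) - (\<integral>z. of_real (mollifier \<delta> (y - z)) * w \<partial>lborel)"
    using m1 by (simp add: reg_kernel_eq[OF \<delta>] mult.assoc)
  also have "\<dots> = (\<integral>z. of_real (mollifier \<delta> (y - z)) * (?r z * c z) - of_real (mollifier \<delta> (y - z)) * w \<partial>lborel)"
    by (rule Bochner_Integration.integral_diff[symmetric, OF i1 i2])
  also have "norm \<dots> \<le> (\<integral>z. mollifier \<delta> (y - z) * e \<partial>lborel)"
  proof (rule Bochner_Integration.integral_norm_bound_integral)
    show "integrable lborel (\<lambda>z. of_real (mollifier \<delta> (y - z)) * (?r z * c z) - of_real (mollifier \<delta> (y - z)) * w)"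
      by (rule Bochner_Integration.integrable_diff[OF i1 i2])
    show "integrable lborel (\<lambda>z. mollifier \<delta> (y - z) * e)" using mi by simp
    fix z
    have "norm (of_real (mollifier \<delta> (y - z)) * (?r z * c z) - of_real (mollifier \<delta> (y - z)) * w) = mollifier \<delta> (y - z) * norm (?r z * c z - w)"
      unfolding right_diff_distrib[symmetric] norm_mult[of "of_real (mollifier \<delta> (y - z))"] norm_of_real
      using mollifier_nonneg[OF \<delta>, of "y - z"] by (simp only: abs_of_nonneg)
    also have "\<dots> \<le> mollifier \<delta> (y - z) * e"
    proof (cases "norm (y - z) < \<delta>")
      case True
      then show ?thesis using e[OF True] mollifier_nonneg[OF \<delta>, of "y - z"] by (intro mult_left_mono) auto
    next
      case False
      then show ?thesis using mollifier_support[OF \<delta>, of "y - z"] by simp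
    qed
    finally show "norm (of_real (mollifier \<delta> (y - z)) * (?r z * c z) - of_real (mollifier \<delta> (y - z)) * w) \<le> mollifier \<delta> (y - z) * e" .
  qed
  also have "\<dots> = e" using m1 by simp
  finally show ?thesis .
qed

lemma reg_kernel_form_continuous:
  fixes c :: "real^'d::finite \<Rightarrow> complex"
  assumes d: "\<And>n. 0 < d n" "\<And>n. d n \<le> 1" "d \<longlonglongrightarrow> 0"
    and c: "continuous_on UNIV c" and M: "\<And>x. norm (c x) \<le> M" and R: "\<And>x. norm x > R \<Longrightarrow> c x = 0"
  shows "(\<lambda>n. kernel_form (\<lambda>y z. of_real (reg_kernel (d n) y z)) c c) \<longlonglongrightarrow> of_real ((L2_norm c)\<^sup>2)"
proof -
  have cm [measurable]: "c \<in> borel_measurable borel" using c by (rule borel_measurable_continuous_onI)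
  have cL2: "c \<in> L2" by (rule L2_bounded_support[OF cm M R])
  have M0: "M \<ge> 0" using M[of 0] norm_ge_zero order_trans by blast
  let ?K = "\<lambda>n y. \<integral>z. of_real (reg_kernel (d n) y z) * c z \<partial>lborel"
  have "(\<lambda>n. \<integral>y. cnj (c y) * ?K n y \<partial>lborel) \<longlonglongrightarrow> (\<integral>y. cnj (c y) * c y \<partial>lborel)"
  proof (rule integral_dominated_convergence[where w = "\<lambda>y. norm (c y) * norm (of_real M * indicator (cball 0 R) y :: complex)"])
    show "integrable lborel (\<lambda>y. norm (c y) * norm (of_real M * indicator (cball 0 R) y :: complex))"
      by (intro L2_integrable_norm_prod cL2 L2_bounded_support[of _ M R])
        (use M0 in \<open>auto simp: indicator_def norm_mult intro!: borel_measurable_times borel_measurable_indicator borel_closed\<close>)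
    show "(\<lambda>y. cnj (c y) * ?K n y) \<in> borel_measurable lborel" for n
      using kernel_apply_measurable[OF bounded_reg_kernel[OF d(1,2)] cm, of n] by measurable
    show "(\<lambda>y. cnj (c y) * c y) \<in> borel_measurable lborel" by measurable
    show "AE y in lborel. norm (cnj (c y) * ?K n y) \<le> norm (c y) * norm (of_real M * indicator (cball 0 R) y :: complex)" for n
    proof (rule AE_I2)
      fix y
      have "norm (?K n y - 0) \<le> M"
      proof (rule reg_kernel_apply_close[OF d(1,2) c M])
        fix z
        have "norm (of_real (bump ((d n * norm (y + z))\<^sup>2) / bump 0) * c z) \<le> 1 * M"
          unfolding norm_mult norm_of_real
          by (intro mult_mono M) (use bump_quotient[OF d(1)[of n] d(2)[of n], of "d n * norm (y + z)"] in auto)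
        then show "norm (of_real (bump ((d n * norm (y + z))\<^sup>2) / bump 0) * c z - 0) \<le> M" by simp
      qed
      then show "norm (cnj (c y) * ?K n y) \<le> norm (c y) * norm (of_real M * indicator (cball 0 R) y :: complex)"
        using R[of y] M0 by (cases "norm y > R") (auto simp: norm_mult intro: mult_left_mono)
    qed
    show "AE y in lborel. (\<lambda>n. cnj (c y) * ?K n y) \<longlonglongrightarrow> cnj (c y) * c y"
    proof (rule AE_I2)
      fix y
      have "(\<lambda>n. ?K n y) \<longlonglongrightarrow> c y"
      proof (rule LIMSEQ_I)
        fix e :: real assume e: "e > 0"
        let ?\<Phi> = "\<lambda>p. complex_of_real (bump ((fst p * norm (y + snd p))\<^sup>2) / bump 0) * c (snd p)"
        have "continuous_on UNIV ?\<Phi>"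
          using bump_bounds(4)[of 0]
          by (intro continuous_intros continuous_on_compose2[OF smooth_continuous_on[OF smooth_bump, of UNIV]] continuous_on_compose2[OF c]) auto
        then have "isCont ?\<Phi> (0, y)" by (simp add: continuous_on_eq_continuous_at)
        moreover have "?\<Phi> (0, y) = c y" using bump_bounds(4)[of 0] by simp
        ultimately obtain s where s: "s > 0" "\<And>p. dist p (0, y) < s \<Longrightarrow> dist (?\<Phi> p) (c y) < e / 2"
          unfolding continuous_at_eps_delta using e by (metis half_gt_zero)
        obtain N where N: "\<And>n. n \<ge> N \<Longrightarrow> d n < s / 2"
          using LIMSEQ_D[OF d(3), of "s / 2"] s(1) d(1) by (auto simp: abs_of_pos)
        have "norm (?K n y - c y) < e" if "n \<ge> N" for n
        proof -
          have "norm (?K n y - c y) \<le> e / 2"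
          proof (rule reg_kernel_apply_close[OF d(1,2) c M])
            fix z assume "norm (y - z) < d n"
            then have "dist (d n, z) (0, y) < s"
              using N[OF that] d(1)[of n] sqrt_sum_squares_le_sum_abs[of "d n" "norm (z - y)"]
              by (simp add: dist_prod_def dist_norm norm_minus_commute)
            then show "norm (of_real (bump ((d n * norm (y + z))\<^sup>2) / bump 0) * c z - c y) \<le> e / 2"
              using s(2)[of "(d n, z)"] by (simp add: dist_norm)
          qed
          then show ?thesis using e by simp
        qed
        then show "\<exists>N. \<forall>n\<ge>N. norm (?K n y - c y) < e" by blast
      qed
      then show "(\<lambda>n. cnj (c y) * ?K n y) \<longlonglongrightarrow> cnj (c y) * c y" by (intro tendsto_intros)
    qed
  qed
  then show ?thesis
    unfolding kernel_form_eq_inner L2_inner_self[OF cL2, symmetric] by (simp add: L2_inner_def)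
qed

lemma reg_kernel_form_tendsto:
  fixes f :: "real^'d::finite \<Rightarrow> complex"
  assumes d: "\<And>n. 0 < d n" "\<And>n. d n \<le> 1" "d \<longlonglongrightarrow> 0" and f: "f \<in> L2"
  shows "(\<lambda>n. kernel_form (\<lambda>y z. of_real (reg_kernel (d n) y z)) f f) \<longlonglongrightarrow> of_real ((L2_norm f)\<^sup>2)"
proof (rule LIMSEQ_I)
  fix e :: real assume e: "e > 0"
  let ?B = "\<lambda>n. kernel_form (\<lambda>y z. of_real (reg_kernel (d n) y z))"
  define s where "s = min 1 (e / (4 * (2 * L2_norm f + 1)))"
  have s: "0 < s" "s \<le> 1" "s * (2 * L2_norm f + 1) \<le> e / 4"
  proof -
    have p: "2 * L2_norm f + 1 > 0" using L2_norm_nonneg[of f] by linarith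
    then show "0 < s" "s \<le> 1" using e by (auto simp: s_def)
    have "s \<le> e / (4 * (2 * L2_norm f + 1))" by (simp add: s_def)
    then show "s * (2 * L2_norm f + 1) \<le> e / 4" using p by (simp add: field_simps)
  qed
  obtain c M where c: "continuous_on UNIV c" "\<And>x. norm (c x) \<le> M" "\<And>x. norm x > M + 1 \<Longrightarrow> c x = 0"
    "c \<in> L2" "L2_norm (\<lambda>x. f x - c x) < s"
    using L2_dense[OF f s(1)] by blast
  let ?g = "\<lambda>x. f x - c x"
  have gL2: "?g \<in> L2" by (rule L2_diff[OF f c(4)])
  have nc: "L2_norm c \<le> L2_norm f + s"
    using L2_norm_triangle_diff[OF f c(4)] c(5) by linarith
  have B: "norm (?B n f f - ?B n c c) \<le> e / 4" for n
  proof -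
    have K: "(\<lambda>y. \<integral>z. of_real (reg_kernel (d n) y z) * h z \<partial>lborel) \<in> L2" if "h \<in> L2" for h
      by (rule kernel_apply_L2[OF bounded_reg_kernel[OF d(1,2)] that])
    have add: "(\<lambda>y. \<integral>z. of_real (reg_kernel (d n) y z) * f z \<partial>lborel) =
       (\<lambda>y. (\<integral>z. of_real (reg_kernel (d n) y z) * ?g z \<partial>lborel) + (\<integral>z. of_real (reg_kernel (d n) y z) * c z \<partial>lborel))"
    proof
      fix y
      have "L2_inner (\<lambda>z. of_real (reg_kernel (d n) y z)) (\<lambda>z. ?g z + c z) =
        L2_inner (\<lambda>z. of_real (reg_kernel (d n) y z)) ?g + L2_inner (\<lambda>z. of_real (reg_kernel (d n) y z)) c"
        by (rule L2_inner_add_right[OF test_function_L2[OF test_function_reg_kernel[OF d(1,2)]] gL2 c(4)])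
      then show "(\<integral>z. of_real (reg_kernel (d n) y z) * f z \<partial>lborel) =
        (\<integral>z. of_real (reg_kernel (d n) y z) * ?g z \<partial>lborel) + (\<integral>z. of_real (reg_kernel (d n) y z) * c z \<partial>lborel)"
        by (simp add: L2_inner_def)
    qed
    have "?B n f f = ?B n f ?g + ?B n f c"
      unfolding kernel_form_eq_inner add by (rule L2_inner_add_right[OF f K[OF gL2] K[OF c(4)]])
    also have "?B n f c = ?B n ?g c + ?B n c c"
      unfolding kernel_form_eq_inner using L2_inner_add_left[OF K[OF c(4)] gL2 c(4)] by simp
    finally have eq: "?B n f f - ?B n c c = ?B n f ?g + ?B n ?g c" by simp
    have "norm (?B n f ?g + ?B n ?g c) \<le> L2_norm f * L2_norm ?g + L2_norm ?g * L2_norm c"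
      by (rule norm_triangle_mono[OF reg_kernel_form_bound[OF d(1,2) f gL2] reg_kernel_form_bound[OF d(1,2) gL2 c(4)]])
    also have "\<dots> = L2_norm ?g * (L2_norm f + L2_norm c)" by (simp only: algebra_simps)
    also have "\<dots> \<le> s * (2 * L2_norm f + 1)"
      using c(5) nc s(1,2) by (intro mult_mono) (auto intro: add_nonneg_nonneg)
    also have "\<dots> \<le> e / 4" by (rule s(3))
    finally show ?thesis unfolding eq .
  qed
  have nn: "\<bar>(L2_norm c)\<^sup>2 - (L2_norm f)\<^sup>2\<bar> \<le> e / 4"
  proof -
    have "\<bar>(L2_norm c)\<^sup>2 - (L2_norm f)\<^sup>2\<bar> = \<bar>L2_norm c - L2_norm f\<bar> * (L2_norm c + L2_norm f)"
      using L2_norm_nonneg[of c] L2_norm_nonneg[of f] by (simp add: power2_eq_square square_diff_square_factored abs_mult)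
    also have "\<dots> \<le> s * (2 * L2_norm f + 1)"
      using L2_norm_triangle_diff[OF f c(4)] c(5) nc s(1,2) by (intro mult_mono) (auto intro: add_nonneg_nonneg)
    finally show ?thesis using s(3) by linarith
  qed
  obtain N where N: "\<And>n. n \<ge> N \<Longrightarrow> norm (?B n c c - of_real ((L2_norm c)\<^sup>2)) < e / 4"
    using LIMSEQ_D[OF reg_kernel_form_continuous[OF d c(1) c(2), where R = "M + 1", OF c(3)], of "e / 4"] e
    by (metis divide_pos_pos zero_less_numeral)
  have "norm (?B n f f - of_real ((L2_norm f)\<^sup>2)) < e" if n: "n \<ge> N" for n
  proof -
    have "?B n f f - of_real ((L2_norm f)\<^sup>2) = (?B n f f - ?B n c c) + (?B n c c - of_real ((L2_norm c)\<^sup>2))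
        + of_real ((L2_norm c)\<^sup>2 - (L2_norm f)\<^sup>2)" by simp
    also have "norm \<dots> \<le> (e / 4 + e / 4) + e / 4"
      by (intro norm_triangle_mono B less_imp_le[OF N[OF n]]) (use nn in \<open>simp only: norm_of_real\<close>)
    also have "\<dots> < e" using e by simp
    finally show ?thesis .
  qed
  then show "\<exists>N. \<forall>n\<ge>N. norm (?B n f f - of_real ((L2_norm f)\<^sup>2)) < e" by blast
qed

section \<open>The energy estimate for weak solutions\<close>

text \<open>At length scale \<open>\<delta>\<close> in \<open>y - z\<close> and \<open>1 / \<delta>\<close> in \<open>y + z\<close> the commutator of the regularisation with the
  Hamiltonian is bounded uniformly in \<open>\<delta>\<close>, and it tends to zero strongly because of the factor
  \<open>min 1 (\<delta> * (1 + norm y))\<close>.\<close>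

lemma reg_energy_derivative:
  fixes u g :: "real \<Rightarrow> real^'d::finite \<Rightarrow> complex"
  assumes \<delta>: "0 < \<delta>" "\<delta> \<le> 1"
    and W: "skew W" and U0: "\<And>t. U t 0 = 0"
    and U: "\<And>t y z. \<bar>U t y - U t z\<bar> \<le> M * norm (y - z) * (norm y + norm z)" and M: "M \<ge> 0"
    and u: "continuous_L2 u" and sol: "weak_solution W U u g"
    and g: "\<And>t. g t \<in> L2" "\<And>t. L2_norm (g t) \<le> \<gamma> t" and \<gamma>: "continuous_on UNIV \<gamma>"
    and C: "\<And>s. 0 \<le> s \<Longrightarrow> \<bar>dir_deriv 1 bump s\<bar> \<le> C" "\<And>s. s > 1 \<Longrightarrow> dir_deriv 1 bump s = 0"
    and a: "a = (16 * C\<^sup>2 + 2 * M) / (bump 0 * bump_mass TYPE(real^'d)) * measure lborel (cball (0::real^'d) 1)"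
  obtains D where "((\<lambda>s. Re (kernel_form (\<lambda>y z. of_real (reg_kernel \<delta> y z)) (u s) (u s))) has_real_derivative D) (at t)"
    and "D \<le> a * L2_norm (\<lambda>y. of_real (min 1 (\<delta> * (1 + norm y))) * u t y) * L2_norm (u t) + 2 * L2_norm (u t) * \<gamma> t"
proof -
  let ?k = "reg_kernel \<delta> :: real^'d \<Rightarrow> _"
  define h where "h s y z = cnj (ham W (U s) (\<lambda>z. of_real (?k y z)) z)" for s y z
  define h0 where "h0 y z = cnj (ham W (\<lambda>x. 0) (\<lambda>z. of_real (?k y z)) z)" for y z
  have lin: "linear W" using W by (simp add: skew_def)
  have uL2: "u s \<in> L2" for s using u by (simp add: continuous_L2_def)
  have Uc: "continuous_on UNIV (U s)" for s
  proof -
    have "(U s \<longlongrightarrow> U s y) (at y)" for y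
    proof (rule Lim_transform[OF tendsto_const])
      have "((\<lambda>z. M * norm (z - y) * (norm z + norm y)) \<longlongrightarrow> M * norm (y - y) * (norm y + norm y)) (at y)"
        by (intro tendsto_intros)
      then show "((\<lambda>z. U s z - U s y) \<longlongrightarrow> 0) (at y)"
        by (intro Lim_null_comparison[where f = "\<lambda>z. U s z - U s y"]) (use U in auto)
    qed
    then show ?thesis by (simp add: continuous_on_def)
  qed
  have bh: "bounded_kernel (h s)" for s
    unfolding h_def[abs_def] by (rule bounded_ham_reg_kernel[OF \<delta> lin Uc])
  have bh0: "bounded_kernel h0"
    unfolding h0_def[abs_def] by (rule bounded_ham_reg_kernel[OF \<delta> lin]) simp
  have bk: "bounded_kernel (\<lambda>y z. complex_of_real (?k y z))" by (rule bounded_reg_kernel[OF \<delta>])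
  obtain N0 where N0: "\<And>y z. norm (h0 y z) \<le> N0" using bh0 unfolding bounded_kernel_def by blast
  obtain Nk where Nk: "\<And>y z. norm (complex_of_real (?k y z)) \<le> Nk" using bk unfolding bounded_kernel_def by blast
  have supp: "h s y z = 0 \<and> ?k y z = 0" if "norm y > 1 / \<delta> \<or> norm z > 1 / \<delta>" for s y z
    unfolding h_def using ham_reg_kernel_zero[OF \<delta> that] reg_kernel_support[OF \<delta> that] by simp
  have hs: "h s y z = h0 y z + of_real (U s z * ?k y z)" for s y z
    unfolding h_def h0_def by (simp add: ham_def)
  have Nk0: "0 \<le> Nk" using order_trans[OF norm_ge_zero Nk[of 0 0]] .
  have hb: "norm (h s y z) \<le> N0 + M * (1 / \<delta>)\<^sup>2 * Nk" for s y z
  proof (cases "norm z > 1 / \<delta>")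
    case True
    then have "h s y z = 0" using supp by blast
    then show ?thesis using M Nk0 order_trans[OF norm_ge_zero N0[of 0 0]] by (auto intro!: add_nonneg_nonneg mult_nonneg_nonneg)
  next
    case False
    have "\<bar>U s z\<bar> \<le> M * (norm z * norm z)" using U[of s z 0] by (simp add: U0 mult.assoc)
    also have "\<dots> \<le> M * (1 / \<delta> * (1 / \<delta>))" using False M \<delta> by (intro mult_left_mono mult_mono) auto
    finally have "\<bar>U s z\<bar> * norm (complex_of_real (?k y z)) \<le> M * (1 / \<delta>)\<^sup>2 * Nk"
      by (intro mult_mono Nk) (use M in \<open>auto simp: power2_eq_square\<close>)
    then have "norm (complex_of_real (U s z * ?k y z)) \<le> M * (1 / \<delta>)\<^sup>2 * Nk"
      by (simp add: norm_mult)
    then show ?thesis unfolding hs by (rule norm_triangle_mono[OF N0])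
  qed
  let ?kc = "\<lambda>y z. complex_of_real (?k y z)"
  let ?D = "2 * Im (kernel_form (h t) (u t) (u t) + kernel_form ?kc (u t) (g t))"
  let ?m = "\<lambda>y::real^'d. min 1 (\<delta> * (1 + norm y))"
  show ?thesis
  proof (rule that)
    show "((\<lambda>s. Re (kernel_form ?kc (u s) (u s))) has_real_derivative ?D) (at t)"
    proof (rule kernel_form_time_derivative[OF u sol g \<gamma> _ _ bk _ bh hb supp])
      show "test_function (\<lambda>z. complex_of_real (?k y z))" for y by (rule test_function_reg_kernel[OF \<delta>])
      show "?k y z = ?k z y" for y z unfolding reg_kernel_def by (rule radial_kernel_sym)
      show "ham W (U s) (\<lambda>z. complex_of_real (?k y z)) z = cnj (h s y z)" for s y z by (simp add: h_def)
    qed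
    define c where "c y z = h t y z - cnj (h t z y)" for y z
    have bh': "bounded_kernel (\<lambda>y z. cnj (h t z y))"
    proof -
      have "(\<lambda>p. h t (snd p) (fst p)) \<in> borel_measurable (borel \<Otimes>\<^sub>M borel)"
        using measurable_compose[OF measurable_pair_swap' bounded_kernel_measurable[OF bh[of t]]] by (simp add: case_prod_beta')
      then have "(\<lambda>(y, z). cnj (h t z y)) \<in> borel_measurable (borel \<Otimes>\<^sub>M borel)"
        unfolding case_prod_beta' by measurable
      then show ?thesis unfolding bounded_kernel_def using hb supp by (metis complex_cnj_zero complex_mod_cnj)
    qed
    have bc: "bounded_kernel (\<lambda>y z. h t y z - cnj (h t z y))"
    proof -
      note [measurable] = bounded_kernel_measurable[OF bh[of t]] bounded_kernel_measurable[OF bh']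
      have "norm (h t y z - cnj (h t z y)) \<le> (N0 + M * (1 / \<delta>)\<^sup>2 * Nk) + (N0 + M * (1 / \<delta>)\<^sup>2 * Nk)" for y z
        using norm_triangle_ineq4[of "h t y z" "cnj (h t z y)"] hb[of t y z] hb[of t z y] complex_mod_cnj[of "h t z y"] by linarith
      moreover have "(\<lambda>(y, z). h t y z - cnj (h t z y)) \<in> borel_measurable (borel \<Otimes>\<^sub>M borel)"
        unfolding case_prod_beta' by measurable
      moreover have "h t y z - cnj (h t z y) = 0" if "norm y > 1 / \<delta> \<or> norm z > 1 / \<delta>" for y z
        using supp[of y z t] supp[of z y t] that by (simp add: disj_commute)
      ultimately show ?thesis unfolding bounded_kernel_def by blast
    qed
    have P: "kernel_form (h t) (u t) (u t) - cnj (kernel_form (h t) (u t) (u t)) = kernel_form c (u t) (u t)"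
      unfolding kernel_form_swap[OF bh uL2 uL2] c_def[abs_def]
      by (rule kernel_form_diff[OF bh bh' uL2 uL2 bc, symmetric])
    have Pb: "norm (kernel_form c (u t) (u t)) \<le> a * L2_norm (\<lambda>y. of_real (?m y) * u t y) * L2_norm (u t)"
    proof (rule kernel_form_Schur[where k = "\<lambda>x. (16 * C\<^sup>2 + 2 * M) / (bump 0 * bump_mass TYPE(real^'d)) / \<delta> ^ CARD('d) * indicator (cball 0 \<delta>) x"])
      have p: "0 \<le> (16 * C\<^sup>2 + 2 * M) / (bump 0 * bump_mass TYPE(real^'d))"
        using M bump_bounds(4)[of 0] bump_mass_pos[where 'a="real^'d"] by simp
      have [measurable]: "cball (0 :: real^'d) \<delta> \<in> sets borel" by (rule borel_closed) simp
      show "bounded_kernel c" unfolding c_def[abs_def] by (rule bc)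
      show "u t \<in> L2" "u t \<in> L2" by (rule uL2)+
      show "?m \<in> borel_measurable borel" by measurable
      show "0 \<le> ?m y" "?m y \<le> 1" for y using \<delta> by auto
      show "(\<lambda>x::real^'d. (16 * C\<^sup>2 + 2 * M) / (bump 0 * bump_mass TYPE(real^'d)) / \<delta> ^ CARD('d) * indicator (cball 0 \<delta>) x) \<in> borel_measurable borel"
        by measurable
      show "0 \<le> (16 * C\<^sup>2 + 2 * M) / (bump 0 * bump_mass TYPE(real^'d)) / \<delta> ^ CARD('d) * indicator (cball 0 \<delta>) x" for x :: "real^'d"
        by (rule mult_nonneg_nonneg[OF divide_nonneg_nonneg[OF p]]) (use \<delta> in simp_all)
      show "(16 * C\<^sup>2 + 2 * M) / (bump 0 * bump_mass TYPE(real^'d)) / \<delta> ^ CARD('d) * indicator (cball 0 \<delta>) (- x) =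
          (16 * C\<^sup>2 + 2 * M) / (bump 0 * bump_mass TYPE(real^'d)) / \<delta> ^ CARD('d) * indicator (cball 0 \<delta>) x" for x :: "real^'d"
        by (simp add: indicator_def)
      show "0 \<le> a" unfolding a by (rule mult_nonneg_nonneg[OF p measure_nonneg])
      show "(\<integral>\<^sup>+z. ennreal ((16 * C\<^sup>2 + 2 * M) / (bump 0 * bump_mass TYPE(real^'d)) / \<delta> ^ CARD('d) * indicator (cball 0 \<delta>) (z :: real^'d)) \<partial>lborel) \<le> ennreal a"
        unfolding cball_mass[OF \<delta> p] a by simp
      show "norm (c y z) \<le> (16 * C\<^sup>2 + 2 * M) / (bump 0 * bump_mass TYPE(real^'d)) / \<delta> ^ CARD('d) * indicator (cball 0 \<delta>) (y - z) * ?m y" for y z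
        using reg_kernel_commutator_bound[OF \<delta> W U[of t y z] M C]
        unfolding c_def h_def complex_cnj_cnj by (simp only: divide_divide_eq_left)
    qed
    have "2 * Im (kernel_form (h t) (u t) (u t)) \<le> norm (kernel_form c (u t) (u t))"
    proof -
      have "kernel_form c (u t) (u t) = of_real (2 * Im (kernel_form (h t) (u t) (u t))) * \<i>"
        unfolding P[symmetric] by (simp add: complex_eq_iff)
      then have "norm (kernel_form c (u t) (u t)) = \<bar>2 * Im (kernel_form (h t) (u t) (u t))\<bar>"
        by (simp only: norm_mult norm_of_real norm_ii mult_1_right)
      then show ?thesis by simp
    qed
    moreover have "Im (kernel_form ?kc (u t) (g t)) \<le> L2_norm (u t) * \<gamma> t"
    proof -
      have "Im (kernel_form ?kc (u t) (g t)) \<le> norm (kernel_form ?kc (u t) (g t))"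
        using abs_Im_le_cmod[of "kernel_form ?kc (u t) (g t)"] by linarith
      also have "\<dots> \<le> L2_norm (u t) * L2_norm (g t)" by (rule reg_kernel_form_bound[OF \<delta> uL2 g(1)])
      also have "\<dots> \<le> L2_norm (u t) * \<gamma> t" by (intro mult_left_mono g(2)) simp
      finally show ?thesis .
    qed
    ultimately show "?D \<le> a * L2_norm (\<lambda>y. of_real (?m y) * u t y) * L2_norm (u t) + 2 * L2_norm (u t) * \<gamma> t"
      using Pb by simp
  qed
qed

lemma energy_estimate:
  fixes u g :: "real \<Rightarrow> real^'d::finite \<Rightarrow> complex"
  assumes W: "skew W" and U0: "\<And>t. U t 0 = 0"
    and U: "\<And>t y z. \<bar>U t y - U t z\<bar> \<le> M * norm (y - z) * (norm y + norm z)" and M: "M \<ge> 0"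
    and u: "continuous_L2 u" and sol: "weak_solution W U u g"
    and g: "\<And>t. g t \<in> L2" "\<And>t. L2_norm (g t) \<le> \<gamma> t" and \<gamma>: "continuous_on UNIV \<gamma>"
    and t: "0 \<le> t"
  shows "(L2_norm (u t))\<^sup>2 \<le> (L2_norm (u 0))\<^sup>2 + integral {0..t} (\<lambda>s. 2 * L2_norm (u s) * \<gamma> s)"
proof -
  have uL2: "u s \<in> L2" for s using u by (simp add: continuous_L2_def)
  obtain C where "C > 0" and C: "\<And>s. 0 \<le> s \<Longrightarrow> \<bar>dir_deriv 1 bump s\<bar> \<le> C" "\<And>s. s > 1 \<Longrightarrow> dir_deriv 1 bump s = 0"
    by (rule dir_deriv_bump_bound) (rule that)
  define a where "a = (16 * C\<^sup>2 + 2 * M) / (bump 0 * bump_mass TYPE(real^'d)) * measure lborel (cball (0::real^'d) 1)"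
  have a0: "0 \<le> a"
    unfolding a_def using M bump_bounds(4)[of 0] bump_mass_pos[where 'a="real^'d"] by simp
  define d where "d n = 1 / real (Suc n)" for n
  have d: "0 < d n" "d n \<le> 1" for n by (auto simp: d_def)
  have dl: "d \<longlonglongrightarrow> 0" unfolding d_def[abs_def] by (rule LIMSEQ_Suc[OF lim_1_over_n])
  let ?m = "\<lambda>n (y::real^'d). min 1 (d n * (1 + norm y))"
  define F where "F n s = Re (kernel_form (\<lambda>y z. of_real (reg_kernel (d n) y z)) (u s) (u s))" for n s
  define e where "e n s = a * L2_norm (\<lambda>y. of_real (?m n y) * u s y) * L2_norm (u s)" for n s
  have mb: "norm (complex_of_real (?m n y)) \<le> 1" for n y
  proof -
    have "0 \<le> ?m n y" "?m n y \<le> 1" using d(1)[of n] by auto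
    then show ?thesis by (simp only: norm_of_real abs_of_nonneg)
  qed
  have mm: "(\<lambda>y::real^'d. complex_of_real (?m n y)) \<in> borel_measurable borel" for n by measurable
  have muL2: "(\<lambda>y. of_real (?m n y) * u s y) \<in> L2" for n s
    by (rule L2_mult_bounded[OF uL2 mm mb])
  have mle: "L2_norm (\<lambda>y. of_real (?m n y) * f y) \<le> L2_norm f" if "f \<in> L2" for n f
  proof -
    have "L2_norm (\<lambda>y. of_real (?m n y) * f y) \<le> 1 * L2_norm f"
    proof (rule L2_norm_bound[OF that])
      show "(\<lambda>y. of_real (?m n y) * f y) \<in> borel_measurable borel"
        by (rule borel_measurable_times[OF mm L2_measurable[OF that]])
      show "AE y in lborel. norm (of_real (?m n y) * f y) \<le> 1 * norm (f y)"
        unfolding norm_mult by (rule AE_I2) (rule mult_right_mono[OF mb norm_ge_zero])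
    qed simp
    then show ?thesis by simp
  qed
  have uc: "continuous_on UNIV (\<lambda>s. L2_norm (u s))" by (rule continuous_L2_norm[OF u])
  have ec: "continuous_on UNIV (e n)" for n
  proof -
    have "continuous_L2 (\<lambda>s y. of_real (?m n y) * u s y)"
      unfolding continuous_L2_def
    proof (intro conjI allI muL2)
      fix t
      have le: "L2_norm (\<lambda>y. of_real (?m n y) * u s y - of_real (?m n y) * u t y) \<le> L2_norm (\<lambda>y. u s y - u t y)" for s
        using mle[OF L2_diff[OF uL2 uL2], of n s t] by (simp only: right_diff_distrib)
      show "((\<lambda>s. L2_norm (\<lambda>y. of_real (?m n y) * u s y - of_real (?m n y) * u t y)) \<longlongrightarrow> 0) (at t)"
        by (rule Lim_null_comparison[where g = "\<lambda>s. L2_norm (\<lambda>y. u s y - u t y)"])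
          (use le u in \<open>auto simp: continuous_L2_def\<close>)
    qed
    then show ?thesis unfolding e_def[abs_def] by (intro continuous_intros continuous_L2_norm uc)
  qed
  have el: "(\<lambda>n. e n s) \<longlonglongrightarrow> 0" for s
  proof -
    have "(\<lambda>n. L2_norm (\<lambda>y. of_real (?m n y) * u s y)) \<longlonglongrightarrow> 0"
    proof (rule L2_norm_tendsto_0[where w = "u s"])
      show "(\<lambda>y. of_real (?m n y) * u s y) \<in> borel_measurable borel" for n by (rule L2_measurable[OF muL2])
      show "AE y in lborel. norm (of_real (?m n y) * u s y) \<le> norm (u s y)" for n
        unfolding norm_mult using mult_right_mono[OF mb norm_ge_zero] by (intro AE_I2) simp
      show "AE y in lborel. (\<lambda>n. of_real (?m n y) * u s y) \<longlonglongrightarrow> 0"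
      proof (rule AE_I2)
        fix y
        have "(\<lambda>n. of_real (min 1 (d n * (1 + norm y))) * u s y) \<longlonglongrightarrow> of_real (min 1 (0 * (1 + norm y))) * u s y"
          by (intro tendsto_intros dl)
        then show "(\<lambda>n. of_real (?m n y) * u s y) \<longlonglongrightarrow> 0" by simp
      qed
    qed (rule uL2)
    then have "(\<lambda>n. a * L2_norm (\<lambda>y. of_real (?m n y) * u s y) * L2_norm (u s)) \<longlonglongrightarrow> a * 0 * L2_norm (u s)"
      by (intro tendsto_intros)
    then show ?thesis by (simp add: e_def)
  qed
  have Fl: "(\<lambda>n. F n s) \<longlonglongrightarrow> (L2_norm (u s))\<^sup>2" for s
    unfolding F_def using tendsto_Re[OF reg_kernel_form_tendsto[OF d dl uL2, of s]] by simp
  let ?r = "\<lambda>s. 2 * L2_norm (u s) * \<gamma> s"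
  have rc: "continuous_on {0..t} ?r"
    by (intro continuous_intros continuous_on_subset[OF uc] continuous_on_subset[OF \<gamma>]) auto
  have ei: "e n integrable_on {0..t}" for n
    by (intro integrable_continuous_real continuous_on_subset[OF ec]) auto
  have ineq: "F n t \<le> F n 0 + integral {0..t} (e n) + integral {0..t} ?r" for n
  proof -
    have "\<exists>D. (F n has_real_derivative D) (at s) \<and> D \<le> e n s + ?r s" for s
      using reg_energy_derivative[OF d W U0 U M u sol g \<gamma> C a_def, of n s thesis for thesis]
      unfolding F_def[abs_def] e_def by blast
    then obtain D where D: "\<And>s. (F n has_real_derivative D s) (at s)" "\<And>s. D s \<le> e n s + ?r s" by metis
    have "(D has_integral (F n t - F n 0)) {0..t}"
      using t D(1) by (intro fundamental_theorem_of_calculus) (auto simp: has_real_derivative_iff_has_vector_derivative intro: has_vector_derivative_at_within)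
    moreover have "((\<lambda>s. e n s + ?r s) has_integral (integral {0..t} (e n) + integral {0..t} ?r)) {0..t}"
      by (intro has_integral_add integrable_integral ei integrable_continuous_real rc)
    ultimately have "F n t - F n 0 \<le> integral {0..t} (e n) + integral {0..t} ?r"
      by (rule has_integral_le) (use D(2) in blast)
    then show ?thesis by simp
  qed
  have "(\<lambda>n. integral {0..t} (e n)) \<longlonglongrightarrow> integral {0..t} (\<lambda>s. 0)"
  proof (rule dominated_convergence(2)[where h = "\<lambda>s. a * L2_norm (u s) * L2_norm (u s)"])
    show "(\<lambda>s. a * L2_norm (u s) * L2_norm (u s)) integrable_on {0..t}"
      by (intro integrable_continuous_real continuous_intros continuous_on_subset[OF uc]) auto
    show "norm (e n s) \<le> a * L2_norm (u s) * L2_norm (u s)" for n s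
      unfolding e_def using a0 mle[OF uL2] by (simp add: abs_mult mult_right_mono mult_left_mono)
  qed (use ei el in auto)
  then have "(\<lambda>n. F n 0 + integral {0..t} (e n) + integral {0..t} ?r) \<longlonglongrightarrow> (L2_norm (u 0))\<^sup>2 + 0 + integral {0..t} ?r"
    by (intro tendsto_intros Fl) simp
  from LIMSEQ_le[OF Fl this] ineq show ?thesis by auto
qed

section \<open>Commuting positions and derivatives through the equation\<close>

definition weak_partial :: "'d::finite \<Rightarrow> (real^'d \<Rightarrow> complex) \<Rightarrow> (real^'d \<Rightarrow> complex) \<Rightarrow> bool" where
  "weak_partial j u w \<longleftrightarrow> u \<in> L2 \<and> w \<in> L2 \<and>
     (\<forall>\<eta>. test_function \<eta> \<longrightarrow> L2_inner (partial j \<eta>) u = - L2_inner \<eta> w)"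

lemma bounded_linear_component:
  fixes W :: "real^'d::finite \<Rightarrow> real^'d"
  shows "linear W \<Longrightarrow> bounded_linear (\<lambda>x. W x $ k)"
  using bounded_linear_compose[OF bounded_linear_vec_nth[of k], of W] by (simp add: linear_conv_bounded_linear)

lemma partial_linear_component:
  fixes W :: "real^'d::finite \<Rightarrow> real^'d"
  assumes "linear W"
  shows "partial j (\<lambda>x. W x $ k) = (\<lambda>x. W (axis j 1) $ k)"
  unfolding partial_def
  using dir_deriv_eq[OF bounded_linear_imp_has_derivative[OF bounded_linear_component[OF assms]]] by blast

lemma test_function_laplacian: "test_function \<eta> \<Longrightarrow> test_function (laplacian \<eta>)"
  unfolding laplacian_def[abs_def] by (intro test_function_sum test_function_partial)

lemma test_function_ham:
  fixes W :: "real^'d::finite \<Rightarrow> real^'d"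
  assumes W: "linear W" and U: "smooth U" and \<eta>: "test_function \<eta>"
  shows "test_function (ham W U \<eta>)"
proof -
  have "test_function (\<lambda>x. (- (1 / 2) * laplacian \<eta> x + of_real (U x) * \<eta> x)
     + (- \<i>) * (\<Sum>j\<in>UNIV. of_real (W x $ j) * partial j \<eta> x))"
    by (intro test_function_add test_function_scale test_function_sum test_function_mult_smooth test_function_laplacian
        test_function_partial smooth_of_real smooth_linear bounded_linear_component \<eta> U W)
  then show ?thesis by (simp add: ham_def[abs_def])
qed

lemma ham_position:
  fixes W :: "real^'d::finite \<Rightarrow> real^'d"
  assumes s: "smooth \<eta>"
  shows "ham W U (\<lambda>x. of_real (x $ j) * \<eta> x) x =
    of_real (x $ j) * ham W U \<eta> x - partial j \<eta> x - \<i> * of_real (W x $ j) * \<eta> x"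
proof -
  have n: "smooth (\<lambda>x::real^'d. complex_of_real (x $ j))" by (intro smooth_of_real smooth_nth)
  have pn: "partial i (\<lambda>x::real^'d. complex_of_real (x $ j)) = (\<lambda>x. if i = j then 1 else 0)" for i
    unfolding partial_of_real[OF smooth_nth] partial_nth by auto
  have p1: "partial i (\<lambda>x. of_real (x $ j) * \<eta> x) = (\<lambda>x. of_real (x $ j) * partial i \<eta> x + (if i = j then \<eta> x else 0))" for i
    unfolding partial_mult[OF n s] pn by (auto simp: fun_eq_iff)
  have p2: "partial i (partial i (\<lambda>x. of_real (x $ j) * \<eta> x)) x =
      of_real (x $ j) * partial i (partial i \<eta>) x + (if i = j then 2 * partial j \<eta> x else 0)" for i
  proof (cases "i = j")
    case True
    show ?thesis unfolding p1 using True s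
      by (simp add: partial_add[OF smooth_mult[OF n smooth_partial[OF s]] s] partial_mult[OF n smooth_partial[OF s]] pn)
  next
    case False
    then show ?thesis unfolding p1 by (simp add: partial_mult[OF n smooth_partial[OF s]] pn)
  qed
  have lap: "laplacian (\<lambda>x. of_real (x $ j) * \<eta> x) x = of_real (x $ j) * laplacian \<eta> x + 2 * partial j \<eta> x"
    unfolding laplacian_def p2 by (simp add: sum.distrib sum_distrib_left)
  have "(\<Sum>i\<in>UNIV. complex_of_real (W x $ i) * (if i = j then \<eta> x else 0)) = of_real (W x $ j) * \<eta> x"
    by (simp add: if_distrib[of "(*) _"] cong: if_cong)
  then have rot: "(\<Sum>i\<in>UNIV. complex_of_real (W x $ i) * partial i (\<lambda>x. of_real (x $ j) * \<eta> x) x) =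
     of_real (x $ j) * (\<Sum>i\<in>UNIV. of_real (W x $ i) * partial i \<eta> x) + of_real (W x $ j) * \<eta> x"
    unfolding p1 by (simp add: distrib_left sum.distrib sum_distrib_left mult_ac)
  show ?thesis unfolding ham_def lap rot by (simp add: algebra_simps)
qed

lemma ham_partial:
  fixes W :: "real^'d::finite \<Rightarrow> real^'d"
  assumes W: "linear W" and U: "smooth U" and s: "smooth \<eta>"
  shows "partial j (ham W U \<eta>) x = ham W U (partial j \<eta>) x + of_real (partial j U x) * \<eta> x
    - \<i> * (\<Sum>k\<in>UNIV. of_real (W (axis j 1) $ k) * partial k \<eta> x)"
proof -
  have Ws: "smooth (\<lambda>x. complex_of_real (W x $ k))" for k
    by (intro smooth_of_real smooth_linear bounded_linear_component W)
  have Us: "smooth (\<lambda>x. complex_of_real (U x))" by (intro smooth_of_real U)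
  have ls: "smooth (laplacian \<eta>)" unfolding laplacian_def[abs_def] by (intro smooth_sum smooth_partial s)
  have rs: "smooth (\<lambda>x. \<Sum>k\<in>UNIV. complex_of_real (W x $ k) * partial k \<eta> x)"
    by (intro smooth_sum smooth_mult Ws smooth_partial s)
  have pl: "partial j (laplacian \<eta>) = laplacian (partial j \<eta>)"
    unfolding laplacian_def[abs_def]
    by (simp add: partial_sum smooth_partial s partial_commute[of _ j] partial_commute[OF s, of j])
  have pU: "partial j (\<lambda>x. of_real (U x) * \<eta> x) = (\<lambda>x. of_real (U x) * partial j \<eta> x + of_real (partial j U x) * \<eta> x)"
    unfolding partial_mult[OF Us s] partial_of_real[OF U] ..
  have pW: "partial j (\<lambda>x. of_real (W x $ k) * partial k \<eta> x) =
      (\<lambda>x. of_real (W x $ k) * partial k (partial j \<eta>) x + of_real (W (axis j 1) $ k) * partial k \<eta> x)" for k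
    unfolding partial_mult[OF Ws smooth_partial[OF s]]
      partial_of_real[OF smooth_linear[OF bounded_linear_component[OF W]]] partial_linear_component[OF W]
      partial_commute[OF s, of j k] ..
  have eq: "ham W U \<eta> = (\<lambda>x. (- (1 / 2) * laplacian \<eta> x + of_real (U x) * \<eta> x)
     + (- \<i>) * (\<Sum>k\<in>UNIV. of_real (W x $ k) * partial k \<eta> x))"
    by (simp add: ham_def[abs_def])
  have "partial j (ham W U \<eta>) x = (- (1 / 2) * laplacian (partial j \<eta>) x + (of_real (U x) * partial j \<eta> x + of_real (partial j U x) * \<eta> x))
     + (- \<i>) * (\<Sum>k\<in>UNIV. of_real (W x $ k) * partial k (partial j \<eta>) x + of_real (W (axis j 1) $ k) * partial k \<eta> x)"
    unfolding eq
    using ls rs smooth_mult[OF smooth_const ls] smooth_mult[OF smooth_const rs] smooth_mult[OF Us s]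
    by (simp only: partial_add smooth_add partial_cmult pl pU partial_sum smooth_mult[OF Ws smooth_partial[OF s]] pW)
  then show ?thesis by (simp add: ham_def sum.distrib algebra_simps)
qed

lemma weak_solution_position:
  fixes u g :: "real \<Rightarrow> real^'d::finite \<Rightarrow> complex"
  assumes W: "linear W" and U: "\<And>t. smooth (U t)" and sol: "weak_solution W U u g"
    and L2: "\<And>t. u t \<in> L2" "\<And>t. g t \<in> L2" "\<And>t k. (\<lambda>x. of_real (x $ k) * u t x) \<in> L2" "\<And>t. (\<lambda>x. of_real (x $ j) * g t x) \<in> L2"
    and w: "\<And>t. weak_partial j (u t) (w t)"
  shows "weak_solution W U (\<lambda>t x. of_real (x $ j) * u t x)
    (\<lambda>t x. (of_real (x $ j) * g t x + w t x) + \<i> * (\<Sum>k\<in>UNIV. of_real (W (axis k 1) $ j) * (of_real (x $ k) * u t x)))"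
  unfolding weak_solution_def
proof (intro allI impI)
  fix \<eta> :: "real^'d \<Rightarrow> complex" and t assume \<eta>: "test_function \<eta>"
  have x\<eta>: "test_function (\<lambda>x. of_real (x $ k) * \<eta> x)" for k
    by (intro test_function_mult_smooth smooth_of_real smooth_nth \<eta>)
  have move: "L2_inner (\<lambda>x. of_real (x $ k) * h x) f = L2_inner h (\<lambda>x. of_real (x $ k) * f x)" for h f :: "real^'d \<Rightarrow> complex" and k
    unfolding L2_inner_def by (simp add: mult_ac)
  have wL2: "w t \<in> L2" using w by (simp add: weak_partial_def)
  have H: "test_function (ham W (U t) \<eta>)" by (rule test_function_ham[OF W U \<eta>])
  have Wx: "W x $ j = (\<Sum>k\<in>UNIV. x $ k * W (axis k 1) $ j)" for x
  proof -
    have "x = (\<Sum>k\<in>UNIV. (x $ k) *\<^sub>R axis k 1)"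
      using basis_expansion[of x] by (simp add: scalar_mult_eq_scaleR)
    then have "W x = W (\<Sum>k\<in>UNIV. (x $ k) *\<^sub>R axis k 1)" by simp
    also have "\<dots> = (\<Sum>k\<in>UNIV. (x $ k) *\<^sub>R W (axis k 1))" using W by (simp add: linear_sum linear_cmul)
    finally show ?thesis by simp
  qed
  let ?R = "\<lambda>x. \<Sum>k\<in>UNIV. of_real (W (axis k 1) $ j) * (of_real (x $ k) * u t x)"
  have RL2: "?R \<in> L2" by (intro L2_sum L2_scale L2)
  have W\<eta>: "test_function (\<lambda>x. \<i> * (of_real (W x $ j) * \<eta> x))"
    by (intro test_function_scale test_function_mult_smooth smooth_of_real smooth_linear bounded_linear_component W \<eta>)
  have "L2_inner (ham W (U t) (\<lambda>x. of_real (x $ j) * \<eta> x)) (u t) =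
      L2_inner (\<lambda>x. (of_real (x $ j) * ham W (U t) \<eta> x - partial j \<eta> x) - \<i> * (of_real (W x $ j) * \<eta> x)) (u t)"
    unfolding ham_position[OF test_function_smooth[OF \<eta>]] by (simp add: mult.assoc)
  also have "\<dots> = L2_inner (\<lambda>x. of_real (x $ j) * ham W (U t) \<eta> x) (u t) - L2_inner (partial j \<eta>) (u t)
      - L2_inner (\<lambda>x. \<i> * (of_real (W x $ j) * \<eta> x)) (u t)"
    by (simp only: L2_inner_diff_left L2_diff L2(1) test_function_L2[OF W\<eta>] test_function_L2[OF test_function_partial[OF \<eta>]]
        test_function_L2[OF test_function_mult_smooth[OF smooth_of_real[OF smooth_nth] H]])
  also have "L2_inner (partial j \<eta>) (u t) = - L2_inner \<eta> (w t)" using w \<eta> by (simp add: weak_partial_def)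
  also have "L2_inner (\<lambda>x. \<i> * (of_real (W x $ j) * \<eta> x)) (u t) = - L2_inner \<eta> (\<lambda>x. \<i> * ?R x)"
  proof -
    have "cnj (\<i> * (of_real (W x $ j) * \<eta> x)) * u t x = - (cnj (\<eta> x) * (\<i> * ?R x))" for x
      unfolding Wx[of x] by (simp add: sum_distrib_left sum_distrib_right sum_negf mult_ac)
    then show ?thesis unfolding L2_inner_def by (simp only: Bochner_Integration.integral_minus)
  qed
  finally have H': "L2_inner (ham W (U t) (\<lambda>x. of_real (x $ j) * \<eta> x)) (u t) =
     L2_inner (ham W (U t) \<eta>) (\<lambda>x. of_real (x $ j) * u t x) + (L2_inner \<eta> (w t) + L2_inner \<eta> (\<lambda>x. \<i> * ?R x))"
  proof -
    assume "L2_inner (ham W (U t) (\<lambda>x. of_real (x $ j) * \<eta> x)) (u t) =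
      L2_inner (\<lambda>x. of_real (x $ j) * ham W (U t) \<eta> x) (u t) - - L2_inner \<eta> (w t) - - L2_inner \<eta> (\<lambda>x. \<i> * ?R x)"
    moreover have "a - - b - - c = a + (b + c)" for a b c :: complex by simp
    ultimately show ?thesis using move[of j "ham W (U t) \<eta>" "u t"] by (simp only:)
  qed
  have sum: "(L2_inner \<eta> (\<lambda>x. of_real (x $ j) * g t x) + L2_inner \<eta> (w t)) + L2_inner \<eta> (\<lambda>x. \<i> * ?R x) =
     L2_inner \<eta> (\<lambda>x. (of_real (x $ j) * g t x + w t x) + \<i> * ?R x)"
    by (simp only: L2_inner_add_right test_function_L2[OF \<eta>] L2 wL2 L2_add L2_scale RL2)
  have eq: "L2_inner (ham W (U t) (\<lambda>x. of_real (x $ j) * \<eta> x)) (u t) + L2_inner (\<lambda>x. of_real (x $ j) * \<eta> x) (g t) =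
     L2_inner (ham W (U t) \<eta>) (\<lambda>x. of_real (x $ j) * u t x) + L2_inner \<eta> (\<lambda>x. (of_real (x $ j) * g t x + w t x) + \<i> * ?R x)"
    unfolding H' sum[symmetric] move[of j \<eta> "g t"] by (simp only: add_ac)
  have "((\<lambda>s. L2_inner (\<lambda>x. of_real (x $ j) * \<eta> x) (u s)) has_vector_derivative
       - \<i> * (L2_inner (ham W (U t) (\<lambda>x. of_real (x $ j) * \<eta> x)) (u t) + L2_inner (\<lambda>x. of_real (x $ j) * \<eta> x) (g t))) (at t)"
    using sol x\<eta> unfolding weak_solution_def by blast
  from this[unfolded eq] show "((\<lambda>s. L2_inner \<eta> (\<lambda>x. of_real (x $ j) * u s x)) has_vector_derivative
       - \<i> * (L2_inner (ham W (U t) \<eta>) (\<lambda>x. of_real (x $ j) * u t x) + L2_inner \<eta> (\<lambda>x. (of_real (x $ j) * g t x + w t x) + \<i> * ?R x))) (at t)"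
    unfolding move[of j \<eta>] .
qed

lemma weak_solution_derivative:
  fixes u g :: "real \<Rightarrow> real^'d::finite \<Rightarrow> complex"
  assumes W: "linear W" and U: "\<And>t. smooth (U t)" and sol: "weak_solution W U u g"
    and Q: "\<And>t x. partial j (U t) x = (\<Sum>k\<in>UNIV. Q t k * x $ k)"
    and L2: "\<And>t. u t \<in> L2" "\<And>t k. (\<lambda>x. of_real (x $ k) * u t x) \<in> L2"
    and w: "\<And>t k. weak_partial k (u t) (w k t)" and h: "\<And>t. weak_partial j (g t) (h t)"
  shows "weak_solution W U (w j)
    (\<lambda>t x. (h t x + (\<Sum>k\<in>UNIV. of_real (Q t k) * (of_real (x $ k) * u t x))) + (- \<i>) * (\<Sum>k\<in>UNIV. of_real (W (axis j 1) $ k) * w k t x))"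
  unfolding weak_solution_def
proof (intro allI impI)
  fix \<eta> :: "real^'d \<Rightarrow> complex" and t assume \<eta>: "test_function \<eta>"
  have wL2: "w k t \<in> L2" for k using w by (simp add: weak_partial_def)
  have hL2: "h t \<in> L2" using h by (simp add: weak_partial_def)
  have H: "test_function (ham W (U t) \<eta>)" by (rule test_function_ham[OF W U \<eta>])
  have pH: "test_function (partial j (ham W (U t) \<eta>))" by (rule test_function_partial[OF H])
  let ?S = "\<lambda>x. \<Sum>k\<in>UNIV. of_real (Q t k) * (of_real (x $ k) * u t x)"
  let ?T = "\<lambda>x. \<Sum>k\<in>UNIV. of_real (W (axis j 1) $ k) * w k t x"
  have SL2: "?S \<in> L2" and TL2: "?T \<in> L2" by (intro L2_sum L2_scale L2 wL2)+
  have Us: "smooth (\<lambda>x. complex_of_real (partial j (U t) x))" by (intro smooth_of_real smooth_partial U)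
  have U\<eta>: "test_function (\<lambda>x. of_real (partial j (U t) x) * \<eta> x)" by (rule test_function_mult_smooth[OF Us \<eta>])
  have W\<eta>: "test_function (\<lambda>x. \<i> * (\<Sum>k\<in>UNIV. of_real (W (axis j 1) $ k) * partial k \<eta> x))"
    by (intro test_function_scale test_function_sum test_function_partial \<eta>)
  have "L2_inner (ham W (U t) (partial j \<eta>)) (u t) = L2_inner (\<lambda>x. (partial j (ham W (U t) \<eta>) x - of_real (partial j (U t) x) * \<eta> x)
      + \<i> * (\<Sum>k\<in>UNIV. of_real (W (axis j 1) $ k) * partial k \<eta> x)) (u t)"
    unfolding ham_partial[OF W U test_function_smooth[OF \<eta>]] by (intro arg_cong2[where f = L2_inner]) (auto simp: fun_eq_iff)
  also have "\<dots> = L2_inner (partial j (ham W (U t) \<eta>)) (u t) - L2_inner (\<lambda>x. of_real (partial j (U t) x) * \<eta> x) (u t)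
      + L2_inner (\<lambda>x. \<i> * (\<Sum>k\<in>UNIV. of_real (W (axis j 1) $ k) * partial k \<eta> x)) (u t)"
    by (simp only: L2_inner_diff_left L2_inner_add_left L2_diff L2(1) test_function_L2[OF W\<eta>] test_function_L2[OF U\<eta>] test_function_L2[OF pH])
  also have "L2_inner (partial j (ham W (U t) \<eta>)) (u t) = - L2_inner (ham W (U t) \<eta>) (w j t)"
    using w H by (simp add: weak_partial_def)
  also have "L2_inner (\<lambda>x. of_real (partial j (U t) x) * \<eta> x) (u t) = L2_inner \<eta> ?S"
    unfolding L2_inner_def Q by (simp add: sum_distrib_left sum_distrib_right mult_ac)
  also have "L2_inner (\<lambda>x. \<i> * (\<Sum>k\<in>UNIV. of_real (W (axis j 1) $ k) * partial k \<eta> x)) (u t) = - L2_inner \<eta> (\<lambda>x. (- \<i>) * ?T x)"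
  proof -
    have "L2_inner (\<lambda>x. \<Sum>k\<in>UNIV. of_real (W (axis j 1) $ k) * partial k \<eta> x) (u t) =
        (\<Sum>k\<in>UNIV. L2_inner (\<lambda>x. of_real (W (axis j 1) $ k) * partial k \<eta> x) (u t))"
      by (intro L2_inner_sum_left L2 test_function_L2 test_function_scale test_function_partial \<eta>)
    also have "\<dots> = (\<Sum>k\<in>UNIV. - L2_inner \<eta> (\<lambda>x. of_real (W (axis j 1) $ k) * w k t x))"
      using w \<eta> by (simp add: L2_inner_scale_left L2_inner_scale_right weak_partial_def)
    also have "\<dots> = - L2_inner \<eta> ?T"
      by (subst L2_inner_sum_right) (auto simp: sum_negf intro: L2_scale wL2 test_function_L2 \<eta>)
    finally show ?thesis unfolding L2_inner_scale_left L2_inner_scale_right by simp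
  qed
  finally have H': "L2_inner (ham W (U t) (partial j \<eta>)) (u t) =
      - (L2_inner (ham W (U t) \<eta>) (w j t) + (L2_inner \<eta> ?S + L2_inner \<eta> (\<lambda>x. (- \<i>) * ?T x)))" by simp
  have gh: "L2_inner (partial j \<eta>) (g t) = - L2_inner \<eta> (h t)" using h \<eta> by (simp add: weak_partial_def)
  have sum: "(L2_inner \<eta> (h t) + L2_inner \<eta> ?S) + L2_inner \<eta> (\<lambda>x. (- \<i>) * ?T x) =
     L2_inner \<eta> (\<lambda>x. (h t x + ?S x) + (- \<i>) * ?T x)"
    by (simp only: L2_inner_add_right test_function_L2[OF \<eta>] hL2 L2_add L2_scale SL2 TL2)
  have eq: "L2_inner (ham W (U t) (partial j \<eta>)) (u t) + L2_inner (partial j \<eta>) (g t) =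
     - (L2_inner (ham W (U t) \<eta>) (w j t) + L2_inner \<eta> (\<lambda>x. (h t x + ?S x) + (- \<i>) * ?T x))"
    unfolding H' gh sum[symmetric] by simp
  have "((\<lambda>s. L2_inner (partial j \<eta>) (u s)) has_vector_derivative
       - \<i> * (L2_inner (ham W (U t) (partial j \<eta>)) (u t) + L2_inner (partial j \<eta>) (g t))) (at t)"
    using sol test_function_partial[OF \<eta>] unfolding weak_solution_def by blast
  then have "((\<lambda>s. - L2_inner (partial j \<eta>) (u s)) has_vector_derivative
       - (- \<i> * (L2_inner (ham W (U t) (partial j \<eta>)) (u t) + L2_inner (partial j \<eta>) (g t)))) (at t)"
    by (rule has_vector_derivative_minus)
  moreover have "- L2_inner (partial j \<eta>) (u s) = L2_inner \<eta> (w j s)" for s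
    using w \<eta> by (simp add: weak_partial_def)
  moreover have "- (- \<i> * (L2_inner (ham W (U t) (partial j \<eta>)) (u t) + L2_inner (partial j \<eta>) (g t))) =
      - \<i> * (L2_inner (ham W (U t) \<eta>) (w j t) + L2_inner \<eta> (\<lambda>x. (h t x + ?S x) + (- \<i>) * ?T x))"
  proof -
    have "- (- c * - z) = - c * z" for c z :: complex by simp
    then show ?thesis unfolding eq .
  qed
  ultimately show "((\<lambda>s. L2_inner \<eta> (w j s)) has_vector_derivative
       - \<i> * (L2_inner (ham W (U t) \<eta>) (w j t) + L2_inner \<eta> (\<lambda>x. (h t x + ?S x) + (- \<i>) * ?T x))) (at t)"
    by (simp only:)
qed

section \<open>Weighted weak derivatives\<close>

lemma mi_deriv_list_zero_outside:
  fixes f :: "real^'d::finite \<Rightarrow> complex"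
  shows "test_function f \<Longrightarrow> test_function (mi_deriv_list is \<alpha> f)"
proof (induction "is")
  case (Cons i "is")
  have "test_function h \<Longrightarrow> test_function ((partial i ^^ n) h)" for n and h :: "real^'d \<Rightarrow> complex"
    by (induction n) (auto intro: test_function_partial)
  then show ?case using Cons by simp
qed simp

lemma test_function_mi_deriv: "test_function f \<Longrightarrow> test_function (mi_deriv \<alpha> f)"
  by (simp add: mi_deriv_eq_list mi_deriv_list_zero_outside)

lemma locally_integrable_diff:
  "locally_integrable f \<Longrightarrow> locally_integrable g \<Longrightarrow> locally_integrable (\<lambda>x. f x - g x)"
  by (auto simp: locally_integrable_def intro!: set_integral_diff(1))

lemma locally_integrable_test_integrable:
  fixes f :: "real^'d::finite \<Rightarrow> complex"
  assumes f: "locally_integrable f" and \<eta>: "test_function \<eta>"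
  shows "integrable lborel (\<lambda>x. f x * \<eta> x)"
proof -
  have [measurable]: "f \<in> borel_measurable borel" using f by (simp add: locally_integrable_def)
  have [measurable]: "\<eta> \<in> borel_measurable borel" by (rule test_function_measurable[OF \<eta>])
  obtain c where c: "\<And>x. norm (\<eta> x) \<le> c" using test_function_bounded[OF \<eta>] by blast
  obtain R where R: "\<And>x. norm x > R \<Longrightarrow> \<eta> x = 0" using \<eta> unfolding test_function_iff by blast
  have "set_integrable lborel (cball 0 R) f" using f by (simp add: locally_integrable_def)
  then have "integrable lborel (\<lambda>x. c * norm (indicator (cball 0 R) x *\<^sub>R f x))"
    unfolding set_integrable_def by (intro integrable_mult_right integrable_norm)
  then show ?thesis
  proof (rule Bochner_Integration.integrable_bound)
    show "AE x in lborel. norm (f x * \<eta> x) \<le> norm (c * norm (indicator (cball 0 R) x *\<^sub>R f x))"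
    proof (rule AE_I2)
      fix x
      have "norm (\<eta> x) * norm (f x) \<le> \<bar>c\<bar> * norm (f x)"
        using c[of x] by (intro mult_right_mono) auto
      then show "norm (f x * \<eta> x) \<le> norm (c * norm (indicator (cball 0 R) x *\<^sub>R f x))"
        using R[of x] by (cases "norm x > R") (auto simp: norm_mult abs_mult mult.commute)
    qed
  qed measurable
qed

lemma has_weak_deriv_diff:
  assumes "has_weak_deriv \<beta> f f'" "has_weak_deriv \<beta> g g'"
  shows "has_weak_deriv \<beta> (\<lambda>x. f x - g x) (\<lambda>x. f' x - g' x)"
proof -
  note d = assms[unfolded has_weak_deriv_def]
  show ?thesis
    unfolding has_weak_deriv_def
  proof (intro conjI allI impI)
    fix \<eta> :: "real^'a \<Rightarrow> complex" assume \<eta>: "test_function \<eta>"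
    have i: "integrable lborel (\<lambda>x. f x * mi_deriv \<beta> \<eta> x)" "integrable lborel (\<lambda>x. g x * mi_deriv \<beta> \<eta> x)"
      "integrable lborel (\<lambda>x. f' x * \<eta> x)" "integrable lborel (\<lambda>x. g' x * \<eta> x)"
      using d \<eta> by (auto intro: locally_integrable_test_integrable test_function_mi_deriv)
    show "(\<integral>x. (f x - g x) * mi_deriv \<beta> \<eta> x \<partial>lborel) = (-1) ^ mi_order \<beta> * (\<integral>x. (f' x - g' x) * \<eta> x \<partial>lborel)"
      unfolding left_diff_distrib Bochner_Integration.integral_diff[OF i(1,2)] Bochner_Integration.integral_diff[OF i(3,4)]
      using d \<eta> by (simp add: right_diff_distrib)
  qed (use d locally_integrable_diff in auto)
qed

lemma has_weak_deriv_unique: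
  assumes "has_weak_deriv \<beta> f g" "has_weak_deriv \<beta> f h"
  shows "AE x in lborel. g x = h x"
proof -
  have "AE x in lborel. g x - h x = 0"
  proof (rule fundamental_lemma)
    show "locally_integrable (\<lambda>x. g x - h x)"
      using assms unfolding has_weak_deriv_def by (intro locally_integrable_diff) auto
    fix \<eta> :: "real^'a \<Rightarrow> complex" assume \<eta>: "test_function \<eta>"
    have i: "integrable lborel (\<lambda>x. g x * \<eta> x)" "integrable lborel (\<lambda>x. h x * \<eta> x)"
      using assms \<eta> unfolding has_weak_deriv_def by (auto intro: locally_integrable_test_integrable)
    have "(-1) ^ mi_order \<beta> * (\<integral>x. g x * \<eta> x \<partial>lborel) = (-1) ^ mi_order \<beta> * (\<integral>x. h x * \<eta> x \<partial>lborel)"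
      using assms \<eta> unfolding has_weak_deriv_def by metis
    then have "(\<integral>x. g x * \<eta> x \<partial>lborel) = (\<integral>x. h x * \<eta> x \<partial>lborel)" by simp
    then show "(\<integral>x. (g x - h x) * \<eta> x \<partial>lborel) = 0"
      unfolding left_diff_distrib Bochner_Integration.integral_diff[OF i] by simp
  qed
  then show ?thesis by simp
qed

lemma has_weak_deriv_weak_deriv: "has_weak_deriv \<beta> f g \<Longrightarrow> has_weak_deriv \<beta> f (weak_deriv \<beta> f)"
  unfolding weak_deriv_def by (rule someI[of "has_weak_deriv \<beta> f" g])

lemma Sigma_space_has_weak_deriv:
  assumes "f \<in> Sigma_space k" "mi_order \<beta> \<le> k"
  shows "has_weak_deriv \<beta> f (weak_deriv \<beta> f)"
proof -
  have "mi_order (\<lambda>i::'a. 0) + mi_order \<beta> \<le> k" using assms(2) by simp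
  then obtain g where "has_weak_deriv \<beta> f g" using assms(1) unfolding Sigma_space_def by blast
  then show ?thesis by (rule has_weak_deriv_weak_deriv)
qed

lemma Sigma_space_weighted_L2:
  "f \<in> Sigma_space k \<Longrightarrow> mi_order \<alpha> + mi_order \<beta> \<le> k \<Longrightarrow> weighted_deriv \<alpha> \<beta> f \<in> L2"
  by (simp add: Sigma_space_def)

lemma weighted_deriv_zero [simp]: "weighted_deriv (\<lambda>i. 0) \<beta> f = weak_deriv \<beta> f"
  by (simp add: fun_eq_iff weighted_deriv_def)

lemma Sigma_space_weak_deriv_L2:
  assumes "f \<in> Sigma_space k" "mi_order \<beta> \<le> k"
  shows "weak_deriv \<beta> f \<in> L2"
  using Sigma_space_weighted_L2[OF assms(1), of "\<lambda>i. 0" \<beta>] assms(2) by simp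

lemma weak_deriv_zero_AE:
  assumes "f \<in> Sigma_space k"
  shows "AE x in lborel. weak_deriv (\<lambda>i. 0) f x = f x"
proof (rule has_weak_deriv_unique[OF Sigma_space_has_weak_deriv[OF assms]])
  have "locally_integrable f"
    using Sigma_space_has_weak_deriv[OF assms, of "\<lambda>i. 0"] by (simp add: has_weak_deriv_def)
  then show "has_weak_deriv (\<lambda>i. 0) f f" by (simp add: has_weak_deriv_def)
qed simp

lemma weighted_deriv_position:
  "of_real (x $ j) * weighted_deriv \<alpha> \<beta> f x = weighted_deriv (\<alpha>(j := Suc (\<alpha> j))) \<beta> f x"
  unfolding weighted_deriv_def mi_power_Suc by simp

lemma smooth_mi_power: "smooth (\<lambda>x. mi_power x \<alpha>)"
proof -
  have "smooth (\<lambda>x::real^'a. (x $ i) ^ n)" for i n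
    by (induction n) (auto intro: smooth_mult smooth_nth)
  then show ?thesis unfolding mi_power_def by (rule smooth_prod)
qed

lemma partial_mi_power:
  "partial j (\<lambda>x. mi_power x \<alpha>) = (\<lambda>x. real (\<alpha> j) * mi_power x (\<alpha>(j := \<alpha> j - 1)))"
proof (induction "mi_order \<alpha>" arbitrary: \<alpha>)
  case 0
  then have "\<alpha> i = 0" for i by (simp add: mi_order_def)
  then have "\<alpha> = (\<lambda>i. 0)" by auto
  then show ?case by simp
next
  case (Suc n)
  obtain \<beta> i where \<beta>: "\<alpha> = \<beta>(i := Suc (\<beta> i))" "mi_order \<alpha> = Suc (mi_order \<beta>)"
    using mi_order_pos_decompose[of \<alpha>] Suc(2) by (metis zero_less_Suc)
  have IH: "partial j (\<lambda>x. mi_power x \<beta>) = (\<lambda>x. real (\<beta> j) * mi_power x (\<beta>(j := \<beta> j - 1)))"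
    by (rule Suc(1)) (use \<beta>(2) Suc(2) in simp)
  have p: "partial j (\<lambda>x. mi_power x \<alpha>) = (\<lambda>x. x $ i * (real (\<beta> j) * mi_power x (\<beta>(j := \<beta> j - 1))) + (if j = i then 1 else 0) * mi_power x \<beta>)"
    unfolding \<beta>(1) mi_power_Suc partial_mult[OF smooth_nth smooth_mi_power] IH partial_nth ..
  show ?case
  proof (cases "j = i")
    case True
    have \<alpha>: "\<alpha> j = Suc (\<beta> j)" "\<alpha>(j := \<alpha> j - 1) = \<beta>" unfolding \<beta>(1) using True by auto
    have "x $ i * mi_power x (\<beta>(j := \<beta> j - 1)) = mi_power x \<beta>" if pos: "\<beta> j \<noteq> 0" for x
    proof -
      have "\<beta> = (\<beta>(j := \<beta> j - 1))(j := Suc ((\<beta>(j := \<beta> j - 1)) j))" using pos by auto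
      then show ?thesis using mi_power_Suc[of x "\<beta>(j := \<beta> j - 1)" j] True by metis
    qed
    then have h: "x $ i * (real (\<beta> j) * mi_power x (\<beta>(j := \<beta> j - 1))) = real (\<beta> j) * mi_power x \<beta>" for x
      by (cases "\<beta> j = 0") (simp_all add: mult.left_commute)
    show ?thesis unfolding p \<alpha>(2) unfolding \<alpha>(1) h
      using True by (simp only: refl if_True mult_1 of_nat_Suc distrib_right add.commute)
  next
    case False
    have e: "\<alpha> j = \<beta> j" "\<alpha>(j := \<alpha> j - 1) = (\<beta>(j := \<beta> j - 1))(i := Suc ((\<beta>(j := \<beta> j - 1)) i))"
      unfolding \<beta>(1) using False by auto
    show ?thesis unfolding p e(2) mi_power_Suc unfolding e(1) using False by (simp add: mult.left_commute)
  qed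
qed

lemma weighted_deriv_partial:
  assumes f: "f \<in> Sigma_space k" and k: "mi_order \<alpha> + mi_order \<beta> < k"
  shows "weak_partial j (weighted_deriv \<alpha> \<beta> f)
    (\<lambda>x. weighted_deriv \<alpha> (\<beta>(j := Suc (\<beta> j))) f x + of_real (real (\<alpha> j)) * weighted_deriv (\<alpha>(j := \<alpha> j - 1)) \<beta> f x)"
  unfolding weak_partial_def
proof (intro conjI allI impI)
  let ?\<beta>' = "\<beta>(j := Suc (\<beta> j))" and ?\<alpha>' = "\<alpha>(j := \<alpha> j - 1)"
  have le: "mi_order ?\<alpha>' \<le> mi_order \<alpha>" unfolding mi_order_def by (intro sum_mono) auto
  show L: "weighted_deriv \<alpha> \<beta> f \<in> L2" by (rule Sigma_space_weighted_L2[OF f]) (use k in simp)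
  have L1: "weighted_deriv \<alpha> ?\<beta>' f \<in> L2" by (rule Sigma_space_weighted_L2[OF f]) (use k in \<open>simp add: mi_order_Suc\<close>)
  have L2': "weighted_deriv ?\<alpha>' \<beta> f \<in> L2" by (rule Sigma_space_weighted_L2[OF f]) (use k le in simp)
  show "(\<lambda>x. weighted_deriv \<alpha> ?\<beta>' f x + of_real (real (\<alpha> j)) * weighted_deriv ?\<alpha>' \<beta> f x) \<in> L2"
    by (intro L2_add L2_scale L1 L2')
  fix \<eta> :: "real^'a \<Rightarrow> complex" assume \<eta>: "test_function \<eta>"
  have s: "smooth (\<lambda>x. complex_of_real (mi_power x \<gamma>))" for \<gamma> :: "'a \<Rightarrow> nat" by (intro smooth_of_real smooth_mi_power)
  have c\<eta>: "test_function (\<lambda>x. cnj (\<eta> x))" by (rule test_function_cnj[OF \<eta>])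
  let ?\<zeta> = "\<lambda>x. of_real (mi_power x \<alpha>) * cnj (\<eta> x)"
  have \<zeta>: "test_function ?\<zeta>" by (rule test_function_mult_smooth[OF s c\<eta>])
  have p\<zeta>: "partial j ?\<zeta> = (\<lambda>x. of_real (mi_power x \<alpha>) * cnj (partial j \<eta> x) + of_real (real (\<alpha> j) * mi_power x ?\<alpha>') * cnj (\<eta> x))"
    unfolding partial_mult[OF s test_function_smooth[OF c\<eta>]] partial_of_real[OF smooth_mi_power] partial_mi_power
      partial_cnj[OF test_function_smooth[OF \<eta>]] ..
  note w = Sigma_space_has_weak_deriv[OF f, of \<beta>] Sigma_space_has_weak_deriv[OF f, of ?\<beta>']
  have w1: "has_weak_deriv \<beta> f (weak_deriv \<beta> f)" and w2: "has_weak_deriv ?\<beta>' f (weak_deriv ?\<beta>' f)"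
    using w k by (auto simp: mi_order_Suc)
  have "(-1) ^ mi_order \<beta> * (\<integral>x. weak_deriv \<beta> f x * partial j ?\<zeta> x \<partial>lborel) = (\<integral>x. f x * mi_deriv \<beta> (partial j ?\<zeta>) x \<partial>lborel)"
    using w1 test_function_partial[OF \<zeta>] unfolding has_weak_deriv_def by simp
  also have "\<dots> = (\<integral>x. f x * mi_deriv ?\<beta>' ?\<zeta> x \<partial>lborel)"
    by (simp only: mi_deriv_Suc[OF test_function_smooth[OF \<zeta>]])
  also have "\<dots> = (-1) ^ mi_order ?\<beta>' * (\<integral>x. weak_deriv ?\<beta>' f x * ?\<zeta> x \<partial>lborel)"
    using w2 \<zeta> unfolding has_weak_deriv_def by blast
  also have "\<dots> = (-1) ^ mi_order \<beta> * (- (\<integral>x. weak_deriv ?\<beta>' f x * ?\<zeta> x \<partial>lborel))"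
    by (simp add: mi_order_Suc)
  finally have main: "(\<integral>x. weak_deriv \<beta> f x * partial j ?\<zeta> x \<partial>lborel) = - (\<integral>x. weak_deriv ?\<beta>' f x * ?\<zeta> x \<partial>lborel)"
    by (rule mult_left_cancel[THEN iffD1, rotated]) simp
  have "L2_inner (partial j \<eta>) (weighted_deriv \<alpha> \<beta> f) =
      (\<integral>x. weak_deriv \<beta> f x * partial j ?\<zeta> x - cnj (\<eta> x) * (of_real (real (\<alpha> j)) * weighted_deriv ?\<alpha>' \<beta> f x) \<partial>lborel)"
    unfolding L2_inner_def p\<zeta> weighted_deriv_def by (intro Bochner_Integration.integral_cong) (auto simp: algebra_simps)
  also have "\<dots> = (\<integral>x. weak_deriv \<beta> f x * partial j ?\<zeta> x \<partial>lborel) - L2_inner \<eta> (\<lambda>x. of_real (real (\<alpha> j)) * weighted_deriv ?\<alpha>' \<beta> f x)"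
    unfolding L2_inner_def
  proof (rule Bochner_Integration.integral_diff)
    show "integrable lborel (\<lambda>x. weak_deriv \<beta> f x * partial j ?\<zeta> x)"
      using w1 by (intro locally_integrable_test_integrable test_function_partial \<zeta>) (simp add: has_weak_deriv_def)
    show "integrable lborel (\<lambda>x. cnj (\<eta> x) * (of_real (real (\<alpha> j)) * weighted_deriv ?\<alpha>' \<beta> f x))"
      by (intro L2_inner_integrable test_function_L2 \<eta> L2_scale L2')
  qed
  also have "(\<integral>x. weak_deriv \<beta> f x * partial j ?\<zeta> x \<partial>lborel) = - L2_inner \<eta> (weighted_deriv \<alpha> ?\<beta>' f)"
    unfolding main L2_inner_def weighted_deriv_def by (simp add: mult_ac)
  finally show "L2_inner (partial j \<eta>) (weighted_deriv \<alpha> \<beta> f) =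
      - L2_inner \<eta> (\<lambda>x. weighted_deriv \<alpha> ?\<beta>' f x + of_real (real (\<alpha> j)) * weighted_deriv ?\<alpha>' \<beta> f x)"
    unfolding L2_inner_add_right[OF test_function_L2[OF \<eta>] L1 L2_scale[OF L2']]
    by (simp only: minus_add_distrib diff_conv_add_uminus)
qed

lemma weighted_deriv_diff_AE:
  assumes "f \<in> Sigma_space k" "g \<in> Sigma_space k" "mi_order \<alpha> + mi_order \<beta> \<le> k"
  shows "AE x in lborel. weighted_deriv \<alpha> \<beta> (\<lambda>x. f x - g x) x = weighted_deriv \<alpha> \<beta> f x - weighted_deriv \<alpha> \<beta> g x"
proof -
  have b: "mi_order \<beta> \<le> k" using assms(3) by simp
  have d: "has_weak_deriv \<beta> (\<lambda>x. f x - g x) (\<lambda>x. weak_deriv \<beta> f x - weak_deriv \<beta> g x)"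
    by (rule has_weak_deriv_diff[OF Sigma_space_has_weak_deriv[OF assms(1) b] Sigma_space_has_weak_deriv[OF assms(2) b]])
  from has_weak_deriv_unique[OF has_weak_deriv_weak_deriv[OF d] d]
  show ?thesis by eventually_elim (simp add: weighted_deriv_def right_diff_distrib)
qed

lemma continuous_L2_weighted_deriv:
  assumes v: "continuous_Sigma k v" and ab: "mi_order \<alpha> + mi_order \<beta> \<le> k"
  shows "continuous_L2 (\<lambda>t. weighted_deriv \<alpha> \<beta> (v t))"
proof -
  have S: "v t \<in> Sigma_space k" for t using v by (simp add: continuous_Sigma_def)
  have L: "weighted_deriv \<alpha> \<beta> (v t) \<in> L2" for t by (rule Sigma_space_weighted_L2[OF S ab])
  have le: "L2_norm (\<lambda>x. weighted_deriv \<alpha> \<beta> (v s) x - weighted_deriv \<alpha> \<beta> (v t) x) \<le> Sigma_norm k (\<lambda>x. v s x - v t x)" for s t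
  proof -
    have b: "mi_order \<beta> \<le> k" using ab by simp
    have d: "has_weak_deriv \<beta> (\<lambda>x. v s x - v t x) (\<lambda>x. weak_deriv \<beta> (v s) x - weak_deriv \<beta> (v t) x)"
      by (rule has_weak_deriv_diff[OF Sigma_space_has_weak_deriv[OF S b] Sigma_space_has_weak_deriv[OF S b]])
    have m: "weighted_deriv \<alpha> \<beta> (\<lambda>x. v s x - v t x) \<in> borel_measurable borel"
    proof -
      have [measurable]: "weak_deriv \<beta> (\<lambda>x. v s x - v t x) \<in> borel_measurable borel"
        using has_weak_deriv_weak_deriv[OF d] by (simp add: has_weak_deriv_def locally_integrable_def)
      have [measurable]: "(\<lambda>x::real^'a. mi_power x \<alpha>) \<in> borel_measurable borel" by (rule smooth_measurable[OF smooth_mi_power])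
      show ?thesis unfolding weighted_deriv_def[abs_def] by measurable
    qed
    have "L2_norm (\<lambda>x. weighted_deriv \<alpha> \<beta> (v s) x - weighted_deriv \<alpha> \<beta> (v t) x) = L2_norm (weighted_deriv \<alpha> \<beta> (\<lambda>x. v s x - v t x))"
      by (rule L2_norm_AE_cong[symmetric, OF m L2_measurable[OF L2_diff[OF L L]] weighted_deriv_diff_AE[OF S S ab]])
    also have "\<dots> \<le> Sigma_norm k (\<lambda>x. v s x - v t x)"
      unfolding Sigma_norm_def
      using member_le_sum[of "(\<alpha>, \<beta>)" "{(\<alpha>, \<beta>). mi_order \<alpha> + mi_order \<beta> \<le> k}" "\<lambda>(\<alpha>, \<beta>). L2_norm (weighted_deriv \<alpha> \<beta> (\<lambda>x. v s x - v t x))"]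
        ab finite_mi_pairs[of k] by auto
    finally show ?thesis .
  qed
  show ?thesis
    unfolding continuous_L2_def
  proof (intro conjI allI L)
    fix t
    show "((\<lambda>s. L2_norm (\<lambda>x. weighted_deriv \<alpha> \<beta> (v s) x - weighted_deriv \<alpha> \<beta> (v t) x)) \<longlongrightarrow> 0) (at t)"
      by (rule Lim_null_comparison[where g = "\<lambda>s. Sigma_norm k (\<lambda>x. v s x - v t x)"])
        (use le v in \<open>auto simp: continuous_Sigma_def\<close>)
  qed
qed

section \<open>Exponential growth of the weighted norms\<close>

inductive weighted_comb :: "(('d::finite \<Rightarrow> nat) \<times> ('d \<Rightarrow> nat) \<Rightarrow> real \<Rightarrow> real^'d \<Rightarrow> complex) \<Rightarrow> nat \<Rightarrow>
    (real \<Rightarrow> real^'d \<Rightarrow> complex) \<Rightarrow> bool" for f k where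
  base: "mi_order (fst i) + mi_order (snd i) \<le> k \<Longrightarrow> weighted_comb f k (f i)"
| zero: "weighted_comb f k (\<lambda>t x. 0)"
| add: "weighted_comb f k g \<Longrightarrow> weighted_comb f k h \<Longrightarrow> weighted_comb f k (\<lambda>t x. g t x + h t x)"
| scale: "weighted_comb f k g \<Longrightarrow> (\<And>t. norm (c t) \<le> B) \<Longrightarrow> weighted_comb f k (\<lambda>t x. c t * g t x)"

lemma weighted_comb_sum:
  "(\<And>i. i \<in> I \<Longrightarrow> weighted_comb f k (g i)) \<Longrightarrow> weighted_comb f k (\<lambda>t x. \<Sum>i\<in>I. g i t x)"
  by (induction I rule: infinite_finite_induct) (auto intro: weighted_comb.zero weighted_comb.add)

lemma weighted_comb_mono: "weighted_comb f k g \<Longrightarrow> k \<le> m \<Longrightarrow> weighted_comb f m g"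
  by (induction rule: weighted_comb.induct) (auto intro: weighted_comb.intros)

lemma weighted_comb_const: "weighted_comb f k g \<Longrightarrow> weighted_comb f k (\<lambda>t x. c * g t x)"
  by (rule weighted_comb.scale[where B = "norm c"]) auto

definition mi_pairs :: "nat \<Rightarrow> (('d::finite \<Rightarrow> nat) \<times> ('d \<Rightarrow> nat)) set" where
  "mi_pairs k = {i. mi_order (fst i) + mi_order (snd i) \<le> k}"

lemma finite_mi_pairs': "finite (mi_pairs k)"
  using finite_mi_pairs[of k] by (simp add: mi_pairs_def case_prod_beta')

lemma integral_Gronwall:
  fixes y :: "real \<Rightarrow> real"
  assumes c: "continuous_on UNIV y" and C: "C > 0"
    and le: "\<And>s. 0 \<le> s \<Longrightarrow> s \<le> t \<Longrightarrow> y s \<le> a + C * integral {0..s} y" and t: "0 \<le> t"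
  shows "y t \<le> a * exp (C * t)"
proof -
  define z where "z s = (a + C * integral {0..s} y) * exp (- C * s)" for s
  have d: "((\<lambda>s. integral {0..s} y) has_real_derivative y s) (at s within {0..t})" if "s \<in> {0..t}" for s
    by (rule integral_has_real_derivative) (use that c in \<open>auto intro: continuous_on_subset\<close>)
  have dz: "(z has_real_derivative (C * y s * exp (- C * s) + (a + C * integral {0..s} y) * (- C * exp (- C * s)))) (at s within {0..t})"
    if "s \<in> {0..t}" for s
    unfolding z_def[abs_def]
    by (rule derivative_eq_intros d[OF that] refl)+ (simp add: algebra_simps)
  have "z t \<le> z 0"
  proof (cases "t = 0")
    case False
    have "continuous_on {0..t} z"
      using dz by (intro DERIV_continuous_on[where D = "\<lambda>s. C * y s * exp (- C * s) + (a + C * integral {0..s} y) * (- C * exp (- C * s))"]) auto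
    then obtain l s where s: "0 < s" "s < t" "(z has_real_derivative l) (at s)" "z t - z 0 = (t - 0) * l"
      using MVT[of 0 t z] t False dz
      by (metis (no_types, lifting) at_within_Icc_at atLeastAtMost_iff less_eq_real_def order_le_less real_differentiable_def)
    have "at s within {0..t} = at s" using s by (intro at_within_Icc_at) auto
    then have "l = C * y s * exp (- C * s) + (a + C * integral {0..s} y) * (- C * exp (- C * s))"
      using DERIV_unique[OF s(3)] dz[of s] s(1,2) by simp
    also have "\<dots> = C * exp (- C * s) * (y s - (a + C * integral {0..s} y))" by (simp add: algebra_simps)
    also have "\<dots> \<le> 0" using le[of s] s(1,2) C by (intro mult_nonneg_nonpos) auto
    finally show ?thesis using s(4) t mult_nonneg_nonpos[of t l] by simp
  qed simp
  then have "(a + C * integral {0..t} y) * exp (- C * t) \<le> a" by (simp add: z_def)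
  then have "(a + C * integral {0..t} y) * exp (- C * t) * exp (C * t) \<le> a * exp (C * t)"
    by (rule mult_right_mono) simp
  then have "a + C * integral {0..t} y \<le> a * exp (C * t)" by (simp add: mult.assoc flip: exp_add)
  then show ?thesis using le[of t] t by simp
qed

lemma smooth_quadratic:
  fixes Q :: "real^'d::finite^'d"
  shows "smooth (\<lambda>y. (y \<bullet> (Q *v y)) / 2)"
proof -
  have "smooth (\<lambda>y::real^'d. (1 / 2) * (y \<bullet> (Q *v y)))"
    by (intro smooth_mult smooth_inner smooth_const smooth_id smooth_linear matrix_vector_mul_bounded_linear)
  then show ?thesis by simp
qed

lemma partial_quadratic:
  fixes Q :: "real^'d::finite^'d"
  assumes sym: "\<And>i j. Q $ i $ j = Q $ j $ i"
  shows "partial j (\<lambda>y. (y \<bullet> (Q *v y)) / 2) x = (\<Sum>l\<in>UNIV. Q $ j $ l * x $ l)"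
proof -
  have "((\<lambda>y. (y \<bullet> (Q *v y)) / 2) has_derivative (\<lambda>h. (x \<bullet> (Q *v h) + h \<bullet> (Q *v x)) / 2)) (at x)"
    by (auto intro!: derivative_eq_intros bounded_linear.has_derivative[OF matrix_vector_mul_bounded_linear])
  from dir_deriv_eq[OF this, of "axis j 1"]
  have "partial j (\<lambda>y. (y \<bullet> (Q *v y)) / 2) x = (x \<bullet> (Q *v axis j 1) + axis j 1 \<bullet> (Q *v x)) / 2" by (simp add: partial_def)
  also have "axis j 1 \<bullet> (Q *v x) = (\<Sum>l\<in>UNIV. Q $ j $ l * x $ l)"
    by (simp add: inner_axis' matrix_vector_mult_def)
  also have "x \<bullet> (Q *v axis j 1) = (\<Sum>l\<in>UNIV. Q $ j $ l * x $ l)"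
    using sym by (simp add: matrix_vector_mult_basis column_def inner_vec_def mult.commute)
  finally show ?thesis by simp
qed

lemma quadratic_lipschitz:
  fixes Q :: "real^'d::finite^'d"
  assumes Q: "\<And>i j. \<bar>Q $ i $ j\<bar> \<le> B"
  shows "\<bar>(y \<bullet> (Q *v y)) / 2 - (z \<bullet> (Q *v z)) / 2\<bar> \<le> (real CARD('d) * real CARD('d) * B) * norm (y - z) * (norm y + norm z)"
proof -
  let ?U = "\<lambda>y. (y \<bullet> (Q *v y)) / 2"
  have B0: "0 \<le> B" using Q order_trans[OF abs_ge_zero] by blast
  have Qn: "norm (Q *v x) \<le> (real CARD('d) * real CARD('d) * B) * norm x" for x
  proof -
    have "norm (Q *v x) \<le> (\<Sum>i\<in>UNIV. \<bar>(Q *v x) $ i\<bar>)" by (rule norm_le_l1_cart)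
    also have "\<dots> \<le> (\<Sum>i\<in>(UNIV::'d set). \<Sum>l\<in>(UNIV::'d set). B * norm x)"
    proof (rule sum_mono)
      fix i
      have "\<bar>(Q *v x) $ i\<bar> \<le> (\<Sum>l\<in>UNIV. \<bar>Q $ i $ l * x $ l\<bar>)"
        unfolding matrix_vector_mult_def by (simp add: sum_abs)
      also have "\<dots> \<le> (\<Sum>l\<in>(UNIV::'d set). B * norm x)"
        unfolding abs_mult by (intro sum_mono mult_mono Q component_le_norm_cart) (use B0 in auto)
      finally show "\<bar>(Q *v x) $ i\<bar> \<le> (\<Sum>l\<in>(UNIV::'d set). B * norm x)" .
    qed
    also have "\<dots> = (real CARD('d) * real CARD('d) * B) * norm x" by simp
    finally show ?thesis .
  qed
  let ?M = "real CARD('d) * real CARD('d) * B"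
  have "2 * (?U y - ?U z) = (y - z) \<bullet> (Q *v y) + z \<bullet> (Q *v (y - z))"
    by (simp add: matrix_vector_mult_diff_distrib inner_diff_left inner_diff_right)
  then have "2 * \<bar>?U y - ?U z\<bar> \<le> \<bar>(y - z) \<bullet> (Q *v y)\<bar> + \<bar>z \<bullet> (Q *v (y - z))\<bar>" by linarith
  also have "\<dots> \<le> norm (y - z) * (?M * norm y) + norm z * (?M * norm (y - z))"
    by (intro add_mono order_trans[OF Cauchy_Schwarz_ineq2] mult_left_mono Qn) auto
  also have "\<dots> = ?M * norm (y - z) * (norm y + norm z)" by (simp add: algebra_simps)
  finally have "2 * \<bar>?U y - ?U z\<bar> \<le> ?M * norm (y - z) * (norm y + norm z)" .
  moreover have "a \<le> b" if "2 * a \<le> b" "0 \<le> a" for a b :: real using that by linarith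
  ultimately show ?thesis using abs_ge_zero by blast
qed

context
  fixes v :: "real \<Rightarrow> real^'d::finite \<Rightarrow> complex" and k :: nat
  assumes v: "continuous_Sigma k v"
begin

abbreviation wd where "wd i t \<equiv> weighted_deriv (fst i) (snd i) (v t)"

lemma wd_Sigma: "v t \<in> Sigma_space k"
  using v by (simp add: continuous_Sigma_def)

lemma weighted_comb_position:
  assumes "weighted_comb wd m g" "m < k"
  shows "weighted_comb wd (Suc m) (\<lambda>t x. of_real (x $ j) * g t x)"
  using assms(1)
proof induction
  case (base i)
  have "(\<lambda>t x. of_real (x $ j) * wd i t x) = wd ((fst i)(j := Suc (fst i j)), snd i)"
    by (simp add: weighted_deriv_position)
  moreover have "weighted_comb wd (Suc m) (wd ((fst i)(j := Suc (fst i j)), snd i))"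
    by (rule weighted_comb.base) (use base in \<open>simp add: mi_order_Suc\<close>)
  ultimately show ?case by (simp only:)
next
  case zero
  show ?case using weighted_comb.zero by simp
next
  case (add g h)
  show ?case using weighted_comb.add[OF add.IH] by (simp add: distrib_left)
next
  case (scale g c B)
  show ?case using weighted_comb.scale[OF scale.IH scale.hyps(2)] by (simp add: mult.left_commute)
qed

lemma weak_partial_zero: "weak_partial j (\<lambda>x. 0) (\<lambda>x. 0)"
  by (simp add: weak_partial_def L2_inner_def)

lemma weak_partial_add:
  assumes "weak_partial j f f'" "weak_partial j g g'"
  shows "weak_partial j (\<lambda>x. f x + g x) (\<lambda>x. f' x + g' x)"
  using assms unfolding weak_partial_def
  by (auto intro!: L2_add simp: L2_inner_add_right test_function_L2 test_function_partial)

lemma weak_partial_scale: "weak_partial j f f' \<Longrightarrow> weak_partial j (\<lambda>x. c * f x) (\<lambda>x. c * f' x)"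
  unfolding weak_partial_def by (auto intro: L2_scale simp: L2_inner_scale_right)

lemma weighted_comb_partial:
  assumes "weighted_comb wd m g" "m < k"
  shows "\<exists>w. weighted_comb wd (Suc m) w \<and> (\<forall>t. weak_partial j (g t) (w t))"
  using assms(1)
proof induction
  case (base i)
  let ?\<alpha> = "fst i" and ?\<beta> = "snd i"
  let ?w = "\<lambda>t x. wd (?\<alpha>, ?\<beta>(j := Suc (?\<beta> j))) t x + of_real (real (?\<alpha> j)) * wd (?\<alpha>(j := ?\<alpha> j - 1), ?\<beta>) t x"
  have le: "mi_order (?\<alpha>(j := ?\<alpha> j - 1)) \<le> mi_order ?\<alpha>" unfolding mi_order_def by (intro sum_mono) auto
  have "weighted_comb wd (Suc m) ?w"
  proof (rule weighted_comb.add[OF weighted_comb.base weighted_comb_const[OF weighted_comb.base]])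
    show "mi_order (fst (?\<alpha>, ?\<beta>(j := Suc (?\<beta> j)))) + mi_order (snd (?\<alpha>, ?\<beta>(j := Suc (?\<beta> j)))) \<le> Suc m"
      using base by (simp only: fst_conv snd_conv mi_order_Suc)
    show "mi_order (fst (?\<alpha>(j := ?\<alpha> j - 1), ?\<beta>)) + mi_order (snd (?\<alpha>(j := ?\<alpha> j - 1), ?\<beta>)) \<le> Suc m"
      unfolding fst_conv snd_conv using base le by linarith
  qed
  moreover have "weak_partial j (wd i t) (?w t)" for t
    using weighted_deriv_partial[OF wd_Sigma, of ?\<alpha> ?\<beta> j t] base assms(2) by simp
  ultimately show ?case by blast
next
  case zero
  show ?case using weighted_comb.zero weak_partial_zero by blast
next
  case (add g h)
  then obtain g' h' where "weighted_comb wd (Suc m) g'" "\<And>t. weak_partial j (g t) (g' t)"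
    "weighted_comb wd (Suc m) h'" "\<And>t. weak_partial j (h t) (h' t)" by blast
  then show ?case
    by (intro exI[of _ "\<lambda>t x. g' t x + h' t x"]) (auto intro: weighted_comb.add weak_partial_add)
next
  case (scale g c B)
  then obtain g' where "weighted_comb wd (Suc m) g'" "\<And>t. weak_partial j (g t) (g' t)" by blast
  then show ?case
    using scale.hyps(2) by (intro exI[of _ "\<lambda>t x. c t * g' t x"]) (auto intro: weighted_comb.scale weak_partial_scale)
qed

lemma wd_L2: "i \<in> mi_pairs k \<Longrightarrow> wd i t \<in> L2"
  by (rule Sigma_space_weighted_L2[OF wd_Sigma]) (simp add: mi_pairs_def)

definition wd_norm :: "real \<Rightarrow> real" where
  "wd_norm t = (\<Sum>i\<in>mi_pairs k. L2_norm (wd i t))"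

lemma wd_le_norm: "i \<in> mi_pairs k \<Longrightarrow> L2_norm (wd i t) \<le> wd_norm t"
  unfolding wd_norm_def by (rule member_le_sum[OF _ _ finite_mi_pairs']) simp_all

lemma wd_norm_nonneg: "0 \<le> wd_norm t"
  unfolding wd_norm_def by (intro sum_nonneg) simp

lemma wd_norm_continuous: "continuous_on UNIV wd_norm"
  unfolding wd_norm_def[abs_def]
  by (intro continuous_on_sum continuous_L2_norm continuous_L2_weighted_deriv[OF v]) (simp add: mi_pairs_def)

lemma weighted_comb_bound:
  assumes "weighted_comb wd m g" "m \<le> k"
  shows "\<exists>B\<ge>0. \<forall>t. g t \<in> L2 \<and> L2_norm (g t) \<le> B * wd_norm t"
  using assms(1)
proof induction
  case (base i)
  then have "i \<in> mi_pairs k" using assms(2) by (simp add: mi_pairs_def)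
  then show ?case using wd_L2 wd_le_norm by (intro exI[of _ 1]) auto
next
  case zero
  show ?case by (intro exI[of _ 0]) auto
next
  case (add g h)
  then obtain B B' where "B \<ge> 0" "\<And>t. g t \<in> L2 \<and> L2_norm (g t) \<le> B * wd_norm t"
    "B' \<ge> 0" "\<And>t. h t \<in> L2 \<and> L2_norm (h t) \<le> B' * wd_norm t" by blast
  then show ?case
    by (intro exI[of _ "B + B'"])
      (auto intro: L2_add order_trans[OF L2_norm_triangle] simp: distrib_right add_mono)
next
  case (scale g c B)
  then obtain B' where B': "B' \<ge> 0" "\<And>t. g t \<in> L2 \<and> L2_norm (g t) \<le> B' * wd_norm t" by blast
  have "L2_norm (\<lambda>x. c t * g t x) \<le> B * (B' * wd_norm t)" for t
    unfolding L2_norm_scale using scale.hyps(2)[of t] B' order_trans[OF norm_ge_zero scale.hyps(2)[of t]]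
    by (intro mult_mono) auto
  moreover have "B \<ge> 0" using order_trans[OF norm_ge_zero scale.hyps(2)[of 0]] .
  ultimately show ?case using B' by (intro exI[of _ "B * B'"]) (auto intro: L2_scale simp: mult.assoc)
qed

lemma weighted_comb_L2: "weighted_comb wd m g \<Longrightarrow> m \<le> k \<Longrightarrow> g t \<in> L2"
  using weighted_comb_bound by blast

context
  fixes W :: "real^'d \<Rightarrow> real^'d" and Q :: "real \<Rightarrow> real^'d^'d" and B :: real
  assumes W: "skew W" and sym: "\<And>t i j. Q t $ i $ j = Q t $ j $ i" and Q: "\<And>t i j. \<bar>Q t $ i $ j\<bar> \<le> B"
    and sol: "weak_solution W (\<lambda>t y. (y \<bullet> (Q t *v y)) / 2) v (\<lambda>t x. 0)"
begin

abbreviation U where "U t y \<equiv> (y \<bullet> (Q t *v y)) / 2"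

lemma wd_weak_solution:
  assumes "i \<in> mi_pairs m" "m \<le> k"
  shows "\<exists>g. weighted_comb wd m g \<and> weak_solution W U (wd i) g"
  using assms
proof (induction m arbitrary: i)
  case 0
  then have z: "mi_order (fst i) = 0" "mi_order (snd i) = 0" by (auto simp: mi_pairs_def)
  have fi: "fst i = (\<lambda>j. 0)" "snd i = (\<lambda>j. 0)" using z by (auto simp: mi_order_def)
  have eq: "L2_inner \<eta> (wd i t) = L2_inner \<eta> (v t)" if "test_function \<eta>" for \<eta> t
    unfolding fi weighted_deriv_zero
    by (rule L2_inner_AE_cong_right[OF test_function_measurable[OF that] _ _ weak_deriv_zero_AE[OF wd_Sigma]])
      (use wd_Sigma[of t] Sigma_space_weak_deriv_L2[OF wd_Sigma, of "\<lambda>j. 0" t] in \<open>auto simp: Sigma_space_def L2_measurable\<close>)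
  have "linear W" using W by (simp add: skew_def)
  then have "weak_solution W U (wd i) (\<lambda>t x. 0)"
    using sol unfolding weak_solution_def by (simp add: eq test_function_ham smooth_quadratic)
  then show ?case using weighted_comb.zero by blast
next
  case (Suc m)
  have m: "m < k" using Suc.prems by simp
  have lin: "linear W" using W by (simp add: skew_def)
  have L: "h t \<in> L2" if "weighted_comb wd (Suc m) h" for h t using weighted_comb_L2[OF that] Suc.prems by simp
  have up: "weighted_comb wd (Suc m) h" if "weighted_comb wd m h" for h by (rule weighted_comb_mono[OF that]) simp
  obtain \<alpha> \<beta> where i: "i = (\<alpha>, \<beta>)" by (cases i)
  have ord: "mi_order \<alpha> + mi_order \<beta> \<le> Suc m" using Suc.prems i by (simp add: mi_pairs_def)
  consider "mi_order \<alpha> + mi_order \<beta> \<le> m" | "mi_order \<alpha> > 0" | "mi_order \<alpha> = 0" "mi_order \<beta> > 0"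
    using ord by linarith
  then show ?case
  proof cases
    case 1
    then have "i \<in> mi_pairs m" by (simp add: i mi_pairs_def)
    then show ?thesis using Suc.IH[of i] Suc.prems up by auto
  next
    case 2
    then obtain \<alpha>' j where \<alpha>: "\<alpha> = \<alpha>'(j := Suc (\<alpha>' j))" "mi_order \<alpha> = Suc (mi_order \<alpha>')"
      by (rule mi_order_pos_decompose)
    let ?u = "wd (\<alpha>', \<beta>)"
    have mem: "(\<alpha>', \<beta>) \<in> mi_pairs m" using ord \<alpha>(2) by (simp add: mi_pairs_def)
    then obtain g where g: "weighted_comb wd m g" "weak_solution W U ?u g" using Suc.IH[of "(\<alpha>', \<beta>)"] m by auto
    have u: "weighted_comb wd m ?u" using mem by (intro weighted_comb.base) (simp add: mi_pairs_def)
    obtain w where w: "weighted_comb wd (Suc m) w" "\<And>t. weak_partial j (?u t) (w t)"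
      using weighted_comb_partial[OF u m] by blast
    note xu = weighted_comb_position[OF u m] and xg = weighted_comb_position[OF g(1) m]
    have "weak_solution W U (\<lambda>t x. of_real (x $ j) * ?u t x)
      (\<lambda>t x. (of_real (x $ j) * g t x + w t x) + \<i> * (\<Sum>l\<in>UNIV. of_real (W (axis l 1) $ j) * (of_real (x $ l) * ?u t x)))"
      by (rule weak_solution_position[OF lin smooth_quadratic g(2) L[OF up[OF u]] L[OF up[OF g(1)]] L[OF xu] L[OF xg] w(2)])
    moreover have "(\<lambda>t x. of_real (x $ j) * ?u t x) = wd i"
      unfolding i \<alpha>(1) by (simp add: weighted_deriv_position)
    moreover have "weighted_comb wd (Suc m)
      (\<lambda>t x. (of_real (x $ j) * g t x + w t x) + \<i> * (\<Sum>l\<in>UNIV. of_real (W (axis l 1) $ j) * (of_real (x $ l) * ?u t x)))"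
      by (intro weighted_comb.add weighted_comb_const weighted_comb_sum xu xg w(1))
    ultimately show ?thesis by auto
  next
    case 3
    obtain \<beta>' j where \<beta>: "\<beta> = \<beta>'(j := Suc (\<beta>' j))" "mi_order \<beta> = Suc (mi_order \<beta>')"
      using 3(2) by (rule mi_order_pos_decompose)
    have \<alpha>: "\<alpha> = (\<lambda>j. 0)" using 3(1) by (auto simp: mi_order_def)
    let ?u = "wd (\<alpha>, \<beta>')"
    have mem: "(\<alpha>, \<beta>') \<in> mi_pairs m" using ord \<beta>(2) by (simp add: mi_pairs_def)
    then obtain g where g: "weighted_comb wd m g" "weak_solution W U ?u g" using Suc.IH[of "(\<alpha>, \<beta>')"] m by auto
    have u: "weighted_comb wd m ?u" using mem by (intro weighted_comb.base) (simp add: mi_pairs_def)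
    define w where "w l = wd (\<alpha>, \<beta>'(l := Suc (\<beta>' l)))" for l
    have w: "weighted_comb wd (Suc m) (w l)" for l
      unfolding w_def by (rule weighted_comb.base) (use mem in \<open>simp add: mi_order_Suc mi_pairs_def\<close>)
    have wp: "weak_partial l (?u t) (w l t)" for t l
    proof -
      have "mi_order \<alpha> + mi_order \<beta>' < k" using mem m by (simp add: mi_pairs_def)
      from weighted_deriv_partial[OF wd_Sigma this, of l t] show ?thesis by (simp add: w_def \<alpha>)
    qed
    obtain h where h: "weighted_comb wd (Suc m) h" "\<And>t. weak_partial j (g t) (h t)"
      using weighted_comb_partial[OF g(1) m] by blast
    note xu = weighted_comb_position[OF u m]
    have eq: "wd i = w j" by (simp only: w_def i \<beta>(1))
    have "weak_solution W U (w j)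
      (\<lambda>t x. (h t x + (\<Sum>l\<in>UNIV. of_real (Q t $ j $ l) * (of_real (x $ l) * ?u t x))) + (- \<i>) * (\<Sum>l\<in>UNIV. of_real (W (axis j 1) $ l) * w l t x))"
      by (rule weak_solution_derivative[OF lin smooth_quadratic g(2) partial_quadratic[OF sym] L[OF up[OF u]] L[OF xu] wp h(2)])
    moreover have "weighted_comb wd (Suc m)
      (\<lambda>t x. (h t x + (\<Sum>l\<in>UNIV. of_real (Q t $ j $ l) * (of_real (x $ l) * ?u t x))) + (- \<i>) * (\<Sum>l\<in>UNIV. of_real (W (axis j 1) $ l) * w l t x))"
    proof (intro weighted_comb.add weighted_comb_const weighted_comb_sum w h(1))
      fix l
      show "weighted_comb wd (Suc m) (\<lambda>t x. of_real (Q t $ j $ l) * (of_real (x $ l) * ?u t x))"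
        by (rule weighted_comb.scale[OF xu, where B = B]) (simp add: Q)
    qed
    ultimately show ?thesis unfolding eq by blast
  qed
qed

lemma wd_norm_growth: "\<exists>C>0. \<exists>K>0. \<forall>t\<ge>0. wd_norm t \<le> K * exp (C * t)"
proof -
  have B0: "0 \<le> B" using Q order_trans[OF abs_ge_zero] by blast
  define E where "E t = (\<Sum>i\<in>mi_pairs k. (L2_norm (wd i t))\<^sup>2)" for t
  define n where "n = real (card (mi_pairs k :: (('d \<Rightarrow> nat) \<times> ('d \<Rightarrow> nat)) set))"
  have "\<exists>b. b \<ge> 0 \<and> (\<forall>t\<ge>0. (L2_norm (wd i t))\<^sup>2 \<le> (L2_norm (wd i 0))\<^sup>2 + integral {0..t} (\<lambda>s. 2 * L2_norm (wd i s) * (b * wd_norm s)))"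
    if i: "i \<in> mi_pairs k" for i
  proof -
    obtain g where g: "weighted_comb wd k g" "weak_solution W U (wd i) g" using wd_weak_solution[OF i] by blast
    obtain b where b: "b \<ge> 0" "\<And>t. g t \<in> L2 \<and> L2_norm (g t) \<le> b * wd_norm t" using weighted_comb_bound[OF g(1)] by blast
    have ci: "continuous_L2 (wd i)"
      by (rule continuous_L2_weighted_deriv[OF v]) (use i in \<open>simp add: mi_pairs_def\<close>)
    have "(L2_norm (wd i t))\<^sup>2 \<le> (L2_norm (wd i 0))\<^sup>2 + integral {0..t} (\<lambda>s. 2 * L2_norm (wd i s) * (b * wd_norm s))" if "0 \<le> t" for t
      by (rule energy_estimate[OF W _ quadratic_lipschitz[OF Q] _ ci g(2) _ _ _ that])
        (use b B0 wd_norm_continuous in \<open>auto intro!: continuous_intros\<close>)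
    then show ?thesis using b(1) by blast
  qed
  then have "\<forall>i\<in>mi_pairs k. \<exists>b. b \<ge> 0 \<and> (\<forall>t\<ge>0. (L2_norm (wd i t))\<^sup>2 \<le> (L2_norm (wd i 0))\<^sup>2 + integral {0..t} (\<lambda>s. 2 * L2_norm (wd i s) * (b * wd_norm s)))"
    by blast
  from bchoice[OF this] obtain b where b: "\<And>i. i \<in> mi_pairs k \<Longrightarrow> b i \<ge> 0"
    "\<And>i t. i \<in> mi_pairs k \<Longrightarrow> 0 \<le> t \<Longrightarrow> (L2_norm (wd i t))\<^sup>2 \<le> (L2_norm (wd i 0))\<^sup>2 + integral {0..t} (\<lambda>s. 2 * L2_norm (wd i s) * (b i * wd_norm s))"
    by blast
  define C where "C = (\<Sum>i\<in>(mi_pairs k :: (('d \<Rightarrow> nat) \<times> ('d \<Rightarrow> nat)) set). 2 * b i) * n + 1"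
  have n0: "n \<ge> 0" by (simp add: n_def)
  have C0: "C > 0" unfolding C_def using b(1) n0 by (intro add_nonneg_pos mult_nonneg_nonneg sum_nonneg) auto
  have Nc: "continuous_on S wd_norm" for S using wd_norm_continuous continuous_on_subset by blast
  have Lc: "continuous_on S (\<lambda>s. L2_norm (wd i s))" if "i \<in> mi_pairs k" for i S
  proof -
    have "continuous_on UNIV (\<lambda>s. L2_norm (wd i s))"
      by (intro continuous_L2_norm continuous_L2_weighted_deriv[OF v]) (use that in \<open>simp add: mi_pairs_def\<close>)
    then show ?thesis using continuous_on_subset by blast
  qed
  have Ec: "continuous_on S E" for S unfolding E_def[abs_def] by (intro continuous_intros Lc)
  have NE: "(wd_norm t)\<^sup>2 \<le> n * E t" for t
  proof -
    have "(\<Sum>i\<in>mi_pairs k. 1 * L2_norm (wd i t))\<^sup>2 \<le> (\<Sum>i\<in>(mi_pairs k :: (('d \<Rightarrow> nat) \<times> ('d \<Rightarrow> nat)) set). 1\<^sup>2) * (\<Sum>i\<in>mi_pairs k. (L2_norm (wd i t))\<^sup>2)"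
      by (rule Cauchy_Schwarz_ineq_sum)
    then show ?thesis by (simp add: wd_norm_def E_def n_def)
  qed
  have main: "E t \<le> E 0 + C * integral {0..t} E" if t: "0 \<le> t" for t
  proof -
    have "E t \<le> (\<Sum>i\<in>mi_pairs k. (L2_norm (wd i 0))\<^sup>2 + integral {0..t} (\<lambda>s. 2 * L2_norm (wd i s) * (b i * wd_norm s)))"
      unfolding E_def by (intro sum_mono b(2) t)
    also have "\<dots> = E 0 + (\<Sum>i\<in>mi_pairs k. integral {0..t} (\<lambda>s. 2 * L2_norm (wd i s) * (b i * wd_norm s)))"
      by (simp add: sum.distrib E_def)
    also have "(\<Sum>i\<in>mi_pairs k. integral {0..t} (\<lambda>s. 2 * L2_norm (wd i s) * (b i * wd_norm s))) \<le>
        (\<Sum>i\<in>(mi_pairs k :: (('d \<Rightarrow> nat) \<times> ('d \<Rightarrow> nat)) set). integral {0..t} (\<lambda>s. 2 * b i * n * E s))"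
    proof (intro sum_mono integral_le)
      fix i :: "('d \<Rightarrow> nat) \<times> ('d \<Rightarrow> nat)" and s assume i: "i \<in> mi_pairs k"
      show "(\<lambda>s. 2 * L2_norm (wd i s) * (b i * wd_norm s)) integrable_on {0..t}"
        by (intro integrable_continuous_real continuous_intros Lc Nc i)
      show "(\<lambda>s. 2 * b i * n * E s) integrable_on {0..t}"
        by (intro integrable_continuous_real continuous_intros Ec)
      have "2 * L2_norm (wd i s) * (b i * wd_norm s) = 2 * b i * (L2_norm (wd i s) * wd_norm s)" by simp
      also have "\<dots> \<le> 2 * b i * (wd_norm s * wd_norm s)"
        using b(1)[OF i] wd_le_norm[OF i] wd_norm_nonneg by (intro mult_left_mono mult_right_mono) auto
      also have "\<dots> \<le> 2 * b i * (n * E s)"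
        using NE[of s] b(1)[OF i] by (intro mult_left_mono) (auto simp: power2_eq_square)
      finally show "2 * L2_norm (wd i s) * (b i * wd_norm s) \<le> 2 * b i * n * E s" by (simp only: mult.assoc)
    qed
    also have "\<dots> = (C - 1) * integral {0..t} E"
      unfolding C_def by (simp add: sum_distrib_right)
    also have "\<dots> \<le> C * integral {0..t} E"
      by (intro mult_right_mono integral_nonneg integrable_continuous_real Ec) (auto simp: E_def sum_nonneg)
    finally show ?thesis by simp
  qed
  have E0: "E 0 \<ge> 0" by (simp add: E_def sum_nonneg)
  have "wd_norm t \<le> sqrt (n * E 0 + 1) * exp (C / 2 * t)" if t: "0 \<le> t" for t
  proof (rule power2_le_imp_le)
    have "(wd_norm t)\<^sup>2 \<le> n * E t" by (rule NE)
    also have "\<dots> \<le> n * (E 0 * exp (C * t))"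
      by (intro mult_left_mono integral_Gronwall[OF Ec C0] main t n0)
    also have "\<dots> \<le> (n * E 0 + 1) * exp (C * t)" by (simp add: distrib_right)
    also have "\<dots> = (sqrt (n * E 0 + 1) * exp (C / 2 * t))\<^sup>2"
      using n0 E0 by (simp add: power_mult_distrib exp_double[symmetric])
    finally show "(wd_norm t)\<^sup>2 \<le> (sqrt (n * E 0 + 1) * exp (C / 2 * t))\<^sup>2" .
  qed (use n0 E0 in simp)
  moreover have "sqrt (n * E 0 + 1) > 0" using n0 E0 by (simp add: add_nonneg_pos)
  ultimately show ?thesis using C0 by (intro exI[of _ "C / 2"] conjI exI[of _ "sqrt (n * E 0 + 1)"]) auto
qed

end

end

section \<open>The moving frame\<close>

lemma L2_inner_moving_derivative:
  fixes f f' \<psi> :: "real \<Rightarrow> real^'d::finite \<Rightarrow> complex"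
  assumes \<psi>: "continuous_L2 \<psi>" and f: "\<And>s. f s \<in> L2" and f': "f' t \<in> L2"
    and d: "\<And>s y. \<bar>s - t\<bar> < 1 \<Longrightarrow> ((\<lambda>s. f s y) has_vector_derivative f' s y) (at s)"
    and b: "\<And>s y. \<bar>s - t\<bar> < 1 \<Longrightarrow> norm (f' s y) \<le> N"
    and supp: "\<And>s y. \<bar>s - t\<bar> < 1 \<Longrightarrow> norm y > R \<Longrightarrow> f s y = 0 \<and> f' s y = 0"
    and D: "((\<lambda>s. L2_inner (f t) (\<psi> s)) has_vector_derivative D) (at t)"
  shows "((\<lambda>s. L2_inner (f s) (\<psi> s)) has_vector_derivative (L2_inner (f' t) (\<psi> t) + D)) (at t)"
proof -
  have \<psi>L2: "\<psi> s \<in> L2" for s using \<psi> by (simp add: continuous_L2_def)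
  have derivative_iff: "(F has_vector_derivative E) (at t) \<longleftrightarrow> ((\<lambda>h. (F (t + h) - F t) / of_real h) \<longlongrightarrow> E) (at 0)"
    for F :: "real \<Rightarrow> complex" and E
  proof -
    have q: "(F (t + h) - F t) / of_real h - E = (F (t + h) - F t - h *\<^sub>R E) / of_real h" if "h \<noteq> 0" for h
      using that by (simp add: diff_divide_distrib scaleR_conv_of_real)
    have "(F has_vector_derivative E) (at t) \<longleftrightarrow> ((\<lambda>h. norm (F (t + h) - F t - h *\<^sub>R E) / norm h) \<longlongrightarrow> 0) (at 0)"
      by (simp add: has_vector_derivative_def has_derivative_at bounded_linear_scaleR_left)
    also have "\<dots> \<longleftrightarrow> ((\<lambda>h. norm ((F (t + h) - F t) / of_real h - E)) \<longlongrightarrow> 0) (at 0)"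
      by (rule filterlim_cong) (auto simp: q norm_divide eventually_at_filter intro!: always_eventually)
    also have "\<dots> \<longleftrightarrow> ((\<lambda>h. (F (t + h) - F t) / of_real h) \<longlongrightarrow> E) (at 0)"
      by (simp add: tendsto_norm_zero_iff flip: LIM_zero_iff[of _ E])
    finally show ?thesis .
  qed
  let ?D = "\<lambda>h y. (f (t + h) y - f t y) / of_real h"
  have DL2: "?D h \<in> L2" for h
    using L2_scale[OF L2_diff[OF f[of "t + h"] f[of t]], of "inverse (of_real h)"] by (simp add: field_simps)
  have lim: "((\<lambda>h. L2_norm (\<lambda>y. ?D h y - f' t y)) \<longlongrightarrow> 0) (at 0)"
    by (rule L2_diff_quotient[OF _ _ d b supp]) (use f f' L2_measurable in auto)
  have lim\<psi>: "((\<lambda>h. L2_norm (\<lambda>y. \<psi> (t + h) y - \<psi> t y)) \<longlongrightarrow> 0) (at 0)"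
    using \<psi> unfolding continuous_L2_def by (simp add: LIM_offset_zero_iff)
  have 1: "((\<lambda>h. L2_inner (?D h) (\<psi> (t + h))) \<longlongrightarrow> L2_inner (f' t) (\<psi> t)) (at 0)"
    by (rule L2_inner_tendsto[OF DL2 \<psi>L2 f' \<psi>L2 lim lim\<psi>])
  have 2: "((\<lambda>h. (L2_inner (f t) (\<psi> (t + h)) - L2_inner (f t) (\<psi> t)) / of_real h) \<longlongrightarrow> D) (at 0)"
    using D unfolding derivative_iff .
  have "L2_inner (?D h) (\<psi> (t + h)) + (L2_inner (f t) (\<psi> (t + h)) - L2_inner (f t) (\<psi> t)) / of_real h =
     (L2_inner (f (t + h)) (\<psi> (t + h)) - L2_inner (f t) (\<psi> t)) / of_real h" for h
  proof -
    have D: "?D h = (\<lambda>y. inverse (of_real h) * (f (t + h) y - f t y))" by (simp add: divide_inverse mult.commute)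
    have "L2_inner (?D h) (\<psi> (t + h)) = inverse (of_real h) * (L2_inner (f (t + h)) (\<psi> (t + h)) - L2_inner (f t) (\<psi> (t + h)))"
      unfolding D L2_inner_scale_left L2_inner_diff_left[OF \<psi>L2 f f] by simp
    then show ?thesis by (simp add: divide_inverse algebra_simps)
  qed
  then show ?thesis using tendsto_add[OF 1 2] unfolding derivative_iff by simp
qed

context
  fixes \<epsilon> :: real and q p :: "real \<Rightarrow> real^'d::finite" and S :: "real \<Rightarrow> real"
  assumes \<epsilon>: "0 < \<epsilon>"
begin

definition phase :: "real \<Rightarrow> real^'d \<Rightarrow> complex" where
  "phase t x = exp (\<i> * of_real ((S t + p t \<bullet> (x - q t)) / \<epsilon>))"

definition to_frame :: "real \<Rightarrow> (real^'d \<Rightarrow> complex) \<Rightarrow> real^'d \<Rightarrow> complex" where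
  "to_frame t f y = of_real (\<epsilon> powr (real CARD('d) / 4)) * f (q t + sqrt \<epsilon> *\<^sub>R y) * cnj (phase t (q t + sqrt \<epsilon> *\<^sub>R y))"

definition from_frame :: "real \<Rightarrow> (real^'d \<Rightarrow> complex) \<Rightarrow> real^'d \<Rightarrow> complex" where
  "from_frame t \<eta> x = of_real (\<epsilon> powr (- real CARD('d) / 4)) * \<eta> ((x - q t) /\<^sub>R sqrt \<epsilon>) * phase t x"

lemma norm_phase [simp]: "norm (phase t x) = 1"
  by (simp add: phase_def)

lemma phase_cnj: "phase t x * cnj (phase t x) = 1" "cnj (phase t x) * phase t x = 1"
  using complex_norm_square[of "phase t x"] by (simp_all add: mult.commute)

lemma sqrt_eps: "sqrt \<epsilon> > 0" "sqrt \<epsilon> * sqrt \<epsilon> = \<epsilon>"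
  using \<epsilon> by auto

lemma powr_eps: "\<epsilon> powr (- real CARD('d) / 4) * \<epsilon> powr (real CARD('d) / 4) = 1"
  "sqrt \<epsilon> ^ CARD('d) * \<epsilon> powr (- real CARD('d) / 4) = \<epsilon> powr (real CARD('d) / 4)"
proof -
  show "\<epsilon> powr (- real CARD('d) / 4) * \<epsilon> powr (real CARD('d) / 4) = 1"
    using \<epsilon> by (simp add: powr_add[symmetric])
  have "sqrt \<epsilon> ^ CARD('d) = \<epsilon> powr (real CARD('d) / 2)"
    using \<epsilon> by (simp add: powr_half_sqrt[symmetric] powr_powr powr_realpow[symmetric])
  then show "sqrt \<epsilon> ^ CARD('d) * \<epsilon> powr (- real CARD('d) / 4) = \<epsilon> powr (real CARD('d) / 4)"
    by (simp add: powr_add[symmetric])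
qed

lemma phase_measurable [measurable]: "phase t \<in> borel_measurable borel"
  unfolding phase_def[abs_def] by (intro borel_measurable_continuous_onI continuous_intros) (use \<epsilon> in auto)

lemma to_frame_measurable: "f \<in> borel_measurable borel \<Longrightarrow> to_frame t f \<in> borel_measurable borel"
proof -
  assume [measurable]: "f \<in> borel_measurable borel"
  show ?thesis unfolding to_frame_def[abs_def] by measurable
qed

lemma from_frame_measurable: "\<eta> \<in> borel_measurable borel \<Longrightarrow> from_frame t \<eta> \<in> borel_measurable borel"
proof -
  assume [measurable]: "\<eta> \<in> borel_measurable borel"
  show ?thesis unfolding from_frame_def[abs_def] by measurable
qed

lemma to_frame_from_frame: "to_frame t (from_frame t \<eta>) = \<eta>"
proof
  fix y
  have "to_frame t (from_frame t \<eta>) y = of_real (\<epsilon> powr (- real CARD('d) / 4) * \<epsilon> powr (real CARD('d) / 4)) * \<eta> y *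
      (phase t (q t + sqrt \<epsilon> *\<^sub>R y) * cnj (phase t (q t + sqrt \<epsilon> *\<^sub>R y)))"
    using sqrt_eps(1) by (simp add: to_frame_def from_frame_def)
  then show "to_frame t (from_frame t \<eta>) y = \<eta> y" by (simp only: powr_eps phase_cnj of_real_1 mult_1 mult_1_right)
qed

lemma to_frame_diff: "to_frame t (\<lambda>x. f x - g x) = (\<lambda>y. to_frame t f y - to_frame t g y)"
  by (simp add: to_frame_def fun_eq_iff algebra_simps)

lemma norm_to_frame: "norm (to_frame t f y) = \<epsilon> powr (real CARD('d) / 4) * norm (f (q t + sqrt \<epsilon> *\<^sub>R y))"
  by (simp add: to_frame_def norm_mult)

lemma norm_to_frame_power2:
  "(norm (to_frame t f y))\<^sup>2 = sqrt \<epsilon> ^ CARD('d) * (norm (f (q t + sqrt \<epsilon> *\<^sub>R y)))\<^sup>2"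
proof -
  have "(\<epsilon> powr (real CARD('d) / 4))\<^sup>2 = sqrt \<epsilon> ^ CARD('d) * (\<epsilon> powr (- real CARD('d) / 4) * \<epsilon> powr (real CARD('d) / 4))"
    unfolding power2_eq_square by (subst powr_eps(2)[symmetric]) simp
  then show ?thesis unfolding norm_to_frame power_mult_distrib powr_eps(1) by simp
qed

lemma to_frame_L2:
  assumes f: "f \<in> L2"
  shows "to_frame t f \<in> L2" and "L2_norm (to_frame t f) = L2_norm f"
proof -
  have [measurable]: "f \<in> borel_measurable borel" using f by (rule L2_measurable)
  have i: "integrable lborel (\<lambda>y. (norm (f (q t + sqrt \<epsilon> *\<^sub>R y)))\<^sup>2)"
    using integrable_lborel_affine[OF L2_integrable_square[OF f], of "sqrt \<epsilon>" "q t"] sqrt_eps by simp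
  show "to_frame t f \<in> L2"
    by (rule L2_I[OF to_frame_measurable]) (use i in \<open>simp_all add: norm_to_frame_power2\<close>)
  have "(\<integral>x. (norm (f x))\<^sup>2 \<partial>lborel) = sqrt \<epsilon> ^ CARD('d) * (\<integral>y. (norm (f (q t + sqrt \<epsilon> *\<^sub>R y)))\<^sup>2 \<partial>lborel)"
    using integral_lborel_affine[of "\<lambda>x. (norm (f x))\<^sup>2" "sqrt \<epsilon>" "q t"] sqrt_eps \<epsilon> by simp
  then show "L2_norm (to_frame t f) = L2_norm f"
    unfolding L2_norm_def norm_to_frame_power2 by simp
qed

lemma L2_inner_to_frame:
  assumes [measurable]: "f \<in> borel_measurable borel" "\<eta> \<in> borel_measurable borel"
  shows "L2_inner \<eta> (to_frame t f) = L2_inner (from_frame t \<eta>) f"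
proof -
  have [measurable]: "from_frame t \<eta> \<in> borel_measurable borel" by (rule from_frame_measurable[OF assms(2)])
  have "(\<integral>x. cnj (from_frame t \<eta> x) * f x \<partial>lborel) =
     (sqrt \<epsilon> ^ CARD('d)) *\<^sub>R (\<integral>y. cnj (from_frame t \<eta> (q t + sqrt \<epsilon> *\<^sub>R y)) * f (q t + sqrt \<epsilon> *\<^sub>R y) \<partial>lborel)"
    using integral_lborel_affine[of "\<lambda>x. cnj (from_frame t \<eta> x) * f x" "sqrt \<epsilon>" "q t"] sqrt_eps \<epsilon> by simp
  also have "\<dots> = (\<integral>y. of_real (sqrt \<epsilon> ^ CARD('d)) * (cnj (from_frame t \<eta> (q t + sqrt \<epsilon> *\<^sub>R y)) * f (q t + sqrt \<epsilon> *\<^sub>R y)) \<partial>lborel)"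
    unfolding scaleR_conv_of_real by (rule integral_mult_right_zero[symmetric])
  also have "\<dots> = (\<integral>y. cnj (\<eta> y) * to_frame t f y \<partial>lborel)"
  proof (rule Bochner_Integration.integral_cong[OF refl])
    fix y
    have "of_real (sqrt \<epsilon> ^ CARD('d)) * (cnj (from_frame t \<eta> (q t + sqrt \<epsilon> *\<^sub>R y)) * f (q t + sqrt \<epsilon> *\<^sub>R y)) =
      of_real (sqrt \<epsilon> ^ CARD('d) * \<epsilon> powr (- real CARD('d) / 4)) * cnj (\<eta> y) * cnj (phase t (q t + sqrt \<epsilon> *\<^sub>R y)) * f (q t + sqrt \<epsilon> *\<^sub>R y)"
      using sqrt_eps(1) by (simp add: from_frame_def mult_ac)
    then show "of_real (sqrt \<epsilon> ^ CARD('d)) * (cnj (from_frame t \<eta> (q t + sqrt \<epsilon> *\<^sub>R y)) * f (q t + sqrt \<epsilon> *\<^sub>R y)) = cnj (\<eta> y) * to_frame t f y"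
      unfolding powr_eps(2) to_frame_def by (simp only: mult_ac)
  qed
  finally show ?thesis by (simp add: L2_inner_def)
qed

lemma to_frame_continuous:
  fixes c :: "real^'d \<Rightarrow> complex"
  assumes c: "continuous_on UNIV c" and M: "\<And>x. norm (c x) \<le> M" and R: "\<And>x. norm x > R \<Longrightarrow> c x = 0"
    and cont: "continuous_on UNIV q" "continuous_on UNIV p" "continuous_on UNIV S"
  shows "((\<lambda>s. L2_norm (\<lambda>y. to_frame s c y - to_frame t c y)) \<longlongrightarrow> 0) (at t)"
  unfolding tendsto_at_iff_sequentially
proof (intro allI impI)
  fix X :: "nat \<Rightarrow> real" assume X: "\<forall>i. X i \<in> UNIV - {t}" "X \<longlonglongrightarrow> t"
  have lim: "(\<lambda>n. h (X n)) \<longlonglongrightarrow> h t" if "continuous_on UNIV h" for h :: "real \<Rightarrow> 'z::t2_space"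
    using continuous_on_tendsto_compose[OF that X(2)] by simp
  have "Bseq (\<lambda>n. q (X n))" using lim[OF cont(1)] by (intro convergent_imp_Bseq convergentI)
  then obtain Cq where Cq: "\<And>n. norm (q (X n)) \<le> Cq" unfolding Bseq_def by blast
  define C where "C = max Cq (norm (q t))"
  define R' where "R' = (\<bar>R\<bar> + C) / sqrt \<epsilon>"
  have M0: "M \<ge> 0" using order_trans[OF norm_ge_zero M[of 0]] .
  have cm: "c \<in> borel_measurable borel" using c by (rule borel_measurable_continuous_onI)
  have supp: "to_frame s c y = 0" if "norm (q s) \<le> C" "norm y > R'" for s y
  proof -
    have "\<bar>R\<bar> + C < sqrt \<epsilon> * norm y" using that(2) sqrt_eps(1) by (simp add: R'_def field_simps)
    then have "norm (q s + sqrt \<epsilon> *\<^sub>R y) > R"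
      using norm_triangle_ineq4[of "q s + sqrt \<epsilon> *\<^sub>R y" "q s"] that(1) sqrt_eps(1) by simp
    then show ?thesis using R by (simp add: to_frame_def)
  qed
  have b: "norm (to_frame s c y) \<le> \<epsilon> powr (real CARD('d) / 4) * M" for s y
    unfolding norm_to_frame by (intro mult_left_mono M) simp
  let ?N = "2 * (\<epsilon> powr (real CARD('d) / 4) * M)"
  have "(\<lambda>n. L2_norm (\<lambda>y. to_frame (X n) c y - to_frame t c y)) \<longlonglongrightarrow> 0"
  proof (rule L2_norm_tendsto_0[where w = "\<lambda>x. of_real ?N * indicator (cball 0 R') x"])
    show "(\<lambda>y. to_frame (X n) c y - to_frame t c y) \<in> borel_measurable borel" for n
      using to_frame_measurable[OF cm] by measurable
    show "(\<lambda>x. of_real ?N * indicator (cball 0 R') x) \<in> L2"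
      by (rule L2_bounded_support[of _ ?N R']) (use M0 in \<open>auto simp: indicator_def norm_mult\<close>)
    show "AE y in lborel. norm (to_frame (X n) c y - to_frame t c y) \<le> norm (of_real ?N * indicator (cball 0 R') y :: complex)" for n
    proof (rule AE_I2)
      fix y :: "real^'d"
      show "norm (to_frame (X n) c y - to_frame t c y) \<le> norm (of_real ?N * indicator (cball 0 R') y :: complex)"
      proof (cases "norm y > R'")
        case True
        then show ?thesis using supp[of "X n" y] supp[of t y] Cq[of n] by (simp add: C_def max.coboundedI1)
      next
        case False
        then show ?thesis
          using norm_triangle_ineq4[of "to_frame (X n) c y" "to_frame t c y"] b[of "X n" y] b[of t y] M0
          by (simp add: norm_mult)
      qed
    qed
    show "AE y in lborel. (\<lambda>n. to_frame (X n) c y - to_frame t c y) \<longlonglongrightarrow> 0"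
    proof (rule AE_I2)
      fix y
      have "continuous_on UNIV (\<lambda>s. to_frame s c y)"
        unfolding to_frame_def phase_def
        by (intro continuous_intros cont continuous_on_compose2[OF c]) (use \<epsilon> in auto)
      from lim[OF this] have "(\<lambda>n. to_frame (X n) c y - to_frame t c y) \<longlonglongrightarrow> to_frame t c y - to_frame t c y"
        by (intro tendsto_intros)
      then show "(\<lambda>n. to_frame (X n) c y - to_frame t c y) \<longlonglongrightarrow> 0" by simp
    qed
  qed
  then show "((\<lambda>s. L2_norm (\<lambda>y. to_frame s c y - to_frame t c y)) \<circ> X) \<longlonglongrightarrow> 0" by (simp add: comp_def)
qed

lemma continuous_L2_to_frame:
  assumes \<psi>: "continuous_L2 \<psi>"
    and cont: "continuous_on UNIV q" "continuous_on UNIV p" "continuous_on UNIV S"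
  shows "continuous_L2 (\<lambda>t. to_frame t (\<psi> t))"
  unfolding continuous_L2_def
proof (intro conjI allI)
  have \<psi>L2: "\<psi> s \<in> L2" for s using \<psi> by (simp add: continuous_L2_def)
  show "to_frame t (\<psi> t) \<in> L2" for t by (rule to_frame_L2(1)[OF \<psi>L2])
  fix t
  show "((\<lambda>s. L2_norm (\<lambda>y. to_frame s (\<psi> s) y - to_frame t (\<psi> t) y)) \<longlongrightarrow> 0) (at t)"
  proof (rule tendstoI)
    fix e :: real assume e: "e > 0"
    have "e / 5 > 0" using e by simp
    from L2_dense[OF \<psi>L2[of t] this] obtain c M where c: "continuous_on UNIV c" "\<And>x. norm (c x) \<le> M" "\<And>x. norm x > M + 1 \<Longrightarrow> c x = 0"
      "c \<in> L2" "L2_norm (\<lambda>x. \<psi> t x - c x) < e / 5" by blast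
    have "\<forall>\<^sub>F s in at t. dist (L2_norm (\<lambda>y. to_frame s c y - to_frame t c y)) 0 < e / 5"
      using tendstoD[OF to_frame_continuous[OF c(1) c(2), where R = "M + 1", OF c(3) cont], of "e / 5"] e by simp
    moreover have "\<forall>\<^sub>F s in at t. dist (L2_norm (\<lambda>y. \<psi> s y - \<psi> t y)) 0 < e / 5"
      using \<psi> e unfolding continuous_L2_def by (intro tendstoD) auto
    ultimately show "\<forall>\<^sub>F s in at t. dist (L2_norm (\<lambda>y. to_frame s (\<psi> s) y - to_frame t (\<psi> t) y)) 0 < e"
    proof eventually_elim
      case (elim s)
      let ?A = "to_frame s (\<lambda>x. \<psi> s x - c x)" and ?B = "\<lambda>y. to_frame s c y - to_frame t c y" and ?C = "to_frame t (\<lambda>x. c x - \<psi> t x)"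
      have L: "?A \<in> L2" "?B \<in> L2" "?C \<in> L2" by (intro to_frame_L2 L2_diff \<psi>L2 c(4))+
      have eq: "(\<lambda>y. to_frame s (\<psi> s) y - to_frame t (\<psi> t) y) = (\<lambda>y. (?A y + ?B y) + ?C y)"
        by (simp add: to_frame_diff fun_eq_iff)
      have "L2_norm (\<lambda>y. to_frame s (\<psi> s) y - to_frame t (\<psi> t) y) \<le> (L2_norm ?A + L2_norm ?B) + L2_norm ?C"
        unfolding eq by (rule order_trans[OF L2_norm_triangle[OF L2_add[OF L(1,2)] L(3)] add_right_mono[OF L2_norm_triangle[OF L(1,2)]]])
      also have "L2_norm ?A = L2_norm (\<lambda>x. \<psi> s x - c x)" by (rule to_frame_L2(2)[OF L2_diff[OF \<psi>L2 c(4)]])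
      also have "L2_norm ?C = L2_norm (\<lambda>x. c x - \<psi> t x)" by (rule to_frame_L2(2)[OF L2_diff[OF c(4) \<psi>L2]])
      also have "L2_norm (\<lambda>x. c x - \<psi> t x) = L2_norm (\<lambda>x. \<psi> t x - c x)" by (simp add: L2_norm_def norm_minus_commute)
      also have "L2_norm (\<lambda>x. \<psi> s x - c x) \<le> L2_norm (\<lambda>x. \<psi> s x - \<psi> t x) + L2_norm (\<lambda>x. \<psi> t x - c x)"
        using L2_norm_triangle[OF L2_diff[OF \<psi>L2[of s] \<psi>L2[of t]] L2_diff[OF \<psi>L2[of t] c(4)]] by simp
      finally show ?case using elim c(5) e by simp
    qed
  qed
qed

lemma smooth_phase: "smooth (phase t)" and partial_phase: "partial j (phase t) = (\<lambda>x. \<i> * of_real (p t $ j / \<epsilon>) * phase t x)"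
proof -
  have d: "((\<lambda>x. c * phase t x) has_derivative (\<lambda>h. (c * (\<i> * of_real (p t \<bullet> h / \<epsilon>))) * phase t x)) (at x)" for c x
  proof -
    have "((\<lambda>x. \<i> * of_real ((S t + p t \<bullet> (x - q t)) / \<epsilon>)) has_derivative (\<lambda>h. \<i> * of_real (p t \<bullet> h / \<epsilon>))) (at x)"
    proof -
      have "((\<lambda>x. \<i> * of_real ((S t + p t \<bullet> (x - q t)) * inverse \<epsilon>)) has_derivative (\<lambda>h. \<i> * of_real ((0 + p t \<bullet> (h - 0)) * inverse \<epsilon>))) (at x)"
        by (rule has_derivative_mult_right[OF has_derivative_of_real[OF has_derivative_mult_left[OF has_derivative_add[OF has_derivative_const
          has_derivative_inner_right[OF has_derivative_diff[OF has_derivative_ident has_derivative_const]]]]]])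
      then show ?thesis by (simp only: divide_inverse add_0 diff_zero)
    qed
    from has_derivative_mult_right[OF has_derivative_compose[OF this DERIV_exp[unfolded has_field_derivative_def]], of c]
    show ?thesis unfolding phase_def by (simp only: mult_ac)
  qed
  have dd: "dir_deriv b (\<lambda>x. c * phase t x) = (\<lambda>x. (c * (\<i> * of_real (p t \<bullet> b / \<epsilon>))) * phase t x)" for b c
    using dir_deriv_eq[OF d] by blast
  show "smooth (phase t)"
  proof (rule smooth_coinduct[where P = "\<lambda>h. \<exists>c. h = (\<lambda>x. c * phase t x)"])
    show "\<exists>c. phase t = (\<lambda>x. c * phase t x)" by (intro exI[of _ 1]) simp
    fix h assume "\<exists>c. h = (\<lambda>x. c * phase t x)"
    then obtain c where h: "h = (\<lambda>x. c * phase t x)" by blast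
    have "h differentiable (at x)" for x unfolding h using d differentiableI by blast
    then show "(\<forall>x. h differentiable (at x)) \<and> (\<forall>b\<in>Basis. \<exists>c. dir_deriv b h = (\<lambda>x. c * phase t x))"
      unfolding h dd by blast
  qed
  show "partial j (phase t) = (\<lambda>x. \<i> * of_real (p t $ j / \<epsilon>) * phase t x)"
    using dd[of "axis j 1" 1] by (simp add: partial_def inner_axis)
qed

lemma from_frame_affine: "from_frame t \<eta> x = of_real (\<epsilon> powr (- real CARD('d) / 4)) * (\<eta> ((1 / sqrt \<epsilon>) *\<^sub>R x + (- (1 / sqrt \<epsilon>)) *\<^sub>R q t) * phase t x)"
proof -
  have "(x - q t) /\<^sub>R sqrt \<epsilon> = (1 / sqrt \<epsilon>) *\<^sub>R x + (- (1 / sqrt \<epsilon>)) *\<^sub>R q t"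
    by (simp add: inverse_eq_divide scaleR_diff_right)
  then show ?thesis by (simp only: from_frame_def mult.assoc)
qed

lemma smooth_from_frame:
  assumes s: "smooth \<eta>"
  shows "smooth (from_frame t \<eta>)"
  unfolding from_frame_affine[abs_def]
  by (rule smooth_mult[OF smooth_const smooth_mult[OF smooth_affine[OF s] smooth_phase]])

lemma partial_from_frame:
  assumes s: "smooth \<eta>"
  shows "partial j (from_frame t \<eta>) = from_frame t (\<lambda>y. of_real (1 / sqrt \<epsilon>) * partial j \<eta> y + \<i> * of_real (p t $ j / \<epsilon>) * \<eta> y)"
proof -
  let ?c = "1 / sqrt \<epsilon>" and ?a = "(- (1 / sqrt \<epsilon>)) *\<^sub>R q t"
  have 1: "partial j (\<lambda>x. \<eta> (?c *\<^sub>R x + ?a)) = (\<lambda>x. ?c *\<^sub>R partial j \<eta> (?c *\<^sub>R x + ?a))"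
    unfolding partial_def by (rule dir_deriv_affine[OF s])
  show ?thesis
    unfolding from_frame_affine[abs_def]
    unfolding partial_cmult[OF smooth_mult[OF smooth_affine[OF s] smooth_phase]] partial_mult[OF smooth_affine[OF s] smooth_phase]
        1 partial_phase
    by (simp only: scaleR_conv_of_real[where 'a = complex] distrib_left distrib_right mult_ac add_ac)
qed

lemma from_frame_support:
  assumes "\<And>y. norm y > R \<Longrightarrow> \<eta> y = 0" "norm x > norm (q t) + sqrt \<epsilon> * R"
  shows "from_frame t \<eta> x = 0"
proof -
  have "sqrt \<epsilon> * R < norm (x - q t)" using norm_triangle_ineq2[of x "q t"] assms(2) by linarith
  then have "R < norm (x - q t) / sqrt \<epsilon>" using sqrt_eps(1) by (simp add: pos_less_divide_eq mult.commute)
  also have "\<dots> = norm ((x - q t) /\<^sub>R sqrt \<epsilon>)" using \<epsilon> by (simp add: divide_inverse mult.commute)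
  finally have "R < norm ((x - q t) /\<^sub>R sqrt \<epsilon>)" .
  then show ?thesis using assms(1) by (simp add: from_frame_def)
qed

lemma test_function_from_frame:
  assumes "test_function \<eta>"
  shows "test_function (from_frame t \<eta>)"
proof -
  obtain R where "\<And>y. norm y > R \<Longrightarrow> \<eta> y = 0" using assms unfolding test_function_iff by blast
  then have "\<forall>x. norm x > norm (q t) + sqrt \<epsilon> * R \<longrightarrow> from_frame t \<eta> x = 0" using from_frame_support[of R \<eta>] by blast
  then show ?thesis
    using smooth_from_frame[OF test_function_smooth[OF assms]] unfolding test_function_iff by blast
qed

end

lemma partial_wave_packet_op:
  fixes \<eta> :: "real^'d::finite \<Rightarrow> complex"
  assumes "smooth \<eta>"
  shows "partial j (\<lambda>y. a * partial j \<eta> y + b * \<eta> y) = (\<lambda>y. a * partial j (partial j \<eta>) y + b * partial j \<eta> y)"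
  unfolding partial_add[OF smooth_mult[OF smooth_const smooth_partial[OF assms]] smooth_mult[OF smooth_const assms]]
    partial_cmult[OF smooth_partial[OF assms]] partial_cmult[OF assms] ..

text \<open>Conjugating with the wave packet turns \<open>\<partial>\<^sub>j\<close> into \<open>\<partial>\<^sub>j / sqrt \<epsilon> + \<i> p\<^sub>j / \<epsilon>\<close>. The terms that are singular
  in \<open>\<epsilon>\<close> cancel against the time derivative precisely because \<open>q\<close>, \<open>p\<close>, \<open>S\<close> solve the classical
  equations; the rotation contributes no further term since \<open>W\<close> is skew.\<close>

lemma hamiltonian_from_frame:
  fixes V S :: "_ \<Rightarrow> real" and W :: "real^'d::finite \<Rightarrow> real^'d" and q p :: "real \<Rightarrow> real^'d" and \<eta> :: "real^'d \<Rightarrow> complex"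
  assumes \<epsilon>: "0 < \<epsilon>" and W: "skew W" and s: "smooth \<eta>"
    and q': "q' = p t + W (q t)" and p': "p' = - dV + W (p t)" and S': "S' = (norm (p t))\<^sup>2 / 2 - V (q t)"
  defines "f \<equiv> from_frame \<epsilon> q p S t"
  shows "- of_real (\<epsilon>\<^sup>2 / 2) * laplacian (f \<eta>) x + of_real (V x) * f \<eta> x
      + of_real \<epsilon> * (- \<i> * (\<Sum>j\<in>UNIV. of_real (W x $ j) * partial j (f \<eta>) x)) =
    of_real \<epsilon> * (f (ham W (\<lambda>y. (V (q t + sqrt \<epsilon> *\<^sub>R y) - V (q t) - sqrt \<epsilon> * (y \<bullet> dV)) / \<epsilon>) \<eta>) x
      + \<i> * f (\<lambda>y. (\<Sum>j\<in>UNIV. of_real (- (q' $ j) / sqrt \<epsilon>) * partial j \<eta> y)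
          + \<i> * of_real ((S' + sqrt \<epsilon> * (p' \<bullet> y) - p t \<bullet> q') / \<epsilon>) * \<eta> y) x)"
proof -
  define r where "r = sqrt \<epsilon>"
  have r: "r > 0" "\<epsilon> = r * r" using \<epsilon> by (auto simp: r_def)
  have lin: "linear W" and sk: "W a \<bullet> b = - (a \<bullet> W b)" for a b using W by (auto simp: skew_def)
  define y where "y = (x - q t) /\<^sub>R r"
  have x: "x = q t + r *\<^sub>R y" using r(1) by (simp add: y_def)
  have Wx: "W x = W (q t) + r *\<^sub>R W y" unfolding x using lin by (simp add: linear_add linear_cmul)
  define K where "K = complex_of_real (\<epsilon> powr (- real CARD('d) / 4)) * phase \<epsilon> q p S t x"
  have f: "f \<zeta> x = K * \<zeta> y" for \<zeta> by (simp add: f_def from_frame_def[OF \<epsilon>] K_def y_def r_def)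
  let ?A = "\<lambda>j \<zeta> y. of_real (1 / r) * partial j \<zeta> y + \<i> * of_real (p t $ j / \<epsilon>) * \<zeta> y"
  have pf: "partial j (f \<zeta>) = f (?A j \<zeta>)" if "smooth \<zeta>" for j \<zeta>
    unfolding f_def r_def by (rule partial_from_frame[OF \<epsilon> that])
  have sA: "smooth (?A j \<eta>)" for j
    by (rule smooth_add[OF smooth_mult[OF smooth_const smooth_partial[OF s]] smooth_mult[OF smooth_const s]])
  define D where "D j = partial j \<eta> y" for j
  define e where "e = \<eta> y"
  define L where "L = laplacian \<eta> y"
  have AA: "?A j (?A j \<eta>) y = of_real (1 / r * (1 / r)) * partial j (partial j \<eta>) y + 2 * \<i> * of_real (p t $ j / \<epsilon> / r) * D j
      - of_real (p t $ j * p t $ j / \<epsilon> / \<epsilon>) * e" for j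
    unfolding partial_wave_packet_op[OF s] D_def e_def by (simp add: algebra_simps)
  define sp where "sp = (\<Sum>j\<in>UNIV. of_real (p t $ j) * D j)"
  define sy where "sy = (\<Sum>j\<in>UNIV. of_real (W y $ j) * D j)"
  define sw where "sw = (\<Sum>j\<in>UNIV. of_real (W (q t) $ j) * D j)"
  have lap: "laplacian (f \<eta>) x = K * (of_real (1 / r * (1 / r)) * L + 2 * \<i> * of_real (1 / \<epsilon> / r) * sp - of_real (p t \<bullet> p t / \<epsilon> / \<epsilon>) * e)"
  proof -
    have "laplacian (f \<eta>) x = (\<Sum>j\<in>UNIV. K * ?A j (?A j \<eta>) y)"
      unfolding laplacian_def pf[OF s] pf[OF sA] f ..
    also have "\<dots> = K * (\<Sum>j\<in>UNIV. of_real (1 / r * (1 / r)) * partial j (partial j \<eta>) y + 2 * \<i> * of_real (p t $ j / \<epsilon> / r) * D j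
      - of_real (p t $ j * p t $ j / \<epsilon> / \<epsilon>) * e)"
      unfolding AA sum_distrib_left ..
    also have "(\<Sum>j\<in>UNIV. of_real (1 / r * (1 / r)) * partial j (partial j \<eta>) y + 2 * \<i> * of_real (p t $ j / \<epsilon> / r) * D j
      - of_real (p t $ j * p t $ j / \<epsilon> / \<epsilon>) * e) =
      of_real (1 / r * (1 / r)) * L + 2 * \<i> * of_real (1 / \<epsilon> / r) * sp - of_real (p t \<bullet> p t / \<epsilon> / \<epsilon>) * e"
      unfolding L_def laplacian_def sp_def inner_vec_def
      by (simp add: sum.distrib sum_subtractf sum_distrib_left sum_distrib_right sum_divide_distrib mult_ac)
    finally show ?thesis .
  qed
  have rot: "(\<Sum>j\<in>UNIV. of_real (W x $ j) * partial j (f \<eta>) x) = K * (of_real (1 / r) * (sw + of_real r * sy) + \<i> * of_real (W x \<bullet> p t / \<epsilon>) * e)"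
  proof -
    have "(\<Sum>j\<in>UNIV. of_real (W x $ j) * partial j (f \<eta>) x) = (\<Sum>j\<in>UNIV. K * (of_real (1 / r) * (of_real (W x $ j) * D j) + \<i> * of_real (W x $ j * p t $ j / \<epsilon>) * e))"
      unfolding pf[OF s] f D_def e_def by (intro sum.cong refl) (simp add: algebra_simps)
    also have "\<dots> = K * (of_real (1 / r) * (\<Sum>j\<in>UNIV. of_real (W x $ j) * D j) + \<i> * of_real (W x \<bullet> p t / \<epsilon>) * e)"
      unfolding inner_vec_def by (simp add: sum.distrib sum_distrib_left sum_distrib_right sum_divide_distrib distrib_left mult_ac)
    also have "(\<Sum>j\<in>UNIV. of_real (W x $ j) * D j) = sw + of_real r * sy"
      unfolding Wx sw_def sy_def by (simp add: algebra_simps sum.distrib sum_distrib_left)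
    finally show ?thesis .
  qed
  have sq: "(\<Sum>j\<in>UNIV. of_real (- (q' $ j) / r) * D j) = - of_real (1 / r) * (sp + sw)"
    unfolding q' sp_def sw_def by (simp add: sum_distrib_left sum.distrib[symmetric] algebra_simps add_divide_distrib diff_divide_distrib sum_negf[symmetric])
  have hm: "f (ham W (\<lambda>y. (V (q t + sqrt \<epsilon> *\<^sub>R y) - V (q t) - sqrt \<epsilon> * (y \<bullet> dV)) / \<epsilon>) \<eta>) x =
      K * (- (1 / 2) * L + of_real ((V x - V (q t) - r * (y \<bullet> dV)) / \<epsilon>) * e - \<i> * sy)"
    unfolding f ham_def L_def e_def sy_def D_def r_def[symmetric] x[symmetric] ..
  have dt: "f (\<lambda>y. (\<Sum>j\<in>UNIV. of_real (- (q' $ j) / sqrt \<epsilon>) * partial j \<eta> y)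
          + \<i> * of_real ((S' + sqrt \<epsilon> * (p' \<bullet> y) - p t \<bullet> q') / \<epsilon>) * \<eta> y) x =
      K * (- of_real (1 / r) * (sp + sw) + \<i> * of_real ((S' + r * (p' \<bullet> y) - p t \<bullet> q') / \<epsilon>) * e)"
    unfolding f sq[symmetric] D_def e_def r_def[symmetric] ..
  have pot: "p t \<bullet> p t / 2 + V x + W x \<bullet> p t = (V x - V (q t) - r * (y \<bullet> dV)) - (S' + r * (p' \<bullet> y) - p t \<bullet> q')"
    unfolding Wx q' p' S' power2_norm_eq_inner
    by (simp add: inner_add_left inner_add_right inner_diff_left sk inner_commute[of dV] inner_commute[of "W (p t)" y] inner_commute[of "p t" "W (q t)"] inner_commute[of "p t" "W y"] algebra_simps)
  define P1 where "P1 = V x - V (q t) - r * (y \<bullet> dV)"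
  define P2 where "P2 = S' + r * (p' \<bullet> y) - p t \<bullet> q'"
  have fe: "f \<eta> x = K * e" unfolding f e_def ..
  have c: "complex_of_real (V x) = of_real P1 - of_real P2 - of_real (p t \<bullet> p t) / 2 - of_real (W x \<bullet> p t)"
  proof -
    have "V x = P1 - P2 - (p t \<bullet> p t) / 2 - W x \<bullet> p t" using pot unfolding P1_def P2_def by linarith
    then show ?thesis by (simp only: of_real_diff of_real_divide of_real_numeral)
  qed
  have rc: "complex_of_real r \<noteq> 0" using r(1) by simp
  show ?thesis
    unfolding lap rot hm dt fe c P1_def[symmetric] P2_def[symmetric] unfolding r(2)
    using rc by (simp add: field_simps power2_eq_square)
qed

lemma has_vector_derivative_from_frame:
  fixes q p :: "real \<Rightarrow> real^'d::finite"
  assumes \<epsilon>: "0 < \<epsilon>" and s: "smooth \<eta>"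
    and q: "(q has_vector_derivative q') (at t)" and p: "(p has_vector_derivative p') (at t)"
    and S: "(S has_real_derivative S') (at t)"
  shows "((\<lambda>t. from_frame \<epsilon> q p S t \<eta> x) has_vector_derivative
    from_frame \<epsilon> q p S t (\<lambda>y. (\<Sum>j\<in>UNIV. of_real (- (q' $ j) / sqrt \<epsilon>) * partial j \<eta> y)
          + \<i> * of_real ((S' + sqrt \<epsilon> * (p' \<bullet> y) - p t \<bullet> q') / \<epsilon>) * \<eta> y) x) (at t)"
proof -
  let ?y = "(x - q t) /\<^sub>R sqrt \<epsilon>"
  have xq: "sqrt \<epsilon> * (p' \<bullet> ?y) = p' \<bullet> (x - q t)" using \<epsilon> by simp
  have "((\<lambda>t. (x - q t) /\<^sub>R sqrt \<epsilon>) has_derivative (\<lambda>h. (0 - h *\<^sub>R q') /\<^sub>R sqrt \<epsilon>)) (at t)"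
    by (rule has_derivative_scaleR_right[OF has_derivative_diff[OF has_derivative_const q[unfolded has_vector_derivative_def]]])
  note 0 = has_derivative_compose[OF this has_derivative_partial[OF s]]
  have "((0 - h *\<^sub>R q') /\<^sub>R sqrt \<epsilon>) $ j = h * (- (q' $ j) / sqrt \<epsilon>)" for j h
    by (simp add: divide_inverse)
  then have "(\<lambda>h. \<Sum>j\<in>UNIV. (((0 - h *\<^sub>R q') /\<^sub>R sqrt \<epsilon>) $ j) *\<^sub>R partial j \<eta> ?y) =
      (\<lambda>h. h *\<^sub>R (\<Sum>j\<in>UNIV. of_real (- (q' $ j) / sqrt \<epsilon>) * partial j \<eta> ?y))"
    by (simp only: scaleR_conv_of_real[where 'a = complex] of_real_mult sum_distrib_left mult.assoc)
  then have 1: "((\<lambda>t. \<eta> ((x - q t) /\<^sub>R sqrt \<epsilon>)) has_vector_derivative (\<Sum>j\<in>UNIV. of_real (- (q' $ j) / sqrt \<epsilon>) * partial j \<eta> ?y)) (at t)"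
    unfolding has_vector_derivative_def using has_derivative_eq_rhs[OF 0] by blast
  define g where "g t = (S t + p t \<bullet> (x - q t)) / \<epsilon>" for t
  have "((\<lambda>t. p t \<bullet> (x - q t)) has_derivative (\<lambda>h. p t \<bullet> (0 - h *\<^sub>R q') + h *\<^sub>R p' \<bullet> (x - q t))) (at t)"
    by (rule has_derivative_inner[OF p[unfolded has_vector_derivative_def] has_derivative_diff[OF has_derivative_const q[unfolded has_vector_derivative_def]]])
  then have "((\<lambda>t. p t \<bullet> (x - q t)) has_real_derivative (p' \<bullet> (x - q t) - p t \<bullet> q')) (at t)"
    unfolding has_field_derivative_def by (rule has_derivative_eq_rhs) (auto simp: fun_eq_iff algebra_simps)
  from DERIV_cdivide[OF DERIV_add[OF S this], of \<epsilon>]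
  have g: "(g has_real_derivative (S' + sqrt \<epsilon> * (p' \<bullet> ?y) - p t \<bullet> q') / \<epsilon>) (at t)"
    unfolding g_def[abs_def] xq by (simp add: add_diff_eq)
  let ?g' = "(S' + sqrt \<epsilon> * (p' \<bullet> ?y) - p t \<bullet> q') / \<epsilon>"
  have "((\<lambda>t. \<i> * of_real (g t)) has_derivative (\<lambda>h. \<i> * of_real (?g' * h))) (at t)"
    by (rule has_derivative_mult_right[OF has_derivative_of_real[OF g[unfolded has_field_derivative_def]]])
  from has_derivative_compose[OF this DERIV_exp[unfolded has_field_derivative_def]]
  have 2: "((\<lambda>t. phase \<epsilon> q p S t x) has_vector_derivative \<i> * of_real ?g' * phase \<epsilon> q p S t x) (at t)"
    unfolding has_vector_derivative_def phase_def[OF \<epsilon>] g_def[symmetric]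
    by (rule has_derivative_eq_rhs) (auto simp: fun_eq_iff scaleR_conv_of_real mult_ac)
  from has_vector_derivative_mult_right[OF has_vector_derivative_mult[OF 1 2], of "of_real (\<epsilon> powr (- real CARD('d) / 4))"]
  show ?thesis unfolding from_frame_def[OF \<epsilon>] mult.assoc by (simp only: distrib_left distrib_right mult_ac add_ac)
qed

lemma weak_solution_to_frame:
  fixes V :: "real^'d::finite \<Rightarrow> real" and W :: "real^'d \<Rightarrow> real^'d" and dV :: "real^'d \<Rightarrow> real^'d"
  assumes \<epsilon>: "0 < \<epsilon>" and W: "skew W" and \<psi>: "continuous_L2 \<psi>"
    and V: "continuous_on UNIV V" and dV: "continuous_on UNIV dV"
    and q: "\<And>t. (q has_vector_derivative (p t + W (q t))) (at t)"
    and p: "\<And>t. (p has_vector_derivative (- dV (q t) + W (p t))) (at t)"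
    and S: "\<And>t. (S has_real_derivative ((norm (p t))\<^sup>2 / 2 - V (q t))) (at t)"
    and sol: "\<And>\<eta> t. test_function \<eta> \<Longrightarrow> \<exists>D. ((\<lambda>s. L2_inner \<eta> (\<psi> s)) has_vector_derivative D) (at t) \<and>
      \<i> * of_real \<epsilon> * D = L2_inner (\<lambda>x. - of_real (\<epsilon>\<^sup>2 / 2) * laplacian \<eta> x + of_real (V x) * \<eta> x
        + of_real \<epsilon> * (- \<i> * (\<Sum>j\<in>UNIV. of_real (W x $ j) * partial j \<eta> x))) (\<psi> t)"
    and sm: "\<And>t. smooth (\<lambda>y. (V (q t + sqrt \<epsilon> *\<^sub>R y) - V (q t) - sqrt \<epsilon> * (y \<bullet> dV (q t))) / \<epsilon>)"
  shows "weak_solution W (\<lambda>t y. (V (q t + sqrt \<epsilon> *\<^sub>R y) - V (q t) - sqrt \<epsilon> * (y \<bullet> dV (q t))) / \<epsilon>)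
    (\<lambda>t. to_frame \<epsilon> q p S t (\<psi> t)) (\<lambda>t x. 0)"
  unfolding weak_solution_def
proof (intro allI impI)
  fix \<eta> :: "real^'d \<Rightarrow> complex" and t assume \<eta>: "test_function \<eta>"
  have s: "smooth \<eta>" by (rule test_function_smooth[OF \<eta>])
  have lin: "linear W" using W by (simp add: skew_def)
  have \<psi>L2: "\<psi> s \<in> L2" for s using \<psi> by (simp add: continuous_L2_def)
  let ?U = "\<lambda>t y. (V (q t + sqrt \<epsilon> *\<^sub>R y) - V (q t) - sqrt \<epsilon> * (y \<bullet> dV (q t))) / \<epsilon>"
  define q' where "q' t = p t + W (q t)" for t
  define p' where "p' t = - dV (q t) + W (p t)" for t
  define S' where "S' t = (norm (p t))\<^sup>2 / 2 - V (q t)" for t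
  define z where "z t y = (\<Sum>j\<in>UNIV. of_real (- (q' t $ j) / sqrt \<epsilon>) * partial j \<eta> y)
          + \<i> * of_real ((S' t + sqrt \<epsilon> * (p' t \<bullet> y) - p t \<bullet> q' t) / \<epsilon>) * \<eta> y" for t y
  have qc: "continuous_on UNIV q" and pc: "continuous_on UNIV p"
    using q p by (meson continuous_at_imp_continuous_on has_vector_derivative_continuous)+
  have Wc: "continuous_on UNIV (\<lambda>t. W (h t))" if "continuous_on UNIV h" for h :: "real \<Rightarrow> real^'d"
    using linear_continuous_on_compose[OF that lin] .
  have q'c: "continuous_on UNIV q'" unfolding q'_def[abs_def] by (intro continuous_intros pc Wc qc)
  have p'c: "continuous_on UNIV p'" unfolding p'_def[abs_def]
    by (intro continuous_intros Wc pc continuous_on_compose2[OF dV qc]) auto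
  have S'c: "continuous_on UNIV S'" unfolding S'_def[abs_def]
    by (intro continuous_intros pc continuous_on_compose2[OF V qc]) auto
  obtain R where R: "\<And>y. norm y > R \<Longrightarrow> \<eta> y = 0" using \<eta> unfolding test_function_iff by blast
  define R0 where "R0 = \<bar>R\<bar>"
  have R0: "\<eta> y = 0" if "norm y > R0" for y using R[of y] that by (simp add: R0_def)
  have zt: "test_function (z s)" for s
  proof -
    have "smooth (\<lambda>y. \<i> * complex_of_real ((1 / \<epsilon>) * ((S' s + sqrt \<epsilon> * (p' s \<bullet> y)) - p s \<bullet> q' s)))"
      by (intro smooth_mult smooth_const smooth_of_real smooth_diff smooth_add smooth_inner smooth_id)
    then have "smooth (\<lambda>y. \<i> * complex_of_real ((S' s + sqrt \<epsilon> * (p' s \<bullet> y) - p s \<bullet> q' s) / \<epsilon>))" by simp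
    then show ?thesis unfolding z_def[abs_def]
      by (intro test_function_add test_function_sum test_function_scale test_function_partial \<eta> test_function_mult_smooth)
  qed
  have z0: "z s y = 0" if "norm y > R0" for s y
    using R0[OF that] partial_eq_0_outside[OF R0 that] by (simp add: z_def)
  obtain Ce where Ce: "\<And>y. norm (\<eta> y) \<le> Ce" "Ce > 0" using test_function_bounded[OF \<eta>] by blast
  have "\<exists>c. \<forall>y. norm (partial j \<eta> y) \<le> c" for j using test_function_bounded[OF test_function_partial[OF \<eta>]] by metis
  then obtain Cp where Cp: "\<And>j y. norm (partial j \<eta> y) \<le> Cp j" by metis
  define Bz where "Bz s = (\<Sum>j\<in>UNIV. \<bar>q' s $ j\<bar> / sqrt \<epsilon> * Cp j) + (\<bar>S' s\<bar> + sqrt \<epsilon> * (norm (p' s) * R0) + norm (p s) * norm (q' s)) / \<epsilon> * Ce" for s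
  have Bzc: "continuous_on UNIV Bz"
    unfolding Bz_def[abs_def] by (intro continuous_intros S'c p'c pc q'c continuous_on_component) (use \<epsilon> in auto)
  have zb: "norm (z s y) \<le> Bz s" for s y
  proof (cases "norm y > R0")
    case True
    have "0 \<le> Cp j" for j using order_trans[OF norm_ge_zero Cp[of j 0]] .
    then have "0 \<le> Bz s" unfolding Bz_def using \<epsilon> Ce(2)
      by (intro add_nonneg_nonneg sum_nonneg mult_nonneg_nonneg divide_nonneg_nonneg) (auto simp: R0_def)
    then show ?thesis using z0[OF True] by simp
  next
    case False
    have "norm (z s y) \<le> (\<Sum>j\<in>UNIV. \<bar>q' s $ j\<bar> / sqrt \<epsilon> * Cp j) + \<bar>(S' s + sqrt \<epsilon> * (p' s \<bullet> y) - p s \<bullet> q' s) / \<epsilon>\<bar> * Ce"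
      unfolding z_def
    proof (rule norm_triangle_mono)
      show "norm (\<Sum>j\<in>UNIV. of_real (- (q' s $ j) / sqrt \<epsilon>) * partial j \<eta> y) \<le> (\<Sum>j\<in>UNIV. \<bar>q' s $ j\<bar> / sqrt \<epsilon> * Cp j)"
      proof (rule sum_norm_le)
        fix j
        have "norm (complex_of_real (- (q' s $ j) / sqrt \<epsilon>)) = \<bar>q' s $ j\<bar> / sqrt \<epsilon>"
          using \<epsilon> by (simp only: norm_of_real abs_divide abs_minus) simp
        then show "norm (of_real (- (q' s $ j) / sqrt \<epsilon>) * partial j \<eta> y) \<le> \<bar>q' s $ j\<bar> / sqrt \<epsilon> * Cp j"
          using \<epsilon> unfolding norm_mult by (simp only:) (intro mult_left_mono Cp, simp)
      qed
      show "norm (\<i> * of_real ((S' s + sqrt \<epsilon> * (p' s \<bullet> y) - p s \<bullet> q' s) / \<epsilon>) * \<eta> y) \<le> \<bar>(S' s + sqrt \<epsilon> * (p' s \<bullet> y) - p s \<bullet> q' s) / \<epsilon>\<bar> * Ce"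
        unfolding norm_mult norm_of_real norm_ii mult_1 by (intro mult_left_mono Ce) simp
    qed
    also have "\<bar>(S' s + sqrt \<epsilon> * (p' s \<bullet> y) - p s \<bullet> q' s) / \<epsilon>\<bar> \<le> (\<bar>S' s\<bar> + sqrt \<epsilon> * (norm (p' s) * R0) + norm (p s) * norm (q' s)) / \<epsilon>"
    proof -
      have "sqrt \<epsilon> * \<bar>p' s \<bullet> y\<bar> \<le> sqrt \<epsilon> * (norm (p' s) * R0)"
        using False \<epsilon> by (intro mult_left_mono order_trans[OF Cauchy_Schwarz_ineq2] mult_left_mono) auto
      moreover have "\<bar>p s \<bullet> q' s\<bar> \<le> norm (p s) * norm (q' s)" by (rule Cauchy_Schwarz_ineq2)
      moreover have "\<bar>sqrt \<epsilon> * (p' s \<bullet> y)\<bar> = sqrt \<epsilon> * \<bar>p' s \<bullet> y\<bar>" using \<epsilon> by (simp add: abs_mult)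
      ultimately have "\<bar>S' s + sqrt \<epsilon> * (p' s \<bullet> y) - p s \<bullet> q' s\<bar> \<le> \<bar>S' s\<bar> + sqrt \<epsilon> * (norm (p' s) * R0) + norm (p s) * norm (q' s)"
        by linarith
      then show ?thesis using \<epsilon> by (simp add: abs_divide divide_right_mono)
    qed
    finally show ?thesis unfolding Bz_def using Ce(2) by (simp add: mult_right_mono)
  qed
  let ?f = "\<lambda>s. from_frame \<epsilon> q p S s"
  let ?k = "\<epsilon> powr (- real CARD('d) / 4)"
  obtain N where N: "N \<ge> 0" "\<And>s. \<bar>s - t\<bar> < 1 \<Longrightarrow> Bz s \<le> N" using bounded_near[OF Bzc, of t] by blast
  have "continuous_on UNIV (\<lambda>s. norm (q s))" by (intro continuous_intros qc)
  from bounded_near[OF this, of t] obtain Cq where Cq: "Cq \<ge> 0" "\<And>s. \<bar>s - t\<bar> < 1 \<Longrightarrow> norm (q s) \<le> Cq" by blast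
  have fL2: "?f s h \<in> L2" if "test_function h" for s h
    by (rule test_function_L2[OF test_function_from_frame[OF \<epsilon> that]])
  have supp: "?f s \<eta> x = 0 \<and> ?f s (z s) x = 0" if "\<bar>s - t\<bar> < 1" "norm x > Cq + sqrt \<epsilon> * R0" for s x
  proof -
    have "norm x > norm (q s) + sqrt \<epsilon> * R0" using Cq(2)[OF that(1)] that(2) by linarith
    then show ?thesis using R0 z0 by (intro conjI from_frame_support[OF \<epsilon>, where R = R0]) simp_all
  qed
  have nb: "norm (?f s (z s) x) \<le> ?k * N" if "\<bar>s - t\<bar> < 1" for s x
  proof -
    have "norm (?f s (z s) x) = ?k * norm (z s ((x - q s) /\<^sub>R sqrt \<epsilon>))"
      by (simp add: from_frame_def[OF \<epsilon>] norm_mult norm_phase[OF \<epsilon>])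
    also have "\<dots> \<le> ?k * N" by (intro mult_left_mono order_trans[OF zb N(2)[OF that]]) simp
    finally show ?thesis .
  qed
  have dd: "((\<lambda>s. ?f s \<eta> x) has_vector_derivative ?f s (z s) x) (at s)" for s x
    unfolding z_def[abs_def] q'_def p'_def S'_def by (rule has_vector_derivative_from_frame[OF \<epsilon> s q p S])
  obtain D where D: "((\<lambda>s. L2_inner (?f t \<eta>) (\<psi> s)) has_vector_derivative D) (at t)"
    "\<i> * of_real \<epsilon> * D = L2_inner (\<lambda>x. - of_real (\<epsilon>\<^sup>2 / 2) * laplacian (?f t \<eta>) x + of_real (V x) * ?f t \<eta> x
        + of_real \<epsilon> * (- \<i> * (\<Sum>j\<in>UNIV. of_real (W x $ j) * partial j (?f t \<eta>) x))) (\<psi> t)"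
    using sol[OF test_function_from_frame[OF \<epsilon> \<eta>]] by blast
  have deriv: "((\<lambda>s. L2_inner (?f s \<eta>) (\<psi> s)) has_vector_derivative (L2_inner (?f t (z t)) (\<psi> t) + D)) (at t)"
    by (rule L2_inner_moving_derivative[OF \<psi> fL2[OF \<eta>] fL2[OF zt] dd nb supp D(1)])
  have H: "test_function (ham W (?U t) \<eta>)" by (rule test_function_ham[OF lin sm \<eta>])
  have "\<i> * of_real \<epsilon> * D = L2_inner (\<lambda>x. of_real \<epsilon> * (?f t (ham W (?U t) \<eta>) x + \<i> * ?f t (z t) x)) (\<psi> t)"
    unfolding D(2) hamiltonian_from_frame[where p = p and q = q and t = t and V = V and W = W and dV = "dV (q t)", OF \<epsilon> W s q'_def[of t] p'_def[of t] S'_def[of t]] z_def[abs_def] ..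
  also have "\<dots> = of_real \<epsilon> * (L2_inner (?f t (ham W (?U t) \<eta>)) (\<psi> t) + - \<i> * L2_inner (?f t (z t)) (\<psi> t))"
    unfolding L2_inner_scale_left L2_inner_add_left[OF \<psi>L2 fL2[OF H] L2_scale[OF fL2[OF zt]]] by simp
  finally have "\<i> * D = L2_inner (?f t (ham W (?U t) \<eta>)) (\<psi> t) + - \<i> * L2_inner (?f t (z t)) (\<psi> t)"
    using \<epsilon> by (simp add: mult.left_commute[of \<i>] mult.assoc)
  then have "- \<i> * (\<i> * D) = - \<i> * (L2_inner (?f t (ham W (?U t) \<eta>)) (\<psi> t) + - \<i> * L2_inner (?f t (z t)) (\<psi> t))" by (simp only:)
  then have "L2_inner (?f t (z t)) (\<psi> t) + D = - \<i> * L2_inner (?f t (ham W (?U t) \<eta>)) (\<psi> t)"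
    by (simp add: algebra_simps)
  also have "L2_inner (?f t (ham W (?U t) \<eta>)) (\<psi> t) = L2_inner (ham W (?U t) \<eta>) (to_frame \<epsilon> q p S t (\<psi> t))"
    by (rule L2_inner_to_frame[OF \<epsilon> L2_measurable[OF \<psi>L2] test_function_measurable[OF H], symmetric])
  finally have e: "L2_inner (?f t (z t)) (\<psi> t) + D = - \<i> * (L2_inner (ham W (?U t) \<eta>) (to_frame \<epsilon> q p S t (\<psi> t)) + L2_inner \<eta> (\<lambda>x. 0))"
    by (simp add: L2_inner_def)
  have "(\<lambda>s. L2_inner (?f s \<eta>) (\<psi> s)) = (\<lambda>s. L2_inner \<eta> (to_frame \<epsilon> q p S s (\<psi> s)))"
    using L2_inner_to_frame[OF \<epsilon> L2_measurable[OF \<psi>L2] test_function_measurable[OF \<eta>]] by simp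
  then show "((\<lambda>s. L2_inner \<eta> (to_frame \<epsilon> q p S s (\<psi> s))) has_vector_derivative
     - \<i> * (L2_inner (ham W (?U t) \<eta>) (to_frame \<epsilon> q p S t (\<psi> t)) + L2_inner \<eta> (\<lambda>x. 0))) (at t)"
    using deriv unfolding e by (simp only:)
qed

section \<open>The potential along the trajectory\<close>

lemma segment_bound:
  fixes f :: "real^'d::finite \<Rightarrow> real"
  assumes s: "smooth f" and B: "\<And>\<tau> i. 0 < \<tau> \<Longrightarrow> \<tau> < 1 \<Longrightarrow> \<bar>partial i f (b + \<tau> *\<^sub>R (a - b))\<bar> \<le> B"
  shows "\<bar>f a - f b\<bar> \<le> real CARD('d) * B * norm (a - b)"
proof -
  have "\<exists>\<tau>. 0 < \<tau> \<and> \<tau> < 1 \<and> f (b + 1 *\<^sub>R (a - b)) - f (b + 0 *\<^sub>R (a - b)) = (1 - 0) * dir_deriv (a - b) f (b + \<tau> *\<^sub>R (a - b))"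
    by (rule MVT2[where f = "\<lambda>\<tau>. f (b + \<tau> *\<^sub>R (a - b))"]) (auto intro: smooth_deriv_line[OF s])
  then obtain \<tau> where \<tau>: "0 < \<tau>" "\<tau> < 1" "f a - f b = dir_deriv (a - b) f (b + \<tau> *\<^sub>R (a - b))" by auto
  have "\<bar>f a - f b\<bar> = \<bar>\<Sum>i\<in>UNIV. ((a - b) $ i) *\<^sub>R partial i f (b + \<tau> *\<^sub>R (a - b))\<bar>"
    unfolding \<tau>(3) dir_deriv_def frechet_derivative_partial[OF s] ..
  also have "\<dots> \<le> (\<Sum>i\<in>(UNIV::'d set). norm (a - b) * B)"
  proof (rule order_trans[OF sum_abs sum_mono])
    fix i
    show "\<bar>((a - b) $ i) *\<^sub>R partial i f (b + \<tau> *\<^sub>R (a - b))\<bar> \<le> norm (a - b) * B"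
      unfolding real_scaleR_def abs_mult by (intro mult_mono component_le_norm_cart B \<tau>) auto
  qed
  also have "\<dots> = real CARD('d) * B * norm (a - b)" by simp
  finally show ?thesis .
qed

lemma norm_segment: "0 < \<tau> \<Longrightarrow> \<tau> < 1 \<Longrightarrow> norm (b + \<tau> *\<^sub>R (a - b)) \<le> norm a + norm b"
proof -
  assume t: "0 < \<tau>" "\<tau> < 1"
  have "b + \<tau> *\<^sub>R (a - b) = \<tau> *\<^sub>R a + (1 - \<tau>) *\<^sub>R b" by (simp add: algebra_simps)
  also have "norm \<dots> \<le> norm (\<tau> *\<^sub>R a) + norm ((1 - \<tau>) *\<^sub>R b)" by (rule norm_triangle_ineq)
  also have "\<dots> = \<tau> * norm a + (1 - \<tau>) * norm b" using t by simp
  also have "\<dots> \<le> 1 * norm a + 1 * norm b" using t by (intro add_mono mult_right_mono) auto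
  finally show ?thesis by simp
qed

lemma norm_segment_0: "0 < \<tau> \<Longrightarrow> \<tau> < 1 \<Longrightarrow> norm (0 + \<tau> *\<^sub>R (a - 0)) \<le> norm a"
  using mult_right_mono[of \<tau> 1 "norm a"] by simp

definition scaled_potential :: "(real^'d::finite \<Rightarrow> real) \<Rightarrow> real \<Rightarrow> real^'d \<Rightarrow> real^'d \<Rightarrow> real" where
  "scaled_potential V \<epsilon> x0 y = (V (x0 + sqrt \<epsilon> *\<^sub>R y) - V x0 - sqrt \<epsilon> * (y \<bullet> gradient V x0)) / \<epsilon>"

context
  fixes V :: "real^'d::finite \<Rightarrow> real" and B2 B3 :: real and \<epsilon> :: real and x0 :: "real^'d"
  assumes V: "smooth V" and B2: "\<And>i j x. \<bar>partial i (partial j V) x\<bar> \<le> B2"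
    and B3: "\<And>i j l x. \<bar>partial l (partial i (partial j V)) x\<bar> \<le> B3"
    and \<epsilon>: "0 < \<epsilon>"
begin

lemma smooth_translate: "smooth f \<Longrightarrow> smooth (\<lambda>y::real^'d. f (x0 + c *\<^sub>R y))"
  using smooth_affine[of f c x0] by (simp add: add.commute)

lemma partial_translate:
  "smooth f \<Longrightarrow> partial j (\<lambda>y::real^'d. f (x0 + c *\<^sub>R y)) = (\<lambda>y. c *\<^sub>R partial j f (x0 + c *\<^sub>R y))"
  using dir_deriv_affine[of f "axis j 1" c x0] unfolding partial_def by (simp add: add.commute)

lemma scaled_potential_eq: "scaled_potential V \<epsilon> x0 =
    (\<lambda>y. (1 / \<epsilon>) * (V (x0 + sqrt \<epsilon> *\<^sub>R y) + (- V x0 + (- sqrt \<epsilon>) * (y \<bullet> gradient V x0))))"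
  by (simp add: scaled_potential_def fun_eq_iff)

lemma smooth_scaled_potential: "smooth (scaled_potential V \<epsilon> x0)"
  unfolding scaled_potential_eq
  by (intro smooth_mult[OF smooth_const] smooth_add smooth_translate[OF V] smooth_const smooth_inner[OF smooth_id smooth_const])

lemma partial_scaled_potential:
  "partial j (scaled_potential V \<epsilon> x0) = (\<lambda>y. (1 / sqrt \<epsilon>) * (partial j V (x0 + sqrt \<epsilon> *\<^sub>R y) + (- partial j V x0)))"
proof -
  note l = smooth_linear[OF bounded_linear_inner_left[of "gradient V x0"]]
  have pl: "partial j (\<lambda>y. y \<bullet> gradient V x0) = (\<lambda>y. partial j V x0)"
    unfolding partial_def
    using dir_deriv_eq[OF bounded_linear_imp_has_derivative[OF bounded_linear_inner_left[of "gradient V x0"]]]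
    by (auto simp: inner_axis' gradient_def partial_def)
  have e: "sqrt \<epsilon> / \<epsilon> = 1 / sqrt \<epsilon>" using \<epsilon> by (simp add: field_simps)
  have "partial j (scaled_potential V \<epsilon> x0) = (\<lambda>y. (1 / \<epsilon>) * (sqrt \<epsilon> * partial j V (x0 + sqrt \<epsilon> *\<^sub>R y) + (0 + (- sqrt \<epsilon>) * partial j V x0)))"
    unfolding scaled_potential_eq
      partial_cmult[OF smooth_add[OF smooth_translate[OF V] smooth_add[OF smooth_const smooth_mult[OF smooth_const l]]]]
      partial_add[OF smooth_translate[OF V] smooth_add[OF smooth_const smooth_mult[OF smooth_const l]]]
      partial_add[OF smooth_const smooth_mult[OF smooth_const l]] partial_translate[OF V] partial_const partial_cmult[OF l] pl
    by (simp only: real_scaleR_def)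
  also have "\<dots> = (\<lambda>y. (sqrt \<epsilon> / \<epsilon>) * (partial j V (x0 + sqrt \<epsilon> *\<^sub>R y) + (- partial j V x0)))"
    by (simp add: fun_eq_iff algebra_simps)
  finally show ?thesis unfolding e .
qed

lemma B_nonneg: "0 \<le> B2" "0 \<le> B3"
  using B2 B3 order_trans[OF abs_ge_zero] by blast+

lemma partial_scaled_potential_bound: "\<bar>partial j (scaled_potential V \<epsilon> x0) y\<bar> \<le> real CARD('d) * B2 * norm y"
proof -
  have "\<bar>partial j V (x0 + sqrt \<epsilon> *\<^sub>R y) - partial j V x0\<bar> \<le> real CARD('d) * B2 * norm ((x0 + sqrt \<epsilon> *\<^sub>R y) - x0)"
    by (rule segment_bound[OF smooth_partial[OF V]]) (rule B2)
  then have "(1 / sqrt \<epsilon>) * \<bar>partial j V (x0 + sqrt \<epsilon> *\<^sub>R y) - partial j V x0\<bar> \<le> (1 / sqrt \<epsilon>) * (real CARD('d) * B2 * (sqrt \<epsilon> * norm y))"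
    using \<epsilon> by (intro mult_left_mono) auto
  also have "\<dots> = real CARD('d) * B2 * norm y" using \<epsilon> by simp
  finally show ?thesis unfolding partial_scaled_potential using \<epsilon> by (simp add: abs_mult)
qed

lemma scaled_potential_lipschitz:
  "\<bar>scaled_potential V \<epsilon> x0 y - scaled_potential V \<epsilon> x0 z\<bar> \<le> (real CARD('d) * real CARD('d) * B2) * norm (y - z) * (norm y + norm z)"
proof -
  have "\<bar>scaled_potential V \<epsilon> x0 y - scaled_potential V \<epsilon> x0 z\<bar> \<le> real CARD('d) * (real CARD('d) * B2 * (norm y + norm z)) * norm (y - z)"
  proof (rule segment_bound[OF smooth_scaled_potential])
    fix \<tau> :: real and i assume "0 < \<tau>" "\<tau> < 1"
    then have "norm (z + \<tau> *\<^sub>R (y - z)) \<le> norm y + norm z" by (rule norm_segment)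
    then have "real CARD('d) * B2 * norm (z + \<tau> *\<^sub>R (y - z)) \<le> real CARD('d) * B2 * (norm y + norm z)"
      using B_nonneg by (intro mult_left_mono) auto
    then show "\<bar>partial i (scaled_potential V \<epsilon> x0) (z + \<tau> *\<^sub>R (y - z))\<bar> \<le> real CARD('d) * B2 * (norm y + norm z)"
      using partial_scaled_potential_bound order_trans by blast
  qed
  then show ?thesis by (simp only: mult_ac)
qed

lemma hessian_sym: "hessian V x0 $ i $ j = hessian V x0 $ j $ i"
  by (simp add: hessian_def partial_commute[OF V, of i j])

lemma scaled_potential_taylor:
  "\<bar>scaled_potential V \<epsilon> x0 y - (y \<bullet> (hessian V x0 *v y)) / 2\<bar> \<le> real CARD('d) ^ 3 * B3 * sqrt \<epsilon> * norm y ^ 3"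
proof -
  let ?Q = "\<lambda>y. (y \<bullet> (hessian V x0 *v y)) / 2" and ?d = "real CARD('d)"
  define R where "R y = scaled_potential V \<epsilon> x0 y + (- 1) * ?Q y" for y
  define H where "H j y = (1 / sqrt \<epsilon>) * (partial j V (x0 + sqrt \<epsilon> *\<^sub>R y) + (- partial j V x0)) + (- 1) * (\<Sum>l\<in>UNIV. hessian V x0 $ j $ l * y $ l)" for j y
  have sR: "smooth R" unfolding R_def[abs_def]
    by (rule smooth_add[OF smooth_scaled_potential smooth_mult[OF smooth_const smooth_quadratic]])
  have pR: "partial j R = H j" for j
    unfolding R_def[abs_def] H_def[abs_def] partial_add[OF smooth_scaled_potential smooth_mult[OF smooth_const smooth_quadratic]]
      partial_cmult[OF smooth_quadratic] partial_scaled_potential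
    by (simp add: partial_quadratic[OF hessian_sym])
  have sH1: "smooth (\<lambda>y. partial j V (x0 + sqrt \<epsilon> *\<^sub>R y) + (- partial j V x0))" for j
    by (rule smooth_add[OF smooth_translate[OF smooth_partial[OF V]] smooth_const])
  have sH2: "smooth (\<lambda>y::real^'d. \<Sum>l\<in>UNIV. hessian V x0 $ j $ l * y $ l)" for j
    by (rule smooth_sum[OF smooth_mult[OF smooth_const smooth_nth]])
  have sH: "smooth (H j)" for j unfolding H_def[abs_def]
    by (rule smooth_add[OF smooth_mult[OF smooth_const sH1] smooth_mult[OF smooth_const sH2]])
  have pH: "partial i (H j) y = partial i (partial j V) (x0 + sqrt \<epsilon> *\<^sub>R y) - partial i (partial j V) x0" for i j y
  proof -
    have "partial i (\<lambda>y::real^'d. \<Sum>l\<in>UNIV. hessian V x0 $ j $ l * y $ l) = (\<lambda>y. \<Sum>l\<in>UNIV. hessian V x0 $ j $ l * (if i = l then 1 else 0))"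
      unfolding partial_sum[OF smooth_mult[OF smooth_const smooth_nth]] partial_cmult[OF smooth_nth] partial_nth ..
    also have "\<dots> = (\<lambda>y. partial i (partial j V) x0)"
      using hessian_sym[of j i] by (simp add: hessian_def if_distrib[of "(*) _"] cong: if_cong)
    finally have 1: "partial i (\<lambda>y::real^'d. \<Sum>l\<in>UNIV. hessian V x0 $ j $ l * y $ l) = (\<lambda>y. partial i (partial j V) x0)" .
    have "partial i (H j) = (\<lambda>y. (1 / sqrt \<epsilon>) * (sqrt \<epsilon> *\<^sub>R partial i (partial j V) (x0 + sqrt \<epsilon> *\<^sub>R y) + 0) + (- 1) * partial i (partial j V) x0)"
      unfolding H_def[abs_def] partial_add[OF smooth_mult[OF smooth_const sH1] smooth_mult[OF smooth_const sH2]]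
        partial_cmult[OF sH1] partial_cmult[OF sH2] 1
        partial_add[OF smooth_translate[OF smooth_partial[OF V]] smooth_const] partial_translate[OF smooth_partial[OF V]] partial_const ..
    then show ?thesis using \<epsilon> by simp
  qed
  have bpH: "\<bar>partial i (H j) y\<bar> \<le> ?d * B3 * (sqrt \<epsilon> * norm y)" for i j y
  proof -
    have "\<bar>partial i (partial j V) (x0 + sqrt \<epsilon> *\<^sub>R y) - partial i (partial j V) x0\<bar> \<le> ?d * B3 * norm ((x0 + sqrt \<epsilon> *\<^sub>R y) - x0)"
      by (rule segment_bound[OF smooth_partial[OF smooth_partial[OF V]]]) (rule B3)
    then show ?thesis unfolding pH using \<epsilon> by simp
  qed
  have bH: "\<bar>H j y\<bar> \<le> ?d * (?d * B3 * (sqrt \<epsilon> * norm y)) * norm y" for j y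
  proof -
    have "\<bar>H j y - H j 0\<bar> \<le> ?d * (?d * B3 * (sqrt \<epsilon> * norm y)) * norm (y - 0)"
    proof (rule segment_bound[OF sH])
      fix \<tau> :: real and i assume t: "0 < \<tau>" "\<tau> < 1"
      have "?d * B3 * (sqrt \<epsilon> * norm (0 + \<tau> *\<^sub>R (y - 0))) \<le> ?d * B3 * (sqrt \<epsilon> * norm y)"
        using norm_segment_0[OF t, of y] B_nonneg \<epsilon> by (intro mult_left_mono) auto
      then show "\<bar>partial i (H j) (0 + \<tau> *\<^sub>R (y - 0))\<bar> \<le> ?d * B3 * (sqrt \<epsilon> * norm y)"
        using bpH order_trans by blast
    qed
    moreover have "H j 0 = 0" by (simp add: H_def)
    ultimately show ?thesis by simp
  qed
  have "\<bar>R y - R 0\<bar> \<le> ?d * (?d * (?d * B3 * (sqrt \<epsilon> * norm y)) * norm y) * norm (y - 0)"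
  proof (rule segment_bound[OF sR])
    fix \<tau> :: real and i assume t: "0 < \<tau>" "\<tau> < 1"
    let ?w = "0 + \<tau> *\<^sub>R (y - 0)"
    have "?d * (?d * B3 * (sqrt \<epsilon> * norm ?w)) * norm ?w \<le> ?d * (?d * B3 * (sqrt \<epsilon> * norm y)) * norm y"
      using norm_segment_0[OF t, of y] B_nonneg \<epsilon> by (intro mult_mono mult_left_mono mult_nonneg_nonneg) auto
    then show "\<bar>partial i R ?w\<bar> \<le> ?d * (?d * B3 * (sqrt \<epsilon> * norm y)) * norm y"
      unfolding pR using bH order_trans by blast
  qed
  moreover have "R 0 = 0" by (simp add: R_def scaled_potential_def)
  ultimately show ?thesis by (simp add: R_def power3_eq_cube mult_ac)
qed

end

lemma second_third_derivative_bounds: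
  fixes V :: "real^'d::finite \<Rightarrow> real"
  assumes V: "smooth V" and b: "\<And>\<alpha>. mi_order \<alpha> \<ge> 2 \<Longrightarrow> bounded (range (mi_deriv \<alpha> V))"
  obtains B2 B3 where "\<And>i j x. \<bar>partial i (partial j V) x\<bar> \<le> B2" "\<And>i j l x. \<bar>partial l (partial i (partial j V)) x\<bar> \<le> B3"
proof -
  define \<alpha>1 :: "'d \<Rightarrow> 'd \<Rightarrow> nat" where "\<alpha>1 j = (\<lambda>i. 0)(j := Suc 0)" for j
  have 1: "mi_deriv (\<alpha>1 j) V = partial j V" "mi_order (\<alpha>1 j) = 1" for j
    using mi_deriv_Suc(1)[OF V, of "\<lambda>i. 0" j] mi_order_Suc[of "\<lambda>i::'d. 0" j] by (simp_all add: \<alpha>1_def)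
  define \<alpha>2 where "\<alpha>2 i j = (\<alpha>1 j)(i := Suc (\<alpha>1 j i))" for i j
  have 2: "mi_deriv (\<alpha>2 i j) V = partial i (partial j V)" "mi_order (\<alpha>2 i j) = 2" for i j
    unfolding \<alpha>2_def using 1 by (simp_all add: mi_deriv_Suc(1)[OF V] mi_order_Suc)
  define \<alpha>3 where "\<alpha>3 l i j = (\<alpha>2 i j)(l := Suc (\<alpha>2 i j l))" for l i j
  have 3: "mi_deriv (\<alpha>3 l i j) V = partial l (partial i (partial j V))" "mi_order (\<alpha>3 l i j) = 3" for l i j
    unfolding \<alpha>3_def using 2 by (simp_all add: mi_deriv_Suc(1)[OF V] mi_order_Suc)
  have "\<exists>c. \<forall>x. \<bar>partial i (partial j V) x\<bar> \<le> c" for i j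
    using b[of "\<alpha>2 i j"] 2[of i j] by (auto simp: bounded_iff)
  then obtain c where c: "\<And>i j x. \<bar>partial i (partial j V) x\<bar> \<le> c i j" by metis
  have "\<exists>c. \<forall>x. \<bar>partial l (partial i (partial j V)) x\<bar> \<le> c" for l i j
    using b[of "\<alpha>3 l i j"] 3[of l i j] by (auto simp: bounded_iff)
  then obtain e where e: "\<And>l i j x. \<bar>partial l (partial i (partial j V)) x\<bar> \<le> e l i j" by metis
  have c0: "0 \<le> c i j" for i j using order_trans[OF abs_ge_zero c] .
  have e0: "0 \<le> e l i j" for l i j using order_trans[OF abs_ge_zero e] .
  show ?thesis
  proof (rule that[of "\<Sum>i\<in>UNIV. \<Sum>j\<in>UNIV. c i j" "\<Sum>l\<in>UNIV. \<Sum>i\<in>UNIV. \<Sum>j\<in>UNIV. e l i j"])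
    fix i j x
    have "c i j \<le> (\<Sum>j\<in>UNIV. c i j)" by (rule member_le_sum) (auto simp: c0)
    also have "\<dots> \<le> (\<Sum>i\<in>UNIV. \<Sum>j\<in>UNIV. c i j)"
      by (rule member_le_sum[where f = "\<lambda>i. \<Sum>j\<in>UNIV. c i j"]) (auto simp: c0 sum_nonneg)
    finally show "\<bar>partial i (partial j V) x\<bar> \<le> (\<Sum>i\<in>UNIV. \<Sum>j\<in>UNIV. c i j)" using c order_trans by blast
  next
    fix i j l x
    have "e l i j \<le> (\<Sum>j\<in>UNIV. e l i j)" by (rule member_le_sum) (auto simp: e0)
    also have "\<dots> \<le> (\<Sum>i\<in>UNIV. \<Sum>j\<in>UNIV. e l i j)"
      by (rule member_le_sum[where f = "\<lambda>i. \<Sum>j\<in>UNIV. e l i j"]) (auto simp: e0 sum_nonneg)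
    also have "\<dots> \<le> (\<Sum>l\<in>UNIV. \<Sum>i\<in>UNIV. \<Sum>j\<in>UNIV. e l i j)"
      by (rule member_le_sum[where f = "\<lambda>l. \<Sum>i\<in>UNIV. \<Sum>j\<in>UNIV. e l i j"]) (auto simp: e0 sum_nonneg)
    finally show "\<bar>partial l (partial i (partial j V)) x\<bar> \<le> (\<Sum>l\<in>UNIV. \<Sum>i\<in>UNIV. \<Sum>j\<in>UNIV. e l i j)" using e order_trans by blast
  qed
qed

section \<open>The cross product in dimensions 2 and 3\<close>

lemma UNIV_card2:
  assumes "CARD('d::{finite,comm_ring_1}) = 2"
  shows "(UNIV :: 'd set) = {1, 2}" "(1::'d) \<noteq> 2"
proof -
  have "(2::'d) = 1 + 1" by (rule one_add_one[symmetric])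
  then show ne: "(1::'d) \<noteq> 2" by (metis add_cancel_right_left zero_neq_one)
  show "(UNIV :: 'd set) = {1, 2}"
    using card_subset_eq[of UNIV "{1, 2::'d}"] ne assms by simp
qed

lemma UNIV_card3:
  assumes c: "CARD('d::{finite,comm_ring_1}) = 3"
  shows "(UNIV :: 'd set) = {1, 2, 3}" "(1::'d) \<noteq> 2" "(1::'d) \<noteq> 3" "(2::'d) \<noteq> 3"
proof -
  have two: "(2::'d) = 1 + 1" by (rule one_add_one[symmetric])
  have three: "(3::'d) = 2 + 1" by simp
  have nz: "(1::'d) + 1 \<noteq> 0"
  proof
    assume z: "(1::'d) + 1 = 0"
    have "(UNIV :: 'd set) \<noteq> {0, 1}"
    proof
      assume "(UNIV :: 'd set) = {0, 1}"
      then have "CARD('d) = card {0, 1::'d}" by (rule arg_cong)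
      then show False using c by simp
    qed
    then obtain x :: 'd where x: "x \<noteq> 0" "x \<noteq> 1" by auto
    have "x + 1 \<noteq> 0" using x(2) z by (metis add_right_cancel)
    moreover have "x + 1 \<noteq> 1" "x + 1 \<noteq> x" using x(1) by auto
    ultimately have "card {0, 1, x, x + 1} = 4" using x by simp
    then show False using card_mono[of "UNIV :: 'd set" "{0, 1, x, x + 1}"] c by simp
  qed
  show 12: "(1::'d) \<noteq> 2" unfolding two by (metis add_cancel_right_left zero_neq_one)
  show 23: "(2::'d) \<noteq> 3" unfolding three by (metis add_cancel_right_right zero_neq_one)
  show 13: "(1::'d) \<noteq> 3" unfolding three two using nz by (metis add.commute add_cancel_right_right)
  show "(UNIV :: 'd set) = {1, 2, 3}"
    using card_subset_eq[of UNIV "{1, 2, 3::'d}"] 12 13 23 c by simp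
qed

lemma skew_wedge:
  assumes dim: "CARD('d::{finite,comm_ring_1}) = 2 \<or> CARD('d::_) = 3"
  shows "skew (wedge \<Omega> :: real^'d::_ \<Rightarrow> real^'d::_)"
  unfolding skew_def
proof (intro conjI allI)
  have add: "to_R3 (x + y) = to_R3 x + to_R3 y" for x y :: "real^'d::_"
    by (simp add: to_R3_def vec_eq_iff forall_3)
  have scale: "to_R3 (c *\<^sub>R x) = c *\<^sub>R to_R3 x" for c and x :: "real^'d::_"
    by (simp add: to_R3_def vec_eq_iff forall_3)
  show "linear (wedge \<Omega> :: real^'d::_ \<Rightarrow> real^'d::_)"
    by (rule linearI) (auto simp: wedge_def vec_eq_iff add scale cross_add_right cross_mult_right)
  fix x y :: "real^'d::_"
  show "wedge \<Omega> x \<bullet> y = - (x \<bullet> wedge \<Omega> y)"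
    using dim
  proof
    assume c: "CARD('d) = 2"
    show ?thesis
      unfolding inner_vec_def UNIV_card2(1)[OF c]
      using UNIV_card2(2)[OF c] c by (simp add: wedge_def to_R3_def cross3_def algebra_simps)
  next
    assume c: "CARD('d) = 3"
    show ?thesis
      unfolding inner_vec_def UNIV_card3(1)[OF c]
      using UNIV_card3(2-4)[OF c] c by (simp add: wedge_def to_R3_def cross3_def algebra_simps)
  qed
qed

section \<open>The error estimate\<close>

lemma from_frame_L2:
  fixes q p :: "real \<Rightarrow> real^'d::finite"
  assumes \<epsilon>: "0 < \<epsilon>" and f: "f \<in> L2"
  shows "from_frame \<epsilon> q p S t f \<in> L2"
proof (rule L2_I[OF from_frame_measurable[OF \<epsilon> L2_measurable[OF f]]])
  let ?c = "1 / sqrt \<epsilon>" and ?a = "(- (1 / sqrt \<epsilon>)) *\<^sub>R q t"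
  have "integrable lborel (\<lambda>x. (norm (f (?a + ?c *\<^sub>R x)))\<^sup>2)"
    using integrable_lborel_affine[OF L2_integrable_square[OF f], of ?c ?a] \<epsilon> by simp
  then have "integrable lborel (\<lambda>x. (\<epsilon> powr (- real CARD('d) / 4))\<^sup>2 * (norm (f (?a + ?c *\<^sub>R x)))\<^sup>2)"
    by (rule integrable_mult_right)
  moreover have "(norm (from_frame \<epsilon> q p S t f x))\<^sup>2 = (\<epsilon> powr (- real CARD('d) / 4))\<^sup>2 * (norm (f (?a + ?c *\<^sub>R x)))\<^sup>2" for x
    unfolding from_frame_affine[OF \<epsilon>] by (simp add: norm_mult norm_phase[OF \<epsilon>] power_mult_distrib add.commute)
  ultimately show "integrable lborel (\<lambda>x. (norm (from_frame \<epsilon> q p S t f x))\<^sup>2)" by (simp only:)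
qed

lemma continuous_L2_diff:
  fixes u w :: "real \<Rightarrow> real^'d::finite \<Rightarrow> complex"
  assumes "continuous_L2 u" "continuous_L2 w"
  shows "continuous_L2 (\<lambda>t x. u t x - w t x)"
  unfolding continuous_L2_def
proof (intro conjI allI)
  have L: "u t \<in> L2" "w t \<in> L2" for t using assms by (auto simp: continuous_L2_def)
  show "(\<lambda>x. u t x - w t x) \<in> L2" for t by (rule L2_diff[OF L])
  fix t
  have cu: "((\<lambda>s. L2_norm (\<lambda>x. u s x - u t x)) \<longlongrightarrow> 0) (at t)"
    and cw: "((\<lambda>s. L2_norm (\<lambda>x. w s x - w t x)) \<longlongrightarrow> 0) (at t)"
    using assms unfolding continuous_L2_def by blast+
  have lim: "((\<lambda>s. L2_norm (\<lambda>x. u s x - u t x) + L2_norm (\<lambda>x. w s x - w t x)) \<longlongrightarrow> 0) (at t)"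
    using tendsto_add[OF cu cw] by simp
  have le: "L2_norm (\<lambda>x. (u s x - w s x) - (u t x - w t x)) \<le> L2_norm (\<lambda>x. u s x - u t x) + L2_norm (\<lambda>x. w s x - w t x)" for s
  proof -
    have e: "(\<lambda>x. (u s x - w s x) - (u t x - w t x)) = (\<lambda>x. (u s x - u t x) + (-1) * (w s x - w t x))"
      by (rule ext) simp
    have "L2_norm (\<lambda>x. (u s x - u t x) + (-1) * (w s x - w t x))
        \<le> L2_norm (\<lambda>x. u s x - u t x) + L2_norm (\<lambda>x. (-1) * (w s x - w t x))"
      by (rule L2_norm_triangle[OF L2_diff[OF L(1) L(1)] L2_scale[OF L2_diff[OF L(2) L(2)]]])
    then show ?thesis unfolding e L2_norm_scale by simp
  qed
  show "((\<lambda>s. L2_norm (\<lambda>x. (u s x - w s x) - (u t x - w t x))) \<longlongrightarrow> 0) (at t)"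
    by (rule Lim_null_comparison[OF always_eventually lim]) (use le in \<open>simp add: L2_norm_def\<close>)
qed

lemma weak_solution_diff:
  fixes u v :: "real \<Rightarrow> real^'d::finite \<Rightarrow> complex" and U U' :: "real \<Rightarrow> real^'d \<Rightarrow> real"
  assumes W: "linear W" and u: "weak_solution W U u (\<lambda>t x. 0)" and v: "weak_solution W U' v (\<lambda>t x. 0)"
    and L: "\<And>t. u t \<in> L2" "\<And>t. v t \<in> L2" and s: "\<And>t. smooth (U t)" "\<And>t. smooth (U' t)"
  shows "weak_solution W U (\<lambda>t x. u t x - v t x) (\<lambda>t x. of_real (U t x - U' t x) * v t x)"
  unfolding weak_solution_def
proof (intro allI impI)
  fix \<eta> :: "real^'d \<Rightarrow> complex" and t assume \<eta>: "test_function \<eta>"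
  have H: "ham W (U t) \<eta> \<in> L2" "ham W (U' t) \<eta> \<in> L2" by (intro test_function_L2 test_function_ham W s \<eta>)+
  have d\<eta>: "test_function (\<lambda>x. of_real (U t x - U' t x) * \<eta> x)"
    by (intro test_function_mult_smooth smooth_of_real smooth_diff s \<eta>)
  have z: "L2_inner \<eta> (\<lambda>x. 0) = 0" by (simp add: L2_inner_def)
  have "L2_inner (ham W (U t) \<eta>) (v t) = L2_inner (\<lambda>x. ham W (U' t) \<eta> x + of_real (U t x - U' t x) * \<eta> x) (v t)"
    by (intro arg_cong2[where f = L2_inner]) (auto simp: ham_def fun_eq_iff algebra_simps)
  also have "\<dots> = L2_inner (ham W (U' t) \<eta>) (v t) + L2_inner (\<lambda>x. of_real (U t x - U' t x) * \<eta> x) (v t)"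
    by (rule L2_inner_add_left[OF L(2) H(2) test_function_L2[OF d\<eta>]])
  also have "L2_inner (\<lambda>x. of_real (U t x - U' t x) * \<eta> x) (v t) = L2_inner \<eta> (\<lambda>x. of_real (U t x - U' t x) * v t x)"
    by (simp add: L2_inner_def mult_ac)
  finally have v': "L2_inner (ham W (U' t) \<eta>) (v t) = L2_inner (ham W (U t) \<eta>) (v t) - L2_inner \<eta> (\<lambda>x. of_real (U t x - U' t x) * v t x)"
    by simp
  have "((\<lambda>s. L2_inner \<eta> (u s) - L2_inner \<eta> (v s)) has_vector_derivative
      (- \<i> * (L2_inner (ham W (U t) \<eta>) (u t) + L2_inner \<eta> (\<lambda>x. 0)) - - \<i> * (L2_inner (ham W (U' t) \<eta>) (v t) + L2_inner \<eta> (\<lambda>x. 0)))) (at t)"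
    using u v \<eta> unfolding weak_solution_def by (intro has_vector_derivative_diff) blast+
  moreover have "- \<i> * (L2_inner (ham W (U t) \<eta>) (u t) + L2_inner \<eta> (\<lambda>x. 0)) - - \<i> * (L2_inner (ham W (U' t) \<eta>) (v t) + L2_inner \<eta> (\<lambda>x. 0))
     = - \<i> * (L2_inner (ham W (U t) \<eta>) (\<lambda>x. u t x - v t x) + L2_inner \<eta> (\<lambda>x. of_real (U t x - U' t x) * v t x))"
    unfolding z v' L2_inner_diff_right[OF H(1) L] by (simp add: algebra_simps)
  ultimately show "((\<lambda>s. L2_inner \<eta> (\<lambda>x. u s x - v s x)) has_vector_derivative
     - \<i> * (L2_inner (ham W (U t) \<eta>) (\<lambda>x. u t x - v t x) + L2_inner \<eta> (\<lambda>x. of_real (U t x - U' t x) * v t x))) (at t)"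
    unfolding L2_inner_diff_right[OF test_function_L2[OF \<eta>] L] by (simp only:)
qed

lemma norm_cube_le_sum:
  fixes y :: "real^'d::finite"
  shows "norm y ^ 3 \<le> real CARD('d) ^ 3 * (\<Sum>j\<in>UNIV. \<bar>y $ j\<bar> ^ 3)"
proof -
  obtain m where m: "\<And>j. \<bar>y $ j\<bar> \<le> \<bar>y $ m\<bar>"
  proof -
    have "finite (range (\<lambda>j. \<bar>y $ j\<bar>))" "range (\<lambda>j. \<bar>y $ j\<bar>) \<noteq> {}" by auto
    from Max_in[OF this] obtain m where "Max (range (\<lambda>j. \<bar>y $ j\<bar>)) = \<bar>y $ m\<bar>" by (rule imageE)
    then show ?thesis using that[of m] Max_ge[OF \<open>finite (range (\<lambda>j. \<bar>y $ j\<bar>))\<close>] by (metis rangeI)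
  qed
  have "norm y \<le> (\<Sum>j\<in>UNIV. \<bar>y $ j\<bar>)" by (rule norm_le_l1_cart)
  also have "\<dots> \<le> (\<Sum>j\<in>(UNIV::'d set). \<bar>y $ m\<bar>)" by (intro sum_mono m)
  finally have "norm y \<le> real CARD('d) * \<bar>y $ m\<bar>" by simp
  then have "norm y ^ 3 \<le> (real CARD('d) * \<bar>y $ m\<bar>) ^ 3" by (rule power_mono) simp
  also have "\<dots> = real CARD('d) ^ 3 * \<bar>y $ m\<bar> ^ 3" by (rule power_mult_distrib)
  also have "\<dots> \<le> real CARD('d) ^ 3 * (\<Sum>j\<in>UNIV. \<bar>y $ j\<bar> ^ 3)"
    by (intro mult_left_mono member_le_sum[where f = "\<lambda>j. \<bar>y $ j\<bar> ^ 3"]) auto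
  finally show ?thesis .
qed

lemma cubic_multiplication:
  fixes v :: "real \<Rightarrow> real^'d::finite \<Rightarrow> complex"
  assumes v: "continuous_Sigma 3 v" and m [measurable]: "m \<in> borel_measurable borel"
    and b: "\<And>y. \<bar>m y\<bar> \<le> c * norm y ^ 3" and c: "0 \<le> c"
  shows "(\<lambda>y. of_real (m y) * v t y) \<in> L2"
    and "L2_norm (\<lambda>y. of_real (m y) * v t y) \<le> c * real CARD('d) ^ 3 * real CARD('d) * wd_norm v 3 t"
proof -
  have S: "v t \<in> Sigma_space 3" using v by (simp add: continuous_Sigma_def)
  have vm [measurable]: "v t \<in> borel_measurable borel" using S by (simp add: Sigma_space_def L2_measurable)
  define \<alpha> :: "'d \<Rightarrow> 'd \<Rightarrow> nat" where "\<alpha> j = (\<lambda>i. if i = j then 3 else 0)" for j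
  have p: "mi_power y (\<alpha> j) = (y $ j) ^ 3" for j y
  proof -
    have "mi_power y (\<alpha> j) = (\<Prod>i\<in>UNIV. if i = j then (y $ j) ^ 3 else 1)"
      unfolding mi_power_def \<alpha>_def by (intro prod.cong) auto
    then show ?thesis by simp
  qed
  have o: "mi_order (\<alpha> j) = 3" for j by (simp add: mi_order_def \<alpha>_def)
  let ?w = "\<lambda>j. weighted_deriv (\<alpha> j) (\<lambda>i. 0) (v t)"
  have mem: "(\<alpha> j, (\<lambda>i. 0)) \<in> mi_pairs 3" for j using o by (simp add: mi_pairs_def)
  have wL: "?w j \<in> L2" for j by (rule Sigma_space_weighted_L2[OF S]) (simp add: o)
  have wle: "L2_norm (?w j) \<le> wd_norm v 3 t" for j
    using wd_le_norm[OF v mem[of j], of t] by simp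
  let ?G = "\<lambda>y. \<Sum>j\<in>UNIV. complex_of_real (norm (?w j y))"
  have nL: "(\<lambda>y. complex_of_real (norm (?w j y))) \<in> L2" for j
    by (rule L2_bound[OF wL[of j], of _ 1]) (use L2_measurable[OF wL[of j]] in auto)
  have nn: "L2_norm (\<lambda>y. complex_of_real (norm (?w j y))) = L2_norm (?w j)" for j
    by (simp add: L2_norm_def)
  have GL: "?G \<in> L2" by (rule L2_sum[OF nL])
  have Gn: "L2_norm ?G \<le> real CARD('d) * wd_norm v 3 t"
  proof -
    have "L2_norm ?G \<le> (\<Sum>j\<in>UNIV. L2_norm (\<lambda>y. complex_of_real (norm (?w j y))))"
      by (rule L2_norm_sum[OF _ nL]) simp
    also have "\<dots> \<le> (\<Sum>j\<in>(UNIV::'d set). wd_norm v 3 t)" unfolding nn by (intro sum_mono wle)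
    finally show ?thesis by simp
  qed
  have meas: "(\<lambda>y. of_real (m y) * v t y) \<in> borel_measurable borel" by measurable
  have ae: "AE y in lborel. norm (of_real (m y) * v t y) \<le> (c * real CARD('d) ^ 3) * norm (?G y)"
    using weak_deriv_zero_AE[OF S]
  proof eventually_elim
    case (elim y)
    have "norm (?w j y) = \<bar>y $ j\<bar> ^ 3 * norm (v t y)" for j
      by (simp add: weighted_deriv_def p elim norm_mult norm_power power_abs)
    then have G: "norm (?G y) = (\<Sum>j\<in>UNIV. \<bar>y $ j\<bar> ^ 3) * norm (v t y)"
      by (simp only: of_real_sum[symmetric] norm_of_real sum_distrib_right[symmetric]) (simp add: sum_nonneg)
    have "norm (of_real (m y) * v t y) \<le> (c * norm y ^ 3) * norm (v t y)"
      unfolding norm_mult norm_of_real by (intro mult_right_mono b) simp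
    also have "\<dots> \<le> (c * (real CARD('d) ^ 3 * (\<Sum>j\<in>UNIV. \<bar>y $ j\<bar> ^ 3))) * norm (v t y)"
      by (intro mult_right_mono mult_left_mono norm_cube_le_sum c) simp
    also have "\<dots> = (c * real CARD('d) ^ 3) * norm (?G y)" unfolding G by (simp only: mult_ac)
    finally show ?case .
  qed
  show "(\<lambda>y. of_real (m y) * v t y) \<in> L2" by (rule L2_bound[OF GL meas ae])
  have "L2_norm (\<lambda>y. of_real (m y) * v t y) \<le> (c * real CARD('d) ^ 3) * L2_norm ?G"
    by (rule L2_norm_bound[OF GL meas ae]) (use c in simp)
  also have "\<dots> \<le> (c * real CARD('d) ^ 3) * (real CARD('d) * wd_norm v 3 t)"
    by (intro mult_left_mono Gn) (use c in simp)
  finally show "L2_norm (\<lambda>y. of_real (m y) * v t y) \<le> c * real CARD('d) ^ 3 * real CARD('d) * wd_norm v 3 t"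
    by (simp only: mult.assoc)
qed

lemma square_Gronwall:
  fixes y \<gamma> :: "real \<Rightarrow> real"
  assumes y: "continuous_on UNIV y" "\<And>s. 0 \<le> y s" and \<gamma>: "continuous_on UNIV \<gamma>" "\<And>s. 0 \<le> \<gamma> s"
    and le: "\<And>s. 0 \<le> s \<Longrightarrow> (y s)\<^sup>2 \<le> integral {0..s} (\<lambda>r. 2 * y r * \<gamma> r)"
    and A: "0 \<le> A" "0 \<le> C" "\<And>s. 0 \<le> s \<Longrightarrow> \<gamma> s \<le> A * exp (C * s)" and t: "0 \<le> t"
  shows "y t \<le> A * exp ((C + 1) * t)"
proof (rule power2_le_imp_le)
  have yc: "continuous_on X y" "continuous_on X \<gamma>" for X using y \<gamma> continuous_on_subset by blast+
  define a where "a = t * (A * exp (C * t))\<^sup>2"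
  have "(y t)\<^sup>2 \<le> a * exp (1 * t)"
  proof (rule integral_Gronwall[where y = "\<lambda>s. (y s)\<^sup>2"])
    show "continuous_on UNIV (\<lambda>s. (y s)\<^sup>2)" by (intro continuous_intros yc)
    fix s assume s: "0 \<le> s" "s \<le> t"
    have "(y s)\<^sup>2 \<le> integral {0..s} (\<lambda>r. 2 * y r * \<gamma> r)" by (rule le[OF s(1)])
    also have "\<dots> \<le> integral {0..s} (\<lambda>r. (A * exp (C * t))\<^sup>2 + (y r)\<^sup>2)"
    proof (rule integral_le)
      fix r assume r: "r \<in> {0..s}"
      have "\<gamma> r \<le> A * exp (C * r)" using A(3) r by simp
      also have "\<dots> \<le> A * exp (C * t)" using r s A by (intro mult_left_mono) (auto intro: mult_left_mono)
      finally have "(\<gamma> r)\<^sup>2 \<le> (A * exp (C * t))\<^sup>2" using \<gamma>(2) by (intro power_mono)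
      moreover have "2 * y r * \<gamma> r \<le> (y r)\<^sup>2 + (\<gamma> r)\<^sup>2" by (rule sum_squares_bound)
      ultimately show "2 * y r * \<gamma> r \<le> (A * exp (C * t))\<^sup>2 + (y r)\<^sup>2" by linarith
    qed (intro integrable_continuous_real continuous_intros yc)+
    also have "\<dots> = s * (A * exp (C * t))\<^sup>2 + integral {0..s} (\<lambda>r. (y r)\<^sup>2)"
      using s by (subst Henstock_Kurzweil_Integration.integral_add) (auto intro!: integrable_continuous_real continuous_intros yc)
    also have "\<dots> \<le> a + 1 * integral {0..s} (\<lambda>r. (y r)\<^sup>2)"
      unfolding a_def using s by (simp add: mult_right_mono)
    finally show "(y s)\<^sup>2 \<le> a + 1 * integral {0..s} (\<lambda>r. (y r)\<^sup>2)" .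
  qed (use t in auto)
  also have "\<dots> \<le> (exp t * (A * exp (C * t))\<^sup>2) * exp (1 * t)"
    unfolding a_def using exp_ge_add_one_self[of t] by (intro mult_right_mono order_trans[OF _ exp_ge_add_one_self[of t]]) auto
  also have "\<dots> = (A * exp ((C + 1) * t))\<^sup>2"
    by (simp add: power_mult_distrib exp_double[symmetric] exp_add[symmetric] distrib_right mult.assoc)
  finally show "(y t)\<^sup>2 \<le> (A * exp ((C + 1) * t))\<^sup>2" .
qed (use A in simp)

lemma continuous_Sigma_imp_L2:
  fixes v :: "real \<Rightarrow> real^'d::finite \<Rightarrow> complex"
  assumes v: "continuous_Sigma k v"
  shows "continuous_L2 v"
proof -
  have S: "v t \<in> Sigma_space k" for t using v by (simp add: continuous_Sigma_def)
  have L: "v t \<in> L2" for t using S[of t] by (simp add: Sigma_space_def)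
  let ?w = "\<lambda>t. weighted_deriv (\<lambda>i. 0) (\<lambda>i. 0) (v t)"
  have cw: "continuous_L2 ?w"
    by (rule continuous_L2_weighted_deriv[OF v]) (simp add: mi_order_def)
  have wL: "?w t \<in> L2" for t using cw by (simp add: continuous_L2_def)
  have ae: "AE x in lborel. ?w t x = v t x" for t
    using weak_deriv_zero_AE[OF S[of t]] by (simp add: weighted_deriv_zero)
  have "L2_norm (\<lambda>x. v s x - v t x) = L2_norm (\<lambda>x. ?w s x - ?w t x)" for s t
  proof (rule L2_norm_AE_cong)
    show "(\<lambda>x. v s x - v t x) \<in> borel_measurable borel" by (rule L2_measurable[OF L2_diff[OF L L]])
    show "(\<lambda>x. ?w s x - ?w t x) \<in> borel_measurable borel" by (rule L2_measurable[OF L2_diff[OF wL wL]])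
    show "AE x in lborel. v s x - v t x = ?w s x - ?w t x" using ae[of s] ae[of t] by eventually_elim simp
  qed
  then show ?thesis using cw L by (simp add: continuous_L2_def)
qed

lemma smooth_continuous_gradient:
  fixes V :: "real^'d::finite \<Rightarrow> real"
  assumes "smooth V" shows "continuous_on UNIV (gradient V)"
  unfolding gradient_def by (intro continuous_on_vec_lambda smooth_continuous_on smooth_partial assms)

lemma coherent_state_error:
  fixes V :: "real^'d::finite \<Rightarrow> real" and W :: "real^'d \<Rightarrow> real^'d" and q p :: "real \<Rightarrow> real^'d"
    and S :: "real \<Rightarrow> real" and v \<psi> :: "real \<Rightarrow> real^'d \<Rightarrow> complex"
  assumes \<epsilon>: "0 < \<epsilon>" and W: "skew W" and V: "smooth V"
    and B2: "\<And>i j x. \<bar>partial i (partial j V) x\<bar> \<le> B2"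
    and B3: "\<And>i j l x. \<bar>partial l (partial i (partial j V)) x\<bar> \<le> B3"
    and q: "\<And>t. (q has_vector_derivative p t + W (q t)) (at t)"
    and p: "\<And>t. (p has_vector_derivative - gradient V (q t) + W (p t)) (at t)"
    and S: "\<And>t. (S has_real_derivative (norm (p t))\<^sup>2 / 2 - V (q t)) (at t)"
    and v: "continuous_Sigma 3 v"
    and v_sol: "weak_solution W (\<lambda>t y. (y \<bullet> (hessian V (q t) *v y)) / 2) v (\<lambda>t x. 0)"
    and growth: "\<And>t. 0 \<le> t \<Longrightarrow> wd_norm v 3 t \<le> K * exp (C * t)" and C: "0 \<le> C" and K: "0 \<le> K"
    and \<psi>: "continuous_L2 \<psi>"
    and \<psi>_sol: "\<And>\<eta> t. test_function \<eta> \<Longrightarrow>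
       \<exists>D. ((\<lambda>s. L2_inner \<eta> (\<psi> s)) has_vector_derivative D) (at t) \<and>
           \<i> * of_real \<epsilon> * D = L2_inner (\<lambda>x. - of_real (\<epsilon>\<^sup>2 / 2) * laplacian \<eta> x + of_real (V x) * \<eta> x
             + of_real \<epsilon> * (- \<i> * (\<Sum>j\<in>UNIV. of_real (W x $ j) * partial j \<eta> x))) (\<psi> t)"
    and init: "L2_norm (\<lambda>x. \<psi> 0 x - from_frame \<epsilon> q p S 0 (v 0) x) = 0" and t: "0 \<le> t"
  shows "L2_norm (\<lambda>x. \<psi> t x - from_frame \<epsilon> q p S t (v t) x)
    \<le> real CARD('d) ^ 3 * B3 * real CARD('d) ^ 3 * real CARD('d) * K * sqrt \<epsilon> * exp ((C + 1) * t)"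
proof -
  let ?d = "real CARD('d)"
  let ?U = "\<lambda>t. scaled_potential V \<epsilon> (q t)" and ?U' = "\<lambda>t y. (y \<bullet> (hessian V (q t) *v y)) / 2"
  define u where "u t = to_frame \<epsilon> q p S t (\<psi> t)" for t
  define w where "w t = (\<lambda>x. u t x - v t x)" for t
  define c where "c = ?d ^ 3 * B3 * sqrt \<epsilon>"
  define \<gamma> where "\<gamma> t = c * ?d ^ 3 * ?d * wd_norm v 3 t" for t
  note pot = V B2 B3 \<epsilon>
  have B: "0 \<le> B2" "0 \<le> B3" by (rule B_nonneg[OF pot])+
  have c: "0 \<le> c" using B \<epsilon> by (simp add: c_def)
  have qpS: "continuous_on UNIV q" "continuous_on UNIV p" "continuous_on UNIV S"
    by (auto intro!: continuous_at_imp_continuous_on has_vector_derivative_continuous[OF q]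
      has_vector_derivative_continuous[OF p] DERIV_isCont[OF S])
  have vL2: "continuous_L2 v" by (rule continuous_Sigma_imp_L2[OF v])
  have uL2: "continuous_L2 u" unfolding u_def[abs_def] by (rule continuous_L2_to_frame[OF \<epsilon> \<psi> qpS])
  have L: "u t \<in> L2" "v t \<in> L2" "\<psi> t \<in> L2" for t using uL2 vL2 \<psi> by (auto simp: continuous_L2_def)
  have u_sol: "weak_solution W ?U u (\<lambda>t x. 0)"
    using weak_solution_to_frame[OF \<epsilon> W \<psi> smooth_continuous_on[OF V] smooth_continuous_gradient[OF V] q p S \<psi>_sol]
      smooth_scaled_potential[OF pot]
    unfolding u_def[abs_def] scaled_potential_def[abs_def] by blast
  have w_sol: "weak_solution W ?U w (\<lambda>t x. of_real (?U t x - ?U' t x) * v t x)"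
    unfolding w_def[abs_def]
    by (rule weak_solution_diff[OF _ u_sol v_sol L(1) L(2)])
      (use W in \<open>auto simp: skew_def intro: smooth_scaled_potential[OF pot] smooth_quadratic\<close>)
  have wL2: "continuous_L2 w" unfolding w_def[abs_def] by (rule continuous_L2_diff[OF uL2 vL2])
  have w_eq: "w t = to_frame \<epsilon> q p S t (\<lambda>x. \<psi> t x - from_frame \<epsilon> q p S t (v t) x)" for t
    unfolding to_frame_diff[OF \<epsilon>] to_frame_from_frame[OF \<epsilon>] w_def u_def ..
  have w_norm: "L2_norm (w t) = L2_norm (\<lambda>x. \<psi> t x - from_frame \<epsilon> q p S t (v t) x)" for t
    unfolding w_eq by (rule to_frame_L2(2)[OF \<epsilon> L2_diff[OF L(3) from_frame_L2[OF \<epsilon> L(2)]]])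
  have rem: "\<bar>?U t y - ?U' t y\<bar> \<le> c * norm y ^ 3" for t y
    unfolding c_def by (rule scaled_potential_taylor[OF pot])
  have meas: "(\<lambda>y. ?U t y - ?U' t y) \<in> borel_measurable borel" for t
    by (intro borel_measurable_continuous_onI smooth_continuous_on smooth_diff smooth_scaled_potential[OF pot] smooth_quadratic)
  note cubic = cubic_multiplication[OF v meas rem c]
  have \<gamma>c: "continuous_on UNIV \<gamma>"
    unfolding \<gamma>_def by (intro continuous_intros wd_norm_continuous[OF v])
  have \<gamma>0: "0 \<le> \<gamma> t" for t unfolding \<gamma>_def using c wd_norm_nonneg[OF v] by simp
  have energy: "(L2_norm (w s))\<^sup>2 \<le> integral {0..s} (\<lambda>r. 2 * L2_norm (w r) * \<gamma> r)" if "0 \<le> s" for s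
  proof -
    have "(L2_norm (w s))\<^sup>2 \<le> (L2_norm (w 0))\<^sup>2 + integral {0..s} (\<lambda>r. 2 * L2_norm (w r) * \<gamma> r)"
    proof (rule energy_estimate[OF W _ _ _ wL2 w_sol cubic(1) _ \<gamma>c that])
      show "?U t 0 = 0" for t by (simp add: scaled_potential_def)
      show "\<bar>?U t y - ?U t z\<bar> \<le> (?d * ?d * B2) * norm (y - z) * (norm y + norm z)" for t y z
        by (rule scaled_potential_lipschitz[OF pot])
      show "0 \<le> ?d * ?d * B2" using B by simp
      show "L2_norm (\<lambda>x. of_real (?U t x - ?U' t x) * v t x) \<le> \<gamma> t" for t
        unfolding \<gamma>_def by (rule cubic(2))
    qed
    then show ?thesis unfolding w_norm[of 0] init by simp
  qed
  have "L2_norm (w t) \<le> (c * ?d ^ 3 * ?d * K) * exp ((C + 1) * t)"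
  proof (rule square_Gronwall[OF continuous_L2_norm[OF wL2] _ \<gamma>c \<gamma>0 energy _ C _ t])
    show "0 \<le> L2_norm (w s)" for s by (simp add: L2_norm_def)
    show "0 \<le> c * ?d ^ 3 * ?d * K" using c K by simp
    show "\<gamma> s \<le> c * ?d ^ 3 * ?d * K * exp (C * s)" if "0 \<le> s" for s
      unfolding \<gamma>_def mult.assoc[of _ K] by (rule mult_left_mono[OF growth[OF that]]) (use c in simp)
  qed
  then show ?thesis unfolding w_norm c_def by (simp only: mult_ac)
qed

lemma logarithmic_time_limit:
  fixes f :: "real \<Rightarrow> real \<Rightarrow> real"
  assumes C: "0 < C" and nn: "\<And>\<epsilon> t. 0 \<le> f \<epsilon> t"
    and le: "\<And>t \<epsilon>. 0 \<le> t \<Longrightarrow> 0 < \<epsilon> \<Longrightarrow> \<epsilon> \<le> 1 \<Longrightarrow> f \<epsilon> t \<le> K * sqrt \<epsilon> * exp (C * t)" and K: "0 \<le> K"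
  shows "((\<lambda>\<epsilon>. SUP t\<in>{0..1 / (4 * C) * ln (1 / \<epsilon>)}. f \<epsilon> t) \<longlongrightarrow> 0) (at_right 0)"
proof (rule tendsto_sandwich[of "\<lambda>_. 0" _ _ "\<lambda>\<epsilon>. K * (\<epsilon> powr (1/4))"])
  have ev: "\<forall>\<^sub>F \<epsilon> in at_right 0. 0 < \<epsilon> \<and> \<epsilon> \<le> (1::real)"
    unfolding eventually_at_right_field by (intro exI[of _ 1]) auto
  have bd: "f \<epsilon> t \<le> K * (\<epsilon> powr (1/4))" if e: "0 < \<epsilon>" "\<epsilon> \<le> 1" and t: "t \<in> {0..1 / (4 * C) * ln (1 / \<epsilon>)}" for \<epsilon> t
  proof -
    have "C * t \<le> C * (1 / (4 * C) * ln (1 / \<epsilon>))" using t C by (intro mult_left_mono) auto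
    also have "\<dots> = - (1/4) * ln \<epsilon>" using C e by (simp add: ln_div)
    finally have "exp (C * t) \<le> \<epsilon> powr (- (1/4))" using e by (simp add: powr_def)
    then have "K * sqrt \<epsilon> * exp (C * t) \<le> K * sqrt \<epsilon> * \<epsilon> powr (- (1/4))"
      using K e by (intro mult_left_mono) auto
    also have "\<dots> = K * (\<epsilon> powr (1/4))"
      using e by (simp add: powr_half_sqrt[symmetric] powr_add[symmetric])
    finally show ?thesis using le[of t \<epsilon>] t e by simp
  qed
  have ne: "0 \<in> {0..1 / (4 * C) * ln (1 / \<epsilon>)}" if "0 < \<epsilon>" "\<epsilon> \<le> 1" for \<epsilon>
    using that C by simp
  show "\<forall>\<^sub>F \<epsilon> in at_right 0. (SUP t\<in>{0..1 / (4 * C) * ln (1 / \<epsilon>)}. f \<epsilon> t) \<le> K * (\<epsilon> powr (1/4))"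
    using ev
  proof eventually_elim
    case (elim \<epsilon>)
    then show ?case using ne[of \<epsilon>] bd[of \<epsilon>] by (intro cSUP_least) blast+
  qed
  show "\<forall>\<^sub>F \<epsilon> in at_right 0. 0 \<le> (SUP t\<in>{0..1 / (4 * C) * ln (1 / \<epsilon>)}. f \<epsilon> t)"
    using ev
  proof eventually_elim
    case (elim \<epsilon>)
    have "f \<epsilon> 0 \<le> (SUP t\<in>{0..1 / (4 * C) * ln (1 / \<epsilon>)}. f \<epsilon> t)"
      using ne[of \<epsilon>] bd[of \<epsilon>] elim by (intro cSUP_upper bdd_aboveI2) blast+
    then show ?case using nn[of \<epsilon> 0] by linarith
  qed
  have "((\<lambda>\<epsilon>::real. \<epsilon> powr (1/4)) \<longlongrightarrow> 0 powr (1/4)) (at_right 0)"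
    by (rule tendsto_powr2) (auto intro!: tendsto_intros simp: eventually_at_right_field intro: exI[of _ 1])
  then show "((\<lambda>\<epsilon>. K * (\<epsilon> powr (1/4))) \<longlongrightarrow> 0) (at_right 0)"
    by (intro tendsto_mult_right_zero) simp
qed simp

lemma action_derivative:
  fixes f :: "real \<Rightarrow> real"
  assumes "continuous_on UNIV f"
  shows "((\<lambda>t. LBINT s=0..t. f s) has_real_derivative f t) (at t)"
proof -
  define a b where "a = min 0 t - 1" and "b = max 0 t + 1"
  have c: "continuous_on {a..b} f" using assms continuous_on_subset by blast
  have "((\<lambda>u. LBINT s=a..u. f s) has_vector_derivative f t) (at t within {a..b})"
    by (rule interval_integral_FTC2) (auto simp: a_def b_def intro: continuous_on_subset[OF assms])
  then have 1: "((\<lambda>u. LBINT s=a..u. f s) has_vector_derivative f t) (at t)"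
    by (subst (asm) at_within_interior) (auto simp: a_def b_def)
  have 2: "(LBINT s=0..u. f s) = (LBINT s=a..u. f s) - (LBINT s=a..0. f s)" for u :: real
  proof -
    let ?l = "min a (min 0 u)" and ?r = "max a (max 0 u)"
    have "interval_lebesgue_integrable lborel (ereal ?l) (ereal ?r) f"
      by (rule interval_integrable_continuous_on) (auto intro: continuous_on_subset[OF assms])
    then have "interval_lebesgue_integrable lborel (min (ereal a) (min (ereal 0) (ereal u))) (max (ereal a) (max (ereal 0) (ereal u))) f"
      by (simp only: ereal_min ereal_max)
    from interval_integral_sum[OF this]
    have "(LBINT s=a..0. f s) + (LBINT s=0..u. f s) = (LBINT s=a..u. f s)" by (simp only: zero_ereal_def)
    then show ?thesis by simp
  qed
  show ?thesis unfolding 2 has_real_derivative_iff_has_vector_derivative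
    using has_vector_derivative_diff[OF 1 has_vector_derivative_const] by simp
qed

theorem proposition2p5:
  fixes \<Omega> :: "real^3"
    and q0 p0 :: "real^'d::{finite,comm_ring_1}"
    and v0 :: "real^'d::_ \<Rightarrow> complex"
    and V :: "real^'d::_ \<Rightarrow> real"
    and q p :: "real \<Rightarrow> real^'d::_"
    and S :: "real \<Rightarrow> real"
    and v :: "real \<Rightarrow> real^'d::_ \<Rightarrow> complex"
    and \<phi> \<psi> :: "real \<Rightarrow> real \<Rightarrow> real^'d::_ \<Rightarrow> complex"
  assumes dim: "CARD('d) = 2 \<or> CARD('d) = 3"
    and rotation: "CARD('d) = 2 \<Longrightarrow> \<Omega> $ 1 = 0 \<and> \<Omega> $ 2 = 0"
    and v0: "v0 \<in> Sigma_space 3"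
    and V_smooth: "smooth V"
    and V_bounded: "\<And>\<alpha>. mi_order \<alpha> \<ge> 2 \<Longrightarrow> bounded (range (mi_deriv \<alpha> V))"
    and qp_smooth: "smooth q" "smooth p"
    and q_eq: "\<And>t. (q has_vector_derivative (p t + wedge \<Omega> (q t))) (at t)"
    and p_eq: "\<And>t. (p has_vector_derivative (- gradient V (q t) + wedge \<Omega> (p t))) (at t)"
    and qp_init: "q 0 = q0" "p 0 = p0"
    and S_eq: "\<And>t. S t = (LBINT s=0..t. (norm (p s))\<^sup>2 / 2 - V (q s))"
    and v_cont: "continuous_Sigma 3 v"
    and v_eq: "schroedinger_solution 1 (\<lambda>t y. (y \<bullet> (hessian V (q t) *v y)) / 2) \<Omega> v"
    and v_init: "AE y in lborel. v 0 y = v0 y"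
    and \<phi>_eq: "\<And>\<epsilon> t x. \<phi> \<epsilon> t x =
        of_real (\<epsilon> powr (- real CARD('d) / 4)) * v t ((x - q t) /\<^sub>R sqrt \<epsilon>) *
        exp (\<i> * of_real ((S t + p t \<bullet> (x - q t)) / \<epsilon>))"
    and \<psi>_cont: "\<And>\<epsilon>. 0 < \<epsilon> \<Longrightarrow> \<epsilon> \<le> 1 \<Longrightarrow> continuous_L2 (\<psi> \<epsilon>)"
    and \<psi>_eq: "\<And>\<epsilon>. 0 < \<epsilon> \<Longrightarrow> \<epsilon> \<le> 1 \<Longrightarrow> schroedinger_solution \<epsilon> (\<lambda>t. V) \<Omega> (\<psi> \<epsilon>)"
    and \<psi>_init: "\<And>\<epsilon>. 0 < \<epsilon> \<Longrightarrow> \<epsilon> \<le> 1 \<Longrightarrow> AE x in lborel. \<psi> \<epsilon> 0 x =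
        of_real (\<epsilon> powr (- real CARD('d) / 4)) * v0 ((x - q0) /\<^sub>R sqrt \<epsilon>) *
        exp (\<i> * of_real ((x - q0) \<bullet> p0 / \<epsilon>))"
  shows "(\<exists>C>0. \<exists>K>0. \<forall>t\<ge>0. \<forall>\<epsilon>. 0 < \<epsilon> \<and> \<epsilon> \<le> 1 \<longrightarrow>
            L2_norm (\<lambda>x. \<psi> \<epsilon> t x - \<phi> \<epsilon> t x) \<le> K * sqrt \<epsilon> * exp (C * t)) \<and>
         (\<exists>c>0. ((\<lambda>\<epsilon>. SUP t\<in>{0..c * ln (1 / \<epsilon>)}. L2_norm (\<lambda>x. \<psi> \<epsilon> t x - \<phi> \<epsilon> t x))
            \<longlongrightarrow> 0) (at_right 0))"
proof -
  have W: "skew (wedge \<Omega> :: real^'d::_ \<Rightarrow> real^'d::_)" by (rule skew_wedge[OF dim])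
  obtain B2 B3 where B2: "\<And>i j x. \<bar>partial i (partial j V) x\<bar> \<le> B2"
    and B3: "\<And>i j l x. \<bar>partial l (partial i (partial j V)) x\<bar> \<le> B3"
  proof (rule second_third_derivative_bounds[OF V_smooth V_bounded])
    fix B2 B3 assume b: "\<And>i j x. \<bar>partial i (partial j V) x\<bar> \<le> B2"
      "\<And>i j l x. \<bar>partial l (partial i (partial j V)) x\<bar> \<le> B3"
    show thesis by (rule that[OF b])
  qed
  have B3_nonneg: "0 \<le> B3" by (rule order_trans[OF abs_ge_zero B3])
  have qp: "continuous_on UNIV q" "continuous_on UNIV p"
    by (auto intro!: continuous_at_imp_continuous_on has_vector_derivative_continuous[OF q_eq]
      has_vector_derivative_continuous[OF p_eq])
  have action: "(S has_real_derivative (norm (p t))\<^sup>2 / 2 - V (q t)) (at t)" for t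
  proof -
    have c: "continuous_on UNIV (\<lambda>s. (norm (p s))\<^sup>2 / 2 - V (q s))"
      by (intro continuous_intros qp continuous_on_compose2[OF smooth_continuous_on[OF V_smooth] qp(1)]) auto
    have eq: "S = (\<lambda>t. LBINT s=0..t. (norm (p s))\<^sup>2 / 2 - V (q s))" by (rule ext) (rule S_eq)
    show ?thesis unfolding eq by (rule action_derivative[OF c])
  qed
  have S0: "S 0 = 0" unfolding S_eq by (simp add: zero_ereal_def[symmetric])
  have v_sol: "weak_solution (wedge \<Omega>) (\<lambda>t y. (y \<bullet> (hessian V (q t) *v y)) / 2) v (\<lambda>t x. 0)"
    unfolding weak_solution_def
  proof (intro allI impI)
    fix \<eta> :: "real^'d::_ \<Rightarrow> complex" and t assume \<eta>: "test_function \<eta>"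
    let ?H = "L2_inner (ham (wedge \<Omega>) (\<lambda>y. (y \<bullet> (hessian V (q t) *v y)) / 2) \<eta>) (v t)"
    obtain D where D: "((\<lambda>s. L2_inner \<eta> (v s)) has_vector_derivative D) (at t)"
      and H: "\<i> * of_real 1 * D = L2_inner (hamiltonian 1 (\<lambda>y. (y \<bullet> (hessian V (q t) *v y)) / 2) \<Omega> \<eta>) (v t)"
      using v_eq \<eta> unfolding schroedinger_solution_def by blast
    have "hamiltonian 1 (\<lambda>y. (y \<bullet> (hessian V (q t) *v y)) / 2) \<Omega> \<eta> = ham (wedge \<Omega>) (\<lambda>y. (y \<bullet> (hessian V (q t) *v y)) / 2) \<eta>"
      by (rule ext) (simp add: hamiltonian_def ham_def Omega_L_def)
    with H have iD: "\<i> * D = ?H" by simp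
    have "D = - \<i> * (\<i> * D)" by simp
    then have "D = - \<i> * ?H" by (simp only: iD)
    moreover have "L2_inner \<eta> (\<lambda>x. 0) = 0" by (simp add: L2_inner_def)
    ultimately show "((\<lambda>s. L2_inner \<eta> (v s)) has_vector_derivative - \<i> * (?H + L2_inner \<eta> (\<lambda>x. 0))) (at t)"
      using D by simp
  qed
  have sym: "hessian V (q t) $ i $ j = hessian V (q t) $ j $ i" for t i j
    by (rule hessian_sym[OF V_smooth B2 B3 zero_less_one])
  have hess: "\<bar>hessian V (q t) $ i $ j\<bar> \<le> B2" for t i j using B2 by (simp add: hessian_def)
  obtain C K where C: "0 < C" and K: "0 < K" and growth: "\<And>t. 0 \<le> t \<Longrightarrow> wd_norm v 3 t \<le> K * exp (C * t)"
    using wd_norm_growth[OF v_cont W sym hess v_sol] by blast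
  let ?d = "real CARD('d)"
  define K' where "K' = ?d ^ 3 * B3 * ?d ^ 3 * ?d * K + 1"
  have K': "0 < K'" using B3_nonneg K by (simp add: K'_def add_nonneg_pos)
  have v_L2: "v t \<in> L2" for t using v_cont by (simp add: continuous_Sigma_def Sigma_space_def)
  have v0_L2: "v0 \<in> L2" using v0 by (simp add: Sigma_space_def)
  have error: "L2_norm (\<lambda>x. \<psi> \<epsilon> t x - \<phi> \<epsilon> t x) \<le> K' * sqrt \<epsilon> * exp ((C + 1) * t)"
    if t: "0 \<le> t" and \<epsilon>: "0 < \<epsilon>" "\<epsilon> \<le> 1" for t \<epsilon>
  proof -
    have \<phi>: "\<phi> \<epsilon> t = from_frame \<epsilon> q p S t (v t)" for t
      by (rule ext) (simp only: \<phi>_eq from_frame_def[OF \<epsilon>(1)] phase_def[OF \<epsilon>(1)])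
    have \<psi>_L2: "\<psi> \<epsilon> t \<in> L2" for t using \<psi>_cont[OF \<epsilon>] by (simp add: continuous_L2_def)
    have \<psi>0: "AE x in lborel. \<psi> \<epsilon> 0 x = from_frame \<epsilon> q p S 0 v0 x"
      using \<psi>_init[OF \<epsilon>] by (simp add: from_frame_def[OF \<epsilon>(1)] phase_def[OF \<epsilon>(1)] S0 qp_init inner_commute)
    let ?e = "\<lambda>x. from_frame \<epsilon> q p S 0 v0 x - from_frame \<epsilon> q p S 0 (v 0) x"
    note fL2 = from_frame_L2[OF \<epsilon>(1), of _ q p S 0]
    have eL2: "?e \<in> L2" by (rule L2_diff[OF fL2[OF v0_L2] fL2[OF v_L2]])
    have "L2_norm (\<lambda>x. \<psi> \<epsilon> 0 x - from_frame \<epsilon> q p S 0 (v 0) x) = L2_norm ?e"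
    proof (rule L2_norm_AE_cong)
      show "(\<lambda>x. \<psi> \<epsilon> 0 x - from_frame \<epsilon> q p S 0 (v 0) x) \<in> borel_measurable borel"
        by (rule L2_measurable[OF L2_diff[OF \<psi>_L2 fL2[OF v_L2]]])
      show "?e \<in> borel_measurable borel" by (rule L2_measurable[OF eL2])
      show "AE x in lborel. \<psi> \<epsilon> 0 x - from_frame \<epsilon> q p S 0 (v 0) x = ?e x"
        using \<psi>0 by eventually_elim simp
    qed
    also have "\<dots> = L2_norm (to_frame \<epsilon> q p S 0 ?e)" by (rule to_frame_L2(2)[OF \<epsilon>(1) eL2, symmetric])
    also have "\<dots> = L2_norm (\<lambda>y. v0 y - v 0 y)"
      unfolding to_frame_diff[OF \<epsilon>(1)] to_frame_from_frame[OF \<epsilon>(1)] ..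
    also have "\<dots> = L2_norm (\<lambda>y::real^'d::_. 0 :: complex)"
    proof (rule L2_norm_AE_cong[OF L2_measurable[OF L2_diff[OF v0_L2 v_L2]]])
      show "AE y in lborel. v0 y - v 0 y = 0" using v_init by eventually_elim simp
    qed simp
    also have "\<dots> = 0" by (simp add: L2_norm_def)
    finally have init: "L2_norm (\<lambda>x. \<psi> \<epsilon> 0 x - from_frame \<epsilon> q p S 0 (v 0) x) = 0" .
    have "\<exists>D. ((\<lambda>s. L2_inner \<eta> (\<psi> \<epsilon> s)) has_vector_derivative D) (at t) \<and>
        \<i> * of_real \<epsilon> * D = L2_inner (\<lambda>x. - of_real (\<epsilon>\<^sup>2 / 2) * laplacian \<eta> x + of_real (V x) * \<eta> x
          + of_real \<epsilon> * (- \<i> * (\<Sum>j\<in>UNIV. of_real (wedge \<Omega> x $ j) * partial j \<eta> x))) (\<psi> \<epsilon> t)"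
      if "test_function \<eta>" for \<eta> t
      using \<psi>_eq[OF \<epsilon>] that unfolding schroedinger_solution_def hamiltonian_def[abs_def] Omega_L_def[abs_def] by blast
    from coherent_state_error[OF \<epsilon>(1) W V_smooth B2 B3 q_eq p_eq action v_cont v_sol growth _ _ \<psi>_cont[OF \<epsilon>] this init t]
    have "L2_norm (\<lambda>x. \<psi> \<epsilon> t x - \<phi> \<epsilon> t x) \<le> (K' - 1) * sqrt \<epsilon> * exp ((C + 1) * t)"
      using C K by (simp add: \<phi> K'_def)
    also have "\<dots> \<le> K' * sqrt \<epsilon> * exp ((C + 1) * t)" using \<epsilon> by (intro mult_right_mono) auto
    finally show ?thesis .
  qed
  have nonneg: "0 \<le> L2_norm (\<lambda>x. \<psi> \<epsilon> t x - \<phi> \<epsilon> t x)" for \<epsilon> t by (simp add: L2_norm_def)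
  have C': "0 < C + 1" using C by simp
  show ?thesis
  proof (intro conjI)
    show "\<exists>C>0. \<exists>K>0. \<forall>t\<ge>0. \<forall>\<epsilon>. 0 < \<epsilon> \<and> \<epsilon> \<le> 1 \<longrightarrow>
        L2_norm (\<lambda>x. \<psi> \<epsilon> t x - \<phi> \<epsilon> t x) \<le> K * sqrt \<epsilon> * exp (C * t)"
      using C' K' error by blast
    show "\<exists>c>0. ((\<lambda>\<epsilon>. SUP t\<in>{0..c * ln (1 / \<epsilon>)}. L2_norm (\<lambda>x. \<psi> \<epsilon> t x - \<phi> \<epsilon> t x)) \<longlongrightarrow> 0) (at_right 0)"
      by (intro exI[of _ "1 / (4 * (C + 1))"] conjI
        logarithmic_time_limit[where K = K', OF C' nonneg error less_imp_le[OF K']]) (use C in auto)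
  qed
qed

end
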